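(* Let $n\in\{2,3\}$, $k>0$, $R>1$, and let $V=\chi_P\varphi$, $V'=\chi_{P'}\varphi'$ be potentials in $L^\infty(B_R)$, where $P,P'\subset B_R$ are admissible shapes and $\varphi$ (relative to $P$) and $\varphi'$ (relative to $P'$) are admissible contrasts. Assume that $V$ and $V'$ give well-posed scattering with constant $\mathcal S$, and that both produce non-vanishing total waves. Assume that both $(P,\varphi)$ and $(P',\varphi')$ satisfy the a-priori bounds (with the same parameters $\ell,\alpha_m,\alpha_M,\mathcal D,\mathcal M,\mu,c$, the same Hölder index $\alpha$ and the same $s,r$). Let $\mathfrak h=d_H(P,P')$. Let $u^i(x)=\exp(ik\omega\cdot x)$, $\omega\in\mathbb S^{n-1}$, be any plane wave, and let $u^s_\infty,u'^s_\infty$ be the far-field patterns of the scattered waves produced by $V$ and $V'$ respectively for this incident wave. Then there are constants $\varepsilon_{min}>0$ and $C<\infty$, depending only on the a-priori parameters $n,k,R,\ell,\alpha_m,\alpha_M,\mathcal D,\mathcal M,\mu,c,\alpha,s,\mathcal S$, and a constant $\gamma=\gamma(\alpha,n,r,s)>0$, such that if $0<\|u^s_\infty-u'^s_\infty\|_{L^2(\mathbb S^{n-1})}<\varepsilon_{min}$, then \[ \mathfrak h\le C\left(\ln\ln\frac{\mathcal S}{\|u^s_\infty-u'^s_\infty\|_{L^2(\mathbb S^{n-1})}}\right)^{-\gamma}. \]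
   Context: $B_\rho=B(0,\rho)$ denotes the open ball in $\mathbb R^n$. Scattering model: for $V\in L^\infty(\mathbb R^n)$ and an incident plane wave $u^i(x)=\exp(ik\omega\cdot x)$, the total wave $u\in H^2_{loc}(\mathbb R^n)$ solves $(\Delta+k^2(1+V))u=0$ in $\mathbb R^n$ and the scattered wave $u^s=u-u^i$ satisfies the Sommerfeld radiation condition $|x|^{(n-1)/2}(\partial_r-ik)u^s\to0$ uniformly in $x/|x|$ as $|x|\to\infty$. The far-field pattern $u^s_\infty:\mathbb S^{n-1}\to\mathbb C$ is defined by $u^s(r\theta)=\frac{e^{ikr}}{r^{(n-1)/2}}u^s_\infty(\theta)+O(r^{-n/2})$ as $r\to\infty$, uniformly in $\theta$. Well-posed scattering with constant $\mathcal S<\infty$: for every incident plane wave there is a unique such $u\in H^2_{loc}$, and $\|u^s\|_{H^2(B_{2R})}\le\mathcal S$. Admissible shape: $P\subset B_R$ is, in 2D, a bounded open convex polygon; in 3D, an open cuboid, i.e. the image of $]0,a[\times]0,b[\times]0,c[$ ($a,b,c>0$) under a rigid motion. Admissible contrast (for an admissible $P$): $\varphi:\mathbb R^n\to\mathbb C$ belongs to the Hölder space $C^\alpha(\mathbb R^n)$ for some $\alpha>0$ in 2D, resp. $\alpha>1/4$ in 3D, and $\varphi\neq0$ at every vertex of $P$. Non-vanishing total waves: for every incident plane wave, the total wave $u$ vanishes nowhere in $B_R\setminus\operatorname{supp}V$. Hausdorff distance: $d_H(P,P')=\max(\sup_{x\in P}d(x,P'),\sup_{x'\in P'}d(x',P))$.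 Norm $\|P\|_{T(s,r)}$: $H^s_r(\mathbb R^n)$ denotes the Bessel potential Sobolev space. For $s\in\mathbb R$, $1\le r<\infty$, let $C_{s,r}\in\mathbb R\cup\{+\infty\}$ be the operator norm of $f\mapsto\chi_Hf$ on $H^s_r(\mathbb R^n)$ for a half-space $H$. A triangulation of a bounded open polytope $P$ is a finite collection $\{H_{jl}: j=1,\dots,J,\ l=1,\dots,L_j\}$ where each $H_{jl}$ satisfies $H\subset H_{jl}\subset\overline H$ for some open half-space $H$, the sets $\bigcap_lH_{jl}$ are pairwise disjoint for different $j$, and $P=\bigcup_{j=1}^J\bigcap_{l=1}^{L_j}H_{jl}$. Then $\|P\|_{T(s,r)}=\inf\sum_{j=1}^JC_{s,r}^{L_j}$ over all triangulations. Indices: $r=2(n+1)/(n+3)$, and $s$ is a fixed number with $0\le s<\min(\alpha,5/6)$ in 2D, resp. $1/4<s<\min(\alpha,3/4)$ in 3D. A-priori bounds (with parameters $\ell\le1$, $\alpha_m,\alpha_M,\mathcal D,\mathcal M,\mu,c$): (1) the minimal distance from any vertex of $P$ to a non-adjacent edge is at least $\ell$, where $0<\ell\le1$; (2) in 2D, all angles of $P$ lie in $[2\alpha_m,2\alpha_M]$ with $0<2\alpha_m<2\alpha_M<\pi$; (3) $\|P\|_{T(s,r)}\le\mathcal D$; (4) $\|\varphi\|_{C^\alpha}\le\mathcal M$; (5) $|\varphi(x_c)|\ge\mu>0$ for every vertex $x_c$ of $P$; (6) for every incident plane wave, the total wave satisfies $|u|\ge c>0$ on $B_R\setminus\operatorname{supp}V$.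 *)

theory Defs
  imports "HOL-Analysis.Analysis"
begin

fun pd :: "'a::euclidean_space list \<Rightarrow> ('a \<Rightarrow> complex) \<Rightarrow> 'a \<Rightarrow> complex" where
  "pd [] f = f"
| "pd (b # bs) f = (\<lambda>x. frechet_derivative (pd bs f) (at x) b)"

definition dirs_le :: "nat \<Rightarrow> 'a::euclidean_space list set" where
  "dirs_le m = {bs. set bs \<subseteq> Basis \<and> length bs \<le> m}"

definition dirs_eq :: "nat \<Rightarrow> 'a::euclidean_space list set" where
  "dirs_eq m = {bs. set bs \<subseteq> Basis \<and> length bs = m}"

definition test_fun :: "'a::euclidean_space set \<Rightarrow> ('a \<Rightarrow> complex) \<Rightarrow> bool" where
  "test_fun U \<psi> \<longleftrightarrow>
     (\<forall>bs. set bs \<subseteq> Basis \<longrightarrow> (\<forall>x. pd bs \<psi> differentiable (at x))) \<and>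
     compact (closure {x. \<psi> x \<noteq> 0}) \<and> closure {x. \<psi> x \<noteq> 0} \<subseteq> U"

definition loc_integrable :: "'a::euclidean_space set \<Rightarrow> ('a \<Rightarrow> complex) \<Rightarrow> bool" where
  "loc_integrable U f \<longleftrightarrow>
     (\<forall>K. compact K \<and> K \<subseteq> U \<longrightarrow> set_integrable lborel K f)"

definition loc_L2 :: "'a::euclidean_space set \<Rightarrow> ('a \<Rightarrow> complex) \<Rightarrow> bool" where
  "loc_L2 U f \<longleftrightarrow> f \<in> borel_measurable lborel \<and>
     (\<forall>K. compact K \<and> K \<subseteq> U \<longrightarrow> (\<integral>\<^sup>+ x\<in>K. ennreal ((cmod (f x))\<^sup>2) \<partial>lborel) < \<infinity>)"

definition weak_deriv ::
  "'a::euclidean_space set \<Rightarrow> ('a \<Rightarrow> complex) \<Rightarrow> 'a list \<Rightarrow> ('a \<Rightarrow> complex) \<Rightarrow> bool" where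
  "weak_deriv U f bs g \<longleftrightarrow> loc_integrable U f \<and> loc_integrable U g \<and>
     (\<forall>\<psi>. test_fun U \<psi> \<longrightarrow>
        (\<integral>x. f x * pd bs \<psi> x \<partial>lborel) = (-1) ^ length bs * (\<integral>x. g x * \<psi> x \<partial>lborel))"

definition H2_loc :: "('a::euclidean_space \<Rightarrow> complex) \<Rightarrow> bool" where
  "H2_loc f \<longleftrightarrow> loc_L2 UNIV f \<and>
     (\<forall>bs\<in>dirs_le 2. \<exists>g. weak_deriv UNIV f bs g \<and> loc_L2 UNIV g)"

definition H2_norm_le :: "'a::euclidean_space set \<Rightarrow> ('a \<Rightarrow> complex) \<Rightarrow> real \<Rightarrow> bool" where
  "H2_norm_le U f S \<longleftrightarrow> 0 \<le> S \<and>
     (\<exists>G. (\<forall>bs\<in>dirs_le 2. weak_deriv U f bs (G bs)) \<and>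
          (\<Sum>bs\<in>dirs_le 2. \<integral>\<^sup>+ x\<in>U. ennreal ((cmod (G bs x))\<^sup>2) \<partial>lborel) \<le> ennreal (S\<^sup>2))"

definition plane_wave :: "real \<Rightarrow> 'a::euclidean_space \<Rightarrow> 'a \<Rightarrow> complex" where
  "plane_wave k \<omega> x = exp (\<i> * complex_of_real (k * (\<omega> \<bullet> x)))"

text \<open>Sommerfeld radiation condition (with the classical radial derivative, which exists for
  large |x| since the scattered wave solves the Helmholtz equation there).\<close>
definition radiating :: "real \<Rightarrow> ('a::euclidean_space \<Rightarrow> complex) \<Rightarrow> bool" where
  "radiating k us \<longleftrightarrow>
     (\<exists>\<rho>. \<forall>x. norm x \<ge> \<rho> \<longrightarrow> us differentiable (at x)) \<and>
     (\<forall>\<epsilon>>0. \<exists>\<rho>. \<forall>x. norm x \<ge> \<rho> \<longrightarrow>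
        norm x powr ((real DIM('a) - 1) / 2) *
        cmod (frechet_derivative us (at x) (x /\<^sub>R norm x) - \<i> * complex_of_real k * us x) < \<epsilon>)"

text \<open>u is a total wave for potential V and incident direction \<omega>.  Since n \<le> 3, H^2_loc functions
  are continuous; u denotes the continuous representative.\<close>
definition total_wave ::
  "real \<Rightarrow> ('a::euclidean_space \<Rightarrow> complex) \<Rightarrow> 'a \<Rightarrow> ('a \<Rightarrow> complex) \<Rightarrow> bool" where
  "total_wave k V \<omega> u \<longleftrightarrow>
     continuous_on UNIV u \<and> H2_loc u \<and>
     (\<exists>G. (\<forall>b\<in>Basis. weak_deriv UNIV u [b, b] (G b)) \<and>
          (AE x in lborel. (\<Sum>b\<in>Basis. G b x)
              + complex_of_real (k\<^sup>2) * (1 + V x) * u x = 0)) \<and>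
     radiating k (\<lambda>x. u x - plane_wave k \<omega> x)"

definition well_posed :: "real \<Rightarrow> real \<Rightarrow> ('a::euclidean_space \<Rightarrow> complex) \<Rightarrow> real \<Rightarrow> bool" where
  "well_posed k R V S \<longleftrightarrow>
     (\<forall>\<omega>\<in>sphere 0 1.
        (\<exists>!u. total_wave k V \<omega> u) \<and>
        (\<forall>u. total_wave k V \<omega> u \<longrightarrow>
             H2_norm_le (ball 0 (2 * R)) (\<lambda>x. u x - plane_wave k \<omega> x) S))"

definition far_field :: "real \<Rightarrow> ('a::euclidean_space \<Rightarrow> complex) \<Rightarrow> ('a \<Rightarrow> complex) \<Rightarrow> bool" where
  "far_field k us F \<longleftrightarrow>
     (\<exists>C \<rho>. \<forall>r\<ge>\<rho>. \<forall>\<theta>\<in>sphere 0 1.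
        cmod (us (r *\<^sub>R \<theta>) - exp (\<i> * complex_of_real (k * r)) /
                 complex_of_real (r powr ((real DIM('a) - 1) / 2)) * F \<theta>)
        \<le> C * r powr (- real DIM('a) / 2))"

definition far_field_of :: "real \<Rightarrow> ('a::euclidean_space \<Rightarrow> complex) \<Rightarrow> 'a \<Rightarrow> ('a \<Rightarrow> complex) \<Rightarrow> bool" where
  "far_field_of k V \<omega> F \<longleftrightarrow>
     (\<exists>u. total_wave k V \<omega> u \<and> far_field k (\<lambda>x. u x - plane_wave k \<omega> x) F)"

text \<open>L^2 norm on the unit sphere with respect to its surface measure, the latter constructed
  as the cone measure: sigma(A) = n * Lebesgue({t x | x \<in> A, 0 < t \<le> 1}).\<close>
definition sphere_L2_norm :: "('a::euclidean_space \<Rightarrow> complex) \<Rightarrow> real" where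
  "sphere_L2_norm F = sqrt (enn2real
     (\<integral>\<^sup>+ x\<in>ball 0 1 - {0}. ennreal (real DIM('a) * (cmod (F (x /\<^sub>R norm x)))\<^sup>2) \<partial>lborel))"

definition supp :: "('a::euclidean_space \<Rightarrow> complex) \<Rightarrow> 'a set" where
  "supp V = closure {x. V x \<noteq> 0}"

definition hausdorff_dist :: "'a::euclidean_space set \<Rightarrow> 'a set \<Rightarrow> real" where
  "hausdorff_dist P Q = max (SUP x\<in>P. infdist x Q) (SUP y\<in>Q. infdist y P)"

definition convex_polygon :: "'a::euclidean_space set \<Rightarrow> bool" where
  "convex_polygon P \<longleftrightarrow> (\<exists>K. polytope K \<and> P = interior K) \<and> P \<noteq> {}"

definition cuboid :: "'a::euclidean_space set \<Rightarrow> bool" where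
  "cuboid P \<longleftrightarrow> (\<exists>t u1 u2 u3 a b c.
     0 < a \<and> 0 < b \<and> 0 < c \<and>
     norm u1 = 1 \<and> norm u2 = 1 \<and> norm u3 = 1 \<and>
     u1 \<bullet> u2 = 0 \<and> u1 \<bullet> u3 = 0 \<and> u2 \<bullet> u3 = 0 \<and>
     P = {t + x1 *\<^sub>R u1 + x2 *\<^sub>R u2 + x3 *\<^sub>R u3 | x1 x2 x3.
            0 < x1 \<and> x1 < a \<and> 0 < x2 \<and> x2 < b \<and> 0 < x3 \<and> x3 < c})"

definition admissible_shape :: "real \<Rightarrow> 'a::euclidean_space set \<Rightarrow> bool" where
  "admissible_shape R P \<longleftrightarrow> P \<subseteq> ball 0 R \<and>
     (if DIM('a) = 2 then convex_polygon P else cuboid P)"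

definition vertices :: "'a::euclidean_space set \<Rightarrow> 'a set" where
  "vertices P = {v. v extreme_point_of (closure P)}"

definition edges :: "'a::euclidean_space set \<Rightarrow> 'a set set" where
  "edges P = {E. E face_of (closure P) \<and> aff_dim E = 1}"

definition vec_angle :: "'a::euclidean_space \<Rightarrow> 'a \<Rightarrow> real" where
  "vec_angle x y = arccos ((x \<bullet> y) / (norm x * norm y))"

definition angles_in :: "'a::euclidean_space set \<Rightarrow> real \<Rightarrow> real \<Rightarrow> bool" where
  "angles_in P lo hi \<longleftrightarrow>
     (\<forall>v\<in>vertices P. \<forall>E1\<in>edges P. \<forall>E2\<in>edges P.
        E1 \<noteq> E2 \<and> v \<in> E1 \<and> v \<in> E2 \<longrightarrow>
        (\<forall>w1\<in>E1 - {v}. \<forall>w2\<in>E2 - {v}. lo \<le> vec_angle (w1 - v) (w2 - v) \<and> vec_angle (w1 - v) (w2 - v) \<le> hi))"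

definition vertex_edge_sep :: "'a::euclidean_space set \<Rightarrow> real \<Rightarrow> bool" where
  "vertex_edge_sep P l \<longleftrightarrow>
     (\<forall>v\<in>vertices P. \<forall>E\<in>edges P. v \<notin> E \<longrightarrow> l \<le> infdist v E)"

text \<open>C^alpha with alpha = m + beta, m = ceil(alpha) - 1, 0 < beta \<le> 1.\<close>
definition holder_order :: "real \<Rightarrow> nat" where
  "holder_order \<alpha> = nat (\<lceil>\<alpha>\<rceil> - 1)"

definition holder_space :: "real \<Rightarrow> ('a::euclidean_space \<Rightarrow> complex) \<Rightarrow> bool" where
  "holder_space \<alpha> f \<longleftrightarrow> 0 < \<alpha> \<and>
     (\<forall>bs. set bs \<subseteq> Basis \<and> length bs < holder_order \<alpha> \<longrightarrow> (\<forall>x. pd bs f differentiable (at x))) \<and>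
     (\<forall>bs\<in>dirs_le (holder_order \<alpha>). bounded (range (pd bs f))) \<and>
     (\<forall>bs\<in>dirs_eq (holder_order \<alpha>). \<exists>L. \<forall>x y.
        cmod (pd bs f x - pd bs f y) \<le> L * dist x y powr (\<alpha> - real (holder_order \<alpha>)))"

definition holder_norm :: "real \<Rightarrow> ('a::euclidean_space \<Rightarrow> complex) \<Rightarrow> real" where
  "holder_norm \<alpha> f =
     (\<Sum>bs\<in>dirs_le (holder_order \<alpha>). SUP x. cmod (pd bs f x)) +
     (\<Sum>bs\<in>dirs_eq (holder_order \<alpha>). SUP xy\<in>{(x, y). x \<noteq> y}.
        cmod (pd bs f (fst xy) - pd bs f (snd xy)) / dist (fst xy) (snd xy) powr (\<alpha> - real (holder_order \<alpha>)))"

text \<open>Bessel kernel G_s (s > 0), whose Fourier transform is (1 + |xi|^2)^(-s/2).\<close>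
definition bessel_kernel :: "real \<Rightarrow> 'a::euclidean_space \<Rightarrow> real" where
  "bessel_kernel s x = (1 / Gamma (s / 2)) *
     (LBINT t:{0<..}. t powr (s / 2 - 1) * exp (- t) * (4 * pi * t) powr (- real DIM('a) / 2)
                       * exp (- (norm x)\<^sup>2 / (4 * t)))"

definition bessel_pot :: "real \<Rightarrow> ('a::euclidean_space \<Rightarrow> complex) \<Rightarrow> 'a \<Rightarrow> complex" where
  "bessel_pot s g x = (if s = 0 then g x
      else \<integral>y. complex_of_real (bessel_kernel s (x - y)) * g y \<partial>lborel)"

definition Lp :: "real \<Rightarrow> ('a::euclidean_space \<Rightarrow> complex) \<Rightarrow> bool" where
  "Lp r g \<longleftrightarrow> g \<in> borel_measurable lborel \<and> integrable lborel (\<lambda>x. cmod (g x) powr r)"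

definition Lp_norm :: "real \<Rightarrow> ('a::euclidean_space \<Rightarrow> complex) \<Rightarrow> real" where
  "Lp_norm r g = (\<integral>x. cmod (g x) powr r \<partial>lborel) powr (1 / r)"

definition in_bessel :: "real \<Rightarrow> real \<Rightarrow> ('a::euclidean_space \<Rightarrow> complex) \<Rightarrow> bool" where
  "in_bessel s r f \<longleftrightarrow> (\<exists>g. Lp r g \<and> (AE x in lborel. f x = bessel_pot s g x))"

definition bessel_norm :: "real \<Rightarrow> real \<Rightarrow> ('a::euclidean_space \<Rightarrow> complex) \<Rightarrow> real" where
  "bessel_norm s r f = Inf {Lp_norm r g | g. Lp r g \<and> (AE x in lborel. f x = bessel_pot s g x)}"

definition open_halfspaces :: "'a::euclidean_space set set" where
  "open_halfspaces = {{x. a \<bullet> x < b} | a b. a \<noteq> 0}"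

text \<open>C_{s,r}: operator norm (in [0,\<infinity>]) of multiplication by the indicator of a half-space on
  H^s_r (the value does not depend on the half-space; we take the supremum over all of them).\<close>
definition C_sr :: "real \<Rightarrow> real \<Rightarrow> ('a::euclidean_space) itself \<Rightarrow> ereal" where
  "C_sr s r _ = (SUP H\<in>(open_halfspaces :: 'a set set).
      (if (\<forall>f::'a \<Rightarrow> complex. in_bessel s r f \<longrightarrow> in_bessel s r (\<lambda>x. indicator H x * f x))
       then (SUP f\<in>{f::'a \<Rightarrow> complex. in_bessel s r f \<and> bessel_norm s r f > 0}.
               ereal (bessel_norm s r (\<lambda>x. indicator H x * f x) / bessel_norm s r f))
       else \<infinity>))"

definition triangulation :: "'a::euclidean_space set \<Rightarrow> 'a set list list \<Rightarrow> bool" where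
  "triangulation P T \<longleftrightarrow>
     (\<forall>Hs\<in>set T. \<forall>H'\<in>set Hs. \<exists>a b. a \<noteq> 0 \<and> {x. a \<bullet> x < b} \<subseteq> H' \<and> H' \<subseteq> {x. a \<bullet> x \<le> b}) \<and>
     (\<forall>i<length T. \<forall>j<length T. i \<noteq> j \<longrightarrow> \<Inter>(set (T ! i)) \<inter> \<Inter>(set (T ! j)) = {}) \<and>
     P = (\<Union>Hs\<in>set T. \<Inter>(set Hs))"

definition T_norm :: "real \<Rightarrow> real \<Rightarrow> 'a::euclidean_space set \<Rightarrow> ereal" where
  "T_norm s r P = (INF T\<in>{T. triangulation P T}.
      sum_list (map (\<lambda>Hs. C_sr s r TYPE('a) ^ length Hs) T))"

definition admissible_contrast :: "real \<Rightarrow> 'a::euclidean_space set \<Rightarrow> ('a \<Rightarrow> complex) \<Rightarrow> bool" where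
  "admissible_contrast \<alpha> P \<phi> \<longleftrightarrow> holder_space \<alpha> \<phi> \<and>
     (if DIM('a) = 2 then 0 < \<alpha> else 1/4 < \<alpha>) \<and>
     (\<forall>v\<in>vertices P. \<phi> v \<noteq> 0)"

definition potential :: "'a::euclidean_space set \<Rightarrow> ('a \<Rightarrow> complex) \<Rightarrow> 'a \<Rightarrow> complex" where
  "potential P \<phi> x = indicator P x * \<phi> x"

definition nonvanishing_waves :: "real \<Rightarrow> real \<Rightarrow> ('a::euclidean_space \<Rightarrow> complex) \<Rightarrow> bool" where
  "nonvanishing_waves k R V \<longleftrightarrow> (\<forall>\<omega>\<in>sphere 0 1. \<forall>u. total_wave k V \<omega> u \<longrightarrow>
      (\<forall>x\<in>ball 0 R - supp V. u x \<noteq> 0))"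

definition apriori_bounds ::
  "real \<Rightarrow> real \<Rightarrow> real \<Rightarrow> real \<Rightarrow> real \<Rightarrow> real \<Rightarrow> real \<Rightarrow> real \<Rightarrow> real \<Rightarrow> real \<Rightarrow> real \<Rightarrow> real
   \<Rightarrow> 'a::euclidean_space set \<Rightarrow> ('a \<Rightarrow> complex) \<Rightarrow> bool" where
  "apriori_bounds k R \<alpha> s r l \<alpha>m \<alpha>M D M \<mu> c P \<phi> \<longleftrightarrow>
     0 < l \<and> l \<le> 1 \<and> vertex_edge_sep P l \<and>
     (DIM('a) = 2 \<longrightarrow> 0 < 2 * \<alpha>m \<and> 2 * \<alpha>m < 2 * \<alpha>M \<and> 2 * \<alpha>M < pi \<and>
                      angles_in P (2 * \<alpha>m) (2 * \<alpha>M)) \<and>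
     T_norm s r P \<le> ereal D \<and>
     holder_norm \<alpha> \<phi> \<le> M \<and>
     0 < \<mu> \<and> (\<forall>v\<in>vertices P. \<mu> \<le> cmod (\<phi> v)) \<and>
     0 < c \<and> (\<forall>\<omega>\<in>sphere 0 1. \<forall>u. total_wave k (potential P \<phi>) \<omega> u \<longrightarrow>
        (\<forall>x\<in>ball 0 R - supp (potential P \<phi>). c \<le> cmod (u x)))"

end

theory Submission
  imports Defs "HOL-Complex_Analysis.Complex_Analysis" "HOL-Real_Asymp.Real_Asymp"
begin

text \<open>Let u, u' be the two total waves. Green's formula pairs the difference of the sources,
  Vu - V'u', with any entire solution v of the Helmholtz equation that decays like a Herglotz
  wave; the result is bounded by the L2 distance eps of the far fields times the decay constant
  of v. On the ball of radius R the complex exponential exp(zeta (x - xc)), with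
  zeta zeta = -k^2 and Re zeta of size tau, is within exp(-tau) of such a v whose constant is
  doubly exponential in tau: in the plane this is a Herglotz wave obtained from Cauchy's formula,
  in space a wave sin(k r)/r centred at a complex point. No unique continuation is needed.
  Take for xc a vertex of P farthest from P', and zeta decaying into the corner
  of P at xc and on P'. The corner contributes a product of one-dimensional exponential integrals
  of order tau^(-n), while the Hoelder remainder and P' are of lower order as long as the
  distance h of xc from P' exceeds tau^(-gamma). So tau^(-n) is at most
  C exp (exp (K tau)) eps for such tau, and tau = ln ln (S / eps) / (2 K) excludes this.\<close>

subsection \<open>Smooth functions\<close>

text \<open>One exponential has to decay into a corner of P and at the same time be small on all of
  P'. Both properties come from a single vector: let x be a point of the closure of P at maximal
  distance from P' and x0 its nearest point in the closure of P'. The direction of x - x0 separates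
  P' by the distance, and it also supports P, because no point of P is farther from P'; the face
  where it is attained contains a vertex. This direction may be orthogonal to an edge at that
  vertex, so it is tilted by an amount proportional to h, and the decay rate along the edges is only
  of order tau h. This loss is what limits gamma. An exponential has no far field, so it cannot be
  paired with the waves directly; the price of replacing it by a solution that decays at infinity is
  the double exponential, hence the double logarithm. The waves enter through two facts: |phi u| is
  at least mu c at the vertex, and phi u is Hoelder continuous with exponent min(alpha, 1/6). The
  lower bound is given only off the support of V and reaches the vertex by continuity; the exponent
  1/6 follows from the H^2 bound by an elementary comparison of means, valid for n < 4.\<close>

definition smooth :: "('a::euclidean_space \<Rightarrow> complex) \<Rightarrow> bool" where
  "smooth f \<longleftrightarrow> (\<forall>bs. set bs \<subseteq> Basis \<longrightarrow> (\<forall>x. pd bs f differentiable (at x)))"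

abbreviation dd :: "'a::euclidean_space \<Rightarrow> ('a \<Rightarrow> complex) \<Rightarrow> 'a \<Rightarrow> complex" where
  "dd b f \<equiv> (\<lambda>x. frechet_derivative f (at x) b)"

definition lap :: "('a::euclidean_space \<Rightarrow> complex) \<Rightarrow> 'a \<Rightarrow> complex" where
  "lap f x = (\<Sum>b\<in>Basis. pd [b, b] f x)"

lemma pd_append: "pd (as @ bs) f = pd as (pd bs f)"
  by (induction as) auto

lemma smooth_differentiable: "smooth f \<Longrightarrow> f differentiable (at x)"
  unfolding smooth_def by (metis empty_set empty_subsetI pd.simps(1))

lemma smooth_continuous: "smooth f \<Longrightarrow> continuous_on A f"
  by (meson continuous_at_imp_continuous_on differentiable_imp_continuous_within smooth_differentiable)

lemma smooth_pd:
  assumes "smooth f" "set bs \<subseteq> Basis"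
  shows "smooth (pd bs f)"
  using assms unfolding smooth_def by (metis Un_subset_iff pd_append set_append)

lemma smooth_dd: "smooth f \<Longrightarrow> b \<in> Basis \<Longrightarrow> smooth (dd b f)"
  using smooth_pd[of f "[b]"] by simp

text \<open>Iterated derivatives never leave \<open>F\<close>, so differentiability of its members
  is all that remains to be checked. In the applications \<open>F\<close> is an explicit family
  (constants, sums of products, Herglotz waves), which replaces inductions over lists of
  directions.\<close>

lemma smooth_coinduct:
  assumes "f \<in> F"
    and "\<And>g x. g \<in> F \<Longrightarrow> g differentiable (at x)"
    and "\<And>g b. g \<in> F \<Longrightarrow> b \<in> Basis \<Longrightarrow> dd b g \<in> F"
  shows "smooth f"
proof -
  have "pd bs f \<in> F" if "set bs \<subseteq> Basis" for bs
    using that by (induction bs) (auto simp: assms)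
  then show ?thesis unfolding smooth_def using assms(2) by blast
qed

lemma smooth_step:
  assumes "\<And>x. f differentiable (at x)" "\<And>b. b \<in> Basis \<Longrightarrow> smooth (dd b f)"
  shows "smooth f"
  unfolding smooth_def
proof (intro allI impI)
  fix bs :: "'a list" and x assume bs: "set bs \<subseteq> Basis"
  show "pd bs f differentiable at x"
  proof (cases bs rule: rev_cases)
    case Nil then show ?thesis using assms(1) by simp
  next
    case (snoc ys b)
    then have "pd bs f = pd ys (dd b f)" by (simp add: pd_append)
    then show ?thesis using assms(2)[of b] bs snoc unfolding smooth_def by auto
  qed
qed

lemma frechet_derivative_eqI:
  "(f has_derivative f') (at x) \<Longrightarrow> frechet_derivative f (at x) = f'"
  using frechet_derivative_at by metis

lemma has_derivative_dd:
  "f differentiable (at x) \<Longrightarrow> (f has_derivative frechet_derivative f (at x)) (at x)"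
  by (simp add: frechet_derivative_works)

lemma smooth_has_derivative: "smooth f \<Longrightarrow> (f has_derivative frechet_derivative f (at x)) (at x)"
  by (simp add: has_derivative_dd smooth_differentiable)

lemma smooth_const [simp]: "smooth (\<lambda>x. c)"
proof (rule smooth_coinduct[where F = "range (\<lambda>c x. c)"])
  fix g :: "'a \<Rightarrow> complex" and b :: 'a assume "g \<in> range (\<lambda>c x. c)"
  then obtain c where g: "g = (\<lambda>x. c)" by auto
  show "dd b g \<in> range (\<lambda>c x. c)" unfolding g by (auto simp: frechet_derivative_const)
qed auto

lemma dd_add: "f differentiable (at x) \<Longrightarrow> g differentiable (at x) \<Longrightarrow>
  frechet_derivative (\<lambda>x. f x + g x) (at x) b = frechet_derivative f (at x) b + frechet_derivative g (at x) b"
  by (subst frechet_derivative_eqI[OF has_derivative_add[OF has_derivative_dd has_derivative_dd]]) auto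

lemma dd_mult:
  assumes "f differentiable (at x)" "g differentiable (at x)"
  shows "frechet_derivative (\<lambda>x. f x * g x) (at x) b = f x * frechet_derivative g (at x) b + frechet_derivative f (at x) b * (g x :: complex)"
  by (subst frechet_derivative_eqI[OF has_derivative_mult[OF has_derivative_dd has_derivative_dd]])
     (use assms in auto)

lemma smooth_add:
  assumes "smooth f" "smooth g" shows "smooth (\<lambda>x. f x + g x)"
proof (rule smooth_coinduct[where F = "{\<lambda>x. f x + g x | f g. smooth f \<and> smooth g}"])
  fix h :: "'a \<Rightarrow> complex" and b :: 'a
  assume "h \<in> {\<lambda>x. f x + g x | f g. smooth f \<and> smooth g}" and b: "b \<in> Basis"
  then obtain f g where h: "h = (\<lambda>x. f x + g x)" and fg: "smooth f" "smooth g" by auto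
  have "dd b h = (\<lambda>x. dd b f x + dd b g x)"
    unfolding h by (rule ext, rule dd_add) (use fg in \<open>auto intro: smooth_differentiable\<close>)
  then show "dd b h \<in> {\<lambda>x. f x + g x | f g. smooth f \<and> smooth g}"
    using smooth_dd[OF fg(1) b] smooth_dd[OF fg(2) b] by auto
qed (use assms in \<open>auto intro: differentiable_add smooth_differentiable\<close>)

text \<open>The Leibniz rule turns one product into a sum of two, so products alone are not closed
  under derivatives; sums of products are.\<close>

inductive_set prods :: "('a::euclidean_space \<Rightarrow> complex) set" where
  "smooth f \<Longrightarrow> smooth g \<Longrightarrow> (\<lambda>x. f x * g x) \<in> prods"
| "f \<in> prods \<Longrightarrow> g \<in> prods \<Longrightarrow> (\<lambda>x. f x + g x) \<in> prods"

lemma smooth_mult: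
  assumes "smooth f" "smooth g" shows "smooth (\<lambda>x. f x * g x)"
proof (rule smooth_coinduct[where F = prods])
  show "(\<lambda>x. f x * g x) \<in> prods" using assms by (rule prods.intros)
next
  fix h :: "'a \<Rightarrow> complex" and x :: 'a
  assume "h \<in> prods" then show "h differentiable at x"
    by (induction) (auto intro: differentiable_add differentiable_mult smooth_differentiable)
next
  fix h :: "'a \<Rightarrow> complex" and b :: 'a
  assume "h \<in> prods" and b: "b \<in> Basis"
  then have "(\<forall>x. h differentiable at x) \<and> dd b h \<in> prods"
  proof induction
    case (1 f g)
    have "dd b (\<lambda>x. f x * g x) = (\<lambda>x. f x * dd b g x + dd b f x * g x)"
      by (rule ext, rule dd_mult) (use 1 in \<open>auto intro: smooth_differentiable\<close>)
    moreover have "(\<lambda>x. f x * dd b g x + dd b f x * g x) \<in> prods"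
      by (rule prods.intros; rule prods.intros) (use 1 b in \<open>auto intro: smooth_dd\<close>)
    ultimately show ?case using 1 by (auto intro: differentiable_mult smooth_differentiable)
  next
    case (2 f g)
    have "dd b (\<lambda>x. f x + g x) = (\<lambda>x. dd b f x + dd b g x)"
      by (rule ext, rule dd_add) (use 2 in auto)
    with 2 show ?case by (auto intro: prods.intros differentiable_add)
  qed
  then show "dd b h \<in> prods" by blast
qed

lemma smooth_sum:
  "(\<And>i. i \<in> I \<Longrightarrow> smooth (f i)) \<Longrightarrow> smooth (\<lambda>x. \<Sum>i\<in>I. f i x)"
  by (induction I rule: infinite_finite_induct) (auto intro: smooth_add)

lemma smooth_minus: "smooth f \<Longrightarrow> smooth (\<lambda>x. - f x)"
  using smooth_mult[OF smooth_const[of "-1"]] by fastforce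

lemma smooth_diff: "smooth f \<Longrightarrow> smooth g \<Longrightarrow> smooth (\<lambda>x. f x - g x)"
  using smooth_add[OF _ smooth_minus, of f g] by simp

lemma smooth_power: "smooth f \<Longrightarrow> smooth (\<lambda>x. f x ^ n)"
  by (induction n) (auto intro: smooth_mult)

lemma smooth_linear:
  fixes f :: "'a::euclidean_space \<Rightarrow> complex"
  assumes "bounded_linear f" shows "smooth f"
proof (rule smooth_step)
  fix x b :: 'a
  show "f differentiable at x"
    using assms bounded_linear_imp_differentiable by blast
  have "dd b f = (\<lambda>x. f b)"
    using assms by (auto intro!: ext simp: frechet_derivative_eqI[OF bounded_linear_imp_has_derivative])
  then show "smooth (dd b f)" by simp
qed

lemma smooth_inner: "smooth (\<lambda>x::'a::euclidean_space. complex_of_real (x \<bullet> a))"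
  by (rule smooth_linear) (auto intro: bounded_linear_compose[OF bounded_linear_of_real bounded_linear_inner_left])

text \<open>Composition with a one-variable function g, phrased so that it covers both holomorphic
  g and smooth functions g of one real variable: G collects the composites of the derivatives of g.\<close>
lemma smooth_compose:
  assumes s: "smooth s" and f: "f \<in> G"
    and G: "\<And>g. g \<in> G \<Longrightarrow> \<exists>g'\<in>G. \<forall>x. (g has_derivative (\<lambda>d. g' x * frechet_derivative s (at x) d)) (at x)"
  shows "smooth f"
proof -
  let ?S = "{h. \<exists>A. finite A \<and> (\<exists>u v. (\<forall>i\<in>A. u i \<in> G \<and> smooth (v i)) \<and> h = (\<lambda>x. \<Sum>i\<in>A. u i x * v (i::nat) x))}"
  have gdiff: "g differentiable at x" if "g \<in> G" for g x
    using G[OF that] by (auto simp: differentiable_def)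
  show ?thesis
  proof (rule smooth_coinduct[where F = ?S])
    show "f \<in> ?S"
      by (rule CollectI, rule exI[of _ "{0}"], rule conjI, simp, rule exI[of _ "\<lambda>_. f"], rule exI[of _ "\<lambda>_ _. 1"])
         (use f in auto)
  next
    fix h x assume "h \<in> ?S"
    then obtain A u v where A: "finite A" "\<And>i. i \<in> A \<Longrightarrow> u i \<in> G" "\<And>i. i \<in> A \<Longrightarrow> smooth (v i)"
      and h: "h = (\<lambda>x. \<Sum>i\<in>A. u i x * v (i::nat) x)" by auto
    show "h differentiable at x" unfolding h
      by (rule differentiable_sum) (use A gdiff in \<open>auto intro!: differentiable_mult intro: smooth_differentiable\<close>)
  next
    fix h and b :: 'a assume "h \<in> ?S" and b: "b \<in> Basis"
    then obtain A u v where A: "finite A" "\<And>i. i \<in> A \<Longrightarrow> u i \<in> G" "\<And>i. i \<in> A \<Longrightarrow> smooth (v i)"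
      and h: "h = (\<lambda>x. \<Sum>i\<in>A. u i x * v (i::nat) x)" by auto
    obtain m where m: "\<And>i. i \<in> A \<Longrightarrow> i < m"
      using A(1) by (metis finite_nat_set_iff_bounded)
    from G A(2) have "\<forall>i\<in>A. \<exists>g'. g' \<in> G \<and> (\<forall>x. (u i has_derivative (\<lambda>d. g' x * frechet_derivative s (at x) d)) (at x))"
      by blast
    then obtain u' where u': "\<And>i. i \<in> A \<Longrightarrow> u' i \<in> G"
       "\<And>i x. i \<in> A \<Longrightarrow> (u i has_derivative (\<lambda>d. u' i x * frechet_derivative s (at x) d)) (at x)"
      by metis
    have D: "dd b h x = (\<Sum>i\<in>A. u i x * dd b (v i) x) + (\<Sum>i\<in>A. u' i x * (dd b s x * v i x))" for x
    proof -
      have "(h has_derivative (\<lambda>d. \<Sum>i\<in>A. u i x * frechet_derivative (v i) (at x) d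
               + (u' i x * frechet_derivative s (at x) d) * v i x)) (at x)"
        unfolding h by (rule has_derivative_sum)
          (use A u' in \<open>auto intro!: has_derivative_mult smooth_has_derivative\<close>)
      then show ?thesis by (simp add: frechet_derivative_eqI sum.distrib algebra_simps)
    qed
    \<comment> \<open>Chain rule and Leibniz rule give two terms for each old one. Shifting the
      indices of the second batch by \<open>m\<close>, which exceeds every index in
      \<open>A\<close>, keeps the two batches disjoint, so that the result is again a single indexed
      sum.\<close>
    let ?A = "A \<union> (\<lambda>i. i + m) ` A"
    let ?u = "\<lambda>i. if i < m then u i else u' (i - m)"
    let ?v = "\<lambda>i. if i < m then dd b (v i) else (\<lambda>x. dd b s x * v (i - m) x)"
    have disj: "A \<inter> (\<lambda>i. i + m) ` A = {}" using m by fastforce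
    have "dd b h = (\<lambda>x. \<Sum>i\<in>?A. ?u i x * ?v i x)"
    proof
      fix x
      have "(\<Sum>i\<in>?A. ?u i x * ?v i x) = (\<Sum>i\<in>A. ?u i x * ?v i x) + (\<Sum>i\<in>(\<lambda>i. i + m) ` A. ?u i x * ?v i x)"
        using A(1) disj by (intro sum.union_disjoint) auto
      also have "(\<Sum>i\<in>A. ?u i x * ?v i x) = (\<Sum>i\<in>A. u i x * dd b (v i) x)"
        by (rule sum.cong) (use m in auto)
      also have "(\<Sum>i\<in>(\<lambda>i. i + m) ` A. ?u i x * ?v i x) = (\<Sum>i\<in>A. u' i x * (dd b s x * v i x))"
        by (subst sum.reindex) (auto simp: inj_on_def)
      finally show "dd b h x = (\<Sum>i\<in>?A. ?u i x * ?v i x)" using D by simp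
    qed
    moreover have "\<forall>i\<in>?A. ?u i \<in> G \<and> smooth (?v i)"
      using A(2,3) u'(1) m b by (auto intro!: smooth_dd smooth_mult s)
    ultimately show "dd b h \<in> ?S"
      using A(1) by (intro CollectI exI[of _ ?A] conjI exI[of _ ?u] exI[of _ ?v]) auto
  qed
qed

lemma smooth_holomorphic:
  assumes "smooth s" and h: "h holomorphic_on UNIV" shows "smooth (\<lambda>x. h (s x))"
proof (rule smooth_compose[OF assms(1), where G = "range (\<lambda>j x. (deriv ^^ j) h (s x))"])
  fix g assume "g \<in> range (\<lambda>j x. (deriv ^^ j) h (s x))"
  then obtain j where g: "g = (\<lambda>x. (deriv ^^ j) h (s x))" by auto
  have hj: "(deriv ^^ j) h holomorphic_on UNIV" using h by (simp add: holomorphic_higher_deriv)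
  have D: "(g has_derivative (\<lambda>d. (deriv ^^ Suc j) h (s x) * frechet_derivative s (at x) d)) (at x)" for x
    unfolding g
    using has_derivative_compose[OF smooth_has_derivative[OF assms(1)], of "(deriv ^^ j) h" "(*) (deriv ((deriv ^^ j) h) (s x))" x]
      holomorphic_derivI[OF hj, of "s x"]
    by (simp add: has_field_derivative_def)
  show "\<exists>g'\<in>range (\<lambda>j x. (deriv ^^ j) h (s x)). \<forall>x. (g has_derivative (\<lambda>d. g' x * frechet_derivative s (at x) d)) (at x)"
    by (rule bexI[of _ "\<lambda>x. (deriv ^^ Suc j) h (s x)"], use D in simp, rule range_eqI[of _ _ "Suc j"], simp)
qed (rule range_eqI[of _ _ 0], simp)

subsection \<open>Cutoff functions\<close>

text \<open>The extra power of y makes the induction work: removing the constant coefficient of the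
  polynomial raises \<open>k\<close> by one.\<close>

lemma poly_times_exp_minus_tendsto:
  "((\<lambda>y::real. y ^ k * poly p y * exp (- y)) \<longlongrightarrow> 0) at_top"
proof (induction p arbitrary: k)
  case 0
  show ?case by simp
next
  case (pCons a p)
  have "((\<lambda>y::real. a * (y ^ k / exp y) + y ^ Suc k * poly p y * exp (- y)) \<longlongrightarrow> a * 0 + 0) at_top"
    by (intro tendsto_intros pCons.IH tendsto_power_div_exp_0)
  then show ?case by (simp add: field_simps exp_minus)
qed

text \<open>The classical function exp(-1/t) with a polynomial in 1/t in front of it. The polynomial
  is carried along so that the family is closed under differentiation.\<close>

definition flat :: "real poly \<Rightarrow> real \<Rightarrow> real" where
  "flat p t = (if t > 0 then poly p (1 / t) * exp (- (1 / t)) else 0)"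

text \<open>With y = 1/t one has dy/dt = -y^2, so p(y) exp(-y) has the derivative y^2 (p - p')(y)
  exp(-y).\<close>

definition flat_deriv :: "real poly \<Rightarrow> real poly" where
  "flat_deriv p = pCons 0 (pCons 0 (p - pderiv p))"

lemma flat_has_derivative: "(flat p has_real_derivative flat (flat_deriv p) t) (at t)"
proof -
  consider "t > 0" | "t < 0" | "t = 0" by linarith
  then show ?thesis
  proof cases
    case 1
    have "((\<lambda>t. poly p (1 / t) * exp (- (1 / t))) has_real_derivative flat (flat_deriv p) t) (at t)"
      unfolding flat_def flat_deriv_def using 1
      by (auto intro!: derivative_eq_intros DERIV_chain2[OF poly_DERIV] simp: field_simps power2_eq_square)
    then show ?thesis
      by (rule has_field_derivative_transform_within_open[where S = "{0<..}"]) (use 1 in \<open>auto simp: flat_def\<close>)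
  next
    case 2
    have "((\<lambda>t. 0) has_real_derivative flat (flat_deriv p) t) (at t)"
      using 2 by (auto simp: flat_def)
    then show ?thesis
      by (rule has_field_derivative_transform_within_open[where S = "{..<0}"]) (use 2 in \<open>auto simp: flat_def\<close>)
  next
    case 3
    have "((\<lambda>y. y ^ 1 * poly p y * exp (- y)) \<longlongrightarrow> 0) at_top"
      by (rule poly_times_exp_minus_tendsto)
    then have "((\<lambda>h. inverse h ^ 1 * poly p (inverse h) * exp (- inverse h)) \<longlongrightarrow> 0) (at_right (0::real))"
      using filterlim_compose filterlim_inverse_at_top_right by blast
    \<comment> \<open>From the right the difference quotient at 0 is y p(y) exp(-y) with y = 1/h
      tending to infinity; from the left it is identically 0.\<close>
    then have R: "((\<lambda>h. (flat p (0 + h) - flat p 0) / h) \<longlongrightarrow> 0) (at_right 0)"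
      by (rule tendsto_cong[THEN iffD1, rotated])
        (auto simp: eventually_at_filter flat_def field_simps)
    have L: "((\<lambda>h. (flat p (0 + h) - flat p 0) / h) \<longlongrightarrow> 0) (at_left 0)"
      by (rule tendsto_cong[THEN iffD1, OF _ tendsto_const[of 0]])
        (auto simp: eventually_at_filter flat_def field_simps)
    have "((\<lambda>h. (flat p (0 + h) - flat p 0) / h) \<longlongrightarrow> 0) (at 0)"
      using R L by (simp add: filterlim_split_at)
    then show ?thesis using 3 unfolding DERIV_def by (simp add: flat_def)
  qed
qed

lemma smooth_real_compose:
  fixes s :: "'a::euclidean_space \<Rightarrow> real"
  assumes s: "smooth (\<lambda>x. of_real (s x))" and f: "f \<in> G"
    and G: "\<And>g. g \<in> G \<Longrightarrow> \<exists>g'\<in>G. \<forall>t. (g has_real_derivative g' t) (at t)"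
  shows "smooth (\<lambda>x. complex_of_real (f (s x)))"
proof (rule smooth_compose[OF s, where G = "(\<lambda>g x. complex_of_real (g (s x))) ` G"])
  show "(\<lambda>x. complex_of_real (f (s x))) \<in> (\<lambda>g x. complex_of_real (g (s x))) ` G" using f by blast
next
  fix h assume "h \<in> (\<lambda>g x. complex_of_real (g (s x))) ` G"
  then obtain g where g: "g \<in> G" and h: "h = (\<lambda>x. complex_of_real (g (s x)))" by blast
  obtain g' where g': "g' \<in> G" "\<And>t. (g has_real_derivative g' t) (at t)" using G[OF g] by blast
  have "(h has_derivative (\<lambda>d. complex_of_real (g' (s x)) * frechet_derivative (\<lambda>x. complex_of_real (s x)) (at x) d)) (at x)" for x
  proof -
    let ?D = "frechet_derivative (\<lambda>x. complex_of_real (s x)) (at x)"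
    have D: "((\<lambda>x. complex_of_real (s x)) has_derivative ?D) (at x)"
      by (rule smooth_has_derivative[OF s])
    from has_derivative_Re[OF D] have DR: "(s has_derivative (\<lambda>d. Re (?D d))) (at x)" by simp
    \<comment> \<open>Since \<open>s\<close> is real, its derivative as a complex valued map takes
      real values; this allows the chain rule over the reals to be read as a complex
      product.\<close>
    from has_derivative_Im[OF D] have "((\<lambda>x. 0::real) has_derivative (\<lambda>d. Im (?D d))) (at x)" by simp
    moreover have "((\<lambda>x::'a. 0::real) has_derivative (\<lambda>d. 0)) (at x)" by simp
    ultimately have "(\<lambda>d. Im (?D d)) = (\<lambda>d. 0)" by (rule has_derivative_unique)
    then have re: "?D d = complex_of_real (Re (?D d))" for d
      by (metis complex_is_Real_iff of_real_Re)
    have "((\<lambda>x. g (s x)) has_derivative (\<lambda>d. g' (s x) * Re (?D d))) (at x)"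
      using has_derivative_compose[OF DR, of g "(*) (g' (s x))"] g'(2)[of "s x"]
      by (simp add: has_field_derivative_def)
    then have "(h has_derivative (\<lambda>d. complex_of_real (g' (s x) * Re (?D d)))) (at x)"
      unfolding h by (rule has_derivative_of_real)
    then show ?thesis by (metis (no_types, lifting) ext of_real_mult re)
  qed
  then show "\<exists>g'\<in>(\<lambda>g x. complex_of_real (g (s x))) ` G. \<forall>x. (h has_derivative
      (\<lambda>d. g' x * frechet_derivative (\<lambda>x. complex_of_real (s x)) (at x) d)) (at x)"
    by (intro bexI[of _ "\<lambda>x. complex_of_real (g' (s x))"]) (use g'(1) in auto)
qed

lemma smooth_flat:
  "smooth (\<lambda>x. complex_of_real (s x)) \<Longrightarrow> smooth (\<lambda>x. complex_of_real (flat p (s x)))"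
  by (rule smooth_real_compose[where G = "range flat"]) (auto intro: flat_has_derivative)

text \<open>The argument will be |y - x0|^2 / rho^2, so the support 1 <= t <= 4 is the shell between
  the radii rho and 2 rho.\<close>

definition bump :: "real \<Rightarrow> real" where
  "bump t = flat 1 (t - 1) * flat 1 (4 - t)"

definition bump' :: "real \<Rightarrow> real" where
  "bump' t = flat (flat_deriv 1) (t - 1) * flat 1 (4 - t) - flat 1 (t - 1) * flat (flat_deriv 1) (4 - t)"

lemma bump_has_derivative: "(bump has_real_derivative bump' t) (at t)"
  unfolding bump_def bump'_def
  by (auto intro!: derivative_eq_intros DERIV_chain2[OF flat_has_derivative])

lemma continuous_on_flat: "continuous_on A (flat p)"
  by (meson DERIV_continuous_on flat_has_derivative has_field_derivative_at_within)

lemma continuous_on_bump: "continuous_on A bump"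
  by (meson DERIV_continuous_on bump_has_derivative has_field_derivative_at_within)

lemma continuous_on_bump': "continuous_on A bump'"
proof -
  have "continuous_on A (\<lambda>t. flat p (t - 1))" "continuous_on A (\<lambda>t. flat p (4 - t))" for p
    using continuous_on_compose[of A "\<lambda>t. t - 1" "flat p"] continuous_on_compose[of A "\<lambda>t. 4 - t" "flat p"]
    by (simp_all add: o_def continuous_on_flat continuous_on_diff)
  then show ?thesis unfolding bump'_def by (intro continuous_intros)
qed

lemma bump_nonneg: "0 \<le> bump t" by (auto simp: bump_def flat_def)
lemma bump_pos: "1 < t \<Longrightarrow> t < 4 \<Longrightarrow> 0 < bump t" by (auto simp: bump_def flat_def)
lemma bump_eq_0: "t \<le> 1 \<or> 4 \<le> t \<Longrightarrow> bump t = 0" by (auto simp: bump_def flat_def)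
lemma bump'_eq_0: "t \<le> 1 \<or> 4 \<le> t \<Longrightarrow> bump' t = 0" by (auto simp: bump'_def flat_def)

lemma smooth_bump:
  fixes s :: "'a::euclidean_space \<Rightarrow> real"
  assumes "smooth (\<lambda>x. complex_of_real (s x))" shows "smooth (\<lambda>x. complex_of_real (bump (s x)))"
proof -
  have 1: "smooth (\<lambda>x. complex_of_real (s x - 1))" "smooth (\<lambda>x. complex_of_real (4 - s x))"
    using smooth_diff[OF assms smooth_const[of 1]] smooth_diff[OF smooth_const[of 4] assms] by auto
  show ?thesis
    unfolding bump_def of_real_mult by (intro smooth_mult smooth_flat 1)
qed

text \<open>The primitive of \<open>- bump\<close> that vanishes from 4 on. Its value for t <= 1 is
  the integral of \<open>bump\<close>; it is not normalised to 1 but carried along as the positive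
  constant \<open>step 1\<close>.\<close>

definition step :: "real \<Rightarrow> real" where
  "step = (SOME X. (\<forall>t. (X has_real_derivative - bump t) (at t)) \<and> X 4 = 0)"

lemma step: "(step has_real_derivative - bump t) (at t)" "step 4 = 0"
proof -
  have "\<exists>F. \<forall>x. - \<infinity> < ereal x \<longrightarrow> ereal x < \<infinity> \<longrightarrow> (F has_vector_derivative - bump x) (at x)"
    by (rule einterval_antiderivative)
      (auto intro!: continuous_intros continuous_on_interior[OF continuous_on_bump[of UNIV]])
  then obtain F where F: "\<And>x. (F has_real_derivative - bump x) (at x)"
    by (auto simp: has_real_derivative_iff_has_vector_derivative)
  have "(\<forall>t. ((\<lambda>t. F t - F 4) has_real_derivative - bump t) (at t)) \<and> F 4 - F 4 = 0"
    using F by (auto intro!: derivative_eq_intros)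
  then have "\<exists>X. (\<forall>t. (X has_real_derivative - bump t) (at t)) \<and> X 4 = 0" by (rule exI[of _ "\<lambda>t. F t - F 4"])
  from someI_ex[OF this] show "(step has_real_derivative - bump t) (at t)" "step 4 = 0"
    unfolding step_def by auto
qed

lemma step_antimono: "s \<le> t \<Longrightarrow> step t \<le> step s"
  by (rule DERIV_nonpos_imp_nonincreasing[of s t step]) (use step(1) bump_nonneg in \<open>auto simp: intro!: exI\<close>)

lemma step_const_1: assumes "t \<le> 1" shows "step t = step 1"
proof (cases "t = 1")
  case False
  then have "t < 1" using assms by simp
  moreover have "continuous_on {t..1} step"
    by (meson DERIV_continuous_on has_field_derivative_at_within step(1))
  moreover have "DERIV step x :> 0" if "t < x" "x < 1" for x
    using step(1)[of x] bump_eq_0[of x] that by simp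
  ultimately show ?thesis using DERIV_isconst_end[of t 1 step] by metis
qed simp

lemma step_eq_0: assumes "4 \<le> t" shows "step t = 0"
proof (cases "t = 4")
  case False
  then have "4 < t" using assms by simp
  moreover have "continuous_on {4..t} step"
    by (meson DERIV_continuous_on has_field_derivative_at_within step(1))
  moreover have "DERIV step x :> 0" if "4 < x" "x < t" for x
    using step(1)[of x] bump_eq_0[of x] that by simp
  ultimately show ?thesis using DERIV_isconst_end[of 4 t step] step(2) by metis
qed (simp add: step)

lemma step_1_pos: "0 < step 1"
proof -
  have "step 3 < step 2"
    by (rule DERIV_neg_imp_decreasing) (use step(1) bump_pos in \<open>auto intro!: exI\<close>)
  then show ?thesis using step_antimono[of 1 2] step_antimono[of 3 4] step(2) by simp
qed

lemma step_nonneg: "0 \<le> step t"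
  using step_antimono[of t "max t 4"] step_eq_0[of "max t 4"] by simp

lemma step_le: "step t \<le> step 1"
  using step_antimono[of 1 t] step_const_1[of t] by linarith

lemma smooth_stepfun:
  fixes s :: "'a::euclidean_space \<Rightarrow> real"
  assumes s: "smooth (\<lambda>x. complex_of_real (s x))" shows "smooth (\<lambda>x. complex_of_real (step (s x)))"
proof -
  let ?f = "\<lambda>x. complex_of_real (step (s x))" and ?s = "\<lambda>x. complex_of_real (s x)"
  have D: "(?f has_derivative (\<lambda>d. complex_of_real (- bump (s x)) * frechet_derivative ?s (at x) d)) (at x)" for x
  proof -
    let ?D = "frechet_derivative (\<lambda>x. complex_of_real (s x)) (at x)"
    have D: "((\<lambda>x. complex_of_real (s x)) has_derivative ?D) (at x)"
      by (rule smooth_has_derivative[OF s])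
    from has_derivative_Re[OF D] have DR: "(s has_derivative (\<lambda>d. Re (?D d))) (at x)" by simp
    from has_derivative_of_real[OF this] have "(?s has_derivative (\<lambda>d. of_real (Re (?D d)))) (at x)" .
    then have re: "?D = (\<lambda>d. of_real (Re (?D d)))" using D has_derivative_unique by blast
    have "((\<lambda>x. step (s x)) has_derivative (\<lambda>d. - bump (s x) * Re (?D d))) (at x)"
      using has_derivative_compose[OF DR, of step "(*) (- bump (s x))"] step(1)[of "s x"]
      by (simp add: has_field_derivative_def)
    then have "(?f has_derivative (\<lambda>d. complex_of_real (- bump (s x) * Re (?D d)))) (at x)"
      by (rule has_derivative_of_real)
    then show ?thesis by (metis (no_types, lifting) ext of_real_mult re)
  qed
  show ?thesis
  proof (rule smooth_step)
    show "?f differentiable at x" for x using D differentiable_def by blast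
    fix b :: 'a assume b: "b \<in> Basis"
    have "dd b ?f = (\<lambda>x. - complex_of_real (bump (s x)) * dd b ?s x)"
      by (rule ext) (simp add: frechet_derivative_eqI[OF D])
    then show "smooth (dd b ?f)"
      by (auto intro!: smooth_mult smooth_minus smooth_bump s smooth_dd b simp del: mult_minus_left)
  qed
qed

lemma bump_bounds: "\<exists>m>0. \<forall>t. \<bar>bump t\<bar> \<le> m \<and> \<bar>bump' t\<bar> \<le> m \<and> \<bar>step t\<bar> \<le> m"
proof -
  have "bounded (bump ` {1..4})" "bounded (bump' ` {1..4})"
    by (auto intro!: compact_imp_bounded compact_continuous_image continuous_on_bump continuous_on_bump')
  then obtain m1 m2 where m: "\<And>t. t \<in> {1..4} \<Longrightarrow> \<bar>bump t\<bar> \<le> m1" "\<And>t. t \<in> {1..4} \<Longrightarrow> \<bar>bump' t\<bar> \<le> m2"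
    unfolding bounded_iff by force
  define m where "m = max (max m1 0) (max (max m2 0) (step 1))"
  have "\<bar>bump t\<bar> \<le> max m1 0" for t
    using m(1)[of t] bump_eq_0[of t] by (cases "t \<in> {1..4}") auto
  then have 1: "\<bar>bump t\<bar> \<le> m" for t unfolding m_def by (meson le_max_iff_disj)
  have "\<bar>bump' t\<bar> \<le> max m2 0" for t
    using m(2)[of t] bump'_eq_0[of t] by (cases "t \<in> {1..4}") auto
  then have 2: "\<bar>bump' t\<bar> \<le> m" for t unfolding m_def by (meson le_max_iff_disj)
  have "\<bar>step t\<bar> \<le> step 1" for t using step_nonneg[of t] step_le[of t] by simp
  then have 3: "\<bar>step t\<bar> \<le> m" for t unfolding m_def by (meson le_max_iff_disj)
  have "0 < m" unfolding m_def using step_1_pos by simp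
  with 1 2 3 show ?thesis by blast
qed

section \<open>Radial cutoffs around a point and their Laplacians\<close>

definition radsq :: "'a::euclidean_space \<Rightarrow> real \<Rightarrow> 'a \<Rightarrow> real" where
  "radsq x0 \<rho> y = (norm (y - x0))\<^sup>2 / \<rho>\<^sup>2"

lemma norm_sq_Basis: "(norm (x::'a::euclidean_space))\<^sup>2 = (\<Sum>b\<in>Basis. (x \<bullet> b)\<^sup>2)"
  unfolding power2_norm_eq_inner by (subst euclidean_inner) (simp add: power2_eq_square)

lemma smooth_radsq: "smooth (\<lambda>y. complex_of_real (radsq x0 \<rho> y))"
proof -
  have "radsq x0 \<rho> y = (\<Sum>b\<in>Basis. (y \<bullet> b - x0 \<bullet> b)^2) * (1/\<rho>\<^sup>2)" for y
    by (simp add: radsq_def norm_sq_Basis inner_diff_left)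
  then have "(\<lambda>y. complex_of_real (radsq x0 \<rho> y)) =
     (\<lambda>y. (\<Sum>b\<in>Basis. (complex_of_real (y \<bullet> b) - of_real (x0 \<bullet> b))^2) * of_real (1/\<rho>\<^sup>2))"
    by (intro ext) simp
  moreover have "smooth \<dots>"
    by (intro smooth_mult smooth_sum smooth_power smooth_diff smooth_inner smooth_const)
  ultimately show ?thesis by simp
qed

lemma radsq_has_derivative:
  "(radsq x0 \<rho> has_derivative (\<lambda>d. 2 * ((y - x0) \<bullet> d) / \<rho>\<^sup>2)) (at y)"
  unfolding radsq_def[abs_def] power2_norm_eq_inner divide_inverse
  by (rule has_derivative_eq_rhs, rule has_derivative_mult_left, rule has_derivative_inner)
     (auto intro!: derivative_eq_intros simp: inner_commute)

definition cutoff :: "'a::euclidean_space \<Rightarrow> real \<Rightarrow> 'a \<Rightarrow> complex" where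
  "cutoff x0 \<rho> y = of_real (step (radsq x0 \<rho> y))"

lemma smooth_cutoff: "smooth (cutoff x0 \<rho>)"
  unfolding cutoff_def[abs_def] by (intro smooth_stepfun smooth_radsq)

lemma cutoff_has_derivative:
  "(cutoff x0 \<rho> has_derivative (\<lambda>d. of_real (- bump (radsq x0 \<rho> y) * (2 * ((y - x0) \<bullet> d) / \<rho>\<^sup>2)))) (at y)"
  unfolding cutoff_def[abs_def]
  using has_derivative_compose[OF radsq_has_derivative, of step "(*) (- bump (radsq x0 \<rho> y))" x0 \<rho> y]
    step(1)[of "radsq x0 \<rho> y"]
  by (intro has_derivative_of_real) (simp add: has_field_derivative_def)

lemma dd_cutoff: "dd b (cutoff x0 \<rho>) = (\<lambda>y. of_real (- bump (radsq x0 \<rho> y) * (2 * ((y - x0) \<bullet> b) / \<rho>\<^sup>2)))"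
  by (rule ext) (simp add: frechet_derivative_eqI[OF cutoff_has_derivative])

lemma bump_radsq_has_derivative:
  "((\<lambda>y. bump (radsq x0 \<rho> y)) has_derivative (\<lambda>d. bump' (radsq x0 \<rho> y) * (2 * ((y - x0) \<bullet> d) / \<rho>\<^sup>2))) (at y)"
  using has_derivative_compose[OF radsq_has_derivative, of bump "(*) (bump' (radsq x0 \<rho> y))" x0 \<rho> y]
    bump_has_derivative[of "radsq x0 \<rho> y"] by (simp add: has_field_derivative_def)

lemma lap_cutoff:
  fixes y :: "'a::euclidean_space"
  shows "lap (cutoff x0 \<rho>) y = of_real (- bump' (radsq x0 \<rho> y) * 4 * (norm (y - x0))\<^sup>2 / \<rho>^4
     - bump (radsq x0 \<rho> y) * 2 * real DIM('a) / \<rho>\<^sup>2)"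
proof -
  have "pd [b, b] (cutoff x0 \<rho>) y = of_real (- bump' (radsq x0 \<rho> y) * 4 * ((y - x0) \<bullet> b)\<^sup>2 / \<rho>^4
     - bump (radsq x0 \<rho> y) * 2 / \<rho>\<^sup>2)" if b: "b \<in> Basis" for b
  proof -
    have "((\<lambda>y. complex_of_real (- bump (radsq x0 \<rho> y) * (2 * ((y - x0) \<bullet> b) / \<rho>\<^sup>2)))
      has_derivative (\<lambda>d. of_real (- bump (radsq x0 \<rho> y) * (2 * (d \<bullet> b) / \<rho>\<^sup>2) +
        - (bump' (radsq x0 \<rho> y) * (2 * ((y - x0) \<bullet> d) / \<rho>\<^sup>2)) * (2 * ((y - x0) \<bullet> b) / \<rho>\<^sup>2)))) (at y)"
    proof (intro has_derivative_of_real has_derivative_mult has_derivative_minus bump_radsq_has_derivative)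
      have "((\<lambda>y. (2 / \<rho>\<^sup>2) * ((y - x0) \<bullet> b)) has_derivative (\<lambda>d. (2 / \<rho>\<^sup>2) * (d \<bullet> b))) (at y)"
        by (rule has_derivative_mult_right) (auto intro!: derivative_eq_intros)
      then show "((\<lambda>y. 2 * ((y - x0) \<bullet> b) / \<rho>\<^sup>2) has_derivative (\<lambda>d. 2 * (d \<bullet> b) / \<rho>\<^sup>2)) (at y)" by simp
    qed
    then have "pd [b, b] (cutoff x0 \<rho>) y = of_real (- bump (radsq x0 \<rho> y) * (2 * (b \<bullet> b) / \<rho>\<^sup>2) +
        - (bump' (radsq x0 \<rho> y) * (2 * ((y - x0) \<bullet> b) / \<rho>\<^sup>2)) * (2 * ((y - x0) \<bullet> b) / \<rho>\<^sup>2))"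
      by (simp add: dd_cutoff frechet_derivative_eqI)
    also have "- bump (radsq x0 \<rho> y) * (2 * (b \<bullet> b) / \<rho>\<^sup>2) +
        - (bump' (radsq x0 \<rho> y) * (2 * ((y - x0) \<bullet> b) / \<rho>\<^sup>2)) * (2 * ((y - x0) \<bullet> b) / \<rho>\<^sup>2)
      = - bump' (radsq x0 \<rho> y) * 4 * ((y - x0) \<bullet> b)\<^sup>2 / \<rho>^4 - bump (radsq x0 \<rho> y) * 2 / \<rho>\<^sup>2"
      using b by (simp add: power2_eq_square power4_eq_xxxx mult_ac)
    finally show ?thesis .
  qed
  then have "lap (cutoff x0 \<rho>) y = of_real (\<Sum>b\<in>Basis. - bump' (radsq x0 \<rho> y) * 4 * ((y - x0) \<bullet> b)\<^sup>2 / \<rho>^4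
     - bump (radsq x0 \<rho> y) * 2 / \<rho>\<^sup>2)"
    unfolding lap_def of_real_sum by (rule sum.cong[OF refl])
  also have "(\<Sum>b\<in>Basis. - bump' (radsq x0 \<rho> y) * 4 * ((y - x0) \<bullet> b)\<^sup>2 / \<rho>^4 - bump (radsq x0 \<rho> y) * 2 / \<rho>\<^sup>2)
    = - bump' (radsq x0 \<rho> y) * 4 * (norm (y - x0))\<^sup>2 / \<rho>^4 - bump (radsq x0 \<rho> y) * 2 * real DIM('a) / \<rho>\<^sup>2"
    by (simp add: sum_subtractf sum_negf norm_sq_Basis[of "y - x0"] sum_distrib_left sum_divide_distrib)
  finally show ?thesis .
qed

lemma lap_mult:
  assumes f: "smooth f" and g: "smooth g"
  shows "lap (\<lambda>x. f x * g x) y = f y * lap g y + 2 * (\<Sum>b\<in>Basis. dd b f y * dd b g y) + lap f y * g y"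
proof -
  have "pd [b, b] (\<lambda>x. f x * g x) y = f y * pd [b, b] g y + 2 * (dd b f y * dd b g y) + pd [b, b] f y * g y"
    if b: "b \<in> Basis" for b
  proof -
    have 1: "dd b (\<lambda>x. f x * g x) = (\<lambda>x. f x * dd b g x + dd b f x * g x)"
      by (rule ext, rule dd_mult) (use f g in \<open>auto intro: smooth_differentiable\<close>)
    have 2: "smooth (dd b f)" "smooth (dd b g)" using f g b by (auto intro: smooth_dd)
    have "((\<lambda>x. f x * dd b g x + dd b f x * g x) has_derivative
       (\<lambda>d. (f y * frechet_derivative (dd b g) (at y) d + frechet_derivative f (at y) d * dd b g y)
           + (dd b f y * frechet_derivative g (at y) d + frechet_derivative (dd b f) (at y) d * g y))) (at y)"
      by (intro has_derivative_add has_derivative_mult smooth_has_derivative f g 2)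
    from frechet_derivative_eqI[OF this] show ?thesis by (simp add: 1)
  qed
  then show ?thesis unfolding lap_def by (simp add: sum.distrib sum_distrib_left sum_distrib_right)
qed

subsection \<open>The weak form of the scattering problem\<close>

lemma test_funI:
  assumes "smooth \<psi>" "compact K" "K \<subseteq> U" "\<And>x. x \<notin> K \<Longrightarrow> \<psi> x = 0"
  shows "test_fun U \<psi>"
proof -
  have "closure {x. \<psi> x \<noteq> 0} \<subseteq> K"
    by (rule closure_minimal) (use assms compact_imp_closed in auto)
  then show ?thesis
    using assms unfolding test_fun_def smooth_def
    by (metis (lifting) closed_closure closed_Int_compact compact_Int_closed inf.absorb_iff2 subset_trans)
qed

lemma integrable_cont_compact:
  fixes f :: "'a::euclidean_space \<Rightarrow> complex"
  assumes "continuous_on UNIV f" "compact K" "\<And>x. x \<notin> K \<Longrightarrow> f x = 0"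
  shows "integrable lborel f"
proof -
  have "integrable lborel (\<lambda>x. indicator K x *\<^sub>R f x)"
    by (rule borel_integrable_compact) (use assms continuous_on_subset[of UNIV f K] in auto)
  moreover have "(\<lambda>x. indicator K x *\<^sub>R f x) = f" using assms(3) by (auto simp: indicator_def)
  ultimately show ?thesis by simp
qed

lemma bounded_cont_compact:
  fixes f :: "'a::euclidean_space \<Rightarrow> complex"
  assumes "continuous_on UNIV f" "compact K" "\<And>x. x \<notin> K \<Longrightarrow> f x = 0"
  obtains M where "0 \<le> M" "\<And>x. norm (f x) \<le> M"
proof -
  have "bounded (f ` K)"
    using assms by (auto intro!: compact_imp_bounded compact_continuous_image intro: continuous_on_subset)
  then obtain M where "\<And>x. x \<in> K \<Longrightarrow> norm (f x) \<le> M" unfolding bounded_iff by auto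
  then have "norm (f x) \<le> max M 0" for x using assms(3)[of x] by (cases "x \<in> K") (auto simp: le_max_iff_disj)
  then show ?thesis using that[of "max M 0"] by auto
qed

lemma loc_integrable_times:
  fixes f \<psi> :: "'a::euclidean_space \<Rightarrow> complex"
  assumes f: "loc_integrable U f" and K: "compact K" "K \<subseteq> U"
    and \<psi>: "continuous_on UNIV \<psi>" "\<And>x. x \<notin> K \<Longrightarrow> \<psi> x = 0"
  shows "integrable lborel (\<lambda>x. f x * \<psi> x)"
proof -
  have i: "integrable lborel (\<lambda>x. indicator K x *\<^sub>R f x)"
    using f K unfolding loc_integrable_def set_integrable_def by auto
  obtain M where M: "0 \<le> M" "\<And>x. norm (\<psi> x) \<le> M" by (rule bounded_cont_compact[OF \<psi>(1) K(1) \<psi>(2)]) auto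
  have m: "\<psi> \<in> borel_measurable lborel" using \<psi>(1) by (simp add: borel_measurable_continuous_onI)
  have "integrable lborel (\<lambda>x. (indicator K x *\<^sub>R f x) * \<psi> x)"
  proof (rule Bochner_Integration.integrable_bound[OF integrable_mult_right[OF integrable_norm[OF i], of M]])
    show "(\<lambda>x. (indicator K x *\<^sub>R f x) * \<psi> x) \<in> borel_measurable lborel"
      using i m by (intro borel_measurable_times) auto
    show "AE x in lborel. norm ((indicator K x *\<^sub>R f x) * \<psi> x) \<le> norm (M * norm (indicator K x *\<^sub>R f x))"
      using M by (intro AE_I2) (auto simp: norm_mult abs_mult mult.commute[of M] mult.assoc intro!: mult_left_mono)
  qed
  moreover have "(\<lambda>x. (indicator K x *\<^sub>R f x) * \<psi> x) = (\<lambda>x. f x * \<psi> x)"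
    using \<psi>(2) by (auto simp: indicator_def)
  ultimately show ?thesis by simp
qed

lemma pd_zero_outside:
  assumes "closed K" "\<And>x. x \<notin> K \<Longrightarrow> \<psi> x = 0" "x \<notin> K"
  shows "pd bs \<psi> x = 0"
  using assms(3)
proof (induction bs arbitrary: x)
  case Nil
  then show ?case using assms by simp
next
  case (Cons b bs)
  have o: "open (- K)" using assms(1) by auto
  have "((\<lambda>_. 0) has_derivative (\<lambda>_. 0)) (at x)" by simp
  then have "(pd bs \<psi> has_derivative (\<lambda>_. 0)) (at x)"
    by (rule has_derivative_transform_within_open[OF _ o]) (use Cons in auto)
  then show ?case by (simp add: frechet_derivative_eqI)
qed

lemma weak_lap:
  assumes d: "\<And>b. b \<in> Basis \<Longrightarrow> weak_deriv U u [b, b] (G b)"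
    and \<psi>: "smooth \<psi>" "compact K" "K \<subseteq> U" "\<And>x. x \<notin> K \<Longrightarrow> \<psi> x = 0"
  shows "(\<integral>x. u x * lap \<psi> x \<partial>lborel) = (\<integral>x. (\<Sum>b\<in>Basis. G b x) * \<psi> x \<partial>lborel)"
    "integrable lborel (\<lambda>x. u x * lap \<psi> x)" "integrable lborel (\<lambda>x. (\<Sum>b\<in>Basis. G b x) * \<psi> x)"
    "\<And>b. b \<in> Basis \<Longrightarrow> integrable lborel (\<lambda>x. G b x * \<psi> x)"
proof -
  have t: "test_fun U \<psi>" by (rule test_funI) (use \<psi> in auto)
  have e: "(\<integral>x. u x * pd [b, b] \<psi> x \<partial>lborel) = (\<integral>x. G b x * \<psi> x \<partial>lborel)" if "b \<in> Basis" for b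
    using d[OF that] t unfolding weak_deriv_def by fastforce
  have i1: "integrable lborel (\<lambda>x. u x * pd [b, b] \<psi> x)" if "b \<in> Basis" for b
    using d[OF that] \<psi> that unfolding weak_deriv_def
    by (intro loc_integrable_times[of U u K] smooth_continuous smooth_pd pd_zero_outside[of K]) (auto intro: compact_imp_closed)
  show i2: "integrable lborel (\<lambda>x. G b x * \<psi> x)" if "b \<in> Basis" for b
    using d[OF that] \<psi> unfolding weak_deriv_def
    by (intro loc_integrable_times[of U _ K] smooth_continuous) auto
  show "integrable lborel (\<lambda>x. u x * lap \<psi> x)"
    unfolding lap_def sum_distrib_left using i1 by (intro Bochner_Integration.integrable_sum) auto
  show "integrable lborel (\<lambda>x. (\<Sum>b\<in>Basis. G b x) * \<psi> x)"
    unfolding sum_distrib_right using i2 by (intro Bochner_Integration.integrable_sum) auto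
  have "(\<integral>x. u x * lap \<psi> x \<partial>lborel) = (\<Sum>b\<in>Basis. (\<integral>x. u x * pd [b, b] \<psi> x \<partial>lborel))"
    unfolding lap_def sum_distrib_left using i1 by (intro Bochner_Integration.integral_sum) auto
  also have "\<dots> = (\<Sum>b\<in>Basis. (\<integral>x. G b x * \<psi> x \<partial>lborel))" using e by (intro sum.cong) auto
  also have "\<dots> = (\<integral>x. (\<Sum>b\<in>Basis. G b x) * \<psi> x \<partial>lborel)"
    unfolding sum_distrib_right using i2 by (intro Bochner_Integration.integral_sum[symmetric]) auto
  finally show "(\<integral>x. u x * lap \<psi> x \<partial>lborel) = (\<integral>x. (\<Sum>b\<in>Basis. G b x) * \<psi> x \<partial>lborel)" .
qed

text \<open>Both derivatives sit on the test function, so the pairing with entire solutions needs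
  nothing about the waves beyond continuity and this identity.\<close>

lemma total_wave_weak:
  fixes V :: "'a::euclidean_space \<Rightarrow> complex"
  assumes u: "total_wave k V \<omega> u" and V: "V \<in> borel_measurable borel" "\<And>x. norm (V x) \<le> M"
    and \<psi>: "smooth \<psi>" "compact K" "\<And>x. x \<notin> K \<Longrightarrow> \<psi> x = 0"
  shows "(\<integral>x. u x * (lap \<psi> x + of_real (k\<^sup>2) * \<psi> x) \<partial>lborel) = - of_real (k\<^sup>2) * (\<integral>x. V x * u x * \<psi> x \<partial>lborel)"
    "integrable lborel (\<lambda>x. u x * (lap \<psi> x + of_real (k\<^sup>2) * \<psi> x))"
    "integrable lborel (\<lambda>x. V x * u x * \<psi> x)"
proof -
  obtain G where G: "\<And>b. b \<in> Basis \<Longrightarrow> weak_deriv UNIV u [b, b] (G b)"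
    "AE x in lborel. (\<Sum>b\<in>Basis. G b x) + complex_of_real (k\<^sup>2) * (1 + V x) * u x = 0"
    and cu: "continuous_on UNIV u"
    using u unfolding total_wave_def by blast
  note wl = weak_lap[OF G(1) \<psi>(1,2) subset_UNIV \<psi>(3)]
  have cup: "continuous_on UNIV (\<lambda>x. u x * \<psi> x)"
    by (intro continuous_intros cu smooth_continuous \<psi>)
  have iu: "integrable lborel (\<lambda>x. u x * \<psi> x)"
    by (rule integrable_cont_compact[OF cup \<psi>(2)]) (use \<psi>(3) in auto)
  show iV: "integrable lborel (\<lambda>x. V x * u x * \<psi> x)"
  proof (rule Bochner_Integration.integrable_bound[OF integrable_mult_right[OF integrable_norm[OF iu], of M]])
    show "(\<lambda>x. V x * u x * \<psi> x) \<in> borel_measurable lborel"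
      using V(1) borel_measurable_continuous_onI[OF cu] borel_measurable_continuous_onI[OF smooth_continuous[OF \<psi>(1)]] by simp
    have "0 \<le> M" using V(2)[of undefined] norm_ge_zero order_trans by blast
    then show "AE x in lborel. norm (V x * u x * \<psi> x) \<le> norm (M * norm (u x * \<psi> x))"
      using V(2) by (auto simp: norm_mult abs_mult mult.assoc intro!: mult_right_mono)
  qed
  show "integrable lborel (\<lambda>x. u x * (lap \<psi> x + of_real (k\<^sup>2) * \<psi> x))"
    using Bochner_Integration.integrable_add[OF wl(2) integrable_mult_right[OF iu, of "of_real (k\<^sup>2)"]]
    by (simp add: algebra_simps)
  have "(\<integral>x. (\<Sum>b\<in>Basis. G b x) * \<psi> x \<partial>lborel) = (\<integral>x. - of_real (k\<^sup>2) * (u x * \<psi> x + V x * u x * \<psi> x) \<partial>lborel)"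
  proof (rule integral_cong_AE)
    show "AE x in lborel. (\<Sum>b\<in>Basis. G b x) * \<psi> x = - of_real (k\<^sup>2) * (u x * \<psi> x + V x * u x * \<psi> x)"
      using G(2)
    proof eventually_elim
      case (elim x)
      then have e: "(\<Sum>b\<in>Basis. G b x) = - (complex_of_real (k\<^sup>2) * (1 + V x) * u x)"
        by (simp add: eq_neg_iff_add_eq_0)
      show ?case unfolding e by (simp add: algebra_simps)
    qed
  qed (use wl(3) iV iu in auto)
  also have "\<dots> = - of_real (k\<^sup>2) * ((\<integral>x. u x * \<psi> x \<partial>lborel) + (\<integral>x. V x * u x * \<psi> x \<partial>lborel))"
    using iV iu by (subst integral_mult_right_zero, subst Bochner_Integration.integral_add) auto
  finally have e: "(\<integral>x. u x * lap \<psi> x \<partial>lborel) = - of_real (k\<^sup>2) * ((\<integral>x. u x * \<psi> x \<partial>lborel) + (\<integral>x. V x * u x * \<psi> x \<partial>lborel))"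
    using wl(1) by simp
  have "(\<integral>x. u x * (lap \<psi> x + of_real (k\<^sup>2) * \<psi> x) \<partial>lborel) = (\<integral>x. u x * lap \<psi> x + of_real (k\<^sup>2) * (u x * \<psi> x) \<partial>lborel)"
    by (simp add: algebra_simps)
  also have "\<dots> = (\<integral>x. u x * lap \<psi> x \<partial>lborel) + of_real (k\<^sup>2) * (\<integral>x. u x * \<psi> x \<partial>lborel)"
    using wl(2) iu by (subst Bochner_Integration.integral_add) auto
  finally show "(\<integral>x. u x * (lap \<psi> x + of_real (k\<^sup>2) * \<psi> x) \<partial>lborel) = - of_real (k\<^sup>2) * (\<integral>x. V x * u x * \<psi> x \<partial>lborel)"
    using e by (simp add: algebra_simps)
qed

lemma lborel_integral_scale:
  fixes h :: "'a::euclidean_space \<Rightarrow> 'b::{banach, second_countable_topology}"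
  assumes "0 < c" "h \<in> borel_measurable borel"
  shows "(\<integral>x. h x \<partial>lborel) = c ^ DIM('a) *\<^sub>R (\<integral>x. h (t + c *\<^sub>R x) \<partial>lborel)"
proof -
  have "(\<integral>x. h x \<partial>lborel) = (\<integral>x. h x \<partial>(density (distr lborel borel (\<lambda>x::'a. t + c *\<^sub>R x)) (\<lambda>_. \<bar>c\<bar> ^ DIM('a))))"
    using lborel_affine[of c t] assms by simp
  also have "\<dots> = (\<integral>x. c ^ DIM('a) *\<^sub>R h x \<partial>(distr lborel borel (\<lambda>x::'a. t + c *\<^sub>R x)))"
    using assms by (subst integral_density) auto
  also have "\<dots> = (\<integral>x. c ^ DIM('a) *\<^sub>R h (t + c *\<^sub>R x) \<partial>lborel)"
    using assms by (subst integral_distr) auto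
  finally show ?thesis by simp
qed

lemma lborel_integrable_scale:
  fixes h :: "'a::euclidean_space \<Rightarrow> 'b::{banach, second_countable_topology}"
  assumes "0 < c" "h \<in> borel_measurable borel" "integrable lborel (\<lambda>x. h (t + c *\<^sub>R x))"
  shows "integrable lborel h"
proof -
  have "integrable (density (distr lborel borel (\<lambda>x::'a. t + c *\<^sub>R x)) (\<lambda>_. \<bar>c\<bar> ^ DIM('a))) h"
    using assms by (subst integrable_density) (auto simp: integrable_distr_eq)
  then show ?thesis using lborel_affine[of c t] assms by simp
qed

subsection \<open>Pairing with entire solutions\<close>

definition helmholtz :: "real \<Rightarrow> ('a::euclidean_space \<Rightarrow> complex) \<Rightarrow> bool" where
  "helmholtz k v \<longleftrightarrow> smooth v \<and> (\<forall>x. lap v x + of_real (k\<^sup>2) * v x = 0)"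

text \<open>This is the decay of a wave with a far field. The second bound concerns the derivative
  in direction x, not x/|x|, hence the additional factor |x|. Only \<open>B\<close> is tracked: the
  radius from which the bounds hold is lost when the cutoff radius tends to infinity.\<close>

definition decays :: "real \<Rightarrow> ('a::euclidean_space \<Rightarrow> complex) \<Rightarrow> bool" where
  "decays B v \<longleftrightarrow> 0 \<le> B \<and> (\<exists>\<rho>. \<forall>x. \<rho> \<le> norm x \<longrightarrow>
     norm (v x) \<le> B * norm x powr (- (real DIM('a) - 1) / 2) \<and>
     norm (frechet_derivative v (at x) x) \<le> B * norm x * norm x powr (- (real DIM('a) - 1) / 2))"

lemma sum_dd_Basis:
  assumes "v differentiable (at x)"
  shows "(\<Sum>b\<in>Basis. of_real (y \<bullet> b) * dd b v x) = frechet_derivative v (at x) y"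
proof -
  have l: "linear (frechet_derivative v (at x))" using assms by (rule linear_frechet_derivative)
  have "frechet_derivative v (at x) y = frechet_derivative v (at x) (\<Sum>b\<in>Basis. (y \<bullet> b) *\<^sub>R b)"
    by (simp add: euclidean_representation)
  also have "\<dots> = (\<Sum>b\<in>Basis. (y \<bullet> b) *\<^sub>R dd b v x)"
    by (simp add: linear_sum[OF l] linear_cmul[OF l])
  finally show ?thesis by (simp add: scaleR_conv_of_real)
qed

text \<open>Since v solves the Helmholtz equation, only terms with derivatives of the cutoff
  survive. The cutoff is radial, so its gradient meets that of v only in the derivative along y -
  x0; for x0 = 0 this is the derivative that \<open>decays\<close> controls.\<close>

lemma lap_cutoff_mult:
  assumes v: "helmholtz k v"
  shows "lap (\<lambda>x. cutoff x0 \<rho> x * v x) y + of_real (k\<^sup>2) * (cutoff x0 \<rho> y * v y)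
    = lap (cutoff x0 \<rho>) y * v y - of_real (4 * bump (radsq x0 \<rho> y) / \<rho>\<^sup>2) * frechet_derivative v (at y) (y - x0)"
proof -
  have s: "smooth v" using v by (simp add: helmholtz_def)
  have "(\<Sum>b\<in>Basis. dd b (cutoff x0 \<rho>) y * dd b v y) =
    (\<Sum>b\<in>Basis. - of_real (2 * bump (radsq x0 \<rho> y) / \<rho>\<^sup>2) * (of_real ((y - x0) \<bullet> b) * dd b v y))"
    by (rule sum.cong[OF refl], simp only: fun_cong[OF dd_cutoff]) (simp add: mult_ac)
  also have "\<dots> = - of_real (2 * bump (radsq x0 \<rho> y) / \<rho>\<^sup>2) * frechet_derivative v (at y) (y - x0)"
    unfolding sum_distrib_left[symmetric] sum_dd_Basis[OF smooth_differentiable[OF s]] ..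
  finally have 1: "(\<Sum>b\<in>Basis. dd b (cutoff x0 \<rho>) y * dd b v y) = \<dots>" .
  have "lap v y = - of_real (k\<^sup>2) * v y" using v by (simp add: helmholtz_def eq_neg_iff_add_eq_0)
  then show ?thesis
    unfolding lap_mult[OF smooth_cutoff s] 1 by (simp add: algebra_simps)
qed

lemma radsq_ge_4:
  assumes "0 < \<rho>" "2 * \<rho> \<le> norm (y - x0)" shows "4 \<le> radsq x0 \<rho> y"
proof -
  have "(2 * \<rho>)\<^sup>2 \<le> (norm (y - x0))\<^sup>2" using assms by (intro power_mono) auto
  then show ?thesis using assms by (simp add: radsq_def field_simps power2_eq_square)
qed

lemma radsq_le_1:
  assumes "0 < \<rho>" "norm (y - x0) \<le> \<rho>" shows "radsq x0 \<rho> y \<le> 1"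
proof -
  have "(norm (y - x0))\<^sup>2 \<le> \<rho>\<^sup>2" using assms by (intro power_mono) auto
  then show ?thesis using assms by (simp add: radsq_def)
qed

lemma cutoff_eq_0: "0 < \<rho> \<Longrightarrow> 2 * \<rho> \<le> norm (y - x0) \<Longrightarrow> cutoff x0 \<rho> y = 0"
  by (simp add: cutoff_def step_eq_0 radsq_ge_4)

lemma cutoff_eq_1: "0 < \<rho> \<Longrightarrow> norm (y - x0) \<le> \<rho> \<Longrightarrow> cutoff x0 \<rho> y = of_real (step 1)"
  using step_const_1[OF radsq_le_1] by (simp add: cutoff_def)

lemma smooth_lap: "smooth f \<Longrightarrow> smooth (lap f)"
  unfolding lap_def[abs_def] by (intro smooth_sum smooth_pd) auto

text \<open>A far-field pattern is known only through its asymptotics. Its measurability follows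
  because it is the pointwise limit of rescaled values of the continuous wave on spheres of integer
  radius.\<close>

lemma far_field_limit_measurable:
  fixes f w :: "'a::euclidean_space \<Rightarrow> complex"
  assumes w: "continuous_on UNIV w"
    and ff: "\<And>r \<theta>. \<rho> \<le> r \<Longrightarrow> norm \<theta> = 1 \<Longrightarrow>
        cmod (w (r *\<^sub>R \<theta>) - exp (\<i> * complex_of_real (k * r)) /
                 complex_of_real (r powr ((real DIM('a) - 1) / 2)) * f \<theta>) \<le> C * r powr (- real DIM('a) / 2)"
  shows "(\<lambda>y. if y = 0 then 0 else f (y /\<^sub>R norm y)) \<in> borel_measurable borel"
proof (rule borel_measurable_LIMSEQ_metric)
  let ?g = "\<lambda>i y. if y = 0 then 0 else exp (- (\<i> * complex_of_real (k * real i))) *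
      complex_of_real (real i powr ((real DIM('a) - 1) / 2)) * w (real i *\<^sub>R (y /\<^sub>R norm y))"
  have wm[measurable]: "w \<in> borel_measurable borel" using w by (rule borel_measurable_continuous_onI)
  show "?g i \<in> borel_measurable borel" for i by measurable
  fix y :: 'a
  show "(\<lambda>i. ?g i y) \<longlonglongrightarrow> (if y = 0 then 0 else f (y /\<^sub>R norm y))"
  proof (cases "y = 0")
    case False
    define \<theta> where "\<theta> = y /\<^sub>R norm y"
    have th: "norm \<theta> = 1" using False by (simp add: \<theta>_def)
    have "(\<lambda>i. ?g i y - f \<theta>) \<longlonglongrightarrow> 0"
    proof (rule Lim_null_comparison)
      have "((\<lambda>r. \<bar>C\<bar> * r powr (-1/2)) \<longlongrightarrow> 0) at_top" by real_asymp
      then show "(\<lambda>i. \<bar>C\<bar> * real i powr (-1/2)) \<longlonglongrightarrow> 0"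
        using filterlim_compose filterlim_real_sequentially by blast
      show "\<forall>\<^sub>F i in sequentially. norm (?g i y - f \<theta>) \<le> \<bar>C\<bar> * real i powr (-1/2)"
        using eventually_ge_at_top[of "nat \<lceil>max \<rho> 1\<rceil>"]
      proof eventually_elim
        case (elim i)
        then have i: "\<rho> \<le> real i" "1 \<le> real i" by linarith+
        let ?p = "complex_of_real (real i powr ((real DIM('a) - 1) / 2))"
        have p: "?p \<noteq> 0" using i by simp
        have e: "exp (- (\<i> * complex_of_real (k * real i))) * exp (\<i> * complex_of_real (k * real i)) = 1"
          by (simp flip: exp_add)
        have "?g i y - f \<theta> = exp (- (\<i> * complex_of_real (k * real i))) * ?p *
           (w (real i *\<^sub>R \<theta>) - exp (\<i> * complex_of_real (k * real i)) / ?p * f \<theta>)"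
          using False p e unfolding \<theta>_def[symmetric] by (simp add: right_diff_distrib mult.assoc)
        then have "norm (?g i y - f \<theta>) = real i powr ((real DIM('a) - 1) / 2) *
           norm (w (real i *\<^sub>R \<theta>) - exp (\<i> * complex_of_real (k * real i)) / ?p * f \<theta>)"
          by (simp add: norm_mult)
        also have "\<dots> \<le> real i powr ((real DIM('a) - 1) / 2) * (C * real i powr (- real DIM('a) / 2))"
          using ff[OF i(1) th] by (intro mult_left_mono) auto
        also have "\<dots> = C * (real i powr ((real DIM('a) - 1) / 2) * real i powr (- real DIM('a) / 2))" by simp
        also have "\<dots> = C * real i powr (-1/2)"
          using i by (simp add: diff_divide_distrib flip: powr_add)
        also have "\<dots> \<le> \<bar>C\<bar> * real i powr (-1/2)" by (intro mult_right_mono) auto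
        finally show ?case .
      qed
    qed
    then show ?thesis using False LIM_zero_iff unfolding \<theta>_def by fastforce
  qed simp
qed

lemma integrable_indicator_ball: "integrable lborel (indicator (ball (a::'a::euclidean_space) r) :: 'a \<Rightarrow> real)"
  by (rule integrable_real_indicator) (simp, rule emeasure_lborel_ball_finite)

text \<open>The passage from L2 to L1, with e the L2 norm: |h| <= e + |h|^2 / e integrates to e
  times (volume + 1).\<close>

lemma sphere_L2_norm_bound:
  fixes f :: "'a::euclidean_space \<Rightarrow> complex"
  defines "h \<equiv> \<lambda>y. if y = 0 then 0 else f (y /\<^sub>R norm y)"
  assumes m: "h \<in> borel_measurable borel" and pos: "0 < sphere_L2_norm f"
  shows "integrable lborel (\<lambda>y. indicator (ball 0 1) y * norm (h y))"
    "(\<integral>y. indicator (ball 0 1) y * norm (h y) \<partial>lborel) \<le> sphere_L2_norm f * (measure lborel (ball (0::'a) 1) + 1)"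
proof -
  note m[measurable]
  let ?B = "ball (0::'a) 1" and ?n = "real DIM('a)" and ?e = "sphere_L2_norm f"
  let ?I = "\<integral>\<^sup>+x. ennreal (?n * (indicator ?B x * (norm (h x))\<^sup>2)) \<partial>lborel"
  have "(\<integral>\<^sup>+ x\<in>?B - {0}. ennreal (?n * (cmod (f (x /\<^sub>R norm x)))\<^sup>2) \<partial>lborel) = ?I"
    by (rule nn_integral_cong) (auto simp: indicator_def h_def)
  then have e: "?e = sqrt (enn2real ?I)" unfolding sphere_L2_norm_def by simp
  \<comment> \<open>\<open>enn2real\<close> sends infinity to 0, so a positive norm excludes an
    infinite integral. Without positivity the value 0 could stand for a pattern that is not square
    integrable.\<close>
  with pos have "enn2real ?I > 0" by simp
  then have fin: "?I < \<infinity>" using enn2real_positive_iff by (simp add: less_top)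
  have i: "integrable lborel (\<lambda>x. ?n * (indicator ?B x * (norm (h x))\<^sup>2))"
  proof (rule integrableI_nonneg)
    show "(\<lambda>x. ?n * (indicator ?B x * (norm (h x))\<^sup>2)) \<in> borel_measurable lborel"
      using m by (intro borel_measurable_times borel_measurable_const borel_measurable_indicator
        borel_measurable_power borel_measurable_norm) auto
  qed (use fin in auto)
  have "(\<integral>x. ?n * (indicator ?B x * (norm (h x))\<^sup>2) \<partial>lborel) = enn2real ?I"
    using borel_measurable_integrable[OF i] by (intro integral_eq_nn_integral) auto
  also have "enn2real ?I = ?e\<^sup>2" using e by simp
  finally have J: "(\<integral>x. ?n * (indicator ?B x * (norm (h x))\<^sup>2) \<partial>lborel) = ?e\<^sup>2" .
  have ib: "integrable lborel (indicator ?B :: 'a \<Rightarrow> real)" by (rule integrable_indicator_ball)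
  let ?g = "\<lambda>x. ?e * indicator ?B x + (1 / ?e) * (?n * (indicator ?B x * (norm (h x))\<^sup>2))"
  have ig: "integrable lborel ?g" using i ib by auto
  have le: "indicator ?B x * norm (h x) \<le> ?g x" for x
  proof (cases "x \<in> ?B")
    case True
    have n1: "1 \<le> ?n" using DIM_positive[where 'a='a] by linarith
    have "?e * norm (h x) \<le> ?e\<^sup>2 + (norm (h x))\<^sup>2"
      using sum_squares_bound[of ?e "norm (h x)"] mult_nonneg_nonneg[OF less_imp_le[OF pos] norm_ge_zero[of "h x"]]
      by (simp only: mult.assoc)
    also have "\<dots> \<le> ?e\<^sup>2 + ?n * (norm (h x))\<^sup>2" using n1 mult_right_mono[OF n1, of "(norm (h x))\<^sup>2"] by simp
    finally have "norm (h x) \<le> (?e\<^sup>2 + ?n * (norm (h x))\<^sup>2) / ?e"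
      using pos by (simp add: pos_le_divide_eq mult.commute)
    also have "\<dots> = ?e + (1 / ?e) * (?n * (norm (h x))\<^sup>2)"
      using pos by (simp add: add_divide_distrib power2_eq_square)
    finally show ?thesis using True by simp
  qed simp
  show I: "integrable lborel (\<lambda>y. indicator ?B y * norm (h y))"
  proof (rule Bochner_Integration.integrable_bound[OF ig _ AE_I2])
    show "(\<lambda>y. indicator ?B y * norm (h y)) \<in> borel_measurable lborel"
      using m by (intro borel_measurable_times borel_measurable_indicator borel_measurable_norm) auto
    fix x
    have "norm (indicator ?B x * norm (h x)) = indicator ?B x * norm (h x)" by simp
    also note le[of x]
    also have "?g x \<le> norm (?g x)" unfolding real_norm_def by (rule abs_ge_self)
    finally show "norm (indicator ?B x * norm (h x)) \<le> norm (?g x)" .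
  qed
  have "(\<integral>y. indicator ?B y * norm (h y) \<partial>lborel) \<le> integral\<^sup>L lborel ?g"
    by (rule integral_mono[OF I ig le])
  also have "\<dots> = ?e * measure lborel ?B + (1 / ?e) * ?e\<^sup>2"
    using i J ib by (subst Bochner_Integration.integral_add) auto
  also have "\<dots> = ?e * (measure lborel ?B + 1)" using pos by (simp add: field_simps power2_eq_square)
  finally show "(\<integral>y. indicator ?B y * norm (h y) \<partial>lborel) \<le> ?e * (measure lborel ?B + 1)" .
qed

text \<open>Green's formula with the cutoff at radius rho; as rho tends to infinity only the leading far-field term of w survives.\<close>
lemma pairing:
  fixes w v g f :: "'a::euclidean_space \<Rightarrow> complex" and k R :: real
  assumes mb: "0 \<le> m" "\<And>t. \<bar>bump t\<bar> \<le> m \<and> \<bar>bump' t\<bar> \<le> m"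
    and w: "continuous_on UNIV w"
    and weak: "\<And>\<psi> K. smooth \<psi> \<Longrightarrow> compact K \<Longrightarrow> (\<And>x. x \<notin> K \<Longrightarrow> \<psi> x = 0) \<Longrightarrow>
       (\<integral>x. w x * (lap \<psi> x + of_real (k\<^sup>2) * \<psi> x) \<partial>lborel) = - of_real (k\<^sup>2) * (\<integral>x. g x * \<psi> x \<partial>lborel)"
    and g: "\<And>x. R \<le> norm x \<Longrightarrow> g x = 0"
    and v: "helmholtz k v" "decays B v"
    and ff: "\<And>r \<theta>. \<rho>\<^sub>1 \<le> r \<Longrightarrow> norm \<theta> = 1 \<Longrightarrow>
        cmod (w (r *\<^sub>R \<theta>) - exp (\<i> * complex_of_real (k * r)) /
                 complex_of_real (r powr ((real DIM('a) - 1) / 2)) * f \<theta>) \<le> C * r powr (- real DIM('a) / 2)"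
    and pos: "0 < sphere_L2_norm f"
  shows "k\<^sup>2 * step 1 * norm (\<integral>x. g x * v x \<partial>lborel)
     \<le> B * 2 ^ DIM('a) * 8 * m * (measure lborel (ball (0::'a) 1) + 1) * sphere_L2_norm f"
proof -
  let ?n = "real DIM('a)"
  define h where "h = (\<lambda>y. if y = 0 then 0 else f (y /\<^sub>R norm y))"
  have hm: "h \<in> borel_measurable borel" unfolding h_def by (rule far_field_limit_measurable[OF w ff])
  have sb: "integrable lborel (\<lambda>y. indicator (ball 0 1) y * norm (h y))"
    "(\<integral>y. indicator (ball 0 1) y * norm (h y) \<partial>lborel) \<le> sphere_L2_norm f * (measure lborel (ball (0::'a) 1) + 1)"
    using sphere_L2_norm_bound[OF hm[unfolded h_def] pos] unfolding h_def by simp_all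
  define I where "I = (\<integral>y. indicator (ball 0 1) y * norm (h y) \<partial>lborel)"
  define vol where "vol = measure lborel (ball (0::'a) 1)"
  obtain \<rho>\<^sub>2 where dec: "0 \<le> B" "\<And>x. \<rho>\<^sub>2 \<le> norm x \<Longrightarrow>
     norm (v x) \<le> B * norm x powr (- (?n - 1) / 2) \<and>
     norm (frechet_derivative v (at x) x) \<le> B * norm x * norm x powr (- (?n - 1) / 2)"
    using v(2) unfolding decays_def by blast
  \<comment> \<open>The Laplacian of the cutoff is at most c2 / rho^2: the first term of c2 comes
    from \<open>bump'\<close> with |y|^2 <= 4 rho^2, the second from \<open>bump\<close>.\<close>
  define c2 where "c2 = 16 * m + 2 * ?n * m"
  have est: "k\<^sup>2 * step 1 * norm (\<integral>x. g x * v x \<partial>lborel) \<le>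
     B * 2 ^ DIM('a) * (8 * m + c2 / \<rho>) * (I + \<bar>C\<bar> * vol * \<rho> powr (-1/2))"
    if \<rho>: "max 1 (max R (max \<rho>\<^sub>1 \<rho>\<^sub>2)) \<le> \<rho>" for \<rho>
  proof -
    have r1: "1 \<le> \<rho>" "R \<le> \<rho>" "\<rho>\<^sub>1 \<le> \<rho>" "\<rho>\<^sub>2 \<le> \<rho>" using \<rho> by auto
    define \<psi> where "\<psi> = (\<lambda>x. cutoff 0 \<rho> x * v x)"
    have sv: "smooth v" using v(1) by (simp add: helmholtz_def)
    have s\<psi>: "smooth \<psi>" unfolding \<psi>_def by (intro smooth_mult smooth_cutoff sv)
    have z\<psi>: "\<psi> x = 0" if "x \<notin> cball 0 (2 * \<rho>)" for x
      using that r1 by (simp add: \<psi>_def cutoff_eq_0)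
    define L where "L = (\<lambda>x. lap \<psi> x + of_real (k\<^sup>2) * \<psi> x)"
    have "(\<integral>x. w x * L x \<partial>lborel) = - of_real (k\<^sup>2) * (\<integral>x. g x * \<psi> x \<partial>lborel)"
      unfolding L_def by (rule weak[OF s\<psi> compact_cball z\<psi>])
    also have "(\<lambda>x. g x * \<psi> x) = (\<lambda>x. of_real (step 1) * (g x * v x))"
    proof
      fix x show "g x * \<psi> x = of_real (step 1) * (g x * v x)"
        using g[of x] cutoff_eq_1[of \<rho> x 0] r1 by (cases "R \<le> norm x") (auto simp: \<psi>_def)
    qed
    finally have 1: "k\<^sup>2 * step 1 * norm (\<integral>x. g x * v x \<partial>lborel) = norm (\<integral>x. w x * L x \<partial>lborel)"
      using step_1_pos by (simp add: norm_mult power2_eq_square)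
    \<comment> \<open>Both w and v decay like r^(-(n-1)/2), so their product carries rho^(-(n-1)).
      Against the volume of order rho^n one factor rho remains. It is cancelled by the 1/rho from
      the gradient of the cutoff, while the term with c2 still tends to 0.\<close>
    define E where "E = B * \<rho> powr (- (?n - 1)) * (8 * m / \<rho> + c2 / \<rho>\<^sup>2)"
    have E0: "0 \<le> E" unfolding E_def c2_def using dec(1) mb(1) r1 by auto
    define H where "H = (\<lambda>y. E * (indicator (ball 0 (2 * \<rho>)) y * norm (h y) + \<bar>C\<bar> * \<rho> powr (-1/2) * indicator (ball 0 (2 * \<rho>)) y))"
    \<comment> \<open>The extension of the pattern is homogeneous of degree 0, so scaling the ball
      of radius 2 rho to the unit ball changes only the volume factor.\<close>
    have hs: "h (c *\<^sub>R y) = h y" if c: "0 < c" for c y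
    proof -
      have e: "inverse c * inverse (norm y) * c = inverse (norm y)" using c by (simp add: field_simps)
      have "(c *\<^sub>R y) /\<^sub>R norm (c *\<^sub>R y) = (inverse c * inverse (norm y) * c) *\<^sub>R y" using c by simp
      also have "\<dots> = y /\<^sub>R norm y" by (rule arg_cong[OF e])
      finally show ?thesis using c unfolding h_def by (metis scaleR_eq_0_iff less_irrefl)
    qed
    \<comment> \<open>Off the shell between rho and 2 rho the cutoff is constant, so
      \<open>L\<close> vanishes there apart from the region where nothing of the cutoff is left;
      inside the shell the decay of v and the far-field expansion of w apply.\<close>
    have pw: "norm (w y * L y) \<le> H y" for y
    proof (cases "\<rho> < norm y \<and> norm y < 2 * \<rho>")
      case False
      then have "radsq 0 \<rho> y \<le> 1 \<or> 4 \<le> radsq 0 \<rho> y"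
        using radsq_le_1[of \<rho> y 0] radsq_ge_4[of \<rho> y 0] r1 by auto
      then have "L y = 0"
        unfolding L_def \<psi>_def lap_cutoff_mult[OF v(1)] lap_cutoff by (auto simp: bump_eq_0 bump'_eq_0)
      then show ?thesis using E0 by (simp add: H_def)
    next
      case True
      define r where "r = norm y"
      have r: "\<rho> < r" "r < 2 * \<rho>" "0 < r" using True r1 by (auto simp: r_def)
      define q where "q = r powr (- (?n - 1) / 2)"
      have q0: "0 \<le> q" by (simp add: q_def)
      have qq: "q * q = r powr (- (?n - 1))" unfolding q_def by (simp flip: powr_add)
      have qq': "q * q \<le> \<rho> powr (- (?n - 1))"
        unfolding qq using r r1 DIM_positive[where 'a='a] by (intro powr_mono2') (auto simp: Suc_leI)
      have y0: "y \<noteq> 0" using r by (auto simp: r_def)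
      have b1: "\<bar>bump (radsq 0 \<rho> y)\<bar> \<le> m" "\<bar>bump' (radsq 0 \<rho> y)\<bar> \<le> m" using mb(2) by auto
      have r2: "r\<^sup>2 \<le> 4 * \<rho>\<^sup>2" using r power_mono[of r "2 * \<rho>" 2] by (simp add: power_mult_distrib)
      have l1: "norm (lap (cutoff 0 \<rho>) y) \<le> c2 / \<rho>\<^sup>2"
      proof -
        have "norm (lap (cutoff 0 \<rho>) y) \<le> \<bar>bump' (radsq 0 \<rho> y)\<bar> * (4 * r\<^sup>2 / \<rho>^4) + \<bar>bump (radsq 0 \<rho> y)\<bar> * (2 * ?n / \<rho>\<^sup>2)"
          unfolding lap_cutoff norm_of_real r_def diff_zero
          by (rule order_trans[OF abs_triangle_ineq4]) (auto simp: abs_mult)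
        also have "\<dots> \<le> m * (4 * (4 * \<rho>\<^sup>2) / \<rho>^4) + m * (2 * ?n / \<rho>\<^sup>2)"
          using b1 mb(1) r2 by (intro add_mono mult_mono divide_right_mono) auto
        also have "\<dots> = c2 / \<rho>\<^sup>2" using r1 by (simp add: c2_def field_simps power2_eq_square power4_eq_xxxx)
        finally show ?thesis .
      qed
      have l2: "norm (of_real (4 * bump (radsq 0 \<rho> y) / \<rho>\<^sup>2) * frechet_derivative v (at y) (y - 0)) \<le> (8 * m / \<rho>) * (B * q)"
      proof -
        have "norm (of_real (4 * bump (radsq 0 \<rho> y) / \<rho>\<^sup>2) * frechet_derivative v (at y) (y - 0))
          = (4 * \<bar>bump (radsq 0 \<rho> y)\<bar> / \<rho>\<^sup>2) * norm (frechet_derivative v (at y) y)"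
          by (simp add: norm_mult norm_divide norm_power)
        also have "\<dots> \<le> (4 * m / \<rho>\<^sup>2) * (B * r * q)"
          using b1 dec(2)[of y] r r1 mb(1) unfolding r_def q_def by (intro mult_mono divide_right_mono) auto
        also have "\<dots> \<le> (4 * m / \<rho>\<^sup>2) * (B * (2 * \<rho>) * q)"
          using mb(1) dec(1) r q0 by (intro mult_left_mono mult_right_mono) auto
        also have "\<dots> = (8 * m / \<rho>) * (B * q)" using r1 by (simp add: field_simps power2_eq_square)
        finally show ?thesis .
      qed
      have Lb: "norm (L y) \<le> (8 * m / \<rho> + c2 / \<rho>\<^sup>2) * (B * q)"
      proof -
        have "norm (L y) \<le> norm (lap (cutoff 0 \<rho>) y) * norm (v y) + (8 * m / \<rho>) * (B * q)"
          unfolding L_def \<psi>_def lap_cutoff_mult[OF v(1)]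
          by (rule order_trans[OF norm_triangle_ineq4]) (use l2 in \<open>simp add: norm_mult\<close>)
        also have "\<dots> \<le> (c2 / \<rho>\<^sup>2) * (B * q) + (8 * m / \<rho>) * (B * q)"
          using l1 dec(2)[of y] r r1 unfolding r_def q_def
          by (intro add_mono mult_mono) (auto simp: c2_def mb(1) dec(1))
        finally show ?thesis by (simp add: algebra_simps)
      qed
      have wb: "norm (w y) \<le> q * (norm (h y) + \<bar>C\<bar> * \<rho> powr (-1/2))"
      proof -
        define \<theta> where "\<theta> = y /\<^sub>R norm y"
        have th: "norm \<theta> = 1" "y = r *\<^sub>R \<theta>" "h y = f \<theta>" using y0 by (auto simp: \<theta>_def r_def h_def)
        have pp: "r powr ((?n - 1) / 2) = 1 / q"
          unfolding q_def by (simp add: powr_minus_divide[symmetric] minus_divide_left)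
        have "norm (w y) \<le> norm (exp (\<i> * complex_of_real (k * r)) / complex_of_real (r powr ((?n - 1) / 2)) * f \<theta>)
          + cmod (w (r *\<^sub>R \<theta>) - exp (\<i> * complex_of_real (k * r)) / complex_of_real (r powr ((?n - 1) / 2)) * f \<theta>)"
          unfolding th(2)[symmetric] by (rule norm_triangle_sub)
        also have "norm (exp (\<i> * complex_of_real (k * r)) / complex_of_real (r powr ((?n - 1) / 2)) * f \<theta>) = q * norm (h y)"
          unfolding th(3) norm_mult norm_divide norm_exp_i_times norm_of_real using q0 by (simp add: pp)
        also have "cmod (w (r *\<^sub>R \<theta>) - exp (\<i> * complex_of_real (k * r)) / complex_of_real (r powr ((?n - 1) / 2)) * f \<theta>)
          \<le> C * r powr (- ?n / 2)" using r r1 by (intro ff th) auto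
        also have "C * r powr (- ?n / 2) \<le> \<bar>C\<bar> * (q * \<rho> powr (-1/2))"
        proof -
          have "r powr (- ?n / 2) = q * r powr (-1/2)" unfolding q_def by (simp flip: powr_add add: field_simps)
          also have "\<dots> \<le> q * \<rho> powr (-1/2)" using r r1 q0 by (intro mult_left_mono powr_mono2') auto
          finally have "\<bar>C\<bar> * r powr (- ?n / 2) \<le> \<bar>C\<bar> * (q * \<rho> powr (-1/2))" by (intro mult_left_mono) auto
          moreover have "C * r powr (- ?n / 2) \<le> \<bar>C\<bar> * r powr (- ?n / 2)" by (intro mult_right_mono) auto
          ultimately show ?thesis by simp
        qed
        finally show ?thesis by (simp add: algebra_simps)
      qed
      have ind: "y \<in> ball 0 (2 * \<rho>)" using r r1 by (simp add: r_def field_simps)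
      have "norm (w y * L y) \<le> (q * (norm (h y) + \<bar>C\<bar> * \<rho> powr (-1/2))) * ((8 * m / \<rho> + c2 / \<rho>\<^sup>2) * (B * q))"
        unfolding norm_mult using wb Lb q0 by (intro mult_mono) auto
      also have "\<dots> = (q * q) * (B * (8 * m / \<rho> + c2 / \<rho>\<^sup>2) * (norm (h y) + \<bar>C\<bar> * \<rho> powr (-1/2)))"
        by (simp add: algebra_simps)
      also have "\<dots> \<le> \<rho> powr (- (?n - 1)) * (B * (8 * m / \<rho> + c2 / \<rho>\<^sup>2) * (norm (h y) + \<bar>C\<bar> * \<rho> powr (-1/2)))"
        using dec(1) mb(1) r1 by (intro mult_right_mono qq' mult_nonneg_nonneg) (auto simp: c2_def)
      also have "\<dots> = H y" using ind by (simp add: H_def E_def algebra_simps)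
      finally show ?thesis .
    qed
    let ?H = "\<lambda>y. E * (indicator (ball 0 1) y * norm (h y) + \<bar>C\<bar> * \<rho> powr (-1/2) * indicator (ball 0 1) y)"
    have HH: "H (0 + (2 * \<rho>) *\<^sub>R y) = ?H y" for y using r1 by (simp add: H_def hs indicator_def)
    have iH': "integrable lborel ?H"
      by (intro integrable_mult_right Bochner_Integration.integrable_add sb(1)
        integrable_indicator_ball)
    have mH: "H \<in> borel_measurable borel" unfolding H_def
      using hm by (intro borel_measurable_times borel_measurable_add borel_measurable_const borel_measurable_indicator borel_measurable_norm) auto
    have iH: "integrable lborel H"
      by (rule lborel_integrable_scale[of "2 * \<rho>" _ 0]) (use r1 mH iH' HH in auto)
    have "integral\<^sup>L lborel H = (2 * \<rho>) ^ DIM('a) * integral\<^sup>L lborel ?H"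
      using lborel_integral_scale[of "2 * \<rho>" H 0] r1 mH HH by simp
    also have "integral\<^sup>L lborel ?H = E * (I + \<bar>C\<bar> * \<rho> powr (-1/2) * vol)"
      using sb(1) integrable_indicator_ball[of "0::'a" 1] by (simp add: I_def vol_def)
    finally have iHv: "integral\<^sup>L lborel H = (2 * \<rho>) ^ DIM('a) * (E * (I + \<bar>C\<bar> * \<rho> powr (-1/2) * vol))" .
    have "continuous_on UNIV (\<lambda>x. w x * L x)"
      unfolding L_def by (intro continuous_intros w smooth_continuous smooth_lap s\<psi>)
    then have "(\<lambda>x. w x * L x) \<in> borel_measurable lborel" by (simp add: borel_measurable_continuous_onI)
    then have iwL: "integrable lborel (\<lambda>x. w x * L x)"
      by (rule Bochner_Integration.integrable_bound[OF iH]) (rule AE_I2, rule order_trans[OF pw], simp)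
    have "norm (\<integral>x. w x * L x \<partial>lborel) \<le> (\<integral>x. norm (w x * L x) \<partial>lborel)"
      by (rule integral_norm_bound)
    also have "\<dots> \<le> integral\<^sup>L lborel H"
      by (rule integral_mono[OF integrable_norm[OF iwL] iH pw])
    also have "\<dots> = B * 2 ^ DIM('a) * (8 * m + c2 / \<rho>) * (I + \<bar>C\<bar> * vol * \<rho> powr (-1/2))"
    proof -
      have e1: "\<rho> ^ DIM('a) * \<rho> powr (- (?n - 1)) = \<rho>"
        using r1 by (simp add: powr_realpow[symmetric] powr_add[symmetric])
      have e2: "(8 * m / \<rho> + c2 / \<rho>\<^sup>2) * \<rho> = 8 * m + c2 / \<rho>" using r1 by (simp add: field_simps power2_eq_square)
      have "(2 * \<rho>) ^ DIM('a) * E = B * 2 ^ DIM('a) * ((8 * m / \<rho> + c2 / \<rho>\<^sup>2) * (\<rho> ^ DIM('a) * \<rho> powr (- (?n - 1))))"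
        unfolding E_def power_mult_distrib by (simp only: mult_ac)
      then have e3: "(2 * \<rho>) ^ DIM('a) * E = B * 2 ^ DIM('a) * (8 * m + c2 / \<rho>)" unfolding e1 e2 .
      show ?thesis unfolding iHv mult.assoc[of "(2 * \<rho>) ^ DIM('a)", symmetric] e3 by (simp only: mult_ac)
    qed
    finally show ?thesis using 1 by simp
  qed
  have "((\<lambda>\<rho>. K * (8 * m + c2 / \<rho>) * (I + cc * \<rho> powr (-1/2))) \<longlongrightarrow> K * (8 * m) * I) at_top" for K cc
  proof -
    have "((\<lambda>\<rho>. c2 / \<rho>) \<longlongrightarrow> 0) at_top" by real_asymp
    moreover have "((\<lambda>\<rho>::real. \<rho> powr (-1/2)) \<longlongrightarrow> 0) at_top" by real_asymp
    ultimately have "((\<lambda>\<rho>. K * (8 * m + c2 / \<rho>) * (I + cc * \<rho> powr (-1/2))) \<longlongrightarrow> K * (8 * m + 0) * (I + cc * 0)) at_top"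
      by (intro tendsto_intros)
    then show ?thesis by simp
  qed
  note lim = this[of "B * 2 ^ DIM('a)" "\<bar>C\<bar> * vol"]
  have "k\<^sup>2 * step 1 * norm (\<integral>x. g x * v x \<partial>lborel) \<le> B * 2 ^ DIM('a) * (8 * m) * I"
  proof (rule tendsto_lowerbound[OF lim])
    show "\<forall>\<^sub>F \<rho> in at_top. k\<^sup>2 * step 1 * norm (\<integral>x. g x * v x \<partial>lborel) \<le>
       B * 2 ^ DIM('a) * (8 * m + c2 / \<rho>) * (I + \<bar>C\<bar> * vol * \<rho> powr (-1/2))"
      using eventually_ge_at_top by (rule eventually_mono) (rule est)
  qed simp
  also have "\<dots> \<le> B * 2 ^ DIM('a) * (8 * m) * (sphere_L2_norm f * (vol + 1))"
    using sb(2) dec(1) mb(1) unfolding I_def vol_def by (intro mult_left_mono) auto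
  finally show ?thesis by (simp add: vol_def algebra_simps)
qed

subsection \<open>Hoelder regularity in two and three dimensions\<close>

text \<open>Cauchy-Schwarz on a ball. The square root of the volume supplies the power delta^(n/2)
  on which the following estimates rest.\<close>

lemma weak_deriv_pairing_bound:
  fixes G \<psi> :: "'a::euclidean_space \<Rightarrow> complex"
  assumes G: "loc_integrable U G" and S: "(\<integral>\<^sup>+ x\<in>U. ennreal ((cmod (G x))\<^sup>2) \<partial>lborel) \<le> ennreal (S\<^sup>2)" "0 \<le> S"
    and K: "cball x0 \<delta> \<subseteq> U" "0 \<le> \<delta>"
    and \<psi>: "continuous_on UNIV \<psi>" "\<And>x. x \<notin> cball x0 \<delta> \<Longrightarrow> \<psi> x = 0" "\<And>x. norm (\<psi> x) \<le> M" "0 \<le> M"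
  shows "norm (\<integral>x. G x * \<psi> x \<partial>lborel) \<le> S * (M * sqrt (unit_ball_vol DIM('a) * \<delta> ^ DIM('a)))"
proof -
  let ?K = "cball x0 \<delta>"
  define g where "g = (\<lambda>x. indicator ?K x *\<^sub>R G x)"
  have ig: "integrable lborel g"
    using G K unfolding loc_integrable_def set_integrable_def g_def by auto
  then have gm: "g \<in> borel_measurable lborel" by auto
  have i: "integrable lborel (\<lambda>x. G x * \<psi> x)"
    by (rule loc_integrable_times[OF G compact_cball K(1) \<psi>(1,2)])
  have "ennreal (norm (\<integral>x. G x * \<psi> x \<partial>lborel)) \<le> (\<integral>\<^sup>+x. norm (G x * \<psi> x) \<partial>lborel)"
    by (rule integral_norm_bound_ennreal[OF i])
  also have "\<dots> = (\<integral>\<^sup>+x. ennreal (norm (g x)) * ennreal (indicator ?K x * norm (\<psi> x)) \<partial>lborel)"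
    by (rule nn_integral_cong) (use \<psi>(2) in \<open>auto simp: g_def norm_mult ennreal_mult' indicator_def\<close>)
  finally have "(ennreal (norm (\<integral>x. G x * \<psi> x \<partial>lborel)))\<^sup>2 \<le>
     (\<integral>\<^sup>+x. ennreal (norm (g x)) * ennreal (indicator ?K x * norm (\<psi> x)) \<partial>lborel)\<^sup>2"
    by (intro power_mono) auto
  also have "\<dots> \<le> (\<integral>\<^sup>+x. (ennreal (norm (g x)))\<^sup>2 \<partial>lborel) * (\<integral>\<^sup>+x. (ennreal (indicator ?K x * norm (\<psi> x)))\<^sup>2 \<partial>lborel)"
  proof (rule Cauchy_Schwarz_nn_integral)
    show "(\<lambda>x. ennreal (norm (g x))) \<in> borel_measurable lborel" using gm by simp
    have "\<psi> \<in> borel_measurable borel" using \<psi>(1) by (rule borel_measurable_continuous_onI)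
    then have "(\<lambda>x. indicator ?K x * norm (\<psi> x)) \<in> borel_measurable lborel"
      by (intro borel_measurable_times borel_measurable_indicator borel_measurable_norm) auto
    then show "(\<lambda>x. ennreal (indicator ?K x * norm (\<psi> x))) \<in> borel_measurable lborel" by simp
  qed
  also have "\<dots> \<le> ennreal (S\<^sup>2) * ennreal (M\<^sup>2 * (unit_ball_vol DIM('a) * \<delta> ^ DIM('a)))"
  proof (rule mult_mono)
    have "(\<integral>\<^sup>+x. (ennreal (norm (g x)))\<^sup>2 \<partial>lborel) \<le> (\<integral>\<^sup>+ x\<in>U. ennreal ((cmod (G x))\<^sup>2) \<partial>lborel)"
      by (rule nn_integral_mono) (use K in \<open>auto simp: g_def indicator_def ennreal_power power_mult_distrib\<close>)
    then show "(\<integral>\<^sup>+x. (ennreal (norm (g x)))\<^sup>2 \<partial>lborel) \<le> ennreal (S\<^sup>2)" using S(1) by (rule order_trans)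
    have "(\<integral>\<^sup>+x. (ennreal (indicator ?K x * norm (\<psi> x)))\<^sup>2 \<partial>lborel) \<le> (\<integral>\<^sup>+x. ennreal (M\<^sup>2) * indicator ?K x \<partial>lborel)"
    proof (rule nn_integral_mono)
      fix x
      have "(norm (\<psi> x))\<^sup>2 \<le> M\<^sup>2" using \<psi>(3) by (intro power_mono) auto
      then show "(ennreal (indicator ?K x * norm (\<psi> x)))\<^sup>2 \<le> ennreal (M\<^sup>2) * indicator ?K x"
        by (auto simp: indicator_def ennreal_power intro: ennreal_leI)
    qed
    also have "\<dots> = ennreal (M\<^sup>2) * emeasure lborel ?K" by (rule nn_integral_cmult_indicator) simp
    also have "\<dots> = ennreal (M\<^sup>2 * (unit_ball_vol DIM('a) * \<delta> ^ DIM('a)))"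
      using K(2) by (simp add: emeasure_cball ennreal_mult')
    finally show "(\<integral>\<^sup>+x. (ennreal (indicator ?K x * norm (\<psi> x)))\<^sup>2 \<partial>lborel) \<le> ennreal (M\<^sup>2 * (unit_ball_vol DIM('a) * \<delta> ^ DIM('a)))" .
  qed auto
  also have "\<dots> = ennreal ((S * (M * sqrt (unit_ball_vol DIM('a) * \<delta> ^ DIM('a))))\<^sup>2)"
    using K(2) by (simp add: ennreal_mult'[symmetric] power_mult_distrib)
  finally have "ennreal ((norm (\<integral>x. G x * \<psi> x \<partial>lborel))\<^sup>2) \<le> ennreal ((S * (M * sqrt (unit_ball_vol DIM('a) * \<delta> ^ DIM('a))))\<^sup>2)"
    by (simp add: ennreal_power)
  then have "(norm (\<integral>x. G x * \<psi> x \<partial>lborel))\<^sup>2 \<le> (S * (M * sqrt (unit_ball_vol DIM('a) * \<delta> ^ DIM('a))))\<^sup>2"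
    by (subst (asm) ennreal_le_iff) auto
  then show ?thesis by (rule power2_le_imp_le) (use S(2) \<psi>(4) K(2) in auto)
qed

section \<open>Means over shells and their dependence on the radius\<close>

definition kern :: "'a::euclidean_space \<Rightarrow> real \<Rightarrow> 'a \<Rightarrow> real" where
  "kern x \<delta> y = 2 / \<delta> ^ DIM('a) * bump (radsq x \<delta> y)"

definition kern' :: "'a::euclidean_space \<Rightarrow> real \<Rightarrow> 'a \<Rightarrow> real" where
  "kern' x \<delta> y = (\<delta> / \<delta> ^ DIM('a)) * (- bump' (radsq x \<delta> y) * 4 * (norm (y - x))\<^sup>2 / \<delta>^4
     - bump (radsq x \<delta> y) * 2 * real DIM('a) / \<delta>\<^sup>2)"

lemma smooth_kern: "smooth (\<lambda>y. complex_of_real (kern x \<delta> y))"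
  unfolding kern_def of_real_mult by (intro smooth_mult smooth_const smooth_bump smooth_radsq)

lemma kern_eq_0: "0 < \<delta> \<Longrightarrow> y \<notin> cball x (2 * \<delta>) \<Longrightarrow> kern x \<delta> y = 0"
  using radsq_ge_4[of \<delta> y x] bump_eq_0[of "radsq x \<delta> y"] by (auto simp: kern_def dist_norm norm_minus_commute)

lemma kern'_eq_0: "0 < \<delta> \<Longrightarrow> y \<notin> cball x (2 * \<delta>) \<Longrightarrow> kern' x \<delta> y = 0"
  using radsq_ge_4[of \<delta> y x] bump_eq_0[of "radsq x \<delta> y"] bump'_eq_0[of "radsq x \<delta> y"]
  by (auto simp: kern'_def dist_norm norm_minus_commute)

lemma kern_has_derivative:
  fixes x y :: "'a::euclidean_space"
  assumes "0 < \<delta>"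
  shows "((\<lambda>\<delta>. kern x \<delta> y) has_real_derivative kern' x \<delta> y) (at \<delta>)"
proof -
  let ?n = "DIM('a)"
  obtain N where N: "?n = Suc N" using DIM_positive[where 'a='a] gr0_conv_Suc by blast
  define s where "s = (norm (y - x))\<^sup>2"
  have 1: "((\<lambda>\<delta>. bump (s / \<delta>\<^sup>2)) has_real_derivative bump' (s / \<delta>\<^sup>2) * (- 2 * s / \<delta> ^ 3)) (at \<delta>)"
    by (rule DERIV_chain2[OF bump_has_derivative])
      (use assms in \<open>auto intro!: derivative_eq_intros simp: field_simps power2_eq_square power3_eq_cube\<close>)
  have 2: "((\<lambda>\<delta>. 2 / \<delta> ^ ?n) has_real_derivative - (2 * real ?n) / (\<delta> ^ ?n * \<delta>)) (at \<delta>)"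
  proof -
    have "((\<lambda>\<delta>. \<delta> ^ Suc N) has_real_derivative real (Suc N) * \<delta> ^ N) (at \<delta>)"
      using DERIV_pow[of "Suc N" \<delta>] by simp
    then have "((\<lambda>\<delta>. 2 / \<delta> ^ Suc N) has_real_derivative (0 * \<delta> ^ Suc N - 2 * (real (Suc N) * \<delta> ^ N)) / (\<delta> ^ Suc N * \<delta> ^ Suc N)) (at \<delta>)"
      using assms by (intro DERIV_divide DERIV_const) auto
    moreover have "(0 * \<delta> ^ Suc N - 2 * (real (Suc N) * \<delta> ^ N)) / (\<delta> ^ Suc N * \<delta> ^ Suc N) = - (2 * real (Suc N)) / (\<delta> ^ Suc N * \<delta>)"
      using assms by (simp add: field_simps)
    ultimately show ?thesis unfolding N by metis
  qed
  show ?thesis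
    unfolding kern_def[abs_def] radsq_def s_def[symmetric]
    apply (rule DERIV_cong[OF DERIV_mult[OF 2 1]])
    unfolding kern'_def radsq_def s_def[symmetric]
    using assms by (simp add: field_simps power2_eq_square power3_eq_cube power4_eq_xxxx)
qed

text \<open>The reason for the form of \<open>kern\<close>: with the profile \<open>bump\<close>,
  which is minus the derivative of \<open>step\<close>, and the factor 2, the derivative of the
  kernel in the radius is exactly delta^(1-n) times the Laplacian of a cutoff. A weak Laplacian
  therefore controls how the means vary with the radius.\<close>

lemma kern'_lap: "complex_of_real (kern' x \<delta> y) = of_real (\<delta> / \<delta> ^ DIM('a)) * lap (cutoff x \<delta>) (y::'a::euclidean_space)"
  unfolding kern'_def lap_cutoff by (simp only: of_real_mult)

lemma continuous_on_kern_kern':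
  fixes x :: "'a::euclidean_space"
  assumes "\<And>d. d \<in> U \<Longrightarrow> 0 < d"
  shows "continuous_on (U \<times> A) (\<lambda>(\<delta>, y). kern' x \<delta> y)" "0 < \<delta> \<Longrightarrow> continuous_on A (\<lambda>y. kern x \<delta> y)"
proof -
  have r: "continuous_on (U \<times> A) (\<lambda>z. radsq x (fst z) (snd z))"
    unfolding radsq_def by (intro continuous_intros) (use assms in \<open>force\<close>)
  have "continuous_on (U \<times> A) (\<lambda>z. bump (radsq x (fst z) (snd z)))"
     "continuous_on (U \<times> A) (\<lambda>z. bump' (radsq x (fst z) (snd z)))"
    by (rule continuous_on_compose2[OF continuous_on_bump[of UNIV] r] continuous_on_compose2[OF continuous_on_bump'[of UNIV] r]; simp)+
  then have "continuous_on (U \<times> A) (\<lambda>z. kern' x (fst z) (snd z))"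
    unfolding kern'_def by (intro continuous_intros) (use assms in \<open>force+\<close>)
  then show "continuous_on (U \<times> A) (\<lambda>(\<delta>, y). kern' x \<delta> y)" by (simp add: case_prod_unfold)
  show "continuous_on A (\<lambda>y. kern x \<delta> y)" if "0 < \<delta>"
    using continuous_on_Re[OF smooth_continuous[OF smooth_kern[of x \<delta>]], of A] by simp
qed

lemma integral_compact_lborel:
  fixes f :: "'a::euclidean_space \<Rightarrow> complex"
  assumes "continuous_on UNIV f" "\<And>x. x \<notin> cbox a b \<Longrightarrow> f x = 0"
  shows "(\<integral>x. f x \<partial>lborel) = integral (cbox a b) f"
proof -
  have "integrable lborel f" by (rule integrable_cont_compact[OF assms(1) compact_cbox assms(2)])
  then have "(\<integral>x. f x \<partial>lborel) = integral UNIV f" by (simp add: integral_lborel)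
  also have "\<dots> = integral UNIV (\<lambda>x. if x \<in> cbox a b then f x else 0)"
    by (rule integral_cong) (use assms(2) in auto)
  also have "\<dots> = integral (cbox a b) f" by (rule Henstock_Kurzweil_Integration.integral_restrict_UNIV)
  finally show ?thesis .
qed

lemma moll_has_derivative:
  fixes f :: "'a::euclidean_space \<Rightarrow> complex"
  assumes f: "continuous_on UNIV f" and d: "0 < d0" "d0 < \<delta>" "\<delta> < d1"
  shows "((\<lambda>\<delta>. \<integral>y. f y * of_real (kern x \<delta> y) \<partial>lborel) has_vector_derivative
     (\<integral>y. f y * of_real (kern' x \<delta> y) \<partial>lborel)) (at \<delta>)"
proof -
  \<comment> \<open>One box contains the supports of all kernels of radius parameter up to
    \<open>d1\<close>, so the differentiation under the integral takes place over a fixed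
    domain.\<close>
  obtain a b where ab: "cball x (2 * d1) \<subseteq> cbox a b"
    using bounded_subset_cbox_symmetric[OF bounded_cball] by metis
  have z: "y \<notin> cball x (2 * e)" if "e \<in> {d0..d1}" "y \<notin> cbox a b" for e y
    using ab that by (smt (verit) atLeastAtMost_iff mem_cball subsetD)
  let ?U = "{d0..d1}"
  have "((\<lambda>\<delta>. integral (cbox a b) (\<lambda>y. f y * of_real (kern x \<delta> y))) has_vector_derivative
    integral (cbox a b) (\<lambda>y. f y * of_real (kern' x \<delta> y))) (at \<delta> within ?U)"
  proof (rule leibniz_rule_vector_derivative)
    fix e y assume e: "e \<in> ?U"
    then have e0: "0 < e" using d by auto
    have "((\<lambda>\<delta>. kern x \<delta> y) has_vector_derivative kern' x e y) (at e within ?U)"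
      using kern_has_derivative[OF e0] has_real_derivative_iff_has_vector_derivative has_vector_derivative_at_within by blast
    then have "((\<lambda>\<delta>. complex_of_real (kern x \<delta> y)) has_vector_derivative of_real (kern' x e y)) (at e within ?U)"
      by (rule bounded_linear.has_vector_derivative[OF bounded_linear_of_real])
    then show "((\<lambda>\<delta>. f y * of_real (kern x \<delta> y)) has_vector_derivative f y * of_real (kern' x e y)) (at e within ?U)"
      by (rule has_vector_derivative_mult_right)
  next
    fix e assume e: "e \<in> ?U"
    show "(\<lambda>y. f y * of_real (kern x e y)) integrable_on cbox a b"
      by (intro integrable_continuous continuous_intros continuous_on_kern_kern'(2) continuous_on_subset[OF f]) (use e d in auto)
  next
    have "continuous_on (?U \<times> cbox a b) (\<lambda>z. f (snd z) * of_real (kern' x (fst z) (snd z)))"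
      using continuous_on_kern_kern'(1)[of ?U "cbox a b" x] d
      by (intro continuous_intros continuous_on_compose2[OF f]) (auto simp: case_prod_unfold)
    then show "continuous_on (?U \<times> cbox a b) (\<lambda>(\<delta>, y). f y * of_real (kern' x \<delta> y))"
      by (simp add: case_prod_unfold)
  qed (use d in auto)
  moreover have "integral (cbox a b) (\<lambda>y. f y * of_real (kern x e y)) = (\<integral>y. f y * of_real (kern x e y) \<partial>lborel)"
    if "e \<in> ?U" for e
    by (rule integral_compact_lborel[symmetric])
      (use that d z in \<open>auto intro!: continuous_intros f continuous_on_kern_kern'(2) kern_eq_0\<close>)
  moreover have "integral (cbox a b) (\<lambda>y. f y * of_real (kern' x \<delta> y)) = (\<integral>y. f y * of_real (kern' x \<delta> y) \<partial>lborel)"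
  proof (rule integral_compact_lborel[symmetric])
    have "continuous_on UNIV (\<lambda>y. complex_of_real (kern' x \<delta> y))"
      unfolding kern'_lap by (intro continuous_intros smooth_continuous smooth_lap smooth_cutoff)
    then show "continuous_on UNIV (\<lambda>y. f y * of_real (kern' x \<delta> y))" by (rule continuous_on_mult[OF f])
  qed (use d z in \<open>auto intro!: kern'_eq_0\<close>)
  ultimately have "((\<lambda>\<delta>. \<integral>y. f y * of_real (kern x \<delta> y) \<partial>lborel) has_vector_derivative
     (\<integral>y. f y * of_real (kern' x \<delta> y) \<partial>lborel)) (at \<delta> within ?U)"
    using has_vector_derivative_transform[of \<delta> ?U] d by (smt (verit) atLeastAtMost_iff)
  moreover have "at \<delta> within ?U = at \<delta>" using d by (intro at_within_interior) auto
  ultimately show ?thesis by simp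
qed

text \<open>The mass of \<open>kern\<close>, which by scaling is the same for every radius. It is
  kept as a constant instead of normalising the kernel.\<close>

definition moll_const :: "'a::euclidean_space itself \<Rightarrow> real" where
  "moll_const _ = (\<integral>z. 2 * bump ((norm (z::'a))\<^sup>2) \<partial>lborel)"

lemma integrable_bump_norm: "integrable lborel (\<lambda>z::'a::euclidean_space. 2 * bump ((norm z)\<^sup>2))"
proof -
  have "integrable lborel (\<lambda>z::'a. complex_of_real (kern 0 1 z))"
    by (rule integrable_cont_compact[OF smooth_continuous[OF smooth_kern] compact_cball[of 0 2]])
       (use kern_eq_0[of 1 _ 0] in auto)
  then have "integrable lborel (\<lambda>z::'a. Re (complex_of_real (kern 0 1 z)))" by (rule integrable_Re)
  moreover have "(\<lambda>z::'a. Re (complex_of_real (kern 0 1 z))) = (\<lambda>z. 2 * bump ((norm z)\<^sup>2))"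
    by (simp add: kern_def radsq_def)
  ultimately show ?thesis by (simp only:)
qed

lemma moll_const_pos: "0 < moll_const TYPE('a::euclidean_space)"
proof -
  have m: "moll_const TYPE('a) = (\<integral>z. 2 * bump ((norm (z::'a))\<^sup>2) \<partial>lborel)" by (simp add: moll_const_def)
  have ge: "0 \<le> moll_const TYPE('a)" unfolding m by (rule integral_nonneg_AE) (simp add: bump_nonneg)
  have "moll_const TYPE('a) \<noteq> 0"
  proof
    assume "moll_const TYPE('a) = 0"
    then have "AE z in lborel. 2 * bump ((norm (z::'a))\<^sup>2) = 0"
      unfolding m by (subst (asm) integral_nonneg_eq_0_iff_AE[OF integrable_bump_norm]) (auto simp: bump_nonneg)
    then have ae: "AE z::'a in lborel. bump ((norm z)\<^sup>2) = 0" by eventually_elim auto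
    obtain b :: 'a where b: "b \<in> Basis" using nonempty_Basis by blast
    \<comment> \<open>\<open>bump\<close> of |z|^2 is positive exactly for 1 < |z| < 2. The ball of
      radius 1/4 around a point of norm 3/2 stays between the radii 5/4 and 7/4.\<close>
    define c where "c = (3/2) *\<^sub>R b"
    have "bump ((norm z)\<^sup>2) \<noteq> 0" if "z \<in> ball c (1/4)" for z
    proof -
      have "dist c z < 1/4" using that by simp
      moreover have "norm c = 3/2" using b by (simp add: c_def)
      ultimately have "5/4 < norm z" "norm z < 7/4"
        using norm_triangle_sub[of c z] norm_triangle_sub[of z c] by (auto simp: dist_norm norm_minus_commute)
      then have "(5/4)\<^sup>2 < (norm z)\<^sup>2" "(norm z)\<^sup>2 < (7/4)\<^sup>2" by (auto intro!: power_strict_mono)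
      then show ?thesis using bump_pos[of "(norm z)\<^sup>2"] by (simp add: power2_eq_square)
    qed
    with ae have "AE z in lborel. z \<notin> ball c (1/4)" by (auto elim!: eventually_mono)
    then have "emeasure lborel (ball c (1/4)) = 0"
      using AE_iff_null_sets[of "ball c (1/4)" lborel] by (auto intro: null_setsD1)
    then show False using unit_ball_vol_pos[of "real DIM('a)"] by (simp add: emeasure_ball)
  qed
  with ge show ?thesis by linarith
qed

lemma moll_tendsto:
  fixes f :: "'a::euclidean_space \<Rightarrow> complex"
  assumes f: "continuous_on UNIV f" and e: "0 < e"
  obtains d where "0 < d" "\<And>\<delta>. 0 < \<delta> \<Longrightarrow> \<delta> < d \<Longrightarrow>
    norm ((\<integral>y. f y * of_real (kern x \<delta> y) \<partial>lborel) - of_real (moll_const TYPE('a)) * f x) \<le> e"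
proof -
  let ?c = "moll_const TYPE('a)"
  have "isCont f x" using f by (simp add: continuous_on_eq_continuous_at)
  then obtain d where d: "0 < d" "\<And>y. dist y x < d \<Longrightarrow> dist (f y) (f x) < e / ?c"
    using e moll_const_pos[where 'a='a] unfolding continuous_at_eps_delta by (metis divide_pos_pos)
  show ?thesis
  proof (rule that[of "d / 2"])
    fix \<delta> :: real assume \<delta>: "0 < \<delta>" "\<delta> < d / 2"
    have cf: "continuous_on UNIV (\<lambda>y. f y * complex_of_real (kern x \<delta> y))"
      by (intro continuous_intros f smooth_continuous[OF smooth_kern] continuous_on_kern_kern'(2) \<delta>)
    let ?b = "\<lambda>z. 2 * bump ((norm (z::'a))\<^sup>2)"
    have k: "\<delta> ^ DIM('a) * kern x \<delta> (x + \<delta> *\<^sub>R z) = ?b z" for z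
      using \<delta> by (simp add: kern_def radsq_def power_mult_distrib)
    have "(\<integral>y. f y * of_real (kern x \<delta> y) \<partial>lborel) =
      \<delta> ^ DIM('a) *\<^sub>R (\<integral>z. f (x + \<delta> *\<^sub>R z) * of_real (kern x \<delta> (x + \<delta> *\<^sub>R z)) \<partial>lborel)"
      by (rule lborel_integral_scale[OF \<delta>(1)]) (rule borel_measurable_continuous_onI[OF cf])
    also have "\<dots> = (\<integral>z. \<delta> ^ DIM('a) *\<^sub>R (f (x + \<delta> *\<^sub>R z) * of_real (kern x \<delta> (x + \<delta> *\<^sub>R z))) \<partial>lborel)"
      by simp
    also have "\<dots> = (\<integral>z. f (x + \<delta> *\<^sub>R z) * of_real (?b z) \<partial>lborel)"
      by (simp add: k[symmetric] scaleR_conv_of_real mult_ac)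
    finally have A: "(\<integral>y. f y * of_real (kern x \<delta> y) \<partial>lborel) = (\<integral>z. f (x + \<delta> *\<^sub>R z) * of_real (?b z) \<partial>lborel)" .
    have ib: "integrable lborel (\<lambda>z. complex_of_real (?b z))" using integrable_bump_norm integrable_of_real by blast
    have B: "of_real ?c * f x = (\<integral>z. f x * of_real (?b z) \<partial>lborel)"
      by (simp only: integral_mult_right_zero integral_complex_of_real moll_const_def mult.commute)
    have cb: "continuous_on UNIV (\<lambda>z. complex_of_real (?b z))"
      using smooth_continuous[OF smooth_kern[of "0::'a" 1], of UNIV] by (simp add: kern_def radsq_def)
    have bz: "?b z = 0" if "z \<notin> cball 0 2" for z :: 'a
      using kern_eq_0[of 1 z 0] that by (simp add: kern_def radsq_def)
    have i1: "integrable lborel (\<lambda>z. f (x + \<delta> *\<^sub>R z) * of_real (?b z))"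
      by (rule integrable_cont_compact[OF _ compact_cball[of 0 2]])
        (use bz in \<open>auto intro!: continuous_intros continuous_on_compose2[OF f] cb simp del: of_real_mult\<close>)
    have "(\<integral>y. f y * of_real (kern x \<delta> y) \<partial>lborel) - of_real ?c * f x = (\<integral>z. (f (x + \<delta> *\<^sub>R z) - f x) * of_real (?b z) \<partial>lborel)"
      unfolding A B left_diff_distrib using i1 ib by (intro Bochner_Integration.integral_diff[symmetric]) auto
    also have "norm \<dots> \<le> (\<integral>z. norm ((f (x + \<delta> *\<^sub>R z) - f x) * of_real (?b z)) \<partial>lborel)"
      by (rule integral_norm_bound)
    also have "\<dots> \<le> (\<integral>z. e / ?c * ?b z \<partial>lborel)"
    proof (rule integral_mono)
      show "integrable lborel (\<lambda>z. norm ((f (x + \<delta> *\<^sub>R z) - f x) * of_real (?b z)))"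
        unfolding left_diff_distrib using i1 ib by (intro integrable_norm Bochner_Integration.integrable_diff) auto
      show "integrable lborel (\<lambda>z. e / ?c * ?b z)" by (intro integrable_mult_right integrable_bump_norm)
      fix z :: 'a
      show "norm ((f (x + \<delta> *\<^sub>R z) - f x) * of_real (?b z)) \<le> e / ?c * ?b z"
      proof (cases "z \<in> cball 0 2")
        case True
        then have "\<delta> * norm z \<le> \<delta> * 2" using \<delta> by (intro mult_left_mono) auto
        then have "\<delta> * norm z < d" using \<delta> by linarith
        then have "dist (x + \<delta> *\<^sub>R z) x < d" using \<delta> by (simp add: dist_norm)
        then have "norm (f (x + \<delta> *\<^sub>R z) - f x) \<le> e / ?c" using d(2) by (fastforce simp: dist_norm)
        moreover have "\<bar>?b z\<bar> = ?b z" using bump_nonneg[of "(norm z)\<^sup>2"] by simp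
        ultimately show ?thesis unfolding norm_mult norm_of_real
          using bump_nonneg[of "(norm z)\<^sup>2"] by (metis abs_ge_zero mult_right_mono)
      qed (use bz in auto)
    qed
    also have "\<dots> = e" using moll_const_pos[where 'a='a] unfolding moll_const_def by simp
    finally show "norm ((\<integral>y. f y * of_real (kern x \<delta> y) \<partial>lborel) - of_real ?c * f x) \<le> e" .
  qed (use d in simp)
qed

text \<open>For delta <= 1 the power delta^(-n/2) is at most delta^(-3/2) when n <= 3, so plane and
  space can be treated with one exponent.\<close>

lemma sqrt_power_bound:
  assumes "0 < \<delta>" "\<delta> \<le> 1" "n = 2 \<or> n = (3::nat)"
  shows "sqrt (\<delta> ^ n) / \<delta> ^ n \<le> 1 / (\<delta> * sqrt \<delta>)"
proof -
  have s: "0 < sqrt \<delta>" "sqrt \<delta> \<le> 1" "sqrt \<delta> * sqrt \<delta> = \<delta>" using assms by auto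
  from assms(3) show ?thesis
  proof
    assume n: "n = 2"
    have "\<delta> * sqrt \<delta> \<le> \<delta> * 1" using s assms by (intro mult_left_mono) auto
    then have "1 / \<delta> \<le> 1 / (\<delta> * sqrt \<delta>)" using assms s by (intro divide_left_mono) auto
    then show ?thesis using n assms by (simp add: power2_eq_square)
  next
    assume n: "n = 3"
    have "sqrt (\<delta> ^ 3) = \<delta> * sqrt \<delta>" using assms s by (intro real_sqrt_unique) (auto simp: power2_eq_square power3_eq_cube)
    moreover have "\<delta> * sqrt \<delta> / \<delta> ^ 3 = 1 / (\<delta> * sqrt \<delta>)"
    proof -
      have "\<delta> ^ 3 = (\<delta> * sqrt \<delta>) * (\<delta> * sqrt \<delta>)" using s(3) by (simp add: power3_eq_cube algebra_simps)
      then show ?thesis using s assms by simp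
    qed
    ultimately show ?thesis using n by simp
  qed
qed

text \<open>The derivative of the mean is delta^(1-n) times the Laplacian of f paired with a cutoff.
  Cauchy-Schwarz contributes delta^(n/2), so the total power is delta^(1-n/2), at worst
  delta^(-1/2).\<close>

lemma moll_derivative_bound:
  fixes f :: "'a::euclidean_space \<Rightarrow> complex"
  assumes dim: "DIM('a) = 2 \<or> DIM('a) = 3" and m: "0 \<le> m" "\<And>t. \<bar>step t\<bar> \<le> m"
    and H: "H2_norm_le U f S" and \<delta>: "0 < \<delta>" "\<delta> \<le> 1" "cball x (2 * \<delta>) \<subseteq> U"
  shows "norm (\<integral>y. f y * of_real (kern' x \<delta> y) \<partial>lborel)
     \<le> real DIM('a) * m * sqrt (unit_ball_vol DIM('a) * 2 ^ DIM('a)) * S / sqrt \<delta>"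
proof -
  let ?n = "DIM('a)"
  obtain G where S: "0 \<le> S" and G: "\<And>bs. bs \<in> dirs_le 2 \<Longrightarrow> weak_deriv U f bs (G bs)"
    and sum: "(\<Sum>bs\<in>dirs_le 2. \<integral>\<^sup>+ x\<in>U. ennreal ((cmod (G bs x))\<^sup>2) \<partial>lborel) \<le> ennreal (S\<^sup>2)"
    using H unfolding H2_norm_le_def by auto
  have fin: "finite (dirs_le 2 :: 'a list set)"
    unfolding dirs_le_def by (rule finite_lists_length_le) simp
  have mem: "[b, b] \<in> dirs_le 2" if "b \<in> Basis" for b :: 'a using that by (simp add: dirs_le_def)
  have Gb: "(\<integral>\<^sup>+ x\<in>U. ennreal ((cmod (G [b, b] x))\<^sup>2) \<partial>lborel) \<le> ennreal (S\<^sup>2)" if "b \<in> Basis" for b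
    by (rule order_trans[OF member_le_sum[OF mem[OF that] _ fin, of "\<lambda>bs. \<integral>\<^sup>+ x\<in>U. ennreal ((cmod (G bs x))\<^sup>2) \<partial>lborel"] sum]) simp
  define \<psi> where "\<psi> = cutoff x \<delta>"
  have s\<psi>: "smooth \<psi>" unfolding \<psi>_def by (rule smooth_cutoff)
  have z\<psi>: "\<psi> y = 0" if "y \<notin> cball x (2 * \<delta>)" for y
    using that \<delta> by (simp add: \<psi>_def cutoff_eq_0 dist_norm norm_minus_commute)
  have b\<psi>: "norm (\<psi> y) \<le> m" for y using m(2) by (simp add: \<psi>_def cutoff_def)
  have Gw: "weak_deriv U f [b, b] (G [b, b])" if "b \<in> Basis" for b using G[OF mem[OF that]] .
  note wl = weak_lap[where G = "\<lambda>b. G [b, b]", OF Gw s\<psi> compact_cball \<delta>(3) z\<psi>]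
  have "(\<integral>y. f y * of_real (kern' x \<delta> y) \<partial>lborel) = of_real (\<delta> / \<delta> ^ ?n) * (\<integral>y. f y * lap \<psi> y \<partial>lborel)"
  proof -
    have "(\<lambda>y. f y * of_real (kern' x \<delta> y)) = (\<lambda>y. of_real (\<delta> / \<delta> ^ ?n) * (f y * lap \<psi> y))"
      unfolding kern'_lap \<psi>_def by (rule ext) (simp only: mult_ac)
    then show ?thesis by (simp only: integral_mult_right_zero)
  qed
  also have "(\<integral>y. f y * lap \<psi> y \<partial>lborel) = (\<Sum>b\<in>Basis. \<integral>y. G [b, b] y * \<psi> y \<partial>lborel)"
    by (subst wl(1)) (auto simp: sum_distrib_right intro!: Bochner_Integration.integral_sum wl(4))
  finally have E: "norm (\<integral>y. f y * of_real (kern' x \<delta> y) \<partial>lborel) = (\<delta> / \<delta> ^ ?n) * norm (\<Sum>b\<in>Basis. \<integral>y. G [b, b] y * \<psi> y \<partial>lborel)"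
    using \<delta> by (simp add: norm_mult norm_divide norm_power)
  have "norm (\<Sum>b\<in>Basis. \<integral>y. G [b, b] y * \<psi> y \<partial>lborel) \<le> (\<Sum>b\<in>(Basis::'a set). S * (m * sqrt (unit_ball_vol ?n * (2 * \<delta>) ^ ?n)))"
  proof (rule sum_norm_le)
    fix b :: 'a assume b: "b \<in> Basis"
    show "norm (\<integral>y. G [b, b] y * \<psi> y \<partial>lborel) \<le> S * (m * sqrt (unit_ball_vol ?n * (2 * \<delta>) ^ ?n))"
      using G[OF mem[OF b]] unfolding weak_deriv_def
      by (intro weak_deriv_pairing_bound[OF _ Gb[OF b] S \<delta>(3) _ smooth_continuous[OF s\<psi>] z\<psi> b\<psi> m(1)]) (use \<delta> in auto)
  qed
  also have "\<dots> = real ?n * m * S * sqrt (unit_ball_vol ?n * 2 ^ ?n) * sqrt (\<delta> ^ ?n)"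
    by (simp add: power_mult_distrib real_sqrt_mult)
  finally have "norm (\<integral>y. f y * of_real (kern' x \<delta> y) \<partial>lborel) \<le>
     (\<delta> / \<delta> ^ ?n) * (real ?n * m * S * sqrt (unit_ball_vol ?n * 2 ^ ?n) * sqrt (\<delta> ^ ?n))"
    unfolding E using \<delta> by (intro mult_left_mono) auto
  also have "\<dots> = real ?n * m * S * sqrt (unit_ball_vol ?n * 2 ^ ?n) * (\<delta> * (sqrt (\<delta> ^ ?n) / \<delta> ^ ?n))"
    by (simp add: field_simps)
  also have "\<dots> \<le> real ?n * m * S * sqrt (unit_ball_vol ?n * 2 ^ ?n) * (\<delta> * (1 / (\<delta> * sqrt \<delta>)))"
    using \<delta> m S dim by (intro mult_left_mono sqrt_power_bound) auto
  also have "\<dots> = real ?n * m * sqrt (unit_ball_vol ?n * 2 ^ ?n) * S / sqrt \<delta>" using \<delta> by (simp add: field_simps)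
  finally show ?thesis .
qed

text \<open>Integrating the bound delta^(-1/2) from a small radius gives 2 sqrt(delta); as that
  radius tends to 0 the mean tends to the value of f at the centre times
  \<open>moll_const\<close>.\<close>

lemma moll_error_bound:
  fixes f :: "'a::euclidean_space \<Rightarrow> complex"
  assumes dim: "DIM('a) = 2 \<or> DIM('a) = 3" and m: "0 \<le> m" "\<And>t. \<bar>step t\<bar> \<le> m" and f: "continuous_on UNIV f"
    and H: "H2_norm_le U f S" and \<delta>: "0 < \<delta>" "\<delta> < 1/2" "cball x 1 \<subseteq> U"
  shows "norm ((\<integral>y. f y * of_real (kern x \<delta> y) \<partial>lborel) - of_real (moll_const TYPE('a)) * f x)
     \<le> 2 * (real DIM('a) * m * sqrt (unit_ball_vol DIM('a) * 2 ^ DIM('a)) * S) * sqrt \<delta>"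
proof -
  let ?a = "\<lambda>\<delta>. \<integral>y. f y * of_real (kern x \<delta> y) \<partial>lborel"
  define C where "C = real DIM('a) * m * sqrt (unit_ball_vol DIM('a) * 2 ^ DIM('a)) * S"
  have C0: "0 \<le> C" using m H by (auto simp: C_def H2_norm_le_def)
  have bd: "norm (?a \<delta> - ?a d) \<le> 2 * C * sqrt \<delta>" if d: "0 < d" "d < \<delta>" for d
  proof -
    have D: "(?a has_vector_derivative (\<integral>y. f y * of_real (kern' x e y) \<partial>lborel)) (at e)" if "d \<le> e" "e \<le> \<delta>" for e
      by (rule moll_has_derivative[OF f, of "d/2" _ "\<delta> + 1"]) (use d that in auto)
    have "norm (?a \<delta> - ?a d) \<le> 2 * C * sqrt \<delta> - 2 * C * sqrt d"
    proof (rule differentiable_bound_general[where \<phi>' = "\<lambda>e. C / sqrt e"])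
      show "d < \<delta>" by fact
      show "continuous_on {d..\<delta>} ?a"
        using D by (meson atLeastAtMost_iff continuous_at_imp_continuous_on has_vector_derivative_continuous)
      show "continuous_on {d..\<delta>} (\<lambda>e. 2 * C * sqrt e)" by (intro continuous_intros)
      fix e assume e: "d < e" "e < \<delta>"
      show "(?a has_vector_derivative (\<integral>y. f y * of_real (kern' x e y) \<partial>lborel)) (at e)"
        using D e by simp
      have "((\<lambda>e. 2 * C * sqrt e) has_real_derivative C / sqrt e) (at e)"
        using e d by (auto intro!: derivative_eq_intros simp: field_simps)
      then show "((\<lambda>e. 2 * C * sqrt e) has_vector_derivative C / sqrt e) (at e)"
        by (simp add: has_real_derivative_iff_has_vector_derivative)
      have "cball x (2 * e) \<subseteq> U" using \<delta> e by (intro order_trans[OF _ \<delta>(3)]) auto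
      then show "norm (\<integral>y. f y * of_real (kern' x e y) \<partial>lborel) \<le> C / sqrt e"
        unfolding C_def by (intro moll_derivative_bound[OF dim m H]) (use d e \<delta> in auto)
    qed
    also have "\<dots> \<le> 2 * C * sqrt \<delta>" using C0 d by simp
    finally show ?thesis .
  qed
  show ?thesis unfolding C_def[symmetric]
  proof (rule field_le_epsilon)
    fix e :: real assume e: "0 < e"
    obtain d where d: "0 < d" "\<And>\<delta>. 0 < \<delta> \<Longrightarrow> \<delta> < d \<Longrightarrow> norm (?a \<delta> - of_real (moll_const TYPE('a)) * f x) \<le> e"
      using moll_tendsto[OF f e] by metis
    define t where "t = min d \<delta> / 2"
    have t: "0 < t" "t < d" "t < \<delta>" using d \<delta> by (auto simp: t_def)
    have "norm (?a \<delta> - of_real (moll_const TYPE('a)) * f x) \<le> norm (?a \<delta> - ?a t) + norm (?a t - of_real (moll_const TYPE('a)) * f x)"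
      by (rule order_trans[OF _ norm_triangle_ineq]) simp
    also have "\<dots> \<le> 2 * C * sqrt \<delta> + e" using bd[OF t(1,3)] d(2)[OF t(1,2)] by linarith
    finally show "norm (?a \<delta> - of_real (moll_const TYPE('a)) * f x) \<le> 2 * C * sqrt \<delta> + e" .
  qed
qed

lemma kern_lipschitz:
  fixes x x' y :: "'a::euclidean_space"
  assumes m: "\<And>t. \<bar>bump' t\<bar> \<le> m" and \<delta>: "0 < \<delta>"
  shows "\<bar>kern x \<delta> y - kern x' \<delta> y\<bar> \<le> 8 * m * norm (x - x') / (\<delta> * \<delta> ^ DIM('a))"
proof -
  have m0: "0 \<le> m" using m[of 0] by simp
  \<comment> \<open>As a function of s, \<open>bump\<close> of s^2 has the derivative 2 s
    \<open>bump'\<close> of s^2. It vanishes for s >= 2, so the factor 2 s costs at most 4.\<close>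
  have L: "\<bar>bump (s\<^sup>2) - bump (t\<^sup>2)\<bar> \<le> 4 * m * \<bar>s - t\<bar>" if "0 \<le> s" "0 \<le> t" for s t
  proof -
    have "norm (bump (s\<^sup>2) - bump (t\<^sup>2)) \<le> 4 * m * norm (s - t)"
    proof (rule field_differentiable_bound[where S = "{0..}" and f' = "\<lambda>s. bump' (s\<^sup>2) * (2 * s)"])
      fix z :: real assume z: "z \<in> {0..}"
      show "((\<lambda>s. bump (s\<^sup>2)) has_real_derivative bump' (z\<^sup>2) * (2 * z)) (at z within {0..})"
        by (rule DERIV_subset[OF DERIV_chain2[OF bump_has_derivative]]) (auto intro!: derivative_eq_intros)
      show "norm (bump' (z\<^sup>2) * (2 * z)) \<le> 4 * m"
      proof (cases "z \<le> 2")
        case True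
        then have "\<bar>bump' (z\<^sup>2)\<bar> * (2 * z) \<le> m * 4" using m[of "z\<^sup>2"] m0 z by (intro mult_mono) auto
        then show ?thesis using z by (simp add: abs_mult)
      next
        case False
        then have "2\<^sup>2 \<le> z\<^sup>2" by (intro power_mono) auto
        then show ?thesis using m0 by (simp add: bump'_eq_0)
      qed
    qed (use that in auto)
    then show ?thesis by simp
  qed
  have r: "radsq x \<delta> y = (norm (y - x) / \<delta>)\<^sup>2" for x by (simp add: radsq_def power_divide)
  have "\<bar>kern x \<delta> y - kern x' \<delta> y\<bar> = 2 / \<delta> ^ DIM('a) * \<bar>bump (radsq x \<delta> y) - bump (radsq x' \<delta> y)\<bar>"
    unfolding kern_def right_diff_distrib[symmetric] abs_mult using \<delta> by simp
  also have "\<dots> \<le> 2 / \<delta> ^ DIM('a) * (4 * m * \<bar>norm (y - x) / \<delta> - norm (y - x') / \<delta>\<bar>)"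
    unfolding r using \<delta> by (intro mult_left_mono L) auto
  also have "\<bar>norm (y - x) / \<delta> - norm (y - x') / \<delta>\<bar> = \<bar>norm (y - x) - norm (y - x')\<bar> / \<delta>"
    using \<delta> by (simp flip: diff_divide_distrib)
  also have "2 / \<delta> ^ DIM('a) * (4 * m * (\<bar>norm (y - x) - norm (y - x')\<bar> / \<delta>)) \<le> 2 / \<delta> ^ DIM('a) * (4 * m * (norm (x - x') / \<delta>))"
  proof -
    have "\<bar>norm (y - x) - norm (y - x')\<bar> \<le> norm ((y - x) - (y - x'))" by (rule norm_triangle_ineq3)
    also have "\<dots> = norm (x - x')" by (simp add: norm_minus_commute)
    finally show ?thesis using \<delta> m0 by (intro mult_left_mono divide_right_mono) auto
  qed
  finally show ?thesis by (simp add: field_simps)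
qed

text \<open>The mean of f over the scale d has derivative in d bounded by the L2 norm of the Laplacian times d^(1 - n/2),
  which is integrable at 0 for n < 4.\<close>
lemma H2_holder_estimate:
  assumes dim: "DIM('a::euclidean_space) = 2 \<or> DIM('a) = 3"
  obtains C where "0 < C" "\<And>(f :: 'a \<Rightarrow> complex) R S x. continuous_on UNIV f \<Longrightarrow> 1 < R \<Longrightarrow>
      H2_norm_le (ball 0 (2 * R)) f S \<Longrightarrow> x \<in> cball 0 R \<Longrightarrow> norm (f x) \<le> C * S"
    "\<And>(f :: 'a \<Rightarrow> complex) R S x x'. continuous_on UNIV f \<Longrightarrow> 1 < R \<Longrightarrow>
      H2_norm_le (ball 0 (2 * R)) f S \<Longrightarrow> x \<in> cball 0 R \<Longrightarrow> x' \<in> cball 0 R \<Longrightarrow> dist x x' \<le> 1 / 64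
      \<Longrightarrow> norm (f x - f x') \<le> C * S * dist x x' powr (1 / 6)"
proof -
  obtain m where m: "0 < m" "\<And>t. \<bar>bump t\<bar> \<le> m \<and> \<bar>bump' t\<bar> \<le> m \<and> \<bar>step t\<bar> \<le> m"
    using bump_bounds by blast
  let ?n = "DIM('a)" and ?c = "moll_const TYPE('a)"
  have c0: "0 < ?c" by (rule moll_const_pos)
  define C1 where "C1 = real ?n * m * sqrt (unit_ball_vol ?n * 2 ^ ?n)"
  define C2 where "C2 = 2 * 4 ^ ?n * m * sqrt (unit_ball_vol ?n)"
  define C3 where "C3 = 8 * m * sqrt (unit_ball_vol ?n * 3 ^ ?n)"
  have C1: "0 \<le> C1" unfolding C1_def using m by auto
  have C2: "0 \<le> C2" unfolding C2_def using m by auto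
  have C3: "0 \<le> C3" unfolding C3_def using m by auto
  define C where "C = (1 + 4 * C1 + C2 + C3) / ?c"
  have C0: "0 < C" using C1 C2 C3 c0 by (simp add: C_def add_pos_nonneg)
  \<comment> \<open>The H^2 bound controls the L2 norm of the weak derivative for the empty list of
    directions, not f itself; on test functions the two agree.\<close>
  have pair0: "norm (\<integral>y. f y * of_real (h y) \<partial>lborel) \<le> S * (M * sqrt (unit_ball_vol ?n * r ^ ?n))"
    if H: "H2_norm_le U f S" and h: "smooth (\<lambda>y. complex_of_real (h y))" and z: "\<And>y. y \<notin> cball x r \<Longrightarrow> h y = 0"
      and M: "\<And>y. \<bar>h y\<bar> \<le> M" "0 \<le> M" and r: "0 \<le> r" "cball x r \<subseteq> U" for U and f :: "'a \<Rightarrow> complex" and S h x r M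
  proof -
    obtain G where S: "0 \<le> S" and G: "\<And>bs. bs \<in> dirs_le 2 \<Longrightarrow> weak_deriv U f bs (G bs)"
      and sum: "(\<Sum>bs\<in>dirs_le 2. \<integral>\<^sup>+ x\<in>U. ennreal ((cmod (G bs x))\<^sup>2) \<partial>lborel) \<le> ennreal (S\<^sup>2)"
      using H unfolding H2_norm_le_def by auto
    have fin: "finite (dirs_le 2 :: 'a list set)"
      unfolding dirs_le_def by (rule finite_lists_length_le) simp
    have mem: "[] \<in> dirs_le 2" by (simp add: dirs_le_def)
    have Gb: "(\<integral>\<^sup>+ x\<in>U. ennreal ((cmod (G [] x))\<^sup>2) \<partial>lborel) \<le> ennreal (S\<^sup>2)"
      by (rule order_trans[OF member_le_sum[OF mem _ fin, of "\<lambda>bs. \<integral>\<^sup>+ x\<in>U. ennreal ((cmod (G bs x))\<^sup>2) \<partial>lborel"] sum]) simp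
    have "test_fun U (\<lambda>y. complex_of_real (h y))"
      by (rule test_funI[OF h compact_cball r(2)]) (use z in auto)
    then have "(\<integral>y. f y * of_real (h y) \<partial>lborel) = (\<integral>y. G [] y * of_real (h y) \<partial>lborel)"
      using G[OF mem] unfolding weak_deriv_def by fastforce
    also have "norm \<dots> \<le> S * (M * sqrt (unit_ball_vol ?n * r ^ ?n))"
      using G[OF mem] unfolding weak_deriv_def
      by (intro weak_deriv_pairing_bound[OF _ Gb S r(2,1) smooth_continuous[OF h] _ _ M(2)]) (use z M in auto)
    finally show ?thesis .
  qed
  show ?thesis
  proof (rule that[OF C0])
    fix f :: "'a \<Rightarrow> complex" and R S :: real and x :: 'a
    assume f: "continuous_on UNIV f" and R: "1 < R" and H: "H2_norm_le (ball 0 (2 * R)) f S" and x: "x \<in> cball 0 R"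
    have S: "0 \<le> S" using H by (simp add: H2_norm_le_def)
    have sub: "cball x 1 \<subseteq> ball 0 (2 * R)"
    proof
      fix y assume "y \<in> cball x 1"
      then show "y \<in> ball 0 (2 * R)" using x R norm_triangle_sub[of y x] by (auto simp: dist_norm norm_minus_commute)
    qed
    let ?a = "\<integral>y. f y * of_real (kern x (1/4) y) \<partial>lborel"
    have e: "norm (?a - of_real ?c * f x) \<le> 2 * (C1 * S) * sqrt (1/4)"
      unfolding C1_def by (rule moll_error_bound[OF dim _ _ f H _ _ sub]) (use m less_imp_le in auto)
    have "norm ?a \<le> S * ((2 * 4 ^ ?n * m) * sqrt (unit_ball_vol ?n * 1 ^ ?n))"
    proof (rule pair0[OF H smooth_kern])
      show "kern x (1/4) y = 0" if "y \<notin> cball x 1" for y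
        using that by (intro kern_eq_0) auto
      show "\<bar>kern x (1/4) y\<bar> \<le> 2 * 4 ^ ?n * m" for y
        using m by (auto simp: kern_def abs_mult power_one_over intro!: mult_left_mono)
    qed (use m sub in auto)
    then have "norm ?a \<le> C2 * S" by (simp add: C2_def mult_ac)
    have "?c * norm (f x) = norm (of_real ?c * f x)" using c0 by (simp add: norm_mult)
    also have "\<dots> \<le> norm ?a + norm (?a - of_real ?c * f x)" by (metis norm_minus_commute norm_triangle_sub)
    also have "\<dots> \<le> C2 * S + C1 * S" using e \<open>norm ?a \<le> C2 * S\<close> by (simp add: real_sqrt_divide)
    also have "\<dots> \<le> (1 + 4 * C1 + C2 + C3) * S" using S C1 C2 C3 by (simp add: algebra_simps)
    finally show "norm (f x) \<le> C * S" using c0 by (simp add: C_def field_simps)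
  next
    fix f :: "'a \<Rightarrow> complex" and R S :: real and x x' :: 'a
    assume f: "continuous_on UNIV f" and R: "1 < R" and H: "H2_norm_le (ball 0 (2 * R)) f S"
      and x: "x \<in> cball 0 R" "x' \<in> cball 0 R" and d: "dist x x' \<le> 1 / 64"
    have S: "0 \<le> S" using H by (simp add: H2_norm_le_def)
    show "norm (f x - f x') \<le> C * S * dist x x' powr (1 / 6)"
    proof (cases "x = x'")
      case False
      \<comment> \<open>Smoothing at scale delta costs sqrt(delta) at each point, and moving the
        centre of the kernel costs |x - x'| delta^(-5/2). With |x - x'| = delta^3 both equal
        sqrt(delta), whence the exponent 1/6. The bound 1/64 makes delta <= 1/4.\<close>
      define \<delta> where "\<delta> = dist x x' powr (1/3)"
      have dp: "0 < dist x x'" using False by simp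
      have \<delta>0: "0 < \<delta>" using False by (simp add: \<delta>_def)
      have \<delta>3: "\<delta> ^ 3 = dist x x'" unfolding \<delta>_def using dp by (simp add: powr_realpow[symmetric] powr_powr)
      have \<delta>4: "\<delta> \<le> 1/4"
      proof (rule power_le_imp_le_base)
        show "\<delta> ^ Suc 2 \<le> (1/4) ^ Suc 2" using \<delta>3 d by (simp add: eval_nat_numeral)
      qed simp
      have d\<delta>: "dist x x' \<le> \<delta>"
        unfolding \<delta>3[symmetric] using \<delta>0 \<delta>4 power_decreasing[of 1 3 \<delta>] by simp
      have sq: "sqrt \<delta> = dist x x' powr (1/6)"
        unfolding \<delta>_def using dp by (simp add: powr_half_sqrt[symmetric] powr_powr)
      have sub: "cball x 1 \<subseteq> ball 0 (2 * R)" if "x \<in> cball 0 R" for x :: 'a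
      proof
        fix y assume "y \<in> cball x 1"
        then show "y \<in> ball 0 (2 * R)" using that R norm_triangle_sub[of y x] by (auto simp: dist_norm norm_minus_commute)
      qed
      let ?a = "\<lambda>x. \<integral>y. f y * of_real (kern x \<delta> y) \<partial>lborel"
      have e: "norm (?a x - of_real ?c * f x) \<le> 2 * (C1 * S) * sqrt \<delta>" if "x \<in> cball 0 R" for x
        unfolding C1_def by (rule moll_error_bound[OF dim _ _ f H _ _ sub[OF that]]) (use m less_imp_le \<delta>0 \<delta>4 in auto)
      have ik: "integrable lborel (\<lambda>y. f y * complex_of_real (kern x \<delta> y))" for x :: 'a
        by (rule integrable_cont_compact[OF _ compact_cball[of x "2 * \<delta>"]])
          (use \<delta>0 kern_eq_0 in \<open>auto intro!: continuous_intros f smooth_continuous[OF smooth_kern]\<close>)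
      have "?a x - ?a x' = (\<integral>y. f y * of_real (kern x \<delta> y - kern x' \<delta> y) \<partial>lborel)"
        using ik by (simp add: right_diff_distrib)
      also have "norm \<dots> \<le> S * ((8 * m * norm (x - x') / (\<delta> * \<delta> ^ ?n)) * sqrt (unit_ball_vol ?n * (3 * \<delta>) ^ ?n))"
      proof (rule pair0[OF H])
        show "smooth (\<lambda>y. complex_of_real (kern x \<delta> y - kern x' \<delta> y))"
          unfolding of_real_diff by (intro smooth_diff smooth_kern)
        show "kern x \<delta> y - kern x' \<delta> y = 0" if y: "y \<notin> cball x (3 * \<delta>)" for y
        proof -
          have "y \<notin> cball x (2 * \<delta>)" using y \<delta>0 by auto
          moreover have "y \<notin> cball x' (2 * \<delta>)" using y d\<delta> dist_triangle[of x y x'] by (auto simp: dist_commute)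
          ultimately show ?thesis using \<delta>0 by (simp add: kern_eq_0)
        qed
        show "\<bar>kern x \<delta> y - kern x' \<delta> y\<bar> \<le> 8 * m * norm (x - x') / (\<delta> * \<delta> ^ ?n)" for y
          by (rule kern_lipschitz) (use m \<delta>0 in auto)
        show "cball x (3 * \<delta>) \<subseteq> ball 0 (2 * R)"
          by (rule order_trans[OF _ sub[OF x(1)]]) (use \<delta>4 in auto)
      qed (use m \<delta>0 in auto)
      also have "\<dots> = S * C3 * (dist x x' / \<delta> * (sqrt (\<delta> ^ ?n) / \<delta> ^ ?n))"
        by (simp add: C3_def dist_norm power_mult_distrib real_sqrt_mult field_simps)
      also have "\<dots> \<le> S * C3 * (dist x x' / \<delta> * (1 / (\<delta> * sqrt \<delta>)))"
        using S C3 \<delta>0 \<delta>4 dim by (intro mult_left_mono sqrt_power_bound) auto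
      also have "dist x x' / \<delta> * (1 / (\<delta> * sqrt \<delta>)) = sqrt \<delta>"
        unfolding \<delta>3[symmetric] using \<delta>0 by (simp add: field_simps power3_eq_cube)
      finally have e2: "norm (?a x - ?a x') \<le> S * C3 * sqrt \<delta>" .
      have "?c * norm (f x - f x') = norm (of_real ?c * f x - of_real ?c * f x')"
        using c0 by (simp add: norm_mult flip: right_diff_distrib)
      also have "\<dots> = norm ((?a x - ?a x') - (?a x - of_real ?c * f x) + (?a x' - of_real ?c * f x'))" by simp
      also have "\<dots> \<le> norm (?a x - ?a x') + norm (?a x - of_real ?c * f x) + norm (?a x' - of_real ?c * f x')"
        by (intro order_trans[OF norm_triangle_ineq] add_right_mono norm_triangle_ineq4)
      also have "\<dots> \<le> S * C3 * sqrt \<delta> + 2 * (C1 * S) * sqrt \<delta> + 2 * (C1 * S) * sqrt \<delta>"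
        by (intro add_mono e2 e x)
      also have "\<dots> = (4 * C1 + C3) * (S * sqrt \<delta>)" by (simp add: algebra_simps)
      also have "\<dots> \<le> (1 + 4 * C1 + C2 + C3) * (S * sqrt \<delta>)"
        using S C2 \<delta>0 by (intro mult_right_mono) auto
      finally show ?thesis using c0 unfolding sq by (simp add: C_def field_simps)
    qed simp
  qed
qed

subsection \<open>Approximation of complex exponentials in three dimensions\<close>

text \<open>The entire function T with z T(z^2) = sin (k z).\<close>
definition sinc_coeff :: "real \<Rightarrow> nat \<Rightarrow> complex" where
  "sinc_coeff k j = of_real ((-1) ^ j * k ^ (2 * j + 1) / fact (2 * j + 1))"

definition sincf :: "real \<Rightarrow> complex \<Rightarrow> complex" where
  "sincf k q = (\<Sum>j. sinc_coeff k j * q ^ j)"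

lemma sinc_sums:
  assumes "z \<noteq> 0"
  shows "(\<lambda>j. sinc_coeff k j * (z\<^sup>2) ^ j) sums (sin (of_real k * z) / z)"
proof -
  let ?w = "of_real k * z"
  have "(\<lambda>n. (of_real (sin_coeff n) :: complex) * ?w ^ n) sums sin ?w"
    using sin_converges[of ?w] by (simp add: scaleR_conv_of_real)
  then have "(\<lambda>n. (of_real (sin_coeff (2 * n + 1)) :: complex) * ?w ^ (2 * n + 1)) sums sin ?w"
    by (subst sums_mono_reindex[of "\<lambda>n. 2 * n + 1" "\<lambda>n. (of_real (sin_coeff n) :: complex) * ?w ^ n", unfolded])
       (auto simp: strict_mono_def sin_coeff_def elim!: oddE)
  then have "(\<lambda>n. (of_real (sin_coeff (2 * n + 1)) :: complex) * ?w ^ (2 * n + 1) / z) sums (sin ?w / z)"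
    by (rule sums_divide)
  moreover have "(of_real (sin_coeff (2 * n + 1)) :: complex) * ?w ^ (2 * n + 1) / z = sinc_coeff k n * (z\<^sup>2) ^ n" for n
  proof -
    have "?w ^ (2 * n + 1) / z = of_real (k ^ (2 * n + 1)) * (z\<^sup>2) ^ n"
      using assms by (simp add: power_mult_distrib power_mult)
    moreover have "(of_real (sin_coeff (2 * n + 1)) :: complex) = of_real ((-1) ^ n / fact (2 * n + 1))"
      by (simp add: sin_coeff_def)
    ultimately have "(of_real (sin_coeff (2 * n + 1)) :: complex) * (?w ^ (2 * n + 1) / z)
       = of_real ((-1) ^ n / fact (2 * n + 1)) * (of_real (k ^ (2 * n + 1)) * (z\<^sup>2) ^ n)" by (simp only:)
    also have "\<dots> = sinc_coeff k n * (z\<^sup>2) ^ n" by (simp add: sinc_coeff_def)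
    finally show ?thesis by (simp only: times_divide_eq_right)
  qed
  ultimately show ?thesis by simp
qed

lemma sinc_summable: "summable (\<lambda>j. sinc_coeff k j * q ^ j)"
proof (cases "q = 0")
  case False
  then have "csqrt q \<noteq> 0" by simp
  from sums_summable[OF sinc_sums[OF this, of k]] show ?thesis by simp
qed (simp add: summable_0_powser)

lemma sincf_square: "z * sincf k (z\<^sup>2) = sin (of_real k * z)"
proof (cases "z = 0")
  case False
  have "sincf k (z\<^sup>2) = sin (of_real k * z) / z"
    using sums_unique[OF sinc_sums[OF False, of k]] by (simp add: sincf_def)
  then show ?thesis using False by simp
qed simp

lemma sincf_holomorphic: "sincf k holomorphic_on UNIV"
proof -
  have "sincf k field_differentiable at q" for q
    using termdiffs_strong_converges_everywhere[of "sinc_coeff k" q] sinc_summable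
    unfolding sincf_def[abs_def] field_differentiable_def by blast
  then show ?thesis by (simp add: holomorphic_on_def field_differentiable_at_within)
qed

lemma sincf_deriv_identity: "sincf k (z\<^sup>2) + 2 * z\<^sup>2 * deriv (sincf k) (z\<^sup>2) = of_real k * cos (of_real k * z)"
proof -
  have D: "(sincf k has_field_derivative deriv (sincf k) (z\<^sup>2)) (at (z\<^sup>2))"
    using sincf_holomorphic holomorphic_derivI by blast
  have "((\<lambda>z. z * sincf k (z\<^sup>2)) has_field_derivative (sincf k (z\<^sup>2) + 2 * z\<^sup>2 * deriv (sincf k) (z\<^sup>2))) (at z)"
    by (rule DERIV_cong[OF DERIV_mult[OF DERIV_ident DERIV_chain2[where g = "\<lambda>z. z\<^sup>2" and x = z, OF D]]])
      (auto intro!: derivative_eq_intros simp: power2_eq_square algebra_simps)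
  moreover have "((\<lambda>z. z * sincf k (z\<^sup>2)) has_field_derivative of_real k * cos (of_real k * z)) (at z)"
    unfolding sincf_square by (auto intro!: derivative_eq_intros)
  ultimately show ?thesis by (rule DERIV_unique)
qed

text \<open>The radial Helmholtz equation of three dimensions in the variable q = r^2, where the
  Laplacian of T(r^2) is 6 T' + 4 q T''. It holds for complex q as well: differentiate z T(z^2) =
  sin(kz) twice and divide by z; q = 0 follows by continuity.\<close>

lemma sincf_ode: "6 * deriv (sincf k) q + 4 * q * (deriv ^^ 2) (sincf k) q + of_real (k\<^sup>2) * sincf k q = 0"
proof -
  let ?T = "sincf k"
  have h1: "deriv ?T holomorphic_on UNIV" using sincf_holomorphic by (simp add: holomorphic_deriv)
  have nz: "6 * deriv ?T q + 4 * q * (deriv ^^ 2) ?T q + of_real (k\<^sup>2) * ?T q = 0" if "q \<noteq> 0" for q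
  proof -
    define z where "z = csqrt q"
    have z: "z \<noteq> 0" "z\<^sup>2 = q" using that by (auto simp: z_def)
    have D: "(?T has_field_derivative deriv ?T (z\<^sup>2)) (at (z\<^sup>2))"
      using sincf_holomorphic holomorphic_derivI by blast
    have D2: "(deriv ?T has_field_derivative deriv (deriv ?T) (z\<^sup>2)) (at (z\<^sup>2))"
      using h1 holomorphic_derivI by blast
    have "((\<lambda>z. ?T (z\<^sup>2) + (2 * z\<^sup>2) * deriv ?T (z\<^sup>2)) has_field_derivative
       (deriv ?T (z\<^sup>2) * (2 * z) + ((4 * z) * deriv ?T (z\<^sup>2) + deriv (deriv ?T) (z\<^sup>2) * (2 * z) * (2 * z\<^sup>2)))) (at z)"
      by (intro DERIV_add DERIV_mult DERIV_chain2[where g = "\<lambda>z. z\<^sup>2" and x = z, OF D]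
        DERIV_chain2[where g = "\<lambda>z. z\<^sup>2" and x = z, OF D2]) (auto intro!: derivative_eq_intros)
    moreover have "((\<lambda>z. ?T (z\<^sup>2) + (2 * z\<^sup>2) * deriv ?T (z\<^sup>2)) has_field_derivative - (of_real (k\<^sup>2) * sin (of_real k * z))) (at z)"
      unfolding sincf_deriv_identity by (auto intro!: derivative_eq_intros simp: power2_eq_square)
    ultimately have "deriv ?T (z\<^sup>2) * (2 * z) + ((4 * z) * deriv ?T (z\<^sup>2) + deriv (deriv ?T) (z\<^sup>2) * (2 * z) * (2 * z\<^sup>2))
        = - (of_real (k\<^sup>2) * sin (of_real k * z))" by (rule DERIV_unique)
    then have "z * (6 * deriv ?T q + 4 * q * (deriv ^^ 2) ?T q + of_real (k\<^sup>2) * ?T q) = 0"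
      unfolding sincf_square[symmetric] z(2)[symmetric] by (simp add: eval_nat_numeral algebra_simps)
    then show ?thesis using z by simp
  qed
  show ?thesis
  proof (cases "q = 0")
    case True
    let ?g = "\<lambda>q. 6 * deriv ?T q + 4 * q * (deriv ^^ 2) ?T q + of_real (k\<^sup>2) * ?T q"
    have "continuous_on UNIV ?g"
      by (intro continuous_intros holomorphic_on_imp_continuous_on h1 sincf_holomorphic holomorphic_higher_deriv) auto
    then have "isCont ?g 0" by (simp add: continuous_on_eq_continuous_at)
    then have "(?g \<longlongrightarrow> ?g 0) (at 0)" by (simp add: isCont_def)
    moreover have "(?g \<longlongrightarrow> 0) (at 0)"
      by (rule tendsto_cong[THEN iffD2, OF _ tendsto_const]) (use nz in \<open>auto simp: eventually_at_filter\<close>)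
    ultimately show ?thesis unfolding True using tendsto_unique[OF trivial_limit_at] by blast
  qed (rule nz)
qed

text \<open>The square of the complexified distance to the point a + i c.\<close>
definition csq :: "'a::euclidean_space \<Rightarrow> 'a \<Rightarrow> 'a \<Rightarrow> complex" where
  "csq a c x = (\<Sum>b\<in>Basis. (of_real ((x - a) \<bullet> b) - \<i> * of_real (c \<bullet> b))\<^sup>2)"

lemma csq_eq: "csq a c x = of_real ((norm (x - a))\<^sup>2 - (norm c)\<^sup>2) - 2 * \<i> * of_real ((x - a) \<bullet> c)"
proof -
  have "csq a c x = (\<Sum>b\<in>Basis. of_real (((x - a) \<bullet> b)\<^sup>2) - of_real ((c \<bullet> b)\<^sup>2) - 2 * \<i> * of_real (((x - a) \<bullet> b) * (c \<bullet> b)))"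
    unfolding csq_def by (rule sum.cong[OF refl]) (simp add: power2_diff power_mult_distrib)
  also have "\<dots> = of_real (\<Sum>b\<in>Basis. ((x - a) \<bullet> b)\<^sup>2) - of_real (\<Sum>b\<in>Basis. (c \<bullet> b)\<^sup>2) - 2 * \<i> * of_real (\<Sum>b\<in>Basis. ((x - a) \<bullet> b) * (c \<bullet> b))"
    by (simp only: sum_subtractf of_real_sum sum_distrib_left)
  finally show ?thesis unfolding norm_sq_Basis[symmetric] euclidean_inner[symmetric] by simp
qed

lemma smooth_shift: "smooth (\<lambda>x::'a::euclidean_space. of_real ((x - a) \<bullet> b) - \<i> * of_real (c \<bullet> b))"
  unfolding inner_diff_left of_real_diff by (intro smooth_diff smooth_inner smooth_const)

lemma smooth_csq: "smooth (csq a c)"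
  unfolding csq_def[abs_def] by (intro smooth_sum smooth_power smooth_shift)

lemma csq_has_derivative:
  "(csq a c has_derivative (\<lambda>d. \<Sum>b\<in>Basis. 2 * (of_real ((x - a) \<bullet> b) - \<i> * of_real (c \<bullet> b)) * of_real (d \<bullet> b))) (at x)"
proof -
  have "((\<lambda>x. (of_real ((x - a) \<bullet> b) - \<i> * of_real (c \<bullet> b))\<^sup>2) has_derivative
     (\<lambda>d. 2 * (of_real ((x - a) \<bullet> b) - \<i> * of_real (c \<bullet> b)) * of_real (d \<bullet> b))) (at x)" for b
  proof -
    have l: "((\<lambda>x. complex_of_real ((x - a) \<bullet> b) - \<i> * of_real (c \<bullet> b)) has_derivative (\<lambda>d. of_real (d \<bullet> b) - 0)) (at x)"
      by (intro has_derivative_diff has_derivative_of_real has_derivative_const) (auto intro!: derivative_eq_intros)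
    show ?thesis
      by (rule has_derivative_eq_rhs[OF has_derivative_power[OF l, of 2]]) (auto simp: fun_eq_iff algebra_simps)
  qed
  then show ?thesis unfolding csq_def[abs_def] by (intro has_derivative_sum) blast
qed

lemma dd_csq: "b \<in> Basis \<Longrightarrow> dd b (csq a c) x = 2 * (of_real ((x - a) \<bullet> b) - \<i> * of_real (c \<bullet> b))"
  unfolding frechet_derivative_eqI[OF csq_has_derivative] by (simp add: inner_Basis if_distrib cong: if_cong)

lemma has_derivative_holomorphic_compose:
  assumes h: "h holomorphic_on UNIV" and s: "smooth s"
  shows "((\<lambda>x. h (s x)) has_derivative (\<lambda>d. deriv h (s x) * frechet_derivative s (at x) d)) (at x)"
  using has_derivative_compose[OF smooth_has_derivative[OF s], of h "(*) (deriv h (s x))" x]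
    holomorphic_derivI[OF h, of "s x"] by (simp add: has_field_derivative_def)

lemma helmholtz_source:
  fixes a c :: "'a::euclidean_space"
  assumes dim: "DIM('a) = 3"
  shows "helmholtz k (\<lambda>x. C * sincf k (csq a c x))"
proof -
  let ?T = "sincf k" and ?q = "csq a c"
  have h1: "deriv ?T holomorphic_on UNIV" using sincf_holomorphic by (simp add: holomorphic_deriv)
  let ?l = "\<lambda>b x. complex_of_real ((x - a) \<bullet> b) - \<i> * of_real (c \<bullet> b)"
  have "pd [b, b] (\<lambda>x. C * ?T (?q x)) x = C * ((deriv ^^ 2) ?T (?q x) * 4 * (?l b x)\<^sup>2 + deriv ?T (?q x) * 2)"
    if b: "b \<in> Basis" for b x
  proof -
    have 1: "dd b (\<lambda>x. C * ?T (?q x)) = (\<lambda>x. C * (deriv ?T (?q x) * (2 * ?l b x)))"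
    proof
      fix x
      show "dd b (\<lambda>x. C * ?T (?q x)) x = C * (deriv ?T (?q x) * (2 * ?l b x))"
        by (subst frechet_derivative_eqI[OF has_derivative_mult_right[OF has_derivative_holomorphic_compose[OF sincf_holomorphic smooth_csq]]])
          (simp add: dd_csq[OF b])
    qed
    have l: "((\<lambda>x. 2 * ?l b x) has_derivative (\<lambda>d. 2 * (of_real (d \<bullet> b) - 0))) (at x)"
      by (intro has_derivative_mult_right has_derivative_diff has_derivative_of_real has_derivative_const) (auto intro!: derivative_eq_intros)
    show ?thesis
      unfolding pd.simps 1
      by (subst frechet_derivative_eqI[OF has_derivative_mult_right[OF has_derivative_mult[OF has_derivative_holomorphic_compose[OF h1 smooth_csq] l]]])
        (use b in \<open>simp add: dd_csq[OF b] eval_nat_numeral algebra_simps\<close>)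
  qed
  note pdb = this
  have S: "(\<Sum>b\<in>(Basis::'a set). C * (A * 4 * g b + B * 2)) = C * (A * 4 * (\<Sum>b\<in>Basis. g b) + 6 * B)" for A B :: complex and g
  proof -
    have "(\<Sum>b\<in>(Basis::'a set). C * (A * 4 * g b + B * 2)) = C * (\<Sum>b\<in>(Basis::'a set). A * 4 * g b + B * 2)"
      by (simp only: sum_distrib_left)
    also have "(\<Sum>b\<in>(Basis::'a set). A * 4 * g b + B * 2) = A * 4 * (\<Sum>b\<in>Basis. g b) + 6 * B"
      using dim by (simp add: sum.distrib sum_distrib_left)
    finally show ?thesis .
  qed
  have L: "lap (\<lambda>x. C * ?T (?q x)) x = C * ((deriv ^^ 2) ?T (?q x) * 4 * ?q x + 6 * deriv ?T (?q x))" for x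
  proof -
    have "lap (\<lambda>x. C * ?T (?q x)) x = (\<Sum>b\<in>Basis. C * ((deriv ^^ 2) ?T (?q x) * 4 * (?l b x)\<^sup>2 + deriv ?T (?q x) * 2))"
      unfolding lap_def by (rule sum.cong[OF refl pdb])
    also have "\<dots> = C * ((deriv ^^ 2) ?T (?q x) * 4 * (\<Sum>b\<in>Basis. (?l b x)\<^sup>2) + 6 * deriv ?T (?q x))" by (rule S)
    finally show ?thesis by (simp only: csq_def)
  qed
  have "lap (\<lambda>x. C * ?T (?q x)) x + of_real (k\<^sup>2) * (C * ?T (?q x)) = C * (6 * deriv ?T (?q x) + 4 * ?q x * (deriv ^^ 2) ?T (?q x) + of_real (k\<^sup>2) * ?T (?q x))" for x
    unfolding L by (simp add: algebra_simps)
  then show ?thesis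
    unfolding helmholtz_def sincf_ode
    by (auto intro!: smooth_mult smooth_holomorphic[OF smooth_csq sincf_holomorphic])
qed

text \<open>If |Im z| exceeded |c|, the real part of z^2 would force |Re z| > |x - a|, and then |Re
  z Im z| > |x - a| |c|; but Re z Im z is -(x - a).c, so this contradicts Cauchy-Schwarz. Hence
  sin(kz) is at most exp(k |c|) uniformly in x, however large x is.\<close>

lemma Im_sqrt_csq_bound:
  assumes z: "z\<^sup>2 = csq a c x" shows "\<bar>Im z\<bar> \<le> norm c"
proof (rule ccontr)
  assume "\<not> \<bar>Im z\<bar> \<le> norm c"
  then have "(norm c)\<^sup>2 < \<bar>Im z\<bar>\<^sup>2" by (intro power_strict_mono) auto
  then have c: "(norm c)\<^sup>2 < (Im z)\<^sup>2" by simp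
  have re: "(Re z)\<^sup>2 - (Im z)\<^sup>2 = (norm (x - a))\<^sup>2 - (norm c)\<^sup>2"
    using arg_cong[OF z, of Re] by (simp add: csq_eq power2_eq_square)
  have im: "Re z * Im z = - ((x - a) \<bullet> c)" using arg_cong[OF z, of Im] by (simp add: csq_eq power2_eq_square mult.commute)
  have r: "(norm (x - a))\<^sup>2 < (Re z)\<^sup>2" using re c by linarith
  have "(norm (x - a))\<^sup>2 * (norm c)\<^sup>2 < (Re z)\<^sup>2 * (Im z)\<^sup>2"
  proof (cases "norm c = 0")
    case True then show ?thesis using r c by (simp add: zero_less_mult_iff)
       (metis le_less_trans zero_le_power2 zero_less_power2)
  next
    case False
    then have "(norm (x - a))\<^sup>2 * (norm c)\<^sup>2 < (Re z)\<^sup>2 * (norm c)\<^sup>2" using r by (intro mult_strict_right_mono) auto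
    also have "\<dots> \<le> (Re z)\<^sup>2 * (Im z)\<^sup>2" using c by (intro mult_left_mono) auto
    finally show ?thesis .
  qed
  also have "\<dots> = ((x - a) \<bullet> c)\<^sup>2" using im by (metis power2_minus power_mult_distrib)
  also have "\<dots> \<le> (norm (x - a))\<^sup>2 * (norm c)\<^sup>2"
    using Cauchy_Schwarz_ineq[of "x - a" c] by (simp add: power2_norm_eq_inner)
  finally show False by simp
qed

lemma norm_sin_cos_le_exp_Im:
  fixes w :: complex
  shows "norm (sin w) \<le> exp \<bar>Im w\<bar>" "norm (cos w) \<le> exp \<bar>Im w\<bar>"
proof -
  have e: "norm (exp (\<i> * w)) \<le> exp \<bar>Im w\<bar>" "norm (exp (- (\<i> * w))) \<le> exp \<bar>Im w\<bar>" by auto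
  have "norm (sin w) = norm (exp (\<i> * w) - exp (- (\<i> * w))) / 2"
    by (simp add: sin_exp_eq norm_divide norm_mult)
  then show "norm (sin w) \<le> exp \<bar>Im w\<bar>"
    using norm_triangle_ineq4[of "exp (\<i> * w)" "exp (- (\<i> * w))"] e by linarith
  have "norm (cos w) = norm (exp (\<i> * w) + exp (- (\<i> * w))) / 2"
    by (simp add: cos_exp_eq norm_divide)
  then show "norm (cos w) \<le> exp \<bar>Im w\<bar>"
    using norm_triangle_ineq[of "exp (\<i> * w)" "exp (- (\<i> * w))"] e by linarith
qed

text \<open>sin(kz)/z decays like 1/r because |z| >= r/2. Solving the derivative identity for T'
  costs a division by q, of size r^2, which the derivative of q in direction x, at most 3 r^2,
  compensates.\<close>

lemma decays_source:
  fixes a c :: "'a::euclidean_space"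
  assumes dim: "DIM('a) = 3" and k: "0 < k"
  shows "decays (cmod C * 8 * (1 + k) * exp (k * norm c)) (\<lambda>x. C * sincf k (csq a c x))"
proof -
  let ?T = "sincf k" and ?q = "csq a c" and ?E = "exp (k * norm c)"
  \<comment> \<open>From this radius on, |x - a| lies between 3/4 and 5/4 of |x| and |c| is at most
    |x|/4, so |q| >= |x|^2 / 4.\<close>
  define r0 where "r0 = 4 * (norm a + norm c + 1)"
  have main: "norm (C * ?T (?q x)) \<le> (cmod C * 8 * (1 + k) * ?E) * (1 / norm x) \<and>
     norm (frechet_derivative (\<lambda>x. C * ?T (?q x)) (at x) x) \<le> (cmod C * 8 * (1 + k) * ?E) * norm x * (1 / norm x)"
    if x: "r0 \<le> norm x" for x
  proof -
    define r where "r = norm x"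
    have r_ge: "4 * norm a + 4 * norm c + 4 \<le> r" using x by (simp add: r0_def r_def)
    have ra: "4 * norm a \<le> r" using r_ge norm_ge_zero[of c] by linarith
    have rc: "4 * norm c \<le> r" using r_ge norm_ge_zero[of a] by linarith
    have r4: "4 \<le> r" using r_ge norm_ge_zero[of c] norm_ge_zero[of a] by linarith
    note r = ra rc r4
    have x0: "x \<noteq> 0" using r4 by (auto simp: r_def)
    have xa: "3/4 * r \<le> norm (x - a)" using norm_triangle_ineq2[of x a] r by (simp add: r_def)
    have xa2: "norm (x - a) \<le> 5/4 * r" using norm_triangle_ineq4[of x a] r by (simp add: r_def)
    define z where "z = csqrt (?q x)"
    have z2: "z\<^sup>2 = ?q x" by (simp add: z_def)
    have "Re (?q x) = (norm (x - a))\<^sup>2 - (norm c)\<^sup>2" by (simp add: csq_eq)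
    moreover have "(3/4 * r)\<^sup>2 \<le> (norm (x - a))\<^sup>2" using xa r by (intro power_mono) auto
    moreover have "(norm c)\<^sup>2 \<le> (r/4)\<^sup>2" using r by (intro power_mono) auto
    moreover have "(3/4 * r)\<^sup>2 = 9/16 * r\<^sup>2" "(r/4)\<^sup>2 = r\<^sup>2 / 16" by (simp_all add: power2_eq_square)
    ultimately have "r\<^sup>2 / 4 \<le> Re (?q x)" using zero_le_power2[of r] by linarith
    then have q: "r\<^sup>2 / 4 \<le> cmod (?q x)" using complex_Re_le_cmod[of "?q x"] by linarith
    have "(r / 2)\<^sup>2 \<le> (cmod z)\<^sup>2" using q unfolding z2[symmetric] by (simp add: norm_power norm_mult power2_eq_square)
    then have z: "r / 2 \<le> cmod z" by (rule power2_le_imp_le) simp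
    have im: "\<bar>Im z\<bar> \<le> norm c" by (rule Im_sqrt_csq_bound[OF z2])
    have e: "exp \<bar>Im (of_real k * z)\<bar> \<le> ?E"
      using im k by (simp add: abs_mult mult_left_mono)
    have sin: "cmod (sin (of_real k * z)) \<le> ?E"
      using norm_sin_cos_le_exp_Im(1)[of "of_real k * z"] e by linarith
    have cos: "cmod (cos (of_real k * z)) \<le> ?E"
      using norm_sin_cos_le_exp_Im(2)[of "of_real k * z"] e by linarith
    have E1: "1 \<le> ?E" using k by simp
    have T: "cmod (?T (?q x)) \<le> 2 * ?E / r"
    proof -
      have "cmod z * cmod (?T (?q x)) \<le> ?E" using sin sincf_square[of z k] z2 by (metis norm_mult)
      moreover have "r / 2 * cmod (?T (?q x)) \<le> cmod z * cmod (?T (?q x))" by (intro mult_right_mono z) auto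
      ultimately have "r / 2 * cmod (?T (?q x)) \<le> ?E" by linarith
      then show ?thesis using r by (simp add: field_simps)
    qed
    have T': "cmod (deriv ?T (?q x)) \<le> 2 * (1 + k) * ?E / r\<^sup>2"
    proof -
      have "2 * z\<^sup>2 * deriv ?T (?q x) = of_real k * cos (of_real k * z) - ?T (?q x)"
        using sincf_deriv_identity[of k z] unfolding z2 by (simp add: algebra_simps)
      then have "2 * cmod (?q x) * cmod (deriv ?T (?q x)) = cmod (of_real k * cos (of_real k * z) - ?T (?q x))"
        unfolding z2 by (metis norm_mult norm_numeral)
      also have "\<dots> \<le> k * ?E + 2 * ?E / r"
        by (rule order_trans[OF norm_triangle_ineq4], intro add_mono T) (use cos k in \<open>simp add: norm_mult\<close>)
      also have "\<dots> \<le> (1 + k) * ?E" using r E1 by (simp add: field_simps)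
      finally have "2 * cmod (?q x) * cmod (deriv ?T (?q x)) \<le> (1 + k) * ?E" .
      moreover have "2 * (r\<^sup>2 / 4) * cmod (deriv ?T (?q x)) \<le> 2 * cmod (?q x) * cmod (deriv ?T (?q x))"
        by (intro mult_right_mono mult_left_mono q) auto
      ultimately have "2 * (r\<^sup>2 / 4) * cmod (deriv ?T (?q x)) \<le> (1 + k) * ?E" by linarith
      then show ?thesis using r by (simp add: field_simps)
    qed
    have D: "frechet_derivative (\<lambda>x. C * ?T (?q x)) (at x) x = C * (deriv ?T (?q x) * frechet_derivative ?q (at x) x)"
      by (subst frechet_derivative_eqI[OF has_derivative_mult_right[OF has_derivative_holomorphic_compose[OF sincf_holomorphic smooth_csq]]]) simp
    have Dq: "frechet_derivative ?q (at x) x = of_real (2 * ((x - a) \<bullet> x)) - 2 * \<i> * of_real (c \<bullet> x)"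
    proof -
      have "of_real (2 * ((x - a) \<bullet> x)) - 2 * \<i> * of_real (c \<bullet> x) =
        (\<Sum>b\<in>Basis. of_real (2 * (((x - a) \<bullet> b) * (x \<bullet> b))) - 2 * \<i> * of_real ((c \<bullet> b) * (x \<bullet> b)))"
        unfolding euclidean_inner[of "x - a" x] euclidean_inner[of c x]
        by (simp only: of_real_sum sum_distrib_left sum_subtractf)
      also have "\<dots> = (\<Sum>b\<in>Basis. 2 * (of_real ((x - a) \<bullet> b) - \<i> * of_real (c \<bullet> b)) * of_real (x \<bullet> b))"
        by (intro sum.cong[OF refl]) (simp add: left_diff_distrib right_diff_distrib mult.assoc)
      finally show ?thesis unfolding frechet_derivative_eqI[OF csq_has_derivative] ..
    qed
    have "cmod (frechet_derivative ?q (at x) x) \<le> 2 * \<bar>(x - a) \<bullet> x\<bar> + 2 * \<bar>c \<bullet> x\<bar>"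
      unfolding Dq by (rule order_trans[OF norm_triangle_ineq4]) (simp add: norm_mult)
    also have "\<dots> \<le> 2 * (5/4 * r * r) + 2 * (r / 4 * r)"
    proof (intro add_mono mult_left_mono)
      show "\<bar>(x - a) \<bullet> x\<bar> \<le> 5/4 * r * r"
        by (rule order_trans[OF Cauchy_Schwarz_ineq2]) (use mult_right_mono[OF xa2, of r] r in \<open>simp add: r_def\<close>)
      show "\<bar>c \<bullet> x\<bar> \<le> r / 4 * r"
        by (rule order_trans[OF Cauchy_Schwarz_ineq2]) (use mult_right_mono[of "norm c" "r / 4" r] r in \<open>simp add: r_def\<close>)
    qed auto
    also have "\<dots> = 3 * r\<^sup>2" by (simp add: power2_eq_square)
    finally have Dq': "cmod (frechet_derivative ?q (at x) x) \<le> 3 * r\<^sup>2" .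
    have "norm (C * ?T (?q x)) \<le> cmod C * (2 * ?E / r)" unfolding norm_mult by (intro mult_left_mono T) auto
    also have "\<dots> \<le> cmod C * (8 * (1 + k) * ?E / r)"
      using r k by (intro mult_left_mono divide_right_mono mult_right_mono) auto
    finally have 1: "norm (C * ?T (?q x)) \<le> (cmod C * 8 * (1 + k) * ?E) * (1 / norm x)"
      by (simp only: r_def mult.assoc times_divide_eq_right mult_1_right)
    have "norm (frechet_derivative (\<lambda>x. C * ?T (?q x)) (at x) x) \<le> cmod C * ((2 * (1 + k) * ?E / r\<^sup>2) * (3 * r\<^sup>2))"
      unfolding D norm_mult by (intro mult_left_mono mult_mono T' Dq') (use k in auto)
    also have "\<dots> = cmod C * (6 * (1 + k) * ?E)" using r by (simp add: field_simps)
    also have "\<dots> \<le> cmod C * (8 * (1 + k) * ?E)" using k by (intro mult_left_mono mult_right_mono) auto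
    finally have 2: "norm (frechet_derivative (\<lambda>x. C * ?T (?q x)) (at x) x) \<le> (cmod C * 8 * (1 + k) * ?E) * norm x * (1 / norm x)"
      using x0 by (simp add: mult_ac)
    from 1 2 show ?thesis by blast
  qed
  have p: "norm x powr (- (real DIM('a) - 1) / 2) = 1 / norm x" if "r0 \<le> norm x" for x :: 'a
  proof -
    have "4 * norm a + 4 * norm c + 4 \<le> norm x" using that by (simp add: r0_def)
    then have "0 < norm x" using norm_ge_zero[of a] norm_ge_zero[of c] by linarith
    then show ?thesis using dim by (simp add: powr_minus_divide)
  qed
  show ?thesis unfolding decays_def
  proof (intro conjI exI[of _ r0] allI impI)
    fix x :: 'a assume x: "r0 \<le> norm x"
    show "norm (C * ?T (?q x)) \<le> cmod C * 8 * (1 + k) * ?E * norm x powr (- (real DIM('a) - 1) / 2)"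
      "norm (frechet_derivative (\<lambda>x. C * ?T (?q x)) (at x) x) \<le>
         cmod C * 8 * (1 + k) * ?E * norm x * norm x powr (- (real DIM('a) - 1) / 2)"
      unfolding p[OF x] using main[OF x] by blast+
  qed (use k in simp)
qed


lemma decays_mono:
  fixes v :: "'a::euclidean_space \<Rightarrow> complex"
  assumes "decays B v" "B \<le> B'" shows "decays B' v"
proof -
  let ?p = "\<lambda>x::'a. norm x powr (- (real DIM('a) - 1) / 2)"
  obtain \<rho> where B: "0 \<le> B" "\<And>x. \<rho> \<le> norm x \<Longrightarrow> norm (v x) \<le> B * ?p x"
    "\<And>x. \<rho> \<le> norm x \<Longrightarrow> norm (frechet_derivative v (at x) x) \<le> B * norm x * ?p x"
    using assms(1) unfolding decays_def by blast
  have le: "B * ?p x \<le> B' * ?p x" "B * norm x * ?p x \<le> B' * norm x * ?p x" for x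
    using assms(2) by (auto intro!: mult_right_mono)
  show ?thesis unfolding decays_def
  proof (intro conjI exI[of _ \<rho>] allI impI)
    show "0 \<le> B'" using B(1) assms(2) by simp
    show "norm (v x) \<le> B' * ?p x" if "\<rho> \<le> norm x" for x by (rule order_trans[OF B(2)[OF that] le(1)])
    show "norm (frechet_derivative v (at x) x) \<le> B' * norm x * ?p x" if "\<rho> \<le> norm x" for x
      by (rule order_trans[OF B(3)[OF that] le(2)])
  qed
qed

text \<open>Constants and single exponentials are absorbed into a double one: each of the three
  exponents is at most exp(N tau) with N = a + b + M, and the summand 2 pays for 3 <= exp(2
  tau).\<close>

lemma exp_exp_bound:
  fixes \<tau> :: real
  assumes "1 \<le> \<tau>" "0 \<le> a" "0 \<le> b" "0 \<le> M"
  shows "exp a * exp (b * \<tau>) * exp (exp (M * \<tau>)) \<le> exp (exp ((a + b + M + 2) * \<tau>))"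
proof -
  let ?N = "a + b + M"
  have "a \<le> a * \<tau>" using assms mult_left_mono[of 1 \<tau> a] by simp
  also have "\<dots> \<le> ?N * \<tau>" using assms by (intro mult_right_mono) auto
  also have "\<dots> \<le> exp (?N * \<tau>)" using exp_ge_add_one_self[of "?N * \<tau>"] by linarith
  finally have 1: "a \<le> exp (?N * \<tau>)" .
  have "b * \<tau> \<le> ?N * \<tau>" using assms by (intro mult_right_mono) auto
  also have "\<dots> \<le> exp (?N * \<tau>)" using exp_ge_add_one_self[of "?N * \<tau>"] by linarith
  finally have 2: "b * \<tau> \<le> exp (?N * \<tau>)" .
  have 3: "exp (M * \<tau>) \<le> exp (?N * \<tau>)" using assms by (simp add: mult_right_mono)
  have "3 \<le> exp (2 * \<tau>)" using exp_ge_add_one_self[of "2 * \<tau>"] assms by linarith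
  then have "3 * exp (?N * \<tau>) \<le> exp (2 * \<tau>) * exp (?N * \<tau>)" by (intro mult_right_mono) auto
  also have "\<dots> = exp ((?N + 2) * \<tau>)" by (simp add: exp_add[symmetric] algebra_simps)
  finally have "a + b * \<tau> + exp (M * \<tau>) \<le> exp ((?N + 2) * \<tau>)" using 1 2 3 by linarith
  then show ?thesis by (simp add: exp_add[symmetric])
qed

lemma norm_exp_minus_1_le:
  fixes z :: complex assumes "norm z \<le> 1" shows "norm (exp z - 1) \<le> 3 * norm z"
proof -
  have "norm (exp z - exp 0) \<le> 3 * norm (z - 0)"
  proof (rule field_differentiable_bound[where S = "cball 0 1" and f' = exp])
    fix w :: complex assume "w \<in> cball 0 1"
    then have "exp (norm w) \<le> exp 1" by simp
    then show "norm (exp w) \<le> 3" using norm_exp[of w] exp_le by linarith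
  qed (use assms in \<open>auto intro!: derivative_eq_intros\<close>)
  then show ?thesis by simp
qed

text \<open>Write q = (iX)^2 with X = L s and s = sqrt(1 + delta). Then the normalised source is
  (exp(kX - kL) - exp(-kX - kL)) / s, and kX - kL = Z + eta with eta of order 1/L. The error
  consists of exp(eta) - 1, of 1/s - 1 and of the second exponential, each O(1/L); the lower bounds
  on L ensure |delta| <= 1/2 and |eta| <= 1.\<close>

lemma sqrt_expansion_error:
  fixes Z :: complex
  assumes k: "0 < k" and L: "1 \<le> L" "2 * d \<le> L" "2 * k * R\<^sup>2 + k * d\<^sup>2 / 2 \<le> L" "0 \<le> R"
    and Z: "norm Z \<le> N" and Y: "0 \<le> Y" "Y \<le> (2 * R)\<^sup>2" and d: "2 * N / k + 4 * R\<^sup>2 \<le> d"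
    and q: "q = - (of_real (L\<^sup>2) + of_real (2 * L / k) * Z - of_real Y)"
  shows "norm (of_real (2 * L * exp (- k * L)) * sincf k q - exp Z)
     \<le> exp N * (12 * k * R\<^sup>2 + 3 * k * d\<^sup>2 + 2 * d + 2 / k) / L"
proof -
  define \<delta> where "\<delta> = of_real (2 / (k * L)) * Z - complex_of_real (Y / L\<^sup>2)"
  define s where "s = csqrt (1 + \<delta>)"
  have N0: "0 \<le> N" using Z norm_ge_zero order_trans by blast
  have s2: "s\<^sup>2 = 1 + \<delta>" by (simp add: s_def)
  have nd: "norm \<delta> \<le> d / L"
  proof -
    have "norm \<delta> \<le> 2 / (k * L) * norm Z + Y / L\<^sup>2"
      unfolding \<delta>_def by (rule order_trans[OF norm_triangle_ineq4])
        (use k L Y in \<open>simp add: norm_mult norm_divide norm_power abs_mult\<close>)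
    also have "\<dots> \<le> 2 / (k * L) * N + (2 * R)\<^sup>2 / L"
    proof (rule add_mono)
      show "2 / (k * L) * norm Z \<le> 2 / (k * L) * N" using Z k L by (intro mult_left_mono) auto
      have "Y / L\<^sup>2 \<le> (2 * R)\<^sup>2 / L\<^sup>2" using Y by (intro divide_right_mono) auto
      also have "\<dots> \<le> (2 * R)\<^sup>2 / L" using L by (intro divide_left_mono) (auto simp: power2_eq_square mult_le_cancel_left1)
      finally show "Y / L\<^sup>2 \<le> (2 * R)\<^sup>2 / L" .
    qed
    also have "\<dots> = (2 * N / k + 4 * R\<^sup>2) / L" using k L by (simp add: field_simps power2_eq_square)
    also have "\<dots> \<le> d / L" using d L by (intro divide_right_mono) auto
    finally show ?thesis .
  qed
  also have "d / L \<le> 1 / 2" using L by (simp add: field_simps)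
  finally have nd2: "norm \<delta> \<le> 1/2" .
  have re: "0 \<le> Re s" unfolding s_def by (rule Re_csqrt)
  have s1: "norm (s - 1) \<le> norm \<delta>"
  proof -
    have "1 \<le> norm (s + 1)" using re complex_Re_le_cmod[of "s + 1"] by simp
    then have "norm (s - 1) * 1 \<le> norm (s - 1) * norm (s + 1)" by (intro mult_left_mono) auto
    also have "\<dots> = norm (s\<^sup>2 - 1)" by (simp add: norm_mult[symmetric] power2_eq_square algebra_simps)
    finally show ?thesis using s2 by simp
  qed
  have sh: "1/2 \<le> norm s" using s1 nd2 norm_triangle_ineq2[of 1 "1 - s"] by (simp add: norm_minus_commute)
  have s0: "s \<noteq> 0" using sh by auto
  define X where "X = of_real L * s"
  define \<eta> where "\<eta> = of_real k * X - of_real (k * L) - Z"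
  have q': "q = (\<i> * X)\<^sup>2"
  proof -
    have "(\<i> * X)\<^sup>2 = - (of_real (L\<^sup>2) * (1 + \<delta>))" by (simp add: X_def power_mult_distrib s2)
    also have "\<dots> = q" unfolding q \<delta>_def using k L by (simp add: field_simps power2_eq_square)
    finally show ?thesis ..
  qed
  have T: "X * sincf k q = (exp (of_real k * X) - exp (- (of_real k * X))) / 2"
  proof -
    have "(\<i> * X) * sincf k q = sin (\<i> * (of_real k * X))" unfolding q' sincf_square by (simp add: mult_ac)
    also have "\<dots> = \<i> * ((exp (of_real k * X) - exp (- (of_real k * X))) / 2)"
      by (simp add: sin_exp_eq field_simps)
    finally have "\<i> * (X * sincf k q) = \<i> * ((exp (of_real k * X) - exp (- (of_real k * X))) / 2)"
      by (simp only: mult.assoc)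
    then show ?thesis by (simp only: mult_left_cancel[OF complex_i_not_zero])
  qed
  have eta: "\<eta> = - of_real (k * Y / (2 * L)) - of_real (k * L / 2) * (s - 1)\<^sup>2"
  proof -
    have ds: "\<delta> = s\<^sup>2 - 1" using s2 by simp
    \<comment> \<open>An exact form of the second-order expansion of the square root: the linear
      term delta/2 yields Z, and the remainder is quadratic in s - 1, whose norm is at most that of
      delta.\<close>
    have "s - 1 = \<delta> / 2 - (s - 1)\<^sup>2 / 2" unfolding ds by (simp add: power2_eq_square field_simps)
    then have "of_real (k * L) * (s - 1) = of_real (k * L) * (\<delta> / 2 - (s - 1)\<^sup>2 / 2)" by (rule arg_cong)
    moreover have "\<eta> = of_real (k * L) * (s - 1) - Z" by (simp add: \<eta>_def X_def algebra_simps)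
    moreover have "of_real (k * L) * \<delta> = 2 * Z - of_real (k * Y / L)"
    proof -
      have "of_real (k * L) * \<delta> = of_real (k * L * (2 / (k * L))) * Z - of_real (k * L * (Y / L\<^sup>2))"
        by (simp only: \<delta>_def right_diff_distrib mult.assoc of_real_mult)
      also have "k * L * (2 / (k * L)) = 2" using k L by simp
      also have "k * L * (Y / L\<^sup>2) = k * Y / L" using L by (simp add: power2_eq_square)
      finally show ?thesis by simp
    qed
    then have "of_real (k * L) * (\<delta> / 2) = Z - of_real (k * Y / (2 * L))"
      by (simp add: mult.commute[of L])
    moreover have "of_real (k * L) * ((s - 1)\<^sup>2 / 2) = of_real (k * L / 2) * (s - 1)\<^sup>2" by simp
    ultimately show ?thesis by (simp only: right_diff_distrib) simp
  qed
  have ne: "norm \<eta> \<le> (2 * k * R\<^sup>2 + k * d\<^sup>2 / 2) / L"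
  proof -
    have "norm \<eta> \<le> k * Y / (2 * L) + k * L / 2 * (norm (s - 1))\<^sup>2"
      unfolding eta by (rule order_trans[OF norm_triangle_ineq4])
        (use k L Y in \<open>simp add: norm_mult norm_divide norm_power abs_mult\<close>)
    also have "\<dots> \<le> k * (2 * R)\<^sup>2 / (2 * L) + k * L / 2 * (d / L)\<^sup>2"
      using k L Y order_trans[OF s1 nd] by (intro add_mono divide_right_mono mult_left_mono power_mono) auto
    also have "\<dots> = (2 * k * R\<^sup>2 + k * d\<^sup>2 / 2) / L" using L by (simp add: field_simps power2_eq_square)
    finally show ?thesis .
  qed
  have ne1: "norm \<eta> \<le> 1" using order_trans[OF ne] L by (simp add: field_simps)
  have e1: "norm (exp \<eta> - 1) \<le> 3 * norm \<eta>" by (rule norm_exp_minus_1_le[OF ne1])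
  have inv: "norm (1 / s) \<le> 2" using sh s0 by (simp add: norm_divide field_simps)
  have inv1: "norm (1 / s - 1) \<le> 2 * (d / L)"
  proof -
    have "1 / s - 1 = (1 / s) * - (s - 1)" using s0 by (simp add: field_simps)
    then have "norm (1 / s - 1) = norm (1 / s) * norm (s - 1)" by (metis norm_minus_cancel norm_mult)
    also have "\<dots> \<le> 2 * (d / L)" by (intro mult_mono inv order_trans[OF s1 nd]) auto
    finally show ?thesis .
  qed
  have key: "of_real (2 * L * exp (- k * L)) * sincf k q - exp Z =
     exp Z * ((1 / s) * (exp \<eta> - 1) + (1 / s - 1)) - (1 / s) * (exp (- (of_real k * X)) * exp (- of_real (k * L)))"
  proof -
    have X0: "X \<noteq> 0" using s0 L by (simp add: X_def)
    have "sincf k q = (exp (of_real k * X) - exp (- (of_real k * X))) / 2 / X"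
      unfolding T[symmetric] using X0 by simp
    then have "of_real (2 * L * exp (- k * L)) * sincf k q = of_real (2 * L * exp (- k * L)) * ((exp (of_real k * X) - exp (- (of_real k * X))) / 2 / X)"
      by (simp only:)
    also have "complex_of_real (2 * L * exp (- k * L)) * ((exp (of_real k * X) - exp (- (of_real k * X))) / 2 / X)
      = 2 * of_real L * exp (- of_real (k * L)) * ((exp (of_real k * X) - exp (- (of_real k * X))) / 2 / X)"
      using exp_of_real[of "- k * L", where 'a = complex] by simp
    also have "2 * of_real L * exp (- of_real (k * L)) * ((exp (of_real k * X) - exp (- (of_real k * X))) / 2 / X)
      = (1 / s) * (exp (of_real k * X) * exp (- of_real (k * L)) - exp (- (of_real k * X)) * exp (- of_real (k * L)))"
    proof -
      have "2 * l * e * ((E1 - E2) / 2 / (l * s)) = (1 / s) * (E1 * e - E2 * e)" if "l \<noteq> 0" for l e E1 E2 :: complex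
        using that s0 by (simp add: field_simps)
      then show ?thesis unfolding X_def using L by auto
    qed
    also have "exp (of_real k * X) * exp (- of_real (k * L)) = exp Z * exp \<eta>"
      unfolding \<eta>_def by (simp add: exp_add[symmetric])
    finally have F: "of_real (2 * L * exp (- k * L)) * sincf k q =
       (1 / s) * (exp Z * exp \<eta> - exp (- (of_real k * X)) * exp (- of_real (k * L)))" .
    show ?thesis unfolding F by (simp add: algebra_simps)
  qed
  have third: "norm ((1 / s) * (exp (- (of_real k * X)) * exp (- of_real (k * L)))) \<le> exp N * (2 / k) / L"
  proof -
    have "norm (exp (- (of_real k * X))) \<le> 1" using re k L by (simp add: X_def)
    moreover have "norm (exp (- complex_of_real (k * L))) \<le> 1 / (k * L)"
    proof -
      have "norm (exp (- complex_of_real (k * L))) = 1 / exp (k * L)"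
        unfolding norm_exp_eq_Re by (simp add: exp_minus divide_inverse)
      also have "\<dots> \<le> 1 / (k * L)"
      proof (rule divide_left_mono)
        show "k * L \<le> exp (k * L)" using exp_ge_add_one_self[of "k * L"] by linarith
      qed (use k L in auto)
      finally show ?thesis .
    qed
    ultimately have "norm ((1 / s) * (exp (- (of_real k * X)) * exp (- of_real (k * L)))) \<le> 2 * (1 * (1 / (k * L)))"
      unfolding norm_mult by (intro mult_mono inv) auto
    also have "\<dots> = 1 * (2 / k) / L" by simp
    also have "\<dots> \<le> exp N * (2 / k) / L" using N0 k L by (intro divide_right_mono mult_right_mono) auto
    finally show ?thesis .
  qed
  have eZ: "norm (exp Z) \<le> exp N" using Z norm_exp[of Z] by (meson exp_le_cancel_iff order_trans)
  have b1: "norm ((1 / s) * (exp \<eta> - 1)) \<le> 2 * (3 * ((2 * k * R\<^sup>2 + k * d\<^sup>2 / 2) / L))"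
    unfolding norm_mult by (intro mult_mono inv order_trans[OF e1] mult_left_mono ne) auto
  have "norm ((1 / s) * (exp \<eta> - 1) + (1 / s - 1)) \<le> 2 * (3 * ((2 * k * R\<^sup>2 + k * d\<^sup>2 / 2) / L)) + 2 * (d / L)"
    by (intro order_trans[OF norm_triangle_ineq] add_mono inv1 b1)
  then have "norm (exp Z * ((1 / s) * (exp \<eta> - 1) + (1 / s - 1))) \<le> exp N * (2 * (3 * ((2 * k * R\<^sup>2 + k * d\<^sup>2 / 2) / L)) + 2 * (d / L))"
    unfolding norm_mult[of "exp Z"] by (intro mult_mono eZ) auto
  then have "norm (of_real (2 * L * exp (- k * L)) * sincf k q - exp Z) \<le>
     exp N * (2 * (3 * ((2 * k * R\<^sup>2 + k * d\<^sup>2 / 2) / L)) + 2 * (d / L)) + exp N * (2 / k) / L"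
    unfolding key using third by (intro order_trans[OF norm_triangle_ineq4] add_mono)
  also have "\<dots> = exp N * (12 * k * R\<^sup>2 + 3 * k * d\<^sup>2 + 2 * d + 2 / k) / L"
    using L k by (simp add: field_simps)
  finally show ?thesis .
qed


text \<open>The conditions on A and B say that zeta = A + iB satisfies zeta.zeta = -k^2, so the
  exponential is itself an entire solution of the Helmholtz equation. One \<open>K\<close> has to
  serve for all tau, directions and centres, since it enters the final constants.\<close>

definition exponential_approx :: "'a::euclidean_space itself \<Rightarrow> real \<Rightarrow> real \<Rightarrow> real \<Rightarrow> bool" where
  "exponential_approx _ k R K \<longleftrightarrow> 0 < K \<and> (\<forall>\<tau>\<ge>max 1 k. \<forall>(A::'a) B xc. A \<bullet> B = 0 \<longrightarrow> (norm B)\<^sup>2 = (norm A)\<^sup>2 + k\<^sup>2 \<longrightarrow>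
     \<tau> \<le> norm A \<longrightarrow> norm A \<le> 2 * \<tau> \<longrightarrow> norm xc \<le> R \<longrightarrow>
     (\<exists>v. helmholtz k v \<and> decays (exp (exp (K * \<tau>))) v \<and>
       (\<forall>y. norm y \<le> R \<longrightarrow> norm (v y - exp (of_real (A \<bullet> (y - xc)) + \<i> * of_real (B \<bullet> (y - xc)))) \<le> exp (- \<tau>))))"

text \<open>A point source moved far away looks like a plane wave; moved to the complex point xc +
  (L/k) zeta it looks like exp(zeta.(y - xc)), because (y - xc - (L/k) zeta)^2 = |y - xc|^2 - (2L/k)
  zeta.(y - xc) - L^2. Its decay constant contains exp(L |B|), and accuracy exp(-tau) forces L to be
  exponential in tau: this is the double exponential.\<close>

lemma approx_exponential_3d:
  assumes dim: "DIM('a::euclidean_space) = 3" and k: "0 < k" and R: "0 < R"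
  shows "\<exists>K. exponential_approx TYPE('a) k R K"
proof -
  define d0 where "d0 = 20 * R / k + 4 * R\<^sup>2"
  define W0 where "W0 = 12 * k * R\<^sup>2 + 3 * k * d0\<^sup>2 + 2 * d0 + 2 / k"
  have d0: "0 \<le> d0" using k R by (simp add: d0_def)
  have W0: "0 \<le> W0" using k d0 by (simp add: W0_def)
  define K1 where "K1 = (10 * R + 1) + (1 + 2 * d0 + W0) + 2"
  have K1: "0 \<le> K1" using R d0 W0 by (simp add: K1_def)
  define K where "K = 16 * (1 + k) + K1 + (K1 + 3) + 2"
  have K0: "0 < K" using k K1 by (simp add: K_def)
  show ?thesis
    unfolding exponential_approx_def
  proof (intro exI[of _ K] conjI K0 allI impI)
    fix \<tau> :: real and A B xc :: 'a
    assume t: "max 1 k \<le> \<tau>" and AB: "A \<bullet> B = 0" "(norm B)\<^sup>2 = (norm A)\<^sup>2 + k\<^sup>2" "\<tau> \<le> norm A" "norm A \<le> 2 * \<tau>"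
      and xc: "norm xc \<le> R"
    have t1: "1 \<le> \<tau>" "k \<le> \<tau>" using t by auto
    have nB: "norm B \<le> 3 * \<tau>"
    proof (rule power2_le_imp_le)
      have "(norm A)\<^sup>2 \<le> (2 * \<tau>)\<^sup>2" by (rule power_mono[OF AB(4)]) simp
      moreover have "k\<^sup>2 \<le> \<tau>\<^sup>2" by (rule power_mono[OF t1(2)]) (use k in simp)
      ultimately show "(norm B)\<^sup>2 \<le> (3 * \<tau>)\<^sup>2" using AB(2) by (simp add: power_mult_distrib) (smt (verit) zero_le_power2)
    qed (use t1 in simp)
    define N where "N = 10 * R * \<tau>"
    define d where "d = d0 * \<tau>\<^sup>2"
    \<comment> \<open>The relative error is of order exp(N)/L, where N bounds |Z|, so exp(N + tau)
      is the size needed. Of the summands in front of tau^4, 1 gives L >= 1, 2 d0 gives 2 d <= L,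
      and W0 dominates the coefficient of the error.\<close>
    define L where "L = exp (N + \<tau>) * ((1 + 2 * d0 + W0) * (\<tau>\<^sup>2)\<^sup>2)"
    have t2: "1 \<le> \<tau>\<^sup>2" "\<tau> \<le> \<tau>\<^sup>2" using t1 by (auto simp: power2_eq_square mult_le_cancel_left1 intro: order_trans)
    have "\<tau>\<^sup>2 * 1 \<le> \<tau>\<^sup>2 * \<tau>\<^sup>2" by (intro mult_left_mono t2) auto
    then have t40: "\<tau>\<^sup>2 \<le> (\<tau>\<^sup>2)\<^sup>2" unfolding power2_eq_square[of "\<tau>\<^sup>2"] by (simp only: mult_1_right)
    note t4 = t40 order_trans[OF t2(1) t40]
    have N0: "0 \<le> N" using R t1 by (simp add: N_def)
    have e1: "1 \<le> exp (N + \<tau>)" using N0 t1 by simp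
    have dN: "2 * N / k + 4 * R\<^sup>2 \<le> d"
    proof -
      have "2 * N / k + 4 * R\<^sup>2 = (20 * R / k) * \<tau> + (4 * R\<^sup>2) * 1" by (simp add: N_def)
      also have "\<dots> \<le> (20 * R / k) * \<tau>\<^sup>2 + (4 * R\<^sup>2) * \<tau>\<^sup>2" using t2 R k by (intro add_mono mult_left_mono) auto
      finally show ?thesis by (simp add: d_def d0_def algebra_simps)
    qed
    have Lge: "x * (\<tau>\<^sup>2)\<^sup>2 \<le> L" if "x \<le> 1 + 2 * d0 + W0" "0 \<le> x" for x
    proof -
      have "1 * (x * (\<tau>\<^sup>2)\<^sup>2) \<le> L" unfolding L_def using that e1 by (intro mult_mono mult_right_mono) auto
      then show ?thesis by simp
    qed
    have L1: "1 \<le> L" using Lge[of 1] t4 d0 W0 by simp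
    have Ld: "2 * d \<le> L"
    proof -
      have "2 * d \<le> 2 * d0 * (\<tau>\<^sup>2)\<^sup>2" using mult_left_mono[OF t4(1), of "2 * d0"] d0 by (simp add: d_def)
      also have "\<dots> \<le> L" using Lge[of "2 * d0"] d0 W0 by simp
      finally show ?thesis .
    qed
    have W: "12 * k * R\<^sup>2 + 3 * k * d\<^sup>2 + 2 * d + 2 / k \<le> W0 * (\<tau>\<^sup>2)\<^sup>2"
    proof -
      have "12 * k * R\<^sup>2 * 1 + 3 * k * d\<^sup>2 + 2 * d0 * \<tau>\<^sup>2 + 2 / k * 1 \<le> 12 * k * R\<^sup>2 * (\<tau>\<^sup>2)\<^sup>2 + 3 * k * (d0\<^sup>2 * (\<tau>\<^sup>2)\<^sup>2) + 2 * d0 * (\<tau>\<^sup>2)\<^sup>2 + 2 / k * (\<tau>\<^sup>2)\<^sup>2"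
        using t4 d0 k by (intro add_mono mult_left_mono) (auto simp: d_def power_mult_distrib)
      then show ?thesis by (simp add: W0_def d_def algebra_simps)
    qed
    have L3: "2 * k * R\<^sup>2 + k * d\<^sup>2 / 2 \<le> L"
    proof -
      have "2 * k * R\<^sup>2 + k * d\<^sup>2 / 2 \<le> 12 * k * R\<^sup>2 + 3 * k * d\<^sup>2 + 2 * d + 2 / k"
        using k d0 by (auto simp: d_def intro!: add_nonneg_nonneg intro: order_trans)
      also have "\<dots> \<le> L" using W Lge[of W0] d0 W0 by simp
      finally show ?thesis .
    qed
    define a where "a = xc + (L / k) *\<^sub>R A"
    define c where "c = (L / k) *\<^sub>R B"
    define v where "v = (\<lambda>x. of_real (2 * L * exp (- k * L)) * sincf k (csq a c x))"
    have "helmholtz k v" unfolding v_def by (rule helmholtz_source[OF dim])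
    moreover have "decays (exp (exp (K * \<tau>))) v"
    proof (rule decays_mono)
      show "decays (cmod (of_real (2 * L * exp (- k * L))) * 8 * (1 + k) * exp (k * norm c)) v"
        unfolding v_def by (rule decays_source[OF dim k])
      have nc: "k * norm c = L * norm B" using k L1 by (simp add: c_def)
      have LK: "L \<le> exp (K1 * \<tau>)"
      proof -
        have p: "1 + 2 * d0 + W0 \<le> exp ((1 + 2 * d0 + W0) * \<tau>)"
        proof -
          have "1 + 2 * d0 + W0 \<le> (1 + 2 * d0 + W0) * \<tau>" using t1 d0 W0 mult_left_mono[of 1 \<tau> "1 + 2 * d0 + W0"] by simp
          also have "\<dots> \<le> exp ((1 + 2 * d0 + W0) * \<tau>)" using exp_ge_add_one_self[of "(1 + 2 * d0 + W0) * \<tau>"] by linarith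
          finally show ?thesis .
        qed
        have "\<tau> \<le> exp (\<tau> / 2)"
        proof -
          have "\<tau> \<le> 1 + \<tau> / 2 + (\<tau> / 2)\<^sup>2 / 2"
            using zero_le_power2[of "\<tau> / 2 - 1"] by (simp add: power2_eq_square algebra_simps)
          also have "\<dots> \<le> exp (\<tau> / 2)" using exp_lower_Taylor_quadratic[of "\<tau> / 2"] t1 by simp
          finally show ?thesis .
        qed
        then have "\<tau> ^ 4 \<le> exp (\<tau> / 2) ^ 4" using t1 by (intro power_mono) auto
        also have "\<dots> = exp (2 * \<tau>)" by (simp add: exp_of_nat_mult[symmetric])
        finally have t44: "(\<tau>\<^sup>2)\<^sup>2 \<le> exp (2 * \<tau>)" by simp
        have "L \<le> exp ((10 * R + 1) * \<tau>) * (exp ((1 + 2 * d0 + W0) * \<tau>) * exp (2 * \<tau>))"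
          unfolding L_def N_def using p t44 d0 W0 by (intro mult_mono) (auto simp: algebra_simps)
        also have "\<dots> = exp (K1 * \<tau>)" by (simp add: K1_def exp_add[symmetric] algebra_simps)
        finally show ?thesis .
      qed
      have "L * norm B \<le> exp (K1 * \<tau>) * exp (3 * \<tau>)"
      proof (rule mult_mono[OF LK])
        show "norm B \<le> exp (3 * \<tau>)" using nB exp_ge_add_one_self[of "3 * \<tau>"] by linarith
      qed auto
      then have LB: "L * norm B \<le> exp ((K1 + 3) * \<tau>)" by (simp add: exp_add[symmetric] algebra_simps)
      have "cmod (of_real (2 * L * exp (- k * L))) * 8 * (1 + k) * exp (k * norm c) = (16 * (1 + k)) * (L * exp (- k * L)) * exp (L * norm B)"
        unfolding nc norm_of_real using L1 k by (simp add: abs_mult)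
      also have "\<dots> \<le> exp (16 * (1 + k)) * exp (K1 * \<tau>) * exp (exp ((K1 + 3) * \<tau>))"
      proof (intro mult_mono)
        show "16 * (1 + k) \<le> exp (16 * (1 + k))" using exp_ge_add_one_self[of "16 * (1 + k)"] by linarith
        have "L * exp (- k * L) \<le> L * 1" using L1 k by (intro mult_left_mono) auto
        then show "L * exp (- k * L) \<le> exp (K1 * \<tau>)" using LK by simp
        show "exp (L * norm B) \<le> exp (exp ((K1 + 3) * \<tau>))" using LB by simp
      qed (use L1 k in auto)
      also have "\<dots> \<le> exp (exp (K * \<tau>))"
        unfolding K_def using exp_exp_bound[of \<tau> "16 * (1 + k)" K1 "K1 + 3"] t1 k K1 by simp
      finally show "cmod (of_real (2 * L * exp (- k * L))) * 8 * (1 + k) * exp (k * norm c) \<le> exp (exp (K * \<tau>))" .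
    qed
    moreover have "norm (v y - exp (of_real (A \<bullet> (y - xc)) + \<i> * of_real (B \<bullet> (y - xc)))) \<le> exp (- \<tau>)" if y: "norm y \<le> R" for y
    proof -
      define Y where "Y = y - xc"
      define Z where "Z = complex_of_real (A \<bullet> Y) + \<i> * of_real (B \<bullet> Y)"
      have nY: "norm Y \<le> 2 * R" using norm_triangle_ineq4[of y xc] y xc by (simp add: Y_def)
      have nZ: "norm Z \<le> N"
      proof -
        have "norm Z \<le> \<bar>A \<bullet> Y\<bar> + \<bar>B \<bullet> Y\<bar>" unfolding Z_def by (rule order_trans[OF norm_triangle_ineq]) (simp add: norm_mult)
        also have "\<dots> \<le> norm A * norm Y + norm B * norm Y" by (intro add_mono Cauchy_Schwarz_ineq2)
        also have "\<dots> \<le> (2 * \<tau>) * (2 * R) + (3 * \<tau>) * (2 * R)" using AB nB nY t1 by (intro add_mono mult_mono) auto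
        finally show ?thesis by (simp add: N_def)
      qed
      have q: "csq a c y = - (of_real (L\<^sup>2) + of_real (2 * L / k) * Z - of_real ((norm Y)\<^sup>2))"
      proof -
        have ya: "y - a = Y - (L / k) *\<^sub>R A" by (simp add: a_def Y_def)
        have n1: "(norm (y - a))\<^sup>2 = (norm Y)\<^sup>2 - 2 * (L / k) * (A \<bullet> Y) + (L / k)\<^sup>2 * (norm A)\<^sup>2"
          unfolding ya power2_norm_eq_inner by (simp add: inner_diff_left inner_diff_right inner_commute power2_eq_square algebra_simps)
        have n2: "(norm c)\<^sup>2 = (L / k)\<^sup>2 * (norm A)\<^sup>2 + L\<^sup>2"
          using k AB(2) by (simp add: c_def power_mult_distrib power_divide distrib_left add_divide_distrib)
        have n3: "(y - a) \<bullet> c = (L / k) * (B \<bullet> Y)"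
          unfolding ya c_def using AB(1) by (simp add: inner_diff_left inner_diff_right inner_commute)
        show ?thesis unfolding csq_eq n1 n2 n3 Z_def by (simp add: algebra_simps)
      qed
      have "norm (v y - exp Z) \<le> exp N * (12 * k * R\<^sup>2 + 3 * k * d\<^sup>2 + 2 * d + 2 / k) / L"
        unfolding v_def
      proof (rule sqrt_expansion_error[OF k L1 Ld L3 _ nZ _ _ dN q])
        show "(norm Y)\<^sup>2 \<le> (2 * R)\<^sup>2" using nY by (intro power_mono) auto
      qed (use R in auto)
      also have "\<dots> \<le> exp N * (W0 * (\<tau>\<^sup>2)\<^sup>2) / L" using W L1 by (intro divide_right_mono mult_left_mono) auto
      also have "\<dots> \<le> exp (- \<tau>)"
      proof -
        have "exp N * (W0 * (\<tau>\<^sup>2)\<^sup>2) \<le> exp N * ((1 + 2 * d0 + W0) * (\<tau>\<^sup>2)\<^sup>2)"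
          using d0 by (intro mult_left_mono mult_right_mono) auto
        also have "\<dots> = exp (- \<tau>) * L" by (simp add: L_def exp_add exp_minus field_simps)
        finally show ?thesis using L1 by (simp add: field_simps)
      qed
      finally show ?thesis by (simp add: Z_def Y_def)
    qed
    ultimately show "\<exists>v. helmholtz k v \<and> decays (exp (exp (K * \<tau>))) v \<and>
       (\<forall>y. norm y \<le> R \<longrightarrow> norm (v y - exp (of_real (A \<bullet> (y - xc)) + \<i> * of_real (B \<bullet> (y - xc)))) \<le> exp (- \<tau>))"
      by blast
  qed
qed

subsection \<open>Approximation of complex exponentials in the plane\<close>

lemma sin_ge_half:
  assumes "0 \<le> x" "x \<le> pi / 2" shows "x / 2 \<le> sin x"
proof -
  have c: "convex_on {0..pi/2} (\<lambda>x. - sin x)"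
  proof (rule f''_ge0_imp_convex)
    fix y :: real assume "y \<in> {0..pi/2}"
    then show "0 \<le> sin y" by (intro sin_ge_zero) auto
  qed (auto intro!: derivative_eq_intros)
  define t where "t = x / (pi / 2)"
  have t: "0 \<le> t" "t \<le> 1" using assms by (auto simp: t_def field_simps)
  have "- sin ((1 - t) *\<^sub>R 0 + t *\<^sub>R (pi / 2)) \<le> (1 - t) * (- sin 0) + t * (- sin (pi / 2))"
    by (rule convex_onD[OF c]) (use t in auto)
  then have "t \<le> sin x" by (simp add: t_def)
  moreover have "x / 2 \<le> t" unfolding t_def using assms mult_right_mono[of pi 4 x] pi_less_4 by (simp add: field_simps)
  ultimately show ?thesis by simp
qed

lemma sin_sq_lower:
  assumes "0 \<le> s" "s \<le> 2 * pi"
  shows "\<exists>c\<in>{0, pi, 2 * pi}. (s - c)\<^sup>2 / 4 \<le> (sin s)\<^sup>2"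
proof -
  have *: "(s - c)\<^sup>2 / 4 \<le> (sin s)\<^sup>2" if "\<bar>s - c\<bar> \<le> pi / 2" "\<bar>sin s\<bar> = sin \<bar>s - c\<bar>" for c
  proof -
    have "\<bar>s - c\<bar> / 2 \<le> \<bar>sin s\<bar>" unfolding that(2) by (rule sin_ge_half) (use that in auto)
    then have "(\<bar>s - c\<bar> / 2)\<^sup>2 \<le> \<bar>sin s\<bar>\<^sup>2" by (intro power_mono) auto
    then show ?thesis by (simp add: power_divide)
  qed
  consider "s \<le> pi / 2" | "pi / 2 \<le> s" "s \<le> pi" | "pi \<le> s" "s \<le> 3 * pi / 2" | "3 * pi / 2 \<le> s" by linarith
  then show ?thesis
  proof cases
    case 1
    then have "\<bar>sin s\<bar> = sin \<bar>s - 0\<bar>" using assms sin_ge_zero[of s] by simp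
    then show ?thesis using *[of 0] 1 assms by auto
  next
    case 2
    then have "\<bar>sin s\<bar> = sin \<bar>s - pi\<bar>" using assms sin_ge_zero[of s] by (simp add: abs_if sin_diff)
    then show ?thesis using *[of pi] 2 assms by auto
  next
    case 3
    have "sin \<bar>s - pi\<bar> = sin (s - pi)" using 3 by simp
    moreover have "0 \<le> sin (s - pi)" using 3 by (intro sin_ge_zero) auto
    ultimately have "\<bar>sin s\<bar> = sin \<bar>s - pi\<bar>" by (simp add: sin_diff)
    then show ?thesis using *[of pi] 3 assms by auto
  next
    case 4
    have "sin \<bar>s - 2 * pi\<bar> = sin (2 * pi - s)" using 4 assms by simp
    moreover have "0 \<le> sin (2 * pi - s)" using 4 assms by (intro sin_ge_zero) auto
    ultimately have "\<bar>sin s\<bar> = sin \<bar>s - 2 * pi\<bar>" by (simp add: sin_diff)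
    then show ?thesis using *[of "2 * pi"] 4 assms by auto
  qed
qed

lemma integral_inverse_quadratic_bound:
  assumes d: "0 < d"
  shows "(\<lambda>s. 1 / ((s - c)\<^sup>2 / 4 + d\<^sup>2)) integrable_on {0..2*pi}"
    "integral {0..2*pi} (\<lambda>s. 1 / ((s - c)\<^sup>2 / 4 + d\<^sup>2)) \<le> 2 * pi / d"
proof -
  let ?F = "\<lambda>s. (2 / d) * arctan ((s - c) / (2 * d))"
  have "((\<lambda>s. 1 / ((s - c)\<^sup>2 / 4 + d\<^sup>2)) has_integral (?F (2 * pi) - ?F 0)) {0..2*pi}"
  proof (rule fundamental_theorem_of_calculus)
    fix s :: real
    have p: "0 < (s - c)\<^sup>2 / 4 + d\<^sup>2" using d by (simp add: add_nonneg_pos)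
    have "(?F has_real_derivative (2 / d) * (inverse (1 + ((s - c) / (2 * d))\<^sup>2) * (1 / (2 * d)))) (at s)"
      by (intro DERIV_cmult DERIV_chain2[OF DERIV_arctan]) (use d in \<open>auto intro!: derivative_eq_intros\<close>)
    also have "(2 / d) * (inverse (1 + ((s - c) / (2 * d))\<^sup>2) * (1 / (2 * d))) = 1 / ((s - c)\<^sup>2 / 4 + d\<^sup>2)"
    proof -
      have "(s - c)\<^sup>2 / 4 + d\<^sup>2 = d\<^sup>2 * (1 + ((s - c) / (2 * d))\<^sup>2)"
        using d by (simp add: power_divide power_mult_distrib distrib_left)
      moreover have "1 + ((s - c) / (2 * d))\<^sup>2 \<noteq> 0" by (smt (verit) zero_le_power2)
      ultimately show ?thesis using d by (simp add: divide_simps power2_eq_square)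
    qed
    finally show "(?F has_vector_derivative 1 / ((s - c)\<^sup>2 / 4 + d\<^sup>2)) (at s within {0..2*pi})"
      by (simp add: has_real_derivative_iff_has_vector_derivative has_vector_derivative_at_within)
  qed simp
  moreover have "?F (2 * pi) - ?F 0 \<le> 2 * pi / d"
  proof -
    have "arctan ((2 * pi - c) / (2 * d)) - arctan ((0 - c) / (2 * d)) \<le> pi / 2 - (- (pi / 2))"
      using arctan_ubound[of "(2 * pi - c) / (2 * d)"] arctan_lbound[of "(0 - c) / (2 * d)"] by linarith
    then have "(2 / d) * (arctan ((2 * pi - c) / (2 * d)) - arctan ((0 - c) / (2 * d))) \<le> (2 / d) * pi"
      using d by (intro mult_left_mono) auto
    then show ?thesis by (simp only: right_diff_distrib) simp
  qed
  ultimately show "(\<lambda>s. 1 / ((s - c)\<^sup>2 / 4 + d\<^sup>2)) integrable_on {0..2*pi}"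
    "integral {0..2*pi} (\<lambda>s. 1 / ((s - c)\<^sup>2 / 4 + d\<^sup>2)) \<le> 2 * pi / d"
    by (auto simp: has_integral_iff)
qed

text \<open>At every point the integrand is dominated by a rational function centred at the nearest
  of the three zeros of sin, whose primitive is an arctan. Adding all three majorants avoids
  splitting the interval.\<close>

lemma integral_inverse_sin_sq_bound:
  assumes d: "0 < d"
  shows "(\<lambda>s. 1 / ((sin s)\<^sup>2 + d\<^sup>2)) integrable_on {0..2*pi}"
    "integral {0..2*pi} (\<lambda>s. 1 / ((sin s)\<^sup>2 + d\<^sup>2)) \<le> 6 * pi / d"
proof -
  have p: "0 < x\<^sup>2 + d\<^sup>2" for x :: real using d by (simp add: add_nonneg_pos)
  have p4: "0 < x\<^sup>2 / 4 + d\<^sup>2" for x :: real using d by (simp add: add_nonneg_pos)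
  show i: "(\<lambda>s. 1 / ((sin s)\<^sup>2 + d\<^sup>2)) integrable_on {0..2*pi}"
    by (intro integrable_continuous_interval continuous_intros) (use p in \<open>auto simp: less_imp_neq[symmetric]\<close>)
  let ?q = "\<lambda>c s. 1 / ((s - c)\<^sup>2 / 4 + d\<^sup>2)"
  note q = integral_inverse_quadratic_bound[OF d]
  have "integral {0..2*pi} (\<lambda>s. 1 / ((sin s)\<^sup>2 + d\<^sup>2)) \<le> integral {0..2*pi} (\<lambda>s. ?q 0 s + ?q pi s + ?q (2 * pi) s)"
  proof (rule integral_le[OF i])
    show "(\<lambda>s. ?q 0 s + ?q pi s + ?q (2 * pi) s) integrable_on {0..2*pi}" by (intro integrable_add q(1))
    fix s assume "s \<in> {0..2*pi}"
    then have "\<exists>c\<in>{0, pi, 2 * pi}. (s - c)\<^sup>2 / 4 \<le> (sin s)\<^sup>2" by (intro sin_sq_lower) auto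
    then obtain c where c: "c \<in> {0, pi, 2 * pi}" "(s - c)\<^sup>2 / 4 \<le> (sin s)\<^sup>2" by blast
    have "1 / ((sin s)\<^sup>2 + d\<^sup>2) \<le> ?q c s"
      using c p4[of "s - c"] p[of "sin s"] by (intro divide_left_mono) auto
    moreover have "0 \<le> ?q c s" for c using p4[of "s - c"] by simp
    ultimately show "1 / ((sin s)\<^sup>2 + d\<^sup>2) \<le> ?q 0 s + ?q pi s + ?q (2 * pi) s"
      using c(1) by (smt (verit) insert_iff empty_iff)
  qed
  also have "\<dots> = integral {0..2*pi} (?q 0) + integral {0..2*pi} (?q pi) + integral {0..2*pi} (?q (2 * pi))"
    by (subst integral_add[OF integrable_add[OF q(1) q(1)] q(1)], subst integral_add[OF q(1) q(1)]) (rule refl)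
  also have "\<dots> \<le> 2 * pi / d + 2 * pi / d + 2 * pi / d" by (intro add_mono q(2))
  finally show "integral {0..2*pi} (\<lambda>s. 1 / ((sin s)\<^sup>2 + d\<^sup>2)) \<le> 6 * pi / d" by simp
qed

text \<open>Van der Corput's estimate; the weight sin^2/(sin^2 + d^2) with d = lam^(-1/2) switches off
  the stationary points smoothly, so that one integration by parts suffices.\<close>
lemma van_der_corput_cos:
  fixes g g' :: "real \<Rightarrow> complex"
  assumes lam: "0 < lam" and H: "0 \<le> H"
    and g: "\<And>s. (g has_vector_derivative g' s) (at s)" "continuous_on UNIV g'"
    and b: "\<And>s. norm (g s) \<le> H" "\<And>s. norm (g' s) \<le> H"
  shows "norm (integral {0..2*pi} (\<lambda>s. exp (\<i> * of_real (lam * cos s)) * g s)) \<le> 13 * pi * H / sqrt lam"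
proof -
  \<comment> \<open>With d^2 = 1/lam the contribution H d^2 / w of the stationary points and the
    contribution H / (lam w) of the integration by parts coincide.\<close>
  define d where "d = 1 / sqrt lam"
  have d: "0 < d" "d\<^sup>2 = 1 / lam" using lam by (auto simp: d_def power_divide)
  define w where "w = (\<lambda>s. (sin s)\<^sup>2 + d\<^sup>2)"
  have w: "0 < w s" for s using d(1) by (simp add: w_def add_nonneg_pos)
  define E where "E = (\<lambda>s. exp (\<i> * complex_of_real (lam * cos s)))"
  have nE: "norm (E s) = 1" for s by (simp add: E_def)
  define m where "m = (\<lambda>s. sin s / w s)"
  define m' where "m' = (\<lambda>s. cos s * (d\<^sup>2 - (sin s)\<^sup>2) / (w s)\<^sup>2)"
  have Dm: "(m has_real_derivative m' s) (at s)" for s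
  proof -
    have "((\<lambda>s. sin s / ((sin s)\<^sup>2 + d\<^sup>2)) has_real_derivative
       (cos s * ((sin s)\<^sup>2 + d\<^sup>2) - sin s * (2 * sin s * cos s)) / (((sin s)\<^sup>2 + d\<^sup>2) * ((sin s)\<^sup>2 + d\<^sup>2))) (at s)"
      by (rule DERIV_divide) (use w[of s] in \<open>auto intro!: derivative_eq_intros simp: w_def\<close>)
    then show ?thesis
      unfolding m_def m'_def w_def by (rule DERIV_cong) (simp add: power2_eq_square algebra_simps)
  qed
  have DE: "(E has_vector_derivative (- \<i> * of_real (lam * sin s)) * E s) (at s)" for s
  proof -
    have "((\<lambda>s. complex_of_real (lam * cos s)) has_vector_derivative of_real (- (lam * sin s))) (at s)"
      by (intro bounded_linear.has_vector_derivative[OF bounded_linear_of_real])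
        (auto intro!: derivative_eq_intros simp flip: has_real_derivative_iff_has_vector_derivative)
    then have "((\<lambda>s. \<i> * complex_of_real (lam * cos s)) has_vector_derivative \<i> * of_real (- (lam * sin s))) (at s)"
      by (rule has_vector_derivative_mult_right)
    from field_vector_diff_chain_at[OF this DERIV_exp]
    show ?thesis unfolding E_def o_def by (simp add: mult_ac)
  qed
  have Dmc: "((\<lambda>s. complex_of_real (m s)) has_vector_derivative of_real (m' s)) (at s)" for s
    by (intro bounded_linear.has_vector_derivative[OF bounded_linear_of_real])
      (use Dm in \<open>simp add: has_real_derivative_iff_has_vector_derivative\<close>)
  define gm' where "gm' = (\<lambda>s. g s * of_real (m' s) + g' s * of_real (m s))"
  have Dgm: "((\<lambda>s. g s * of_real (m s)) has_vector_derivative gm' s) (at s)" for s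
    unfolding gm'_def by (rule has_vector_derivative_mult[OF g(1) Dmc])
  \<comment> \<open>The factor \<open>m\<close> carries sin s, which cancels the derivative of the
    phase and also makes the boundary terms at 0 and 2 pi vanish.\<close>
  let ?P = "\<lambda>s. (\<i> / of_real lam) * (E s * (g s * of_real (m s)))"
  have DP: "(?P has_vector_derivative E s * g s * of_real ((sin s)\<^sup>2 / w s) + (\<i> / of_real lam) * (E s * gm' s)) (at s)" for s
  proof -
    have "(?P has_vector_derivative (\<i> / of_real lam) * (E s * gm' s + ((- \<i> * of_real (lam * sin s)) * E s) * (g s * of_real (m s)))) (at s)"
      by (intro has_vector_derivative_mult_right has_vector_derivative_mult DE Dgm)
    moreover
    have "(\<i> / of_real lam) * (((- \<i> * of_real (lam * sin s)) * E s) * (g s * of_real (m s))) = E s * g s * of_real ((sin s)\<^sup>2 / w s)"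
      using lam by (simp add: m_def power2_eq_square field_simps)
    then have "(\<i> / of_real lam) * (E s * gm' s + ((- \<i> * of_real (lam * sin s)) * E s) * (g s * of_real (m s)))
      = E s * g s * of_real ((sin s)\<^sup>2 / w s) + (\<i> / of_real lam) * (E s * gm' s)"
      by (simp only: distrib_left add.commute)
    ultimately show ?thesis by (simp only:)
  qed
  have "((\<lambda>s. E s * g s * of_real ((sin s)\<^sup>2 / w s) + (\<i> / of_real lam) * (E s * gm' s)) has_integral (?P (2 * pi) - ?P 0)) {0..2*pi}"
    by (rule fundamental_theorem_of_calculus) (simp, rule has_vector_derivative_at_within[OF DP])
  then have I0: "((\<lambda>s. E s * g s * of_real ((sin s)\<^sup>2 / w s) + (\<i> / of_real lam) * (E s * gm' s)) has_integral 0) {0..2*pi}"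
    by (simp add: m_def)
  \<comment> \<open>What is left after one integration by parts: the integrand with the
    complementary weight d^2 / w, and the terms where the derivative falls on the amplitude. The
    bound 13 is 12 from the integral of 1 / w plus 1 from the term with g'.\<close>
  define K where "K = (\<lambda>s. E s * g s * of_real (d\<^sup>2 / w s) - (\<i> / of_real lam) * (E s * gm' s))"
  have cg: "continuous_on A g" for A
    using g(1) by (meson continuous_at_imp_continuous_on has_vector_derivative_continuous)
  have cE: "continuous_on A E" for A
    using DE by (meson continuous_at_imp_continuous_on has_vector_derivative_continuous)
  have cg': "continuous_on A g'" for A using g(2) continuous_on_subset by blast
  have cw: "continuous_on A w" for A unfolding w_def by (intro continuous_intros)
  have wn: "w s \<noteq> 0" for s using w[of s] by simp
  have cgm: "continuous_on A gm'" for A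
    unfolding gm'_def m_def m'_def by (intro continuous_intros cg cg' cw ballI) (use wn in auto)
  have iK: "K integrable_on {0..2*pi}"
    unfolding K_def by (intro integrable_continuous_interval continuous_intros cE cg cgm cw ballI wn) (use wn lam in auto)
  have "integral {0..2*pi} (\<lambda>s. E s * g s) = integral {0..2*pi} K"
  proof -
    have "E s * g s = K s + (E s * g s * of_real ((sin s)\<^sup>2 / w s) + (\<i> / of_real lam) * (E s * gm' s))" for s
    proof -
      have "(sin s)\<^sup>2 / w s + d\<^sup>2 / w s = 1" using wn[of s] by (simp add: w_def add_divide_distrib[symmetric])
      then have "complex_of_real ((sin s)\<^sup>2 / w s) = 1 - of_real (d\<^sup>2 / w s)" by (metis eq_diff_eq of_real_1 of_real_diff)
      then show ?thesis by (simp only: K_def) (simp add: algebra_simps)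
    qed
    then have "(\<lambda>s. E s * g s) = (\<lambda>s. K s + (E s * g s * of_real ((sin s)\<^sup>2 / w s) + (\<i> / of_real lam) * (E s * gm' s)))" by blast
    moreover have "((\<lambda>s. K s + (E s * g s * of_real ((sin s)\<^sup>2 / w s) + (\<i> / of_real lam) * (E s * gm' s))) has_integral (integral {0..2*pi} K + 0)) {0..2*pi}"
      by (intro has_integral_add I0 integrable_integral iK)
    ultimately show ?thesis by (simp add: integral_unique)
  qed
  also have "norm \<dots> \<le> integral {0..2*pi} (\<lambda>s. 2 * H / lam * (1 / w s) + H / (2 * d * lam))"
  proof (rule integral_norm_bound_integral[OF iK])
    show "(\<lambda>s. 2 * H / lam * (1 / w s) + H / (2 * d * lam)) integrable_on {0..2*pi}"
      by (intro integrable_continuous_interval continuous_intros cw ballI wn)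
    fix s
    have mb: "\<bar>m s\<bar> \<le> 1 / (2 * d)"
    proof -
      have "2 * \<bar>sin s\<bar> * d \<le> w s" unfolding w_def using sum_squares_bound[of "\<bar>sin s\<bar>" d] by simp
      then show ?thesis using w[of s] d by (simp add: m_def field_simps)
    qed
    have m'b: "\<bar>m' s\<bar> \<le> 1 / w s"
    proof -
      have "\<bar>cos s\<bar> * \<bar>d\<^sup>2 - (sin s)\<^sup>2\<bar> \<le> 1 * w s"
        unfolding w_def by (intro mult_mono) (auto simp: abs_le_iff)
      then have "\<bar>cos s\<bar> * \<bar>d\<^sup>2 - (sin s)\<^sup>2\<bar> / (w s)\<^sup>2 \<le> w s / (w s)\<^sup>2" by (intro divide_right_mono) auto
      then show ?thesis using w[of s] by (simp add: m'_def abs_mult power2_eq_square)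
    qed
    have "norm (K s) \<le> norm (g s) * (d\<^sup>2 / w s) + (1 / lam) * norm (gm' s)"
      unfolding K_def by (rule order_trans[OF norm_triangle_ineq4])
        (use lam w[of s] in \<open>simp add: norm_mult norm_divide nE norm_power\<close>)
    moreover have "norm (gm' s) \<le> H * (1 / w s) + H * (1 / (2 * d))"
      unfolding gm'_def by (rule order_trans[OF norm_triangle_ineq], unfold norm_mult norm_of_real)
        (intro add_mono mult_mono b mb m'b H; simp)
    then have "(1 / lam) * norm (gm' s) \<le> (1 / lam) * (H * (1 / w s) + H * (1 / (2 * d)))"
      using lam by (intro mult_left_mono) auto
    moreover have "norm (g s) * (d\<^sup>2 / w s) \<le> H * (d\<^sup>2 / w s)" using b w[of s] by (intro mult_right_mono) auto
    moreover have "H * (d\<^sup>2 / w s) + (1 / lam) * (H * (1 / w s) + H * (1 / (2 * d))) = 2 * H / lam * (1 / w s) + H / (2 * d * lam)"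
      using lam d(1) wn[of s] by (simp add: d(2) field_simps)
    ultimately show "norm (K s) \<le> 2 * H / lam * (1 / w s) + H / (2 * d * lam)" by linarith
  qed
  also have "\<dots> = 2 * H / lam * integral {0..2*pi} (\<lambda>s. 1 / w s) + 2 * pi * (H / (2 * d * lam))"
  proof (rule integral_unique)
    have "((\<lambda>s. 1 / w s) has_integral integral {0..2*pi} (\<lambda>s. 1 / w s)) {0..2*pi}"
      using integral_inverse_sin_sq_bound(1)[OF d(1)] unfolding w_def by (rule integrable_integral)
    moreover have "((\<lambda>s. H / (2 * d * lam)) has_integral 2 * pi * (H / (2 * d * lam))) {0..2*pi}"
      using has_integral_const_real[of "H / (2 * d * lam)" 0 "2 * pi"] by simp
    ultimately show "((\<lambda>s. 2 * H / lam * (1 / w s) + H / (2 * d * lam)) has_integral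
       2 * H / lam * integral {0..2*pi} (\<lambda>s. 1 / w s) + 2 * pi * (H / (2 * d * lam))) {0..2*pi}"
      by (intro has_integral_add has_integral_mult_right)
  qed
  also have "\<dots> \<le> 2 * H / lam * (6 * pi / d) + 2 * pi * (H / (2 * d * lam))"
    using integral_inverse_sin_sq_bound(2)[OF d(1)] H lam unfolding w_def by (intro add_right_mono mult_left_mono) auto
  also have "\<dots> = 13 * pi * H / (lam * d)" by (simp add: field_simps)
  also have "lam * d = sqrt lam" using lam by (simp add: d_def real_div_sqrt)
  finally show ?thesis by (simp add: E_def)
qed

text \<open>The derivative of the integral with respect to the shift is f(a + 2 pi) - f(a) =
  0.\<close>

lemma periodic_integral_shift:
  fixes f :: "real \<Rightarrow> complex"
  assumes c: "continuous_on UNIV f" and p: "\<And>s. f (s + 2 * pi) = f s"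
  shows "integral {0..2*pi} (\<lambda>s. f (s + a)) = integral {0..2*pi} f"
proof -
  let ?J = "\<lambda>a. integral {0..2*pi} (\<lambda>s. f (s + a))"
  obtain Fp where Fp: "\<And>x. (Fp has_vector_derivative f x) (at x)"
    using einterval_antiderivative[of "-\<infinity>" "\<infinity>" f] c by (auto simp: continuous_on_eq_continuous_at)
  have J: "?J a = Fp (2 * pi + a) - Fp (0 + a)" for a
  proof -
    have "((\<lambda>s. Fp (s + a)) has_vector_derivative f (s + a)) (at s)" for s
    proof -
      have "((\<lambda>s. s + a) has_vector_derivative 1) (at s)" by (auto intro!: derivative_eq_intros)
      from vector_diff_chain_at[OF this Fp[of "s + a"]] show ?thesis by (simp add: o_def)
    qed
    then have "((\<lambda>s. f (s + a)) has_integral (Fp (2 * pi + a) - Fp (0 + a))) {0..2*pi}"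
      by (intro fundamental_theorem_of_calculus) (auto intro: has_vector_derivative_at_within)
    then show ?thesis by (rule integral_unique)
  qed
  have "(?J has_vector_derivative 0) (at a)" for a
  proof -
    have "((\<lambda>s. Fp (s + 2 * pi)) has_vector_derivative f (a + 2 * pi)) (at a)"
    proof -
      have "((\<lambda>s. s + 2 * pi) has_vector_derivative 1) (at a)" by (auto intro!: derivative_eq_intros)
      from vector_diff_chain_at[OF this Fp[of "a + 2 * pi"]] show ?thesis by (simp add: o_def)
    qed
    from has_vector_derivative_diff[OF this Fp[of a]] show ?thesis unfolding J by (simp add: p add.commute)
  qed
  then have "?J a = ?J 0"
    using has_vector_derivative_zero_constant[of UNIV ?J] by (metis UNIV_I convex_UNIV)
  then show ?thesis by simp
qed


section \<open>Herglotz waves in the plane\<close>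

definition cdir :: "'a::euclidean_space \<Rightarrow> 'a \<Rightarrow> real \<Rightarrow> 'a" where
  "cdir b1 b2 s = cos s *\<^sub>R b1 - sin s *\<^sub>R b2"

definition herglotz :: "real \<Rightarrow> 'a::euclidean_space \<Rightarrow> 'a \<Rightarrow> (real \<Rightarrow> complex) \<Rightarrow> 'a \<Rightarrow> complex" where
  "herglotz k b1 b2 h x = integral {0..2*pi} (\<lambda>s. exp (\<i> * of_real (k * (x \<bullet> cdir b1 b2 s))) * h s)"

lemma continuous_on_cdir: "continuous_on A (cdir b1 b2)"
  unfolding cdir_def by (intro continuous_intros)

text \<open>A derivative multiplies the density by a continuous factor. Herglotz waves with
  continuous densities thus form a family to which \<open>smooth_coinduct\<close> applies.\<close>

lemma herglotz_has_derivative: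
  fixes b1 b2 x :: "'a::euclidean_space"
  assumes h: "continuous_on UNIV h"
  shows "(herglotz k b1 b2 h has_derivative
    (\<lambda>d. herglotz k b1 b2 (\<lambda>s. h s * (\<i> * of_real (k * (d \<bullet> cdir b1 b2 s)))) x)) (at x)"
proof -
  let ?c = "cdir b1 b2"
  define e where "e = (\<lambda>x s. exp (\<i> * complex_of_real (k * (x \<bullet> ?c s))) * h s)"
  define fx where "fx = (\<lambda>x s. blinfun_scaleR_left (\<i> * of_real k * e x s) o\<^sub>L blinfun_inner_right (?c s))"
  have fxa: "blinfun_apply (fx x s) d = e x s * (\<i> * of_real (k * (d \<bullet> ?c s)))" for x s d
    by (simp add: fx_def inner_commute scaleR_conv_of_real mult_ac)
  have ch: "continuous_on A (\<lambda>z. h (snd z))" for A :: "('a \<times> real) set"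
    by (rule continuous_on_compose2[OF h]) (auto intro!: continuous_intros)
  have cc: "continuous_on A (\<lambda>z. ?c (snd z))" for A :: "('a \<times> real) set"
    by (rule continuous_on_compose2[OF continuous_on_cdir[of UNIV]]) (auto intro!: continuous_intros)
  have ce: "continuous_on A (\<lambda>z. e (fst z) (snd z))" for A
    unfolding e_def by (intro continuous_intros ch cc)
  have cfx: "continuous_on A (\<lambda>(x, s). fx x s)" for A
    unfolding fx_def case_prod_unfold
    by (intro bounded_bilinear.continuous_on[OF bounded_bilinear_blinfun_compose]
      bounded_linear.continuous_on[OF bounded_linear_blinfun_scaleR_left] bounded_linear.continuous_on[OF bounded_linear_blinfun_inner_right]
      continuous_on_mult_left ce cc)
  have cP: "continuous_on A (\<lambda>s. (x, s))" for A :: "real set" and x :: 'a by (intro continuous_intros)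
  have ces: "continuous_on A (\<lambda>s. e x s)" for A x
    using continuous_on_compose2[OF ce[of UNIV] cP] by simp
  have cfs: "continuous_on A (\<lambda>s. fx x s)" for A x
    using continuous_on_compose2[OF cfx[of UNIV] cP] by simp
  have "((\<lambda>x. integral (cbox 0 (2*pi)) (e x)) has_derivative integral (cbox 0 (2*pi)) (fx x)) (at x within UNIV)"
  proof (rule leibniz_rule)
    fix y s
    have "((\<lambda>x. \<i> * complex_of_real (k * (x \<bullet> ?c s))) has_derivative (\<lambda>d. \<i> * of_real (k * (d \<bullet> ?c s)))) (at y)"
      by (intro has_derivative_mult_right has_derivative_of_real) (auto intro!: derivative_eq_intros)
    from has_derivative_compose[OF this DERIV_exp[unfolded has_field_derivative_def]]
    have "((\<lambda>x. exp (\<i> * complex_of_real (k * (x \<bullet> ?c s)))) has_derivative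
       (\<lambda>d. exp (\<i> * complex_of_real (k * (y \<bullet> ?c s))) * (\<i> * of_real (k * (d \<bullet> ?c s))))) (at y)" .
    from has_derivative_mult_left[OF this, of "h s"]
    have "((\<lambda>x. e x s) has_derivative (\<lambda>d. blinfun_apply (fx y s) d)) (at y)"
      unfolding fxa unfolding e_def by (simp add: mult_ac)
    then show "((\<lambda>x. e x s) has_derivative blinfun_apply (fx y s)) (at y within UNIV)" by simp
  qed (auto intro!: integrable_continuous_interval cfx ces)
  moreover have "blinfun_apply (integral (cbox 0 (2*pi)) (fx x)) = (\<lambda>d. herglotz k b1 b2 (\<lambda>s. h s * (\<i> * of_real (k * (d \<bullet> ?c s)))) x)"
    by (rule ext, subst blinfun_apply_integral) (auto intro!: integrable_continuous_interval cfs simp: fxa herglotz_def e_def mult_ac)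
  moreover have "(\<lambda>x. integral (cbox 0 (2*pi)) (e x)) = herglotz k b1 b2 h"
    by (auto simp: herglotz_def e_def)
  ultimately show ?thesis by simp
qed

lemma dd_herglotz:
  assumes "continuous_on UNIV h"
  shows "dd b (herglotz k b1 b2 h) = herglotz k b1 b2 (\<lambda>s. h s * (\<i> * of_real (k * (b \<bullet> cdir b1 b2 s))))"
  by (rule ext) (simp add: frechet_derivative_eqI[OF herglotz_has_derivative[OF assms]])

lemma herglotz_helmholtz:
  fixes b1 b2 :: "'a::euclidean_space"
  assumes h: "continuous_on UNIV h" and b: "norm b1 = 1" "norm b2 = 1" "b1 \<bullet> b2 = 0"
  shows "helmholtz k (herglotz k b1 b2 h)"
proof -
  let ?c = "cdir b1 b2"
  have cont: "continuous_on UNIV (\<lambda>s. h s * (\<i> * of_real (k * (b \<bullet> ?c s))))" if "continuous_on UNIV h" for h b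
    by (intro continuous_intros that continuous_on_cdir)
  have s: "smooth (herglotz k b1 b2 h)"
  proof (rule smooth_coinduct[where F = "herglotz k b1 b2 ` {h. continuous_on UNIV h}"])
    fix g b assume "g \<in> herglotz k b1 b2 ` {h. continuous_on UNIV h}"
    then obtain h0 where h0: "continuous_on UNIV h0" "g = herglotz k b1 b2 h0" by blast
    show "dd b g \<in> herglotz k b1 b2 ` {h. continuous_on UNIV h}"
      unfolding h0(2) dd_herglotz[OF h0(1)] using cont[OF h0(1), of b] by blast
  next
    fix g x assume "g \<in> herglotz k b1 b2 ` {h. continuous_on UNIV h}"
    then obtain h0 where h0: "continuous_on UNIV h0" "g = herglotz k b1 b2 h0" by blast
    show "g differentiable at x"
      unfolding h0(2) differentiable_def using herglotz_has_derivative[OF h0(1)] by blast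
  qed (use h in simp)
  have n: "(norm (?c s))\<^sup>2 = 1" for s
    using b unfolding power2_norm_eq_inner
    by (simp add: cdir_def inner_diff_left inner_diff_right inner_commute norm_eq_1 flip: power2_eq_square)
  have "lap (herglotz k b1 b2 h) x + of_real (k\<^sup>2) * herglotz k b1 b2 h x = 0" for x
  proof -
    let ?E = "\<lambda>s. exp (\<i> * complex_of_real (k * (x \<bullet> ?c s)))"
    let ?m = "\<lambda>b s. \<i> * complex_of_real (k * (b \<bullet> ?c s))"
    have "pd [b, b] (herglotz k b1 b2 h) x = integral {0..2*pi} (\<lambda>s. ?E s * (h s * ?m b s * ?m b s))" for b
      by (simp only: pd.simps dd_herglotz[OF h] dd_herglotz[OF cont[OF h]] herglotz_def)
    then have "lap (herglotz k b1 b2 h) x = (\<Sum>b\<in>Basis. integral {0..2*pi} (\<lambda>s. ?E s * (h s * ?m b s * ?m b s)))"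
      by (simp only: lap_def)
    also have "\<dots> = integral {0..2*pi} (\<lambda>s. \<Sum>b\<in>Basis. ?E s * (h s * ?m b s * ?m b s))"
      by (rule integral_sum[symmetric], simp, intro integrable_continuous_interval continuous_intros continuous_on_cdir)
        (use h continuous_on_subset in blast)+
    also have "\<dots> = integral {0..2*pi} (\<lambda>s. - of_real (k\<^sup>2) * (?E s * h s))"
    proof (rule integral_cong)
      fix s
      have "(\<Sum>b\<in>Basis. ?E s * (h s * ?m b s * ?m b s)) = (\<Sum>b\<in>Basis. - of_real (k\<^sup>2) * (?E s * h s) * of_real ((?c s \<bullet> b)\<^sup>2))"
        by (rule sum.cong) (auto simp: power2_eq_square inner_commute mult_ac)
      also have "\<dots> = - of_real (k\<^sup>2) * (?E s * h s) * of_real (\<Sum>b\<in>Basis. (?c s \<bullet> b)\<^sup>2)"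
        by (simp only: sum_distrib_left of_real_sum)
      also have "(\<Sum>b\<in>Basis. (?c s \<bullet> b)\<^sup>2) = 1" unfolding norm_sq_Basis[symmetric] by (rule n)
      finally show "(\<Sum>b\<in>Basis. ?E s * (h s * ?m b s * ?m b s)) = - of_real (k\<^sup>2) * (?E s * h s)" by simp
    qed
    also have "\<dots> = - of_real (k\<^sup>2) * herglotz k b1 b2 h x" by (simp only: integral_mult_right herglotz_def)
    finally show ?thesis by simp
  qed
  with s show ?thesis by (simp add: helmholtz_def)
qed

lemma orthonormal_pair_norm:
  fixes b1 b2 x :: "'a::euclidean_space"
  assumes dim: "DIM('a) = 2" and b: "norm b1 = 1" "norm b2 = 1" "b1 \<bullet> b2 = 0"
  shows "x = (x \<bullet> b1) *\<^sub>R b1 + (x \<bullet> b2) *\<^sub>R b2" "(norm x)\<^sup>2 = (x \<bullet> b1)\<^sup>2 + (x \<bullet> b2)\<^sup>2"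
proof -
  have ne: "b1 \<noteq> b2" using b by auto
  have po: "pairwise orthogonal {b1, b2}" using b by (auto simp: pairwise_def orthogonal_def inner_commute)
  have ind: "independent {b1, b2}" by (rule pairwise_orthogonal_independent[OF po]) (use b in auto)
  have "span {b1, b2} = UNIV"
    using card_eq_dim[of "{b1, b2}" UNIV] ind ne dim by (auto simp: dim_UNIV)
  then have "(\<Sum>v\<in>{b1, b2}. (x \<bullet> v) *\<^sub>R v) = x"
    using orthonormal_basis_expand[OF po, of x] b by auto
  then show 1: "x = (x \<bullet> b1) *\<^sub>R b1 + (x \<bullet> b2) *\<^sub>R b2" using ne by (simp add: inner_commute)
  have "(norm x)\<^sup>2 = x \<bullet> ((x \<bullet> b1) *\<^sub>R b1 + (x \<bullet> b2) *\<^sub>R b2)" unfolding 1[symmetric] power2_norm_eq_inner ..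
  then show "(norm x)\<^sup>2 = (x \<bullet> b1)\<^sup>2 + (x \<bullet> b2)\<^sup>2" by (simp add: inner_add_right power2_eq_square)
qed

lemma herglotz_decays:
  fixes b1 b2 :: "'a::euclidean_space"
  assumes dim: "DIM('a) = 2" and b: "norm b1 = 1" "norm b2 = 1" "b1 \<bullet> b2 = 0" and k: "0 < k"
    and h: "\<And>s. (h has_vector_derivative h' s) (at s)" "continuous_on UNIV h'" "\<And>s. h (s + 2 * pi) = h s"
    and H: "0 \<le> H" "\<And>s. norm (h s) \<le> H" "\<And>s. norm (h' s) \<le> H"
  shows "decays (13 * pi * (1 + 2 * k) / sqrt k * H) (herglotz k b1 b2 h)"
proof -
  let ?c = "cdir b1 b2"
  have ch: "continuous_on UNIV h"
    using h(1) by (meson continuous_at_imp_continuous_on has_vector_derivative_continuous)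
  have main: "norm (herglotz k b1 b2 h x) \<le> 13 * pi * (1 + 2 * k) / sqrt k * H * (1 / sqrt (norm x)) \<and>
     norm (frechet_derivative (herglotz k b1 b2 h) (at x) x) \<le> 13 * pi * (1 + 2 * k) / sqrt k * H * norm x * (1 / sqrt (norm x))"
    if x: "1 \<le> norm x" for x
  proof -
    define r where "r = norm x"
    have r: "1 \<le> r" using x by (simp add: r_def)
    define z where "z = Complex (x \<bullet> b1) (x \<bullet> b2)"
    have "(norm z)\<^sup>2 = r\<^sup>2" unfolding cmod_power2 z_def r_def using orthonormal_pair_norm(2)[OF dim b, of x] by simp
    then have nz: "norm z = r" using r by (simp add: power2_eq_iff_nonneg)
    \<comment> \<open>The polar angle of x in the frame b1, b2 turns the phase into k r cos(s +
      phi). By periodicity the shift passes to the density, and van der Corput's estimate applies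
      with lam = k r.\<close>
    define \<phi> where "\<phi> = Arg z"
    have "z = of_real r * cis \<phi>" using nz Arg_eq[of z] r unfolding \<phi>_def
      by (metis cis_conv_exp norm_zero not_one_le_zero)
    then have xb: "x \<bullet> b1 = r * cos \<phi>" "x \<bullet> b2 = r * sin \<phi>"
      by (auto simp: z_def complex_eq_iff)
    have xc: "x \<bullet> ?c s = r * cos (s + \<phi>)" for s
      by (simp add: cdir_def inner_diff_right xb cos_add algebra_simps)
    define lam where "lam = k * r"
    have lam: "0 < lam" using k r by (simp add: lam_def)
    have sl: "sqrt lam = sqrt k * sqrt r" by (simp add: lam_def real_sqrt_mult)
    let ?E = "\<lambda>s. exp (\<i> * complex_of_real (lam * cos s))"
    have Dh: "((\<lambda>s. h (s - \<phi>)) has_vector_derivative h' (s - \<phi>)) (at s)" for s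
    proof -
      have "((\<lambda>s. s - \<phi>) has_vector_derivative 1) (at s)" by (auto intro!: derivative_eq_intros)
      from vector_diff_chain_at[OF this h(1)[of "s - \<phi>"]] show ?thesis by (simp add: o_def)
    qed
    have ch1: "continuous_on UNIV (\<lambda>s. h (s - \<phi>))" by (rule continuous_on_compose2[OF ch]) (auto intro!: continuous_intros)
    have ch2: "continuous_on UNIV (\<lambda>s. h' (s - \<phi>))" by (rule continuous_on_compose2[OF h(2)]) (auto intro!: continuous_intros)
    have per: "h (s + 2 * pi - \<phi>) = h (s - \<phi>)" for s using h(3)[of "s - \<phi>"] by (simp add: algebra_simps)
    have "herglotz k b1 b2 h x = integral {0..2*pi} (\<lambda>s. (\<lambda>s. ?E s * h (s - \<phi>)) (s + \<phi>))"
      unfolding herglotz_def xc lam_def by (simp add: mult.assoc)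
    also have "\<dots> = integral {0..2*pi} (\<lambda>s. ?E s * h (s - \<phi>))"
      by (rule periodic_integral_shift) (auto intro!: continuous_intros ch1 simp: per)
    finally have "norm (herglotz k b1 b2 h x) \<le> 13 * pi * H / sqrt lam"
      using van_der_corput_cos[OF lam H(1) Dh ch2] H by simp
    also have "\<dots> \<le> 13 * pi * (1 + 2 * k) / sqrt k * H * (1 / sqrt r)"
    proof -
      have "13 * pi * H / sqrt lam = 1 * (13 * pi * H / sqrt lam)" by simp
      also have "\<dots> \<le> (1 + 2 * k) * (13 * pi * H / sqrt lam)" using k H lam by (intro mult_right_mono) auto
      also have "\<dots> = 13 * pi * (1 + 2 * k) / sqrt k * H * (1 / sqrt r)" unfolding sl by (simp add: field_simps)
      finally show ?thesis .
    qed
    finally have 1: "norm (herglotz k b1 b2 h x) \<le> 13 * pi * (1 + 2 * k) / sqrt k * H * (1 / sqrt r)" .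
    \<comment> \<open>The derivative in direction x multiplies the density by i lam cos s, so
      amplitude and derivative are at most 2 lam H. The factor lam = k r is the additional power of
      r that \<open>decays\<close> permits.\<close>
    let ?g = "\<lambda>s. h (s - \<phi>) * (\<i> * of_real (lam * cos s))"
    let ?g' = "\<lambda>s. h (s - \<phi>) * (\<i> * of_real (- (lam * sin s))) + h' (s - \<phi>) * (\<i> * of_real (lam * cos s))"
    have "frechet_derivative (herglotz k b1 b2 h) (at x) x = integral {0..2*pi} (\<lambda>s. (\<lambda>s. ?E s * ?g s) (s + \<phi>))"
      unfolding frechet_derivative_eqI[OF herglotz_has_derivative[OF ch]] herglotz_def xc lam_def by (simp add: mult.assoc)
    also have "\<dots> = integral {0..2*pi} (\<lambda>s. ?E s * ?g s)"
      by (rule periodic_integral_shift) (auto intro!: continuous_intros ch1 simp: per)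
    finally have e: "frechet_derivative (herglotz k b1 b2 h) (at x) x = integral {0..2*pi} (\<lambda>s. ?E s * ?g s)" .
    have "norm (integral {0..2*pi} (\<lambda>s. ?E s * ?g s)) \<le> 13 * pi * (2 * lam * H) / sqrt lam"
    proof (rule van_der_corput_cos[OF lam])
      fix s
      have "((\<lambda>s. complex_of_real (lam * cos s)) has_vector_derivative of_real (- (lam * sin s))) (at s)"
        by (intro bounded_linear.has_vector_derivative[OF bounded_linear_of_real])
          (auto intro!: derivative_eq_intros simp flip: has_real_derivative_iff_has_vector_derivative)
      then show "(?g has_vector_derivative ?g' s) (at s)"
        by (intro has_vector_derivative_mult has_vector_derivative_mult_right Dh)
      have c: "\<bar>lam * cos s\<bar> \<le> lam" "\<bar>lam * sin s\<bar> \<le> lam"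
        using lam abs_cos_le_one[of s] abs_sin_le_one[of s] by (auto simp: abs_mult intro: mult_left_le)
      have "norm (?g s) \<le> H * lam" unfolding norm_mult norm_ii norm_of_real mult_1_left using c H by (intro mult_mono) auto
      also have "\<dots> \<le> 2 * lam * H" using lam H by simp
      finally show "norm (?g s) \<le> 2 * lam * H" .
      have "norm (?g' s) \<le> H * lam + H * lam"
        by (rule order_trans[OF norm_triangle_ineq], rule add_mono; unfold norm_mult norm_ii norm_of_real mult_1_left)
          (use c H in \<open>auto intro!: mult_mono\<close>)
      also have "H * lam + H * lam = 2 * lam * H" by simp
      finally show "norm (?g' s) \<le> 2 * lam * H" .
    qed (use lam H in \<open>auto intro!: continuous_intros ch1 ch2\<close>)
    also have "\<dots> \<le> 13 * pi * (1 + 2 * k) / sqrt k * H * r * (1 / sqrt r)"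
    proof -
      have "13 * pi * (2 * lam * H) / sqrt lam = (2 * k) * (13 * pi * H / sqrt k * r * (1 / sqrt r))"
        unfolding sl by (simp add: lam_def field_simps)
      also have "\<dots> \<le> (1 + 2 * k) * (13 * pi * H / sqrt k * r * (1 / sqrt r))" using k H r by (intro mult_right_mono) auto
      finally show ?thesis by (simp add: field_simps)
    qed
    finally show ?thesis using 1 e by (simp add: r_def)
  qed
  have p: "norm x powr (- (real DIM('a) - 1) / 2) = 1 / sqrt (norm x)" if "1 \<le> norm x" for x :: 'a
    using that dim by (simp add: powr_minus_divide powr_half_sqrt)
  show ?thesis unfolding decays_def
  proof (intro conjI exI[of _ 1] allI impI)
    fix x :: 'a assume x: "1 \<le> norm x"
    show "norm (herglotz k b1 b2 h x) \<le> 13 * pi * (1 + 2 * k) / sqrt k * H * norm x powr (- (real DIM('a) - 1) / 2)"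
      "norm (frechet_derivative (herglotz k b1 b2 h) (at x) x) \<le>
         13 * pi * (1 + 2 * k) / sqrt k * H * norm x * norm x powr (- (real DIM('a) - 1) / 2)"
      unfolding p[OF x] using main[OF x] by blast+
  qed (use k H in simp)
qed


text \<open>The difference quotient of F has no singularity at q0, so its integrals over both
  circles agree. The remaining kernel F(q0)/(q - q0) gives 2 pi i F(q0) on the outer circle and 0 on
  the inner one, because q0 lies outside the unit disc.\<close>

lemma cauchy_annulus:
  assumes F: "F holomorphic_on - {0}" and q0: "1 < norm q0" "norm q0 < r"
  shows "2 * of_real pi * \<i> * F q0 = contour_integral (circlepath 0 r) (\<lambda>q. F q / (q - q0))
     - contour_integral (circlepath 0 1) (\<lambda>q. F q / (q - q0))"
    "(\<lambda>q. F q / (q - q0)) contour_integrable_on circlepath 0 r"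
    "(\<lambda>q. F q / (q - q0)) contour_integrable_on circlepath 0 1"
proof -
  define D where "D = (\<lambda>q. if q = q0 then deriv F q0 else (F q - F q0) / (q - q0))"
  have "open (- {0::complex})" by auto
  then have D: "D holomorphic_on UNIV - {0}"
    unfolding D_def using pole_lemma_open[OF F, of q0] by (simp add: Compl_eq_Diff_UNIV)
  note eq = contour_integral_circlepath_eq[OF open_UNIV D zero_less_one, of r]
  have r: "1 \<le> r" "0 < r" using q0 by auto
  have c: "((\<lambda>q. F q0 / (q - q0)) has_contour_integral (2 * of_real pi * \<i> * F q0)) (circlepath 0 r)"
    by (rule Cauchy_integral_circlepath_simple) (use q0 in auto)
  have z: "((\<lambda>q. F q0 / (q - q0)) has_contour_integral 0) (circlepath 0 1)"
    by (rule Cauchy_theorem_disc_simple[of _ 0 "norm q0"]) (use q0 in \<open>auto intro!: holomorphic_intros\<close>)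
  have split: "((\<lambda>q. F q / (q - q0)) has_contour_integral (contour_integral (circlepath 0 e) D + I)) (circlepath 0 e)"
    if "D contour_integrable_on circlepath 0 e" "((\<lambda>q. F q0 / (q - q0)) has_contour_integral I) (circlepath 0 e)"
      "norm q0 \<noteq> e" "0 < e" for e I
  proof (rule has_contour_integral_eq)
    show "((\<lambda>q. D q + F q0 / (q - q0)) has_contour_integral (contour_integral (circlepath 0 e) D + I)) (circlepath 0 e)"
      by (rule has_contour_integral_add[OF has_contour_integral_integral[OF that(1)] that(2)])
    show "D x + F q0 / (x - q0) = F x / (x - q0)" if "x \<in> path_image (circlepath 0 e)" for x
      using that \<open>norm q0 \<noteq> e\<close> \<open>0 < e\<close> by (auto simp: D_def diff_divide_distrib)
  qed
  note s1 = split[OF eq(2)[OF r(1)] c] and s2 = split[OF eq(1)[OF r(1)] z]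
  show "2 * of_real pi * \<i> * F q0 = contour_integral (circlepath 0 r) (\<lambda>q. F q / (q - q0))
     - contour_integral (circlepath 0 1) (\<lambda>q. F q / (q - q0))"
    using contour_integral_unique[OF s1] contour_integral_unique[OF s2] q0 r eq(3)[OF r(1)] by simp
  show "(\<lambda>q. F q / (q - q0)) contour_integrable_on circlepath 0 r"
    "(\<lambda>q. F q / (q - q0)) contour_integrable_on circlepath 0 1"
    unfolding contour_integrable_on_def by (intro exI, rule s1 s2; use q0 r in simp)+
qed

text \<open>The plane wave exp(zeta y), zeta = A + i B, is G(q0) with G(q) = exp(X q + Y/q) and
  q0 = -i Q; Cauchy's formula in the annulus with the extra factor (q0/q)^N leaves the
  Herglotz integral over |q| = 1 and an integral over |q| = 2 Q of size 2^(-N).\<close>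
lemma herglotz_exponential_error:
  fixes b1 b2 y xc :: "'a::euclidean_space"
  assumes dim: "DIM('a) = 2" and b: "norm b1 = 1" "norm b2 = 1" "b1 \<bullet> b2 = 0" and k: "0 < k"
    and Q: "1 < Q" and y: "norm (y - xc) \<le> 2 * R" "0 \<le> R"
  shows "norm (herglotz k b1 b2 (\<lambda>t. - (1 / (2 * of_real pi)) * (- (\<i> * of_real Q)) ^ Suc M * exp (- (\<i> * of_real M * of_real t))
       / (exp (\<i> * of_real t) + \<i> * of_real Q) * exp (- (\<i> * of_real (k * (xc \<bullet> cdir b1 b2 t))))) y
     - exp (of_real (k / 2 * (Q - 1 / Q) * ((y - xc) \<bullet> b1)) + \<i> * of_real (k / 2 * (Q + 1 / Q) * ((y - xc) \<bullet> b2))))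
     \<le> 2 * exp (2 * k * R * (Q + 1)) / 2 ^ Suc M"
proof -
  define q0 where "q0 = - (\<i> * complex_of_real Q)"
  have nq0: "norm q0 = Q" using Q by (simp add: q0_def norm_mult)
  have q00: "q0 \<noteq> 0" using Q by (simp add: q0_def)
  define Y where "Y = y - xc"
  define y1 where "y1 = Y \<bullet> b1"
  define y2 where "y2 = Y \<bullet> b2"
  \<comment> \<open>The parameter q runs through the solutions of zeta.zeta = -k^2: |q| = 1 gives
    the real plane waves of a Herglotz integral, while q = -iQ gives growth k/2 (Q - 1/Q) along b1
    and oscillation k/2 (Q + 1/Q) along b2.\<close>
  define \<alpha> where "\<alpha> = \<i> * of_real (k / 2) * Complex y1 y2"
  define \<beta> where "\<beta> = \<i> * of_real (k / 2) * Complex y1 (- y2)"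
  define G where "G = (\<lambda>q. exp (\<alpha> * q + \<beta> / q))"
  define F where "F = (\<lambda>q. G q * (q0 / q) ^ Suc M)"
  have F: "F holomorphic_on - {0}" unfolding F_def G_def by (intro holomorphic_intros) auto
  have Fq0: "F q0 = G q0" using q00 by (simp add: F_def)
  have nY: "(norm Y)\<^sup>2 = y1\<^sup>2 + y2\<^sup>2" unfolding y1_def y2_def by (rule orthonormal_pair_norm(2)[OF dim b])
  have nC: "norm (Complex y1 y2) = norm Y" "norm (Complex y1 (- y2)) = norm Y"
    by (rule power2_eq_imp_eq; simp add: cmod_power2 nY)+
  have n\<alpha>: "norm \<alpha> = k / 2 * norm Y" "norm \<beta> = k / 2 * norm Y"
    unfolding \<alpha>_def \<beta>_def norm_mult nC using k by simp_all
  have Gq0: "G q0 = exp (of_real (k / 2 * (Q - 1 / Q) * (Y \<bullet> b1)) + \<i> * of_real (k / 2 * (Q + 1 / Q) * (Y \<bullet> b2)))"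
  proof -
    have i: "1 / q0 = \<i> * of_real (1 / Q)" using Q by (simp add: q0_def field_simps)
    have "\<alpha> * q0 + \<beta> / q0 = \<alpha> * q0 + \<beta> * (1 / q0)" by simp
    also have "\<dots> = of_real (k / 2 * (Q - 1 / Q) * y1) + \<i> * of_real (k / 2 * (Q + 1 / Q) * y2)"
      unfolding i by (simp add: complex_eq_iff q0_def \<alpha>_def \<beta>_def) (simp add: algebra_simps)
    finally show ?thesis by (simp add: G_def y1_def y2_def)
  qed
  note ca = cauchy_annulus[OF F, of q0 "2 * Q", unfolded nq0, OF Q]
  have Q2: "Q < 2 * Q" using Q by simp
  have err: "norm (contour_integral (circlepath 0 (2 * Q)) (\<lambda>q. F q / (q - q0))) \<le> (exp (2 * k * R * (Q + 1)) / 2 ^ Suc M / Q) * (2 * pi * (2 * Q))"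
  proof (rule has_contour_integral_bound_circlepath[OF has_contour_integral_integral[OF ca(2)[OF Q2]]])
    fix q :: complex assume q: "norm (q - 0) = 2 * Q"
    have qn: "norm q = 2 * Q" using q by simp
    have "norm (\<alpha> * q + \<beta> / q) \<le> norm \<alpha> * (2 * Q) + norm \<beta> / (2 * Q)"
      by (rule order_trans[OF norm_triangle_ineq]) (simp add: norm_mult norm_divide qn)
    also have "\<dots> = k / 2 * norm Y * (2 * Q + 1 / (2 * Q))" unfolding n\<alpha> by (simp add: algebra_simps)
    also have "\<dots> \<le> k / 2 * (2 * R) * (2 * Q + 2)"
      using k y Q by (intro mult_mono) (auto simp: Y_def field_simps)
    also have "\<dots> = 2 * k * R * (Q + 1)" by (simp add: algebra_simps)
    finally have "norm (G q) \<le> exp (2 * k * R * (Q + 1))"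
      unfolding G_def by (meson exp_le_cancel_iff norm_exp order_trans)
    then have "norm (F q) \<le> exp (2 * k * R * (Q + 1)) * (1 / 2) ^ Suc M"
      unfolding F_def norm_mult norm_power norm_divide nq0 qn using Q by (intro mult_mono) auto
    then have 1: "norm (F q) \<le> exp (2 * k * R * (Q + 1)) / 2 ^ Suc M" by (simp add: power_one_over)
    have 2: "Q \<le> norm (q - q0)" using norm_triangle_ineq2[of q q0] qn nq0 by simp
    show "norm (F q / (q - q0)) \<le> exp (2 * k * R * (Q + 1)) / 2 ^ Suc M / Q"
      unfolding norm_divide using 1 2 Q by (intro frac_le) auto
  qed (use Q k y in auto)
  define h where "h = (\<lambda>t::real. - (1 / (2 * complex_of_real pi)) * (- (\<i> * of_real Q)) ^ Suc M * exp (- (\<i> * of_real M * of_real t))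
       / (exp (\<i> * of_real t) + \<i> * of_real Q) * exp (- (\<i> * of_real (k * (xc \<bullet> cdir b1 b2 t)))))"
  have her: "herglotz k b1 b2 h y = - (1 / (2 * of_real pi * \<i>)) * contour_integral (circlepath 0 1) (\<lambda>q. F q / (q - q0))"
  proof -
    have "contour_integral (circlepath 0 1) (\<lambda>q. F q / (q - q0)) = integral {0..2*pi} (\<lambda>t. F (cis t) / (cis t - q0) * \<i> * cis t)"
      unfolding circlepath_def by (subst contour_integral_part_circlepath_eq) auto
    also have "- (1 / (2 * of_real pi * \<i>)) * \<dots> = integral {0..2*pi} (\<lambda>t. - (1 / (2 * of_real pi * \<i>)) * (F (cis t) / (cis t - q0) * \<i> * cis t))"
      by (simp only: integral_mult_right)
    also have "\<dots> = herglotz k b1 b2 h y"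
      unfolding herglotz_def
    proof (rule integral_cong)
      fix t :: real
      have e: "cis t = exp (\<i> * of_real t)" by (simp add: cis_conv_exp)
      have ic: "1 / cis t = cis (- t)" by (simp add: divide_inverse)
      have "\<alpha> * cis t + \<beta> / cis t = \<alpha> * cis t + \<beta> * (1 / cis t)" by simp
      also have "\<dots> = \<i> * of_real (k * (Y \<bullet> cdir b1 b2 t))"
      proof -
        \<comment> \<open>On the unit circle alpha q + beta/q is i k times the real part of (y1 + i
          y2) q. This fixes the minus sign in \<open>cdir\<close>.\<close>
        have yc: "Y \<bullet> cdir b1 b2 t = y1 * cos t - y2 * sin t"
          by (simp add: cdir_def inner_diff_right y1_def y2_def mult.commute)
        show ?thesis unfolding ic yc \<alpha>_def \<beta>_def by (rule complex_eqI; simp; simp add: field_simps)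
      qed
      also have "\<dots> = \<i> * of_real (k * (y \<bullet> cdir b1 b2 t)) + - (\<i> * of_real (k * (xc \<bullet> cdir b1 b2 t)))"
        by (simp add: Y_def inner_diff_left algebra_simps)
      finally have e3: "\<alpha> * cis t + \<beta> / cis t = \<i> * of_real (k * (y \<bullet> cdir b1 b2 t)) + - (\<i> * of_real (k * (xc \<bullet> cdir b1 b2 t)))" .
      have G: "G (cis t) = exp (\<i> * of_real (k * (y \<bullet> cdir b1 b2 t))) * exp (- (\<i> * of_real (k * (xc \<bullet> cdir b1 b2 t))))"
        unfolding G_def e3 by (rule exp_add)
      \<comment> \<open>One of the \<open>Suc M\<close> factors 1/q cancels the q in dq = i q dt, so
        only M of them remain in the density.\<close>
      have pw: "(q0 / cis t) ^ Suc M * cis t = q0 ^ Suc M * exp (- (\<i> * of_real M * of_real t))"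
      proof -
        have "(q0 / cis t) ^ Suc M * cis t = q0 ^ Suc M * (1 / cis t) ^ M"
          by (simp add: power_divide)
        also have "(1 / cis t) ^ M = cis (real M * - t)" unfolding ic by (rule Complex.DeMoivre)
        also have "\<dots> = exp (- (\<i> * of_real M * of_real t))" by (simp add: cis_conv_exp algebra_simps)
        finally show ?thesis .
      qed
      have "- (1 / (2 * of_real pi * \<i>)) * (F (cis t) / (cis t - q0) * \<i> * cis t)
        = - (1 / (2 * of_real pi)) * (G (cis t) * ((q0 / cis t) ^ Suc M * cis t) / (cis t - q0))"
      proof -
        have "- (1 / (2 * of_real pi * \<i>)) * (f / d * \<i> * c) = - (1 / (2 * of_real pi)) * (f * c / d)" for f d c :: complex
          by simp
        then show ?thesis by (simp only: F_def mult.assoc)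
      qed
      also have "\<dots> = exp (\<i> * of_real (k * (y \<bullet> cdir b1 b2 t))) * h t"
      proof -
        have alg: "- p * ((E1 * E2) * (Z * X) / D) = E1 * (- p * Z * X / D * E2)" for p E1 E2 Z X D :: complex
          by simp
        have "h t = - (1 / (2 * of_real pi)) * q0 ^ Suc M * exp (- (\<i> * of_real M * of_real t)) / (cis t - q0)
          * exp (- (\<i> * of_real (k * (xc \<bullet> cdir b1 b2 t))))"
          by (simp only: h_def e q0_def diff_minus_eq_add)
        then show ?thesis unfolding pw G by (simp only: alg)
      qed
      finally show "- (1 / (2 * of_real pi * \<i>)) * (F (cis t) / (cis t - q0) * \<i> * cis t) = exp (\<i> * of_real (k * (y \<bullet> cdir b1 b2 t))) * h t" .
    qed
    finally show ?thesis ..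
  qed
  have "herglotz k b1 b2 h y - G q0 = - (1 / (2 * of_real pi * \<i>)) * contour_integral (circlepath 0 (2 * Q)) (\<lambda>q. F q / (q - q0))"
  proof -
    let ?p = "2 * complex_of_real pi * \<i>"
    have "?p * G q0 = contour_integral (circlepath 0 (2 * Q)) (\<lambda>q. F q / (q - q0)) - contour_integral (circlepath 0 1) (\<lambda>q. F q / (q - q0))"
      using ca(1)[OF Q2] Fq0 by simp
    then have "G q0 = (1 / ?p) * (contour_integral (circlepath 0 (2 * Q)) (\<lambda>q. F q / (q - q0)) - contour_integral (circlepath 0 1) (\<lambda>q. F q / (q - q0)))"
      by (simp add: field_simps)
    then show ?thesis unfolding her by (simp add: algebra_simps)
  qed
  then have "norm (herglotz k b1 b2 h y - G q0) = 1 / (2 * pi) * norm (contour_integral (circlepath 0 (2 * Q)) (\<lambda>q. F q / (q - q0)))"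
    by (simp add: norm_mult norm_divide)
  also have "\<dots> \<le> 1 / (2 * pi) * ((exp (2 * k * R * (Q + 1)) / 2 ^ Suc M / Q) * (2 * pi * (2 * Q)))"
    by (intro mult_left_mono err) auto
  also have "\<dots> = 2 * exp (2 * k * R * (Q + 1)) / 2 ^ Suc M" using Q by (simp add: field_simps)
  finally show ?thesis unfolding Gq0 h_def Y_def .
qed


text \<open>A complex direction zeta corresponds to some Q of order tau. Truncation at order M of
  the same order makes the Cauchy error smaller than exp(-tau), at the price of a density of size
  Q^(M+1).\<close>

lemma approx_exponential_2d:
  assumes dim: "DIM('a::euclidean_space) = 2" and k: "0 < k" and R: "0 < R"
  shows "\<exists>K. exponential_approx TYPE('a) k R K"
proof -
  define N0 where "N0 = 20 * R + 4 * k * R + 6"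
  define c where "c = 13 * pi * (1 + 2 * k) / sqrt k"
  define K where "K = c + (N0 + 2 + 2 * k * R) + (5 * N0 / k + 1) + 2"
  have N0: "0 \<le> N0" using k R by (simp add: N0_def)
  have c: "0 \<le> c" using k by (simp add: c_def)
  have K0: "0 < K" unfolding K_def using N0 c k R by (intro add_nonneg_pos add_nonneg_nonneg) auto
  show ?thesis
    unfolding exponential_approx_def
  proof (intro exI[of _ K] conjI K0 allI impI)
    fix \<tau> :: real and A B xc :: 'a
    assume t: "max 1 k \<le> \<tau>" and AB: "A \<bullet> B = 0" "(norm B)\<^sup>2 = (norm A)\<^sup>2 + k\<^sup>2" "\<tau> \<le> norm A" "norm A \<le> 2 * \<tau>"
      and xc: "norm xc \<le> R"
    have t1: "1 \<le> \<tau>" "k \<le> \<tau>" using t by auto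
    define a where "a = norm A"
    define b where "b = norm B"
    have nB: "b \<le> 3 * \<tau>" unfolding b_def
    proof (rule power2_le_imp_le)
      have "(norm A)\<^sup>2 \<le> (2 * \<tau>)\<^sup>2" by (rule power_mono[OF AB(4)]) simp
      moreover have "k\<^sup>2 \<le> \<tau>\<^sup>2" by (rule power_mono[OF t1(2)]) (use k in simp)
      ultimately show "(norm B)\<^sup>2 \<le> (3 * \<tau>)\<^sup>2" using AB(2) by (simp add: power_mult_distrib) (smt (verit) zero_le_power2)
    qed (use t1 in simp)
    have ab: "a \<le> b" unfolding a_def b_def by (rule power2_le_imp_le) (use AB(2) in auto)
    have pos: "0 < a" "0 < b" "k \<le> a" using ab AB(3) t1 by (auto simp: a_def)
    define b1 where "b1 = A /\<^sub>R a"
    define b2 where "b2 = B /\<^sub>R b"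
    have on: "norm b1 = 1" "norm b2 = 1" "b1 \<bullet> b2 = 0"
      using pos AB(1) by (auto simp: b1_def b2_def a_def b_def)
    have A: "A = a *\<^sub>R b1" and B: "B = b *\<^sub>R b2" using pos by (auto simp: b1_def b2_def)
    \<comment> \<open>The solution of k/2 (Q - 1/Q) = |A| and k/2 (Q + 1/Q) = |B|; the two equations
      are compatible because |B|^2 - |A|^2 = k^2.\<close>
    define Q where "Q = (a + b) / k"
    have Q2: "2 \<le> Q" using pos ab k by (simp add: Q_def field_simps)
    have Qt: "Q \<le> 5 * \<tau> / k" unfolding Q_def using nB AB(4) k by (intro divide_right_mono) (auto simp: a_def)
    have iQ: "1 / Q = (b - a) / k"
    proof -
      have "(b - a) * (a + b) = k\<^sup>2" using AB(2) by (simp add: a_def b_def power2_eq_square algebra_simps)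
      then show ?thesis using k pos by (simp add: Q_def field_simps power2_eq_square)
    qed
    have Qa: "k / 2 * (Q - 1 / Q) = a" "k / 2 * (Q + 1 / Q) = b"
      unfolding iQ unfolding Q_def using k by (simp_all add: field_simps)
    define M0 where "M0 = 2 * k * R * (Q + 1)"
    \<comment> \<open>The Cauchy error is exp(M0) / 2^M. Since exp(1/2) <= 2, M >= 2 (M0 + tau)
      brings it below exp(-tau).\<close>
    define M where "M = nat \<lceil>2 * (M0 + \<tau> + 1)\<rceil>"
    have M0: "0 \<le> M0" using k R Q2 by (simp add: M0_def)
    have Mge: "2 * (M0 + \<tau> + 1) \<le> real M" unfolding M_def by (rule real_nat_ceiling_ge)
    have "0 \<le> \<lceil>2 * (M0 + \<tau> + 1)\<rceil>" using M0 t1 by (simp add: zero_le_ceiling)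
    then have "real M = of_int \<lceil>2 * (M0 + \<tau> + 1)\<rceil>" by (simp add: M_def)
    then have M_le: "real M \<le> 2 * (M0 + \<tau> + 1) + 1" using of_int_ceiling_le_add_one[of "2 * (M0 + \<tau> + 1)"] by linarith
    have M0_le: "M0 \<le> (10 * R + 2 * k * R) * \<tau>"
    proof -
      have "M0 \<le> 2 * k * R * (5 * \<tau> / k + 1 * \<tau>)" unfolding M0_def using Qt t1 k R by (intro mult_left_mono add_mono) auto
      also have "\<dots> = (10 * R + 2 * k * R) * \<tau>" using k by (simp add: field_simps)
      finally show ?thesis .
    qed
    have "2 * ((10 * R + 2 * k * R) * \<tau> + \<tau> + 1) + 1 \<le> N0 * \<tau>" using t1 by (simp add: N0_def algebra_simps)
    moreover have "2 * (M0 + \<tau> + 1) + 1 \<le> 2 * ((10 * R + 2 * k * R) * \<tau> + \<tau> + 1) + 1" using M0_le by simp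
    ultimately have MN: "real M \<le> N0 * \<tau>" using M_le by (meson order_trans)
    let ?h = "\<lambda>t::real. - (1 / (2 * complex_of_real pi)) * (- (\<i> * of_real Q)) ^ Suc M * exp (- (\<i> * of_real M * of_real t))
       / (exp (\<i> * of_real t) + \<i> * of_real Q) * exp (- (\<i> * of_real (k * (xc \<bullet> cdir b1 b2 t))))"
    define p where "p = xc \<bullet> b1"
    define q where "q = xc \<bullet> b2"
    have pq: "\<bar>p\<bar> \<le> R" "\<bar>q\<bar> \<le> R"
      using Cauchy_Schwarz_ineq2[of xc b1] Cauchy_Schwarz_ineq2[of xc b2] on xc by (auto simp: p_def q_def)
    have xcd: "xc \<bullet> cdir b1 b2 t = p * cos t - q * sin t" for t by (simp add: cdir_def p_def q_def inner_diff_right)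
    define C where "C = - (1 / (2 * complex_of_real pi)) * (- (\<i> * of_real Q)) ^ Suc M"
    have nC: "norm C \<le> Q ^ Suc M"
    proof -
      have "norm C = 1 / (2 * pi) * Q ^ Suc M" using Q2 by (simp add: C_def norm_mult norm_divide norm_power)
      also have "\<dots> \<le> 1 * Q ^ Suc M" using Q2 pi_gt3 by (intro mult_right_mono) auto
      finally show ?thesis by simp
    qed
    \<comment> \<open>The density extended to complex arguments, so that its derivative follows from
      complex differentiation; \<open>lz\<close> is the logarithmic derivative. On the real line the
      denominator has norm at least Q - 1 >= 1, so no pole is met.\<close>
    define hz where "hz = (\<lambda>z::complex. C * exp (- (\<i> * of_real M * z)) / (exp (\<i> * z) + \<i> * of_real Q)
        * exp (- (\<i> * (of_real k * (of_real p * cos z - of_real q * sin z)))))"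
    define lz where "lz = (\<lambda>z::complex. - (\<i> * of_real M) - \<i> * exp (\<i> * z) / (exp (\<i> * z) + \<i> * of_real Q)
        + \<i> * (of_real k * (of_real p * sin z + of_real q * cos z)))"
    have hhz: "?h t = hz (of_real t)" for t
      by (simp add: hz_def C_def xcd cos_of_real sin_of_real)
    have den: "1 \<le> norm (exp (\<i> * of_real t) + \<i> * of_real Q)" for t
      using norm_triangle_ineq2[of "\<i> * of_real Q" "- exp (\<i> * of_real t)"] Q2 by (simp add: norm_mult add.commute)
    have den0: "exp (\<i> * of_real t) + \<i> * of_real Q \<noteq> 0" for t using den[of t] by auto
    have Dhz: "(hz has_field_derivative hz z * lz z) (at z)" if "exp (\<i> * z) + \<i> * of_real Q \<noteq> 0" for z
      unfolding hz_def lz_def using that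
      by (auto intro!: derivative_eq_intros) (simp add: field_simps)
    have Dh: "(?h has_vector_derivative hz (of_real t) * lz (of_real t)) (at t)" for t
      unfolding hhz by (rule has_vector_derivative_real_field[OF Dhz[OF den0]])
    have chz: "continuous_on UNIV (\<lambda>t::real. hz (of_real t) * lz (of_real t))"
      unfolding hz_def lz_def by (intro continuous_intros) (use den0 in auto)
    have nh: "norm (hz (of_real t)) \<le> Q ^ Suc M" for t
    proof -
      have "norm (exp (- (\<i> * (of_real k * (of_real p * cos (complex_of_real t) - of_real q * sin (of_real t)))))) = 1"
        unfolding cos_of_real sin_of_real by simp
      then have "norm (hz (of_real t)) = norm C / norm (exp (\<i> * of_real t) + \<i> * of_real Q)"
        by (simp add: hz_def norm_mult norm_divide)
      also have "\<dots> \<le> norm C / 1" using den[of t] by (intro divide_left_mono) auto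
      finally show ?thesis using nC by simp
    qed
    have nl: "norm (lz (of_real t)) \<le> real M + 1 + 2 * k * R" for t
    proof -
      have "norm (\<i> * exp (\<i> * of_real t) / (exp (\<i> * of_real t) + \<i> * of_real Q)) \<le> 1"
      proof -
        have "norm (\<i> * exp (\<i> * of_real t) / (exp (\<i> * of_real t) + \<i> * of_real Q)) = 1 / norm (exp (\<i> * of_real t) + \<i> * of_real Q)"
          by (simp add: norm_divide norm_mult)
        also have "\<dots> \<le> 1 / 1" using den[of t] by (intro divide_left_mono) auto
        finally show ?thesis by simp
      qed
      moreover have "norm (\<i> * (of_real k * (of_real p * sin (complex_of_real t) + of_real q * cos (of_real t)))) \<le> 2 * k * R"
      proof -
        have "norm (\<i> * (of_real k * (of_real p * sin (complex_of_real t) + of_real q * cos (of_real t)))) = k * \<bar>p * sin t + q * cos t\<bar>"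
          unfolding cos_of_real sin_of_real of_real_mult[symmetric] of_real_add[symmetric] norm_mult norm_of_real using k by (simp add: abs_mult)
        also have "\<bar>p * sin t + q * cos t\<bar> \<le> R * 1 + R * 1"
          by (rule order_trans[OF abs_triangle_ineq], unfold abs_mult) (intro add_mono mult_mono pq; use R in simp)
        then have "k * \<bar>p * sin t + q * cos t\<bar> \<le> k * (R * 1 + R * 1)" using k by (intro mult_left_mono) auto
        finally show ?thesis by simp
      qed
      moreover have "norm (- (\<i> * complex_of_real (real M))) = real M" by (simp add: norm_mult)
      ultimately show ?thesis unfolding lz_def
        by (intro order_trans[OF norm_triangle_ineq] add_mono order_trans[OF norm_triangle_ineq4]) auto
    qed
    define H where "H = Q ^ Suc M * (real M + 2 + 2 * k * R)"
    have kR: "0 \<le> k * R" using k R by simp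
    have Q0: "0 \<le> Q ^ Suc M" using Q2 by simp
    have H0: "0 \<le> H" using Q0 kR by (simp add: H_def)
    have H1: "norm (?h t) \<le> H" for t
    proof -
      have "norm (?h t) \<le> Q ^ Suc M * 1" using nh hhz by simp
      also have "\<dots> \<le> H" unfolding H_def using Q0 kR by (intro mult_left_mono) auto
      finally show ?thesis .
    qed
    have H2: "norm (hz (of_real t) * lz (of_real t)) \<le> H" for t
    proof -
      have "norm (hz (of_real t) * lz (of_real t)) \<le> Q ^ Suc M * (real M + 1 + 2 * k * R)"
        unfolding norm_mult by (intro mult_mono nh nl Q0) auto
      also have "\<dots> \<le> H" unfolding H_def using Q0 kR by (intro mult_left_mono) auto
      finally show ?thesis .
    qed
    have per: "?h (t + 2 * pi) = ?h t" for t
    proof -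
      have "exp (- (\<i> * of_real M * complex_of_real (t + 2 * pi))) = exp (- (\<i> * of_real M * of_real t))"
      proof -
        have "- (\<i> * of_real M * complex_of_real (t + 2 * pi)) = - (\<i> * of_real M * of_real t) + of_int (- int M) * (of_real pi * 2 * \<i>)"
          by (simp add: algebra_simps)
        then show ?thesis using exp_plus_2pin[of "- (\<i> * of_real M * complex_of_real t)" "- int M"]
          by (simp add: algebra_simps)
      qed
      moreover have "exp (\<i> * complex_of_real (t + 2 * pi)) = exp (\<i> * of_real t)"
        by (simp add: distrib_left exp_add exp_two_pi_i' mult.commute mult.left_commute)
      ultimately show ?thesis by (simp only: xcd cos_periodic sin_periodic)
    qed
    define v where "v = herglotz k b1 b2 ?h"
    have ch: "continuous_on UNIV ?h"
      using Dh by (meson continuous_at_imp_continuous_on has_vector_derivative_continuous)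
    have "helmholtz k v" unfolding v_def by (rule herglotz_helmholtz[OF ch on])
    moreover have "decays (exp (exp (K * \<tau>))) v"
    proof (rule decays_mono)
      show "decays (13 * pi * (1 + 2 * k) / sqrt k * H) v"
        unfolding v_def by (rule herglotz_decays[OF dim on k Dh chz per H0 H1 H2])
      have tt: "\<tau>\<^sup>2 \<le> exp \<tau>"
      proof -
        have "\<tau> \<le> 1 + \<tau> / 2 + (\<tau> / 2)\<^sup>2 / 2"
          using zero_le_power2[of "\<tau> / 2 - 1"] by (simp add: power2_eq_square algebra_simps)
        also have "\<dots> \<le> exp (\<tau> / 2)" using exp_lower_Taylor_quadratic[of "\<tau> / 2"] t1 by simp
        finally have "\<tau>\<^sup>2 \<le> (exp (\<tau> / 2))\<^sup>2" using t1 by (intro power_mono) auto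
        also have "\<dots> = exp \<tau>" by (simp add: exp_of_nat_mult[symmetric])
        finally show ?thesis .
      qed
      \<comment> \<open>This crude bound makes the power at most exp(C tau^2), which fits under the
        double exponential that is needed in three dimensions anyway.\<close>
      have "Q \<le> exp Q" using exp_ge_add_one_self[of Q] by linarith
      then have "Q ^ Suc M \<le> exp Q ^ Suc M" using Q2 by (intro power_mono) auto
      also have "\<dots> = exp (real (Suc M) * Q)" by (rule exp_of_nat_mult[symmetric])
      also have "\<dots> \<le> exp (exp ((5 * N0 / k + 1) * \<tau>) )"
      proof -
        have "2 * (M0 + \<tau> + 1) \<ge> 0" using M0 t1 by simp
        have "real (Suc M) \<le> N0 * \<tau>"
        proof -
          have "real (Suc M) \<le> 2 * (M0 + \<tau> + 1) + 2" using M_le by simp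
          also have "\<dots> \<le> 2 * ((10 * R + 2 * k * R) * \<tau> + \<tau> + 1) + 2" using M0_le by simp
          also have "\<dots> \<le> N0 * \<tau>" using t1 by (simp add: N0_def algebra_simps)
          finally show ?thesis .
        qed
        then have "real (Suc M) * Q \<le> (N0 * \<tau>) * (5 * \<tau> / k)" using Qt Q2 N0 t1 by (intro mult_mono) auto
        also have "\<dots> = (5 * N0 / k) * \<tau>\<^sup>2" by (simp add: power2_eq_square)
        also have "\<dots> \<le> exp ((5 * N0 / k) * \<tau>) * exp \<tau>"
        proof (rule mult_mono[OF _ tt])
          have "5 * N0 / k * 1 \<le> 5 * N0 / k * \<tau>" using t1 N0 k by (intro mult_left_mono) auto
          also have "\<dots> \<le> exp ((5 * N0 / k) * \<tau>)" using exp_ge_add_one_self[of "(5 * N0 / k) * \<tau>"] by linarith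
          finally show "5 * N0 / k \<le> exp ((5 * N0 / k) * \<tau>)" by simp
        qed auto
        also have "\<dots> = exp ((5 * N0 / k + 1) * \<tau>)" by (simp add: exp_add[symmetric] algebra_simps)
        finally show ?thesis by simp
      qed
      finally have Qe: "Q ^ Suc M \<le> exp (exp ((5 * N0 / k + 1) * \<tau>))" .
      have Me: "real M + 2 + 2 * k * R \<le> exp ((N0 + 2 + 2 * k * R) * \<tau>)"
      proof -
        have "real M + (2 + 2 * k * R) * 1 \<le> N0 * \<tau> + (2 + 2 * k * R) * \<tau>" using MN t1 kR by (intro add_mono mult_left_mono) auto
        also have "\<dots> = (N0 + 2 + 2 * k * R) * \<tau>" by (simp add: algebra_simps)
        also have "\<dots> \<le> exp ((N0 + 2 + 2 * k * R) * \<tau>)" using exp_ge_add_one_self[of "(N0 + 2 + 2 * k * R) * \<tau>"] by linarith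
        finally show ?thesis by simp
      qed
      have "13 * pi * (1 + 2 * k) / sqrt k * H = c * (real M + 2 + 2 * k * R) * Q ^ Suc M" by (simp add: c_def H_def)
      also have "\<dots> \<le> exp c * exp ((N0 + 2 + 2 * k * R) * \<tau>) * exp (exp ((5 * N0 / k + 1) * \<tau>))"
      proof (intro mult_mono Me Qe)
        show "c \<le> exp c" using exp_ge_add_one_self[of c] by linarith
      qed (use c kR Q0 in auto)
      also have "\<dots> \<le> exp (exp (K * \<tau>))"
        unfolding K_def by (rule exp_exp_bound) (use t1 c N0 kR k in auto)
      finally show "13 * pi * (1 + 2 * k) / sqrt k * H \<le> exp (exp (K * \<tau>))" .
    qed
    moreover have "norm (v y - exp (of_real (A \<bullet> (y - xc)) + \<i> * of_real (B \<bullet> (y - xc)))) \<le> exp (- \<tau>)" if y: "norm y \<le> R" for y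
    proof -
      have nY: "norm (y - xc) \<le> 2 * R" using norm_triangle_ineq4[of y xc] y xc by simp
      have Q1: "1 < Q" using Q2 by simp
      have "norm (v y - exp (of_real (A \<bullet> (y - xc)) + \<i> * of_real (B \<bullet> (y - xc)))) \<le> 2 * exp M0 / 2 ^ Suc M"
        using herglotz_exponential_error[OF dim on k Q1 nY less_imp_le[OF R], of M] unfolding Qa
        unfolding v_def M0_def A B by (simp add: inner_commute)
      also have "\<dots> = exp M0 / 2 ^ M" by simp
      also have "\<dots> \<le> exp M0 / exp (M0 + \<tau>)"
      proof (rule divide_left_mono)
        have "exp (M0 + \<tau>) \<le> exp (real M * (1/2))" using Mge by simp
        also have "\<dots> = exp (1/2) ^ M" by (simp add: exp_of_nat_mult[symmetric])
        also have "\<dots> \<le> 2 ^ M"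
        proof (rule power_mono)
          have "exp (1/2 :: real) ^ 2 = exp 1" by (simp add: exp_of_nat_mult[symmetric])
          also have "\<dots> \<le> 2 ^ 2" using exp_le by simp
          finally show "exp (1/2 :: real) \<le> 2" by (rule power2_le_imp_le) simp
        qed simp
        finally show "exp (M0 + \<tau>) \<le> 2 ^ M" .
      qed auto
      also have "\<dots> = exp (- \<tau>)" by (simp add: exp_add exp_minus field_simps)
      finally show ?thesis .
    qed
    ultimately show "\<exists>v. helmholtz k v \<and> decays (exp (exp (K * \<tau>))) v \<and>
       (\<forall>y. norm y \<le> R \<longrightarrow> norm (v y - exp (of_real (A \<bullet> (y - xc)) + \<i> * of_real (B \<bullet> (y - xc)))) \<le> exp (- \<tau>))"
      by blast
  qed
qed

subsection \<open>Linear images of Lebesgue measure\<close>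

lemma lborel_translate_nn:
  fixes f :: "'a::euclidean_space \<Rightarrow> ennreal"
  assumes "f \<in> borel_measurable borel"
  shows "(\<integral>\<^sup>+x. f (t + x) \<partial>lborel) = (\<integral>\<^sup>+x. f x \<partial>lborel)"
proof -
  have "lborel = density (distr lborel borel (\<lambda>x::'a. t + x)) (\<lambda>_. 1)"
    using lborel_affine[of 1 t] by simp
  then have "(\<integral>\<^sup>+x. f x \<partial>lborel) = (\<integral>\<^sup>+x. f x \<partial>(density (distr lborel borel (\<lambda>x::'a. t + x)) (\<lambda>_. 1)))"
    by (rule arg_cong)
  also have "\<dots> = (\<integral>\<^sup>+x. f (t + x) \<partial>lborel)"
    using assms by (subst nn_integral_density) (auto simp: nn_integral_distr)
  finally show ?thesis by simp
qed

text \<open>Uniqueness of translation invariant measures, by Tonelli applied to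
  f(x) g(x + y).\<close>
lemma translation_invariant_unique:
  fixes \<mu> :: "'a::euclidean_space measure"
  assumes sets: "sets \<mu> = sets borel" and sf: "sigma_finite_measure \<mu>"
    and inv: "\<And>(f::'a \<Rightarrow> ennreal) t. f \<in> borel_measurable borel \<Longrightarrow> (\<integral>\<^sup>+x. f (t + x) \<partial>\<mu>) = (\<integral>\<^sup>+x. f x \<partial>\<mu>)"
    and f: "f \<in> borel_measurable borel" and g: "g \<in> borel_measurable borel"
  shows "(\<integral>\<^sup>+x. f x \<partial>\<mu>) * (\<integral>\<^sup>+y. g y \<partial>lborel) = (\<integral>\<^sup>+x. g x \<partial>\<mu>) * (\<integral>\<^sup>+y. f (- y) \<partial>lborel)"
proof -
  interpret M: sigma_finite_measure \<mu> by (rule sf)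
  interpret L: sigma_finite_measure "lborel :: 'a measure" by (rule sigma_finite_lborel)
  interpret P: pair_sigma_finite \<mu> "lborel :: 'a measure" ..
  have [measurable_cong]: "sets \<mu> = sets borel" by (rule sets)
  note [measurable] = f g
  have "(\<integral>\<^sup>+x. f x \<partial>\<mu>) * (\<integral>\<^sup>+y. g y \<partial>lborel) = (\<integral>\<^sup>+x. f x * (\<integral>\<^sup>+y. g y \<partial>lborel) \<partial>\<mu>)"
    by (rule nn_integral_multc[symmetric]) measurable
  also have "\<dots> = (\<integral>\<^sup>+x. (\<integral>\<^sup>+y. f x * g (x + y) \<partial>lborel) \<partial>\<mu>)"
    by (rule nn_integral_cong, subst nn_integral_cmult) (auto simp: lborel_translate_nn)
  also have "\<dots> = (\<integral>\<^sup>+y. (\<integral>\<^sup>+x. f x * g (x + y) \<partial>\<mu>) \<partial>lborel)"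
    by (rule P.Fubini'[symmetric]) measurable
  also have "\<dots> = (\<integral>\<^sup>+y. (\<integral>\<^sup>+x. f (x + - y) * g x \<partial>\<mu>) \<partial>lborel)"
  proof (rule nn_integral_cong)
    fix y :: 'a
    show "(\<integral>\<^sup>+x. f x * g (x + y) \<partial>\<mu>) = (\<integral>\<^sup>+x. f (x + - y) * g x \<partial>\<mu>)"
      using inv[of "\<lambda>x. f (x + - y) * g x" y] by (simp add: add.commute)
  qed
  also have "\<dots> = (\<integral>\<^sup>+x. (\<integral>\<^sup>+y. f (x + - y) * g x \<partial>lborel) \<partial>\<mu>)"
    by (rule P.Fubini') measurable
  also have "\<dots> = (\<integral>\<^sup>+x. (\<integral>\<^sup>+y. f (- y) \<partial>lborel) * g x \<partial>\<mu>)"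
  proof (rule nn_integral_cong)
    fix x :: 'a
    have "(\<integral>\<^sup>+y. f (x + - y) * g x \<partial>lborel) = (\<integral>\<^sup>+y. f (x + - y) \<partial>lborel) * g x"
      by (rule nn_integral_multc) measurable
    also have "(\<integral>\<^sup>+y. f (x + - y) \<partial>lborel) = (\<integral>\<^sup>+y. f (- (- x + y)) \<partial>lborel)" by simp
    also have "\<dots> = (\<integral>\<^sup>+y. f (- y) \<partial>lborel)"
      by (rule lborel_translate_nn[of "\<lambda>y. f (- y)"]) measurable
    finally show "(\<integral>\<^sup>+y. f (x + - y) * g x \<partial>lborel) = (\<integral>\<^sup>+y. f (- y) \<partial>lborel) * g x" .
  qed
  also have "\<dots> = (\<integral>\<^sup>+y. f (- y) \<partial>lborel) * (\<integral>\<^sup>+x. g x \<partial>\<mu>)"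
    by (rule nn_integral_cmult) measurable
  finally show ?thesis by (simp add: mult.commute)
qed

text \<open>The image of Lebesgue measure under an invertible linear map is again translation
  invariant, hence a multiple of Lebesgue measure. The factor J is |det L|, but no determinant has
  to be computed: later only a lower bound for J is required.\<close>

lemma lborel_linear_distr:
  fixes L :: "'a::euclidean_space \<Rightarrow> 'a"
  assumes L: "linear L" "inj L"
  obtains J where "0 < J" "lborel = density (distr lborel borel L) (\<lambda>_. ennreal J)"
proof -
  obtain L' where L': "linear L'" "\<And>x. L' (L x) = x" "\<And>x. L (L' x) = x"
    using linear_injective_isomorphism[OF L] by blast
  have vi: "L -` A \<subseteq> L' ` A" for A using L'(2) by (metis image_eqI subsetI vimage_eq)
  have Lm[measurable]: "L \<in> borel_measurable borel"
    using L(1) by (intro borel_measurable_continuous_onI linear_continuous_on) (simp add: linear_conv_bounded_linear)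
  have L'm[measurable]: "L' \<in> borel_measurable borel"
    using L'(1) by (intro borel_measurable_continuous_onI linear_continuous_on) (simp add: linear_conv_bounded_linear)
  let ?\<mu> = "distr lborel borel L"
  let ?B = "ball (0::'a) 1"
  have sf: "sigma_finite_measure ?\<mu>"
  proof
    have "emeasure ?\<mu> (ball 0 (real n)) \<noteq> \<infinity>" for n
    proof -
      have "bounded (L' ` ball 0 (real n))"
        using L'(1) by (intro bounded_linear_image) (auto simp: linear_conv_bounded_linear)
      then obtain r where r: "L' ` ball 0 (real n) \<subseteq> ball 0 r" using bounded_subset_ballD[of _ 0] by metis
      have "emeasure lborel (L -` ball 0 (real n) \<inter> space lborel) \<le> emeasure lborel (ball 0 r :: 'a set)"
        using order_trans[OF vi r] by (intro emeasure_mono) auto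
      also have "\<dots> < \<infinity>" by (rule emeasure_lborel_ball_finite)
      finally show ?thesis by (simp add: emeasure_distr)
    qed
    moreover have "(\<Union>n. ball (0::'a) (real n)) = UNIV"
      using reals_Archimedean2 by auto
    ultimately show "\<exists>A. countable A \<and> A \<subseteq> sets ?\<mu> \<and> \<Union> A = space ?\<mu> \<and> (\<forall>a\<in>A. emeasure ?\<mu> a \<noteq> \<infinity>)"
      by (intro exI[of _ "range (\<lambda>n::nat. ball (0::'a) (real n))"]) auto
  qed
  have inv: "(\<integral>\<^sup>+x. f (t + x) \<partial>?\<mu>) = (\<integral>\<^sup>+x. f x \<partial>?\<mu>)" if [measurable]: "f \<in> borel_measurable borel" for f :: "'a \<Rightarrow> ennreal" and t
  proof -
    have "(\<integral>\<^sup>+x. f (t + x) \<partial>?\<mu>) = (\<integral>\<^sup>+x. f (t + L x) \<partial>lborel)" by (subst nn_integral_distr) auto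
    also have "\<dots> = (\<integral>\<^sup>+x. f (L (L' t + x)) \<partial>lborel)" by (simp add: linear_add[OF L(1)] L'(3))
    also have "\<dots> = (\<integral>\<^sup>+x. f (L x) \<partial>lborel)" by (rule lborel_translate_nn[of "\<lambda>x. f (L x)"]) measurable
    also have "\<dots> = (\<integral>\<^sup>+x. f x \<partial>?\<mu>)" by (subst nn_integral_distr) auto
    finally show ?thesis .
  qed
  have bpos: "0 < emeasure lborel ?B" "emeasure lborel ?B < \<infinity>"
    using unit_ball_vol_pos[of "real DIM('a)"] by (auto simp: emeasure_ball emeasure_lborel_ball_finite)
  \<comment> \<open>The uniqueness lemma for the indicators of the unit ball and of A; the
    reflection in it has no effect because the ball is symmetric.\<close>
  have key: "emeasure ?\<mu> ?B * emeasure lborel A = emeasure ?\<mu> A * emeasure lborel ?B" if A: "A \<in> sets borel" for A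
  proof -
    have "(\<integral>\<^sup>+x. indicator ?B x \<partial>?\<mu>) * (\<integral>\<^sup>+y. indicator A y \<partial>lborel) = (\<integral>\<^sup>+x. indicator A x \<partial>?\<mu>) * (\<integral>\<^sup>+y. indicator ?B (- y) \<partial>lborel)"
      by (rule translation_invariant_unique[OF _ sf inv]) (use A in \<open>auto intro!: borel_measurable_indicator\<close>)
    also have "(\<integral>\<^sup>+y. indicator ?B (- y) \<partial>lborel) = (\<integral>\<^sup>+y. indicator ?B y \<partial>lborel)"
      by (rule nn_integral_cong) (simp add: indicator_def)
    finally show ?thesis using A by (subst (asm) (1 2 3 4) nn_integral_indicator) auto
  qed
  have mfin: "emeasure ?\<mu> ?B < \<infinity>"
  proof -
    have "bounded (L' ` ?B)" using L'(1) by (intro bounded_linear_image) (auto simp: linear_conv_bounded_linear)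
    then obtain r where r: "L' ` ?B \<subseteq> ball 0 r" using bounded_subset_ballD[of _ 0] by metis
    have "emeasure lborel (L -` ?B \<inter> space lborel) \<le> emeasure lborel (ball 0 r :: 'a set)"
      using order_trans[OF vi r] by (intro emeasure_mono) auto
    also have "\<dots> < \<infinity>" by (rule emeasure_lborel_ball_finite)
    finally show ?thesis by (simp add: emeasure_distr)
  qed
  have mpos: "emeasure ?\<mu> ?B \<noteq> 0"
  proof
    assume "emeasure ?\<mu> ?B = 0"
    then have "emeasure ?\<mu> UNIV * emeasure lborel ?B = 0" using key[of UNIV] by simp
    then show False using bpos by (simp add: emeasure_distr)
  qed
  define J where "J = measure lborel ?B / measure ?\<mu> ?B"
  have e: "emeasure lborel ?B = ennreal (measure lborel ?B)" "emeasure ?\<mu> ?B = ennreal (measure ?\<mu> ?B)"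
    using bpos mfin by (auto simp: emeasure_eq_ennreal_measure less_top)
  have p: "0 < measure lborel ?B" "0 < measure ?\<mu> ?B"
    using bpos mpos e by (auto simp: zero_less_measure_iff less_top ennreal_0 intro!: neq0_conv[THEN iffD1] le_neq_trans)
  have J: "0 < J" using p by (simp add: J_def)
  moreover have "lborel = density ?\<mu> (\<lambda>_. ennreal J)"
  proof (rule measure_eqI)
    fix A :: "'a set" assume "A \<in> sets lborel"
    then have A: "A \<in> sets borel" by simp
    have "emeasure lborel A = ennreal J * emeasure ?\<mu> A"
    proof -
      have "ennreal (measure ?\<mu> ?B) * emeasure lborel A = emeasure ?\<mu> A * ennreal (measure lborel ?B)"
        using key[OF A] unfolding e .
      then have "ennreal (1 / measure ?\<mu> ?B) * (ennreal (measure ?\<mu> ?B) * emeasure lborel A) = ennreal (1 / measure ?\<mu> ?B) * (emeasure ?\<mu> A * ennreal (measure lborel ?B))"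
        by simp
      moreover have "ennreal (1 / measure ?\<mu> ?B) * ennreal (measure ?\<mu> ?B) = 1"
        using p by (simp flip: ennreal_mult')
      moreover have "ennreal (1 / measure ?\<mu> ?B) * ennreal (measure lborel ?B) = ennreal J"
        using p by (simp add: J_def flip: ennreal_mult')
      ultimately show ?thesis by (metis mult.assoc mult.commute mult.left_neutral)
    qed
    then show "emeasure lborel A = emeasure (density ?\<mu> (\<lambda>_. ennreal J)) A"
      using A by (subst emeasure_density_const) auto
  qed simp
  ultimately show ?thesis by (rule that)
qed

lemma lborel_integral_linear:
  fixes L :: "'a::euclidean_space \<Rightarrow> 'a"
  assumes L: "linear L" "inj L"
  obtains J where "0 < J"
    "\<And>(f :: 'a \<Rightarrow> complex) x0. f \<in> borel_measurable borel \<Longrightarrow> (\<integral>x. f x \<partial>lborel) = of_real J * (\<integral>s. f (x0 + L s) \<partial>lborel)"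
    "\<And>A x0. A \<in> sets borel \<Longrightarrow> emeasure lborel A = ennreal J * emeasure lborel {s. x0 + L s \<in> A}"
proof -
  obtain J where J: "0 < J" "lborel = density (distr lborel borel L) (\<lambda>_. ennreal J)"
    using lborel_linear_distr[OF L] .
  have Lm[measurable]: "L \<in> borel_measurable borel"
    using L(1) by (intro borel_measurable_continuous_onI linear_continuous_on) (simp add: linear_conv_bounded_linear)
  show ?thesis
  proof (rule that[OF J(1)])
    fix f :: "'a \<Rightarrow> complex" and x0 assume fm[measurable]: "f \<in> borel_measurable borel"
    have "(\<integral>x. f x \<partial>lborel) = (\<integral>x. f (x0 + x) \<partial>lborel)"
      using lborel_integral_scale[of 1 f x0] by simp
    also have "\<dots> = (\<integral>x. f (x0 + x) \<partial>(density (distr lborel borel L) (\<lambda>_. ennreal J)))" using J(2) by simp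
    also have "\<dots> = (\<integral>x. J *\<^sub>R f (x0 + x) \<partial>(distr lborel borel L))"
      using J(1) by (subst integral_density) auto
    also have "\<dots> = (\<integral>s. J *\<^sub>R f (x0 + L s) \<partial>lborel)" by (subst integral_distr) auto
    also have "\<dots> = of_real J * (\<integral>s. f (x0 + L s) \<partial>lborel)" by (simp add: scaleR_conv_of_real)
    finally show "(\<integral>x. f x \<partial>lborel) = of_real J * (\<integral>s. f (x0 + L s) \<partial>lborel)" .
  next
    fix A :: "'a set" and x0 assume A[measurable]: "A \<in> sets borel"
    have "emeasure lborel A = (\<integral>\<^sup>+x. indicator A x \<partial>lborel)" by simp
    also have "\<dots> = (\<integral>\<^sup>+x. indicator A (x0 + x) \<partial>lborel)" by (rule lborel_translate_nn[symmetric]) measurable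
    also have "\<dots> = (\<integral>\<^sup>+x. indicator A (x0 + x) \<partial>(density (distr lborel borel L) (\<lambda>_. ennreal J)))" using J(2) by simp
    also have "\<dots> = (\<integral>\<^sup>+x. ennreal J * indicator A (x0 + x) \<partial>(distr lborel borel L))"
      by (subst nn_integral_density) auto
    also have "\<dots> = (\<integral>\<^sup>+s. ennreal J * indicator A (x0 + L s) \<partial>lborel)" by (subst nn_integral_distr) auto
    also have "\<dots> = ennreal J * (\<integral>\<^sup>+s. indicator {s. x0 + L s \<in> A} s \<partial>lborel)"
    proof -
      have "(\<lambda>s. indicator A (x0 + L s) :: ennreal) = indicator {s. x0 + L s \<in> A}" by (auto simp: indicator_def)
      moreover have "(\<integral>\<^sup>+s. ennreal J * indicator A (x0 + L s) \<partial>lborel) = ennreal J * (\<integral>\<^sup>+s. indicator A (x0 + L s) \<partial>lborel)"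
        by (rule nn_integral_cmult) measurable
      ultimately show ?thesis by simp
    qed
    also have "(\<integral>\<^sup>+s. indicator {s. x0 + L s \<in> A} s \<partial>lborel) = emeasure lborel {s. x0 + L s \<in> A}"
      by (rule nn_integral_indicator) measurable
    finally show "emeasure lborel A = ennreal J * emeasure lborel {s. x0 + L s \<in> A}" .
  qed
qed

lemma lborel_integral_prod_Basis:
  fixes f :: "'a::euclidean_space \<Rightarrow> real \<Rightarrow> complex"
  assumes "\<And>b. b \<in> Basis \<Longrightarrow> integrable lborel (f b)"
  shows "(\<integral>s. (\<Prod>b\<in>Basis. f b (s \<bullet> b)) \<partial>lborel) = (\<Prod>b\<in>Basis. \<integral>t. f b t \<partial>lborel)"
proof -
  interpret product_sigma_finite "\<lambda>b::'a. lborel :: real measure" ..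
  have fm[measurable]: "f b \<in> borel_measurable borel" if "b \<in> Basis" for b
    using borel_measurable_integrable[OF assms[OF that]] by simp
  have m: "(\<lambda>s::'a. \<Prod>b\<in>Basis. f b (s \<bullet> b)) \<in> borel_measurable borel"
    by (rule borel_measurable_prod) measurable
  have "(\<integral>s. (\<Prod>b\<in>Basis. f b (s \<bullet> b)) \<partial>lborel) =
     (\<integral>g. (\<Prod>b\<in>Basis. f b ((\<Sum>i\<in>Basis. g i *\<^sub>R i) \<bullet> b)) \<partial>(\<Pi>\<^sub>M b\<in>Basis. lborel))"
    by (subst lborel_eq, subst integral_distr) (auto intro: m)
  also have "\<dots> = (\<integral>g. (\<Prod>b\<in>Basis. f b (g b)) \<partial>(\<Pi>\<^sub>M b\<in>Basis. lborel))"
    by (intro Bochner_Integration.integral_cong prod.cong) (auto simp: inner_sum_left inner_Basis if_distrib cong: if_cong)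
  also have "\<dots> = (\<Prod>b\<in>Basis. \<integral>t. f b t \<partial>lborel)"
    by (rule product_integral_prod) (use assms in auto)
  finally show ?thesis .
qed

lemma integral_exp_interval:
  fixes z :: complex
  assumes "z \<noteq> 0" "0 < \<sigma>"
  shows "(\<integral>t. indicator {0<..<\<sigma>} t * exp (of_real t * z) \<partial>lborel) = (exp (of_real \<sigma> * z) - 1) / z"
    "integrable lborel (\<lambda>t. indicator {0<..<\<sigma>} t * exp (of_real t * z))"
proof -
  have i: "set_integrable lborel {0..\<sigma>} (\<lambda>t. exp (of_real t * z))"
    by (rule borel_integrable_atLeastAtMost') (intro continuous_intros)
  have "((\<lambda>t. exp (of_real t * z)) has_integral (exp (of_real \<sigma> * z) / z - exp (of_real 0 * z) / z)) {0..\<sigma>}"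
  proof (rule fundamental_theorem_of_calculus)
    fix t :: real
    have "((\<lambda>w. exp (w * z) / z) has_field_derivative exp (of_real t * z)) (at (of_real t))"
      using assms by (auto intro!: derivative_eq_intros)
    from has_vector_derivative_real_field[OF this]
    show "((\<lambda>t. exp (of_real t * z) / z) has_vector_derivative exp (of_real t * z)) (at t within {0..\<sigma>})"
      by (rule has_vector_derivative_at_within)
  qed (use assms in simp)
  then have "integral {0..\<sigma>} (\<lambda>t. exp (of_real t * z)) = (exp (of_real \<sigma> * z) - 1) / z"
    by (simp add: integral_unique diff_divide_distrib)
  then have 1: "(LINT t:{0..\<sigma>}|lborel. exp (of_real t * z)) = (exp (of_real \<sigma> * z) - 1) / z"
    using set_borel_integral_eq_integral(2)[OF i] by simp
  have ae: "AE t in lborel. indicator {0<..<\<sigma>} t * exp (of_real t * z) = indicator {0..\<sigma>} t *\<^sub>R exp (of_real t * z)"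
    using AE_lborel_singleton[of 0] AE_lborel_singleton[of \<sigma>] by eventually_elim (auto simp: indicator_def)
  have m: "(\<lambda>t. indicator {0<..<\<sigma>} t * exp (of_real t * z)) \<in> borel_measurable lborel"
    by (intro borel_measurable_times borel_measurable_indicator borel_measurable_continuous_onI continuous_intros) auto
  show "(\<integral>t. indicator {0<..<\<sigma>} t * exp (of_real t * z) \<partial>lborel) = (exp (of_real \<sigma> * z) - 1) / z"
    unfolding 1[symmetric] set_lebesgue_integral_def by (rule integral_cong_AE[OF m _ ae]) (use i in \<open>auto simp: set_integrable_def\<close>)
  show "integrable lborel (\<lambda>t. indicator {0<..<\<sigma>} t * exp (of_real t * z))"
    by (rule integrable_cong_AE_imp[OF _ m]) (use i ae in \<open>auto simp: set_integrable_def elim: eventually_mono\<close>)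
qed

subsection \<open>Integrals over corners\<close>

text \<open>\<open>L\<close> maps the coordinate directions to the unit edge vectors at xc and the
  positive orthant to a cone that contains P - xc; near its tip, up to edge parameter
  \<open>d\<close>, the open cone lies in P - xc. The condition on \<open>L One\<close> says that
  the sum of the edge vectors makes a uniformly acute angle with each of them: this is the direction
  into which exponentials get tilted.\<close>

definition corner :: "real \<Rightarrow> real \<Rightarrow> 'a::euclidean_space set \<Rightarrow> 'a \<Rightarrow> ('a \<Rightarrow> 'a) \<Rightarrow> bool" where
  "corner \<kappa> d P xc L \<longleftrightarrow> linear L \<and> (\<forall>b\<in>Basis. norm (L b) = 1) \<and> (\<forall>s. \<kappa> * norm s \<le> norm (L s)) \<and>
     (\<forall>b\<in>Basis. \<kappa>\<^sup>2 \<le> L One \<bullet> L b) \<and>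
     (\<forall>x\<in>P. \<exists>s. (\<forall>b\<in>Basis. 0 \<le> s \<bullet> b) \<and> x = xc + L s) \<and>
     (\<forall>s. (\<forall>b\<in>Basis. 0 < s \<bullet> b \<and> s \<bullet> b < d) \<longrightarrow> xc + L s \<in> P)"

lemma linear_Basis_expand:
  fixes L :: "'a::euclidean_space \<Rightarrow> 'b::real_vector"
  assumes "linear L"
  shows "L s = (\<Sum>b\<in>Basis. (s \<bullet> b) *\<^sub>R L b)"
proof -
  have "L (\<Sum>b\<in>Basis. (s \<bullet> b) *\<^sub>R b) = (\<Sum>b\<in>Basis. (s \<bullet> b) *\<^sub>R L b)"
    by (simp only: linear_sum[OF assms] linear_cmul[OF assms])
  then show ?thesis by (simp only: euclidean_representation)
qed

lemma corner_inj: "corner \<kappa> d P xc L \<Longrightarrow> 0 < \<kappa> \<Longrightarrow> inj L"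
proof (rule injI)
  fix x y assume c: "corner \<kappa> d P xc L" "0 < \<kappa>" and e: "L x = L y"
  have "L (x - y) = 0" using c e by (simp add: corner_def linear_diff)
  then have "\<kappa> * norm (x - y) \<le> 0" using c by (auto simp: corner_def dest: spec[of _ "x - y"])
  then show "x = y" using c(2) by (simp add: mult_le_0_iff)
qed

lemma half_of: "0 < (\<kappa>::real) \<Longrightarrow> a < \<kappa> / 2 \<Longrightarrow> \<kappa> * t \<le> a \<Longrightarrow> t < 1 / 2"
proof -
  assume *: "0 < \<kappa>" "a < \<kappa> / 2" "\<kappa> * t \<le> a"
  then have "\<kappa> * t < \<kappa> * (1/2)" by linarith
  then show ?thesis using *(1) by (simp only: mult_less_cancel_left_pos)
qed

lemma corner_box:
  fixes L :: "'a::euclidean_space \<Rightarrow> 'a"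
  assumes c: "corner \<kappa> d P xc L" and k: "0 < \<kappa>" and s: "0 < \<sigma>"
  defines "Q \<equiv> (\<lambda>s. xc + L s) ` box 0 (\<sigma> *\<^sub>R One)"
  shows "Q \<in> sets borel"
    and "\<exists>J\<ge>unit_ball_vol DIM('a) * (\<kappa> / 2) ^ DIM('a). measure lborel Q = J * \<sigma> ^ DIM('a) \<and> emeasure lborel Q < \<infinity> \<and>
      (\<forall>z::'a \<Rightarrow> complex. (\<forall>b\<in>Basis. z b \<noteq> 0) \<longrightarrow>
      (\<integral>y. indicator Q y * exp (\<Sum>b\<in>Basis. of_real ((inv L (y - xc)) \<bullet> b) * z b) \<partial>lborel) = of_real J * (\<Prod>b\<in>Basis. (exp (of_real \<sigma> * z b) - 1) / z b))"
proof -
  have L: "linear L" "inj L" using c corner_inj[OF c k] by (auto simp: corner_def)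
  have surj: "surj L" using L by (simp add: linear_injective_imp_surjective)
  have invL: "inv L (L x) = x" "L (inv L x) = x" for x
    using L(2) surj by (auto simp: surj_f_inv_f)
  have cL': "continuous_on UNIV (inv L)"
    using linear_injective_isomorphism[OF L] invL by (metis inj_linear_imp_inv_linear L(1) L(2) linear_continuous_on linear_conv_bounded_linear)
  have Qopen: "open Q"
  proof -
    have "Q = (+) xc ` (L ` box 0 (\<sigma> *\<^sub>R One))" unfolding Q_def by (auto simp: image_image)
    then show ?thesis using open_surjective_linear_image[OF open_box L(1) surj] open_translation by metis
  qed
  then show Qs: "Q \<in> sets borel" by simp
  have Qpre: "{s. xc + L s \<in> Q} = box 0 (\<sigma> *\<^sub>R One)"
    unfolding Q_def using L(2) by (auto simp: inj_def image_iff)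
  obtain J where J: "0 < J"
    "\<And>(f :: 'a \<Rightarrow> complex) x0. f \<in> borel_measurable borel \<Longrightarrow> (\<integral>x. f x \<partial>lborel) = of_real J * (\<integral>s. f (x0 + L s) \<partial>lborel)"
    "\<And>A x0. A \<in> sets borel \<Longrightarrow> emeasure lborel A = ennreal J * emeasure lborel {s. x0 + L s \<in> A}"
    using lborel_integral_linear[OF L] by metis
  have "emeasure lborel Q = ennreal J * emeasure lborel (box 0 (\<sigma> *\<^sub>R (One::'a)))"
    using J(3)[OF Qs, of xc] unfolding Qpre .
  also have "emeasure lborel (box 0 (\<sigma> *\<^sub>R (One::'a))) = ennreal (\<sigma> ^ DIM('a))"
    using s by (subst emeasure_lborel_box) (auto simp: inner_add_left)
  finally have eQ: "emeasure lborel Q = ennreal (J * \<sigma> ^ DIM('a))" using J(1) s by (simp add: ennreal_mult')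
  then have mQ: "measure lborel Q = J * \<sigma> ^ DIM('a)" using J(1) s by (simp add: measure_def)
  have Jge: "unit_ball_vol DIM('a) * (\<kappa> / 2) ^ DIM('a) \<le> J"
  proof -
    let ?c = "xc + L ((1/2) *\<^sub>R One)"
    let ?A = "ball ?c (\<kappa> / 2)"
    \<comment> \<open>By the lower bound kappa |s| <= |L s|, the ball of radius kappa/2 about the
      image of the centre of the unit box pulls back into that box. Comparing volumes bounds J from
      below in terms of kappa alone.\<close>
    have sub: "{s. xc + L s \<in> ?A} \<subseteq> box 0 One"
    proof
      fix s assume "s \<in> {s. xc + L s \<in> ?A}"
      then have "norm (L ((1/2) *\<^sub>R One) - L s) < \<kappa> / 2" by (simp add: dist_norm)
      then have "norm (L ((1/2) *\<^sub>R One - s)) < \<kappa> / 2" by (simp add: linear_diff[OF L(1)])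
      moreover have "\<kappa> * norm ((1/2) *\<^sub>R One - s) \<le> norm (L ((1/2) *\<^sub>R One - s))" using c unfolding corner_def by blast
      ultimately have "norm ((1/2) *\<^sub>R One - s) < 1/2" using half_of[OF k] by blast
      then have hb: "\<bar>((1/2) *\<^sub>R One - s) \<bullet> b\<bar> < 1/2" if "b \<in> Basis" for b
        using Basis_le_norm[OF that, of "(1/2) *\<^sub>R One - s"] by (rule le_less_trans[rotated])
      have "0 < s \<bullet> b \<and> s \<bullet> b < 1" if bB: "b \<in> Basis" for b
      proof -
        have "((1/2) *\<^sub>R One - s) \<bullet> b = 1/2 - s \<bullet> b" using bB by (simp add: inner_diff_left)
        then have "\<bar>1/2 - s \<bullet> b\<bar> < 1/2" using hb[OF bB] by (simp only:)
        then show ?thesis unfolding abs_less_iff by simp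
      qed
      then show "s \<in> box 0 One" by (simp add: mem_box)
    qed
    have "ennreal (unit_ball_vol DIM('a) * (\<kappa> / 2) ^ DIM('a)) = emeasure lborel ?A" using k by (simp add: emeasure_ball)
    also have "\<dots> = ennreal J * emeasure lborel {s. xc + L s \<in> ?A}" by (rule J(3)) simp
    also have "\<dots> \<le> ennreal J * emeasure lborel (box 0 (One::'a))" by (intro mult_left_mono emeasure_mono sub) auto
    also have "\<dots> = ennreal J" by (subst emeasure_lborel_box) auto
    finally show ?thesis using J(1) by (simp add: ennreal_le_iff)
  qed
  have int: "(\<integral>y. indicator Q y * exp (\<Sum>b\<in>Basis. of_real ((inv L (y - xc)) \<bullet> b) * z b) \<partial>lborel) = of_real J * (\<Prod>b\<in>Basis. (exp (of_real \<sigma> * z b) - 1) / z b)"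
    if z: "\<forall>b\<in>Basis. z b \<noteq> 0" for z :: "'a \<Rightarrow> complex"
  proof -
    have m: "(\<lambda>y. indicator Q y * exp (\<Sum>b\<in>Basis. complex_of_real ((inv L (y - xc)) \<bullet> b) * z b)) \<in> borel_measurable borel"
      by (intro borel_measurable_times borel_measurable_indicator Qs borel_measurable_continuous_onI continuous_intros continuous_on_compose2[OF cL']) auto
    have "(\<integral>y. indicator Q y * exp (\<Sum>b\<in>Basis. of_real ((inv L (y - xc)) \<bullet> b) * z b) \<partial>lborel)
      = of_real J * (\<integral>s. indicator Q (xc + L s) * exp (\<Sum>b\<in>Basis. of_real ((inv L (xc + L s - xc)) \<bullet> b) * z b) \<partial>lborel)"
      by (rule J(2)[OF m])
    also have "(\<lambda>s. indicator Q (xc + L s) * exp (\<Sum>b\<in>Basis. of_real ((inv L (xc + L s - xc)) \<bullet> b) * z b))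
      = (\<lambda>s::'a. \<Prod>b\<in>Basis. indicator {0<..<\<sigma>} (s \<bullet> b) * exp (of_real (s \<bullet> b) * z b))"
    proof
      fix s :: 'a
      have "indicator Q (xc + L s) = (indicator (box 0 (\<sigma> *\<^sub>R One)) s :: complex)" unfolding Qpre[symmetric] by (simp add: indicator_def)
      also have "\<dots> = (\<Prod>b\<in>Basis. indicator {0<..<\<sigma>} (s \<bullet> b))"
      proof (cases "s \<in> box 0 (\<sigma> *\<^sub>R One)")
        case True then show ?thesis by (auto simp: mem_box intro!: prod.neutral[symmetric])
      next
        case False
        then obtain b where b: "b \<in> Basis" "\<not> (0 < s \<bullet> b \<and> s \<bullet> b < \<sigma>)" by (auto simp: mem_box)
        then have "(\<Prod>b\<in>Basis. indicator {0<..<\<sigma>} (s \<bullet> b) :: complex) = 0" by (intro prod_zero) (auto intro!: bexI[of _ b])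
        then show ?thesis using False by simp
      qed
      finally show "indicator Q (xc + L s) * exp (\<Sum>b\<in>Basis. of_real ((inv L (xc + L s - xc)) \<bullet> b) * z b)
        = (\<Prod>b\<in>Basis. indicator {0<..<\<sigma>} (s \<bullet> b) * exp (of_real (s \<bullet> b) * z b))"
        by (simp add: invL exp_sum prod.distrib)
    qed
    also have "(\<integral>s. (\<Prod>b\<in>Basis. indicator {0<..<\<sigma>} (s \<bullet> b) * exp (of_real (s \<bullet> b) * z b)) \<partial>lborel)
      = (\<Prod>b\<in>Basis. \<integral>t. indicator {0<..<\<sigma>} t * exp (of_real t * z b) \<partial>lborel)"
      by (rule lborel_integral_prod_Basis) (use z s in \<open>auto intro!: integral_exp_interval(2)\<close>)
    also have "\<dots> = (\<Prod>b\<in>Basis. (exp (of_real \<sigma> * z b) - 1) / z b)"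
      by (rule prod.cong[OF refl]) (use z s in \<open>auto intro!: integral_exp_interval(1)\<close>)
    finally show ?thesis .
  qed
  show "\<exists>J\<ge>unit_ball_vol DIM('a) * (\<kappa> / 2) ^ DIM('a). measure lborel Q = J * \<sigma> ^ DIM('a) \<and> emeasure lborel Q < \<infinity> \<and>
      (\<forall>z::'a \<Rightarrow> complex. (\<forall>b\<in>Basis. z b \<noteq> 0) \<longrightarrow>
      (\<integral>y. indicator Q y * exp (\<Sum>b\<in>Basis. of_real ((inv L (y - xc)) \<bullet> b) * z b) \<partial>lborel) = of_real J * (\<Prod>b\<in>Basis. (exp (of_real \<sigma> * z b) - 1) / z b))"
    using Jge mQ eQ int by (intro exI[of _ J]) auto
qed

text \<open>From a point of an open P one can step back a little along every edge vector and stay in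
  P; a coordinate that is nonnegative after the step was positive before it.\<close>

lemma corner_open_pos:
  fixes L :: "'a::euclidean_space \<Rightarrow> 'a"
  assumes c: "corner \<kappa> d P xc L" and k: "0 < \<kappa>" and P: "open P" and x: "x \<in> P"
  obtains s where "\<And>b. b \<in> Basis \<Longrightarrow> 0 < s \<bullet> b" "x = xc + L s"
proof -
  have L: "linear L" "inj L" using c corner_inj[OF c k] by (auto simp: corner_def)
  obtain s where s: "\<forall>b\<in>Basis. 0 \<le> s \<bullet> b" "x = xc + L s" using c x unfolding corner_def by blast
  obtain e where e: "0 < e" "ball x e \<subseteq> P" using P x open_contains_ball by blast
  have "0 < s \<bullet> b" if b: "b \<in> Basis" for b
  proof -
    have "x - (e/2) *\<^sub>R L b \<in> ball x e" using e c b by (simp add: corner_def dist_norm)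
    then obtain s' where s': "\<forall>b\<in>Basis. 0 \<le> s' \<bullet> b" "x - (e/2) *\<^sub>R L b = xc + L s'"
      using e(2) c unfolding corner_def by blast
    have "L s' = L (s - (e/2) *\<^sub>R b)" using s(2) s'(2) by (simp add: linear_diff[OF L(1)] linear_cmul[OF L(1)])
    then have "s' = s - (e/2) *\<^sub>R b" using L(2) by (simp add: inj_eq)
    then have "0 \<le> (s - (e/2) *\<^sub>R b) \<bullet> b" using s'(1) b by blast
    then show ?thesis using e(1) b by (simp add: inner_diff_left)
  qed
  then show ?thesis using that s(2) by blast
qed

lemma norm_le_five:
  fixes a :: "'a::real_normed_vector"
  assumes "g = a + (b + (c - d + e))"
  shows "norm a \<le> norm g + norm b + norm c + norm d + norm e"
proof -
  have "a = g - b - c + d - e" using assms by (simp add: algebra_simps)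
  moreover have "norm (g - b - c + d - e) \<le> norm (g - b - c + d) + norm e" by (rule norm_triangle_ineq4)
  moreover have "norm (g - b - c + d) \<le> norm (g - b - c) + norm d" by (rule norm_triangle_ineq)
  moreover have "norm (g - b - c) \<le> norm (g - b) + norm c" by (rule norm_triangle_ineq4)
  moreover have "norm (g - b) \<le> norm g + norm b" by (rule norm_triangle_ineq4)
  ultimately show ?thesis by (simp only:)
qed

text \<open>With E the exact exponential and Q the image of a box of side sigma at the corner, the
  integrand is split into f0 E on Q, the Hoelder remainder on Q, the rest of P, the part on P', and
  the error v - E. The first is bounded from below by a product of one-dimensional integrals;
  hypothesis \<open>small\<close> says that the second takes at most half of it.\<close>

lemma corner_estimate:
  fixes P P' :: "'a::euclidean_space set" and f f' v :: "'a \<Rightarrow> complex"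
  assumes c: "corner \<kappa> d P xc L" and k: "0 < \<kappa>" and P: "open P" "P \<subseteq> ball 0 R" and P': "open P'" "P' \<subseteq> ball 0 R"
    and fm: "f \<in> borel_measurable borel" "f' \<in> borel_measurable borel" "v \<in> borel_measurable borel"
    and fb: "\<And>y. y \<in> P \<Longrightarrow> norm (f y) \<le> M" "\<And>y. y \<in> P' \<Longrightarrow> norm (f' y) \<le> M" "0 \<le> M"
    and f0: "m0 \<le> norm f0" "0 < m0" and fh: "\<And>y. y \<in> P \<Longrightarrow> norm (y - xc) \<le> 1 / 64 \<Longrightarrow> norm (f y - f0) \<le> M * norm (y - xc) powr \<beta>"
    and \<beta>: "0 < \<beta>"
    and A: "\<And>b. b \<in> Basis \<Longrightarrow> A \<bullet> L b \<le> - \<theta>" "\<And>y. y \<in> P' \<Longrightarrow> A \<bullet> (y - xc) \<le> - \<eta>" "norm A + norm B \<le> T"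
    and v: "\<And>y. norm y \<le> R \<Longrightarrow> norm (v y - exp (of_real (A \<bullet> (y - xc)) + \<i> * of_real (B \<bullet> (y - xc)))) \<le> \<nu>"
    and \<sigma>: "0 < \<sigma>" "\<sigma> \<le> d" "real DIM('a) * \<sigma> \<le> 1 / 64" "1 \<le> \<theta> * \<sigma>" "0 < \<theta>"
    and small: "M * (real DIM('a) * \<sigma>) powr \<beta> * \<sigma> ^ DIM('a) \<le> m0 * (1 / (2 * T)) ^ DIM('a) / 2"
  shows "unit_ball_vol DIM('a) * (\<kappa> / 2) ^ DIM('a) * (m0 * (1 / (2 * T)) ^ DIM('a) / 2)
     \<le> norm (\<integral>y. (indicator P y * f y - indicator P' y * f' y) * v y \<partial>lborel)
       + M * (unit_ball_vol DIM('a) * R ^ DIM('a)) * (exp (- (\<theta> * \<sigma>)) + exp (- \<eta>) + 2 * \<nu>)"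
proof -
  let ?n = "DIM('a)"
  have L: "linear L" "inj L" using c corner_inj[OF c k] by (auto simp: corner_def)
  have surj: "surj L" using L by (simp add: linear_injective_imp_surjective)
  have invL: "inv L (L x) = x" "L (inv L x) = x" for x
    using L(2) surj by (auto simp: surj_f_inv_f)
  define E where "E = (\<lambda>y. exp (complex_of_real (A \<bullet> (y - xc)) + \<i> * of_real (B \<bullet> (y - xc))))"
  define z where "z = (\<lambda>b. complex_of_real (A \<bullet> L b) + \<i> * of_real (B \<bullet> L b))"
  have Lb: "norm (L b) = 1" if "b \<in> Basis" for b using c that by (simp add: corner_def)
  have Els: "E y = exp (\<Sum>b\<in>Basis. of_real ((inv L (y - xc)) \<bullet> b) * z b)" for y
  proof -
    have "y - xc = (\<Sum>b\<in>Basis. ((inv L (y - xc)) \<bullet> b) *\<^sub>R L b)"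
      using linear_Basis_expand[OF L(1), of "inv L (y - xc)"] by (simp add: invL)
    then have "A \<bullet> (y - xc) = (\<Sum>b\<in>Basis. ((inv L (y - xc)) \<bullet> b) * (A \<bullet> L b))" "B \<bullet> (y - xc) = (\<Sum>b\<in>Basis. ((inv L (y - xc)) \<bullet> b) * (B \<bullet> L b))"
      by (metis (no_types, lifting) inner_scaleR_right inner_sum_right sum.cong)+
    then have "of_real (A \<bullet> (y - xc)) + \<i> * of_real (B \<bullet> (y - xc)) = (\<Sum>b\<in>Basis. of_real ((inv L (y - xc)) \<bullet> b) * z b)"
      by (simp add: z_def distrib_left sum.distrib sum_distrib_left mult_ac)
    then show ?thesis by (simp add: E_def)
  qed
  have nE: "norm (E y) = exp (A \<bullet> (y - xc))" for y by (simp add: E_def)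
  have cE: "continuous_on UNIV E" unfolding E_def by (intro continuous_intros)
  have Em: "E \<in> borel_measurable borel" using cE by (rule borel_measurable_continuous_onI)
  define Q where "Q = (\<lambda>s. xc + L s) ` box 0 (\<sigma> *\<^sub>R (One::'a))"
  obtain J where J: "unit_ball_vol ?n * (\<kappa> / 2) ^ ?n \<le> J" "measure lborel Q = J * \<sigma> ^ ?n" "emeasure lborel Q < \<infinity>"
    "\<And>z::'a \<Rightarrow> complex. (\<forall>b\<in>Basis. z b \<noteq> 0) \<Longrightarrow>
      (\<integral>y. indicator Q y * exp (\<Sum>b\<in>Basis. of_real ((inv L (y - xc)) \<bullet> b) * z b) \<partial>lborel) = of_real J * (\<Prod>b\<in>Basis. (exp (of_real \<sigma> * z b) - 1) / z b)"
    using corner_box(2)[OF c k \<sigma>(1)] unfolding Q_def by blast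
  have Qs: "Q \<in> sets borel" unfolding Q_def by (rule corner_box(1)[OF c k \<sigma>(1)])
  have J0: "0 < J" using J(1) k by (meson less_le_trans mult_pos_pos unit_ball_vol_pos zero_less_power half_gt_zero of_nat_0_le_iff)
  have QP: "Q \<subseteq> P"
  proof
    fix y assume "y \<in> Q"
    then obtain s where s: "y = xc + L s" "s \<in> box 0 (\<sigma> *\<^sub>R One)" by (auto simp: Q_def)
    then have "\<forall>b\<in>Basis. 0 < s \<bullet> b \<and> s \<bullet> b < d" using \<sigma>(2) by (auto simp: mem_box)
    then show "y \<in> P" using c s(1) unfolding corner_def by blast
  qed
  have z0: "z b \<noteq> 0" "Re (z b) \<le> - \<theta>" "norm (z b) \<le> T" if "b \<in> Basis" for b
  proof -
    show re: "Re (z b) \<le> - \<theta>" using A(1)[OF that] by (simp add: z_def)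
    then show "z b \<noteq> 0" using \<sigma>(5) by auto
    have "norm (z b) \<le> \<bar>A \<bullet> L b\<bar> + \<bar>B \<bullet> L b\<bar>" unfolding z_def by (rule order_trans[OF norm_triangle_ineq]) (simp add: norm_mult)
    also have "\<dots> \<le> norm A * norm (L b) + norm B * norm (L b)" by (intro add_mono Cauchy_Schwarz_ineq2)
    also have "\<dots> \<le> T" using A(3) Lb[OF that] by simp
    finally show "norm (z b) \<le> T" .
  qed
  have T0: "0 < T"
  proof -
    obtain b :: 'a where b: "b \<in> Basis" using nonempty_Basis by blast
    have "0 < norm (z b)" using z0(1)[OF b] by simp
    then show ?thesis using z0(3)[OF b] by linarith
  qed
  \<comment> \<open>Each factor is (exp(sigma z) - 1)/z. Since theta sigma >= 1, the exponential has
    norm at most 1/e <= 1/2, and |z| <= T, so the factor has norm at least 1/(2T).\<close>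
  have main: "J * (1 / (2 * T)) ^ ?n \<le> norm (\<integral>y. indicator Q y * E y \<partial>lborel)"
  proof -
    have "(\<Prod>b\<in>(Basis::'a set). 1 / (2 * T)) \<le> (\<Prod>b\<in>Basis. norm ((exp (of_real \<sigma> * z b) - 1) / z b))"
    proof (rule prod_mono, intro conjI)
      fix b :: 'a assume b: "b \<in> Basis"
      show "0 \<le> 1 / (2 * T)" using T0 by simp
      have "norm (exp (of_real \<sigma> * z b)) = exp (\<sigma> * Re (z b))" by simp
      also have "\<dots> \<le> exp (- 1)" using mult_left_mono[OF z0(2)[OF b], of \<sigma>] \<sigma> by (simp add: mult.commute)
      also have "\<dots> \<le> 1 / 2" using exp_ge_add_one_self[of 1] by (simp add: exp_minus field_simps)
      finally have "1 / 2 \<le> norm (exp (of_real \<sigma> * z b) - 1)"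
        using norm_triangle_ineq2[of 1 "exp (of_real \<sigma> * z b)"] by (simp add: norm_minus_commute)
      then have "(1 / 2) / T \<le> norm (exp (of_real \<sigma> * z b) - 1) / norm (z b)"
        using z0[OF b] T0 by (intro frac_le) auto
      then show "1 / (2 * T) \<le> norm ((exp (of_real \<sigma> * z b) - 1) / z b)" by (simp add: norm_divide)
    qed
    then have "(1 / (2 * T)) ^ ?n \<le> norm (\<Prod>b\<in>Basis. (exp (of_real \<sigma> * z b) - 1) / z b)"
      by (simp only: prod_constant prod_norm)
    moreover have "(\<integral>y. indicator Q y * E y \<partial>lborel) = of_real J * (\<Prod>b\<in>Basis. (exp (of_real \<sigma> * z b) - 1) / z b)"
      unfolding Els using J(4)[of z] z0(1) by blast
    ultimately show ?thesis using J0 by (simp add: norm_mult mult_left_mono)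
  qed
  \<comment> \<open>In edge coordinates the real exponent is at most -theta times the sum of the
    coordinates; outside Q one of them is at least sigma.\<close>
  have Pexp: "norm (E y) \<le> 1" "y \<notin> Q \<Longrightarrow> norm (E y) \<le> exp (- (\<theta> * \<sigma>))" if y: "y \<in> P" for y
  proof -
    obtain s where s: "\<And>b. b \<in> Basis \<Longrightarrow> 0 < s \<bullet> b" "y = xc + L s" using corner_open_pos[OF c k P(1) y] by metis
    have "A \<bullet> (y - xc) = (\<Sum>b\<in>Basis. (s \<bullet> b) * (A \<bullet> L b))"
      using linear_Basis_expand[OF L(1), of s] s(2) by (simp add: inner_sum_right)
    also have "\<dots> \<le> (\<Sum>b\<in>Basis. (s \<bullet> b) * (- \<theta>))"
      using s(1) A(1) by (intro sum_mono mult_left_mono) (auto intro: less_imp_le)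
    finally have a: "A \<bullet> (y - xc) \<le> - \<theta> * (\<Sum>b\<in>Basis. s \<bullet> b)" by (simp add: sum_distrib_left sum_negf mult.commute)
    have s0: "0 \<le> (\<Sum>b\<in>Basis. s \<bullet> b)" using s(1) by (intro sum_nonneg) (auto intro: less_imp_le)
    have "0 \<le> \<theta> * (\<Sum>b\<in>Basis. s \<bullet> b)" using s0 \<sigma>(5) by simp
    then show "norm (E y) \<le> 1" unfolding nE using a by simp
    assume "y \<notin> Q"
    then have "s \<notin> box 0 (\<sigma> *\<^sub>R One)" using s(2) by (auto simp: Q_def)
    then obtain b where b: "b \<in> Basis" "\<sigma> \<le> s \<bullet> b" using s(1) by (auto simp: mem_box not_less)
    have "s \<bullet> b \<le> (\<Sum>b\<in>Basis. s \<bullet> b)" by (rule member_le_sum[OF b(1)]) (use s(1) in \<open>auto intro: less_imp_le\<close>)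
    then have "\<theta> * \<sigma> \<le> \<theta> * (\<Sum>b\<in>Basis. s \<bullet> b)" using b \<sigma>(5) by (intro mult_left_mono) auto
    then show "norm (E y) \<le> exp (- (\<theta> * \<sigma>))" unfolding nE using a by simp
  qed
  have Qnorm: "norm (y - xc) \<le> real ?n * \<sigma>" if yQ: "y \<in> Q" for y
  proof -
    obtain s where s: "y = xc + L s" "s \<in> box 0 (\<sigma> *\<^sub>R One)" using yQ by (auto simp: Q_def)
    have "norm (L s) \<le> (\<Sum>b\<in>Basis. norm ((s \<bullet> b) *\<^sub>R L b))" unfolding linear_Basis_expand[OF L(1), of s] by (rule norm_sum)
    also have "\<dots> \<le> (\<Sum>b\<in>(Basis::'a set). \<sigma>)" using s(2) Lb by (intro sum_mono) (auto simp: mem_box less_imp_le)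
    finally show ?thesis using s(1) by simp
  qed
  let ?V = "unit_ball_vol ?n * R ^ ?n"
  have R0: "0 \<le> R"
  proof (rule ccontr)
    assume "\<not> 0 \<le> R"
    then have "ball (0::'a) R = {}" by (intro ball_empty) simp
    then have "P = {}" using P(2) by blast
    moreover have "xc + L ((d/2) *\<^sub>R One) \<in> P" using c \<sigma> unfolding corner_def by (auto)
    ultimately show False by simp
  qed
  have Vb: "measure lborel (ball (0::'a) R) = ?V" using R0 by (rule content_ball)
  note [measurable] = fm Em Qs
  have Ps[measurable]: "P \<in> sets borel" "P' \<in> sets borel" using P P' by auto
  have ib: "integrable lborel (\<lambda>y::'a. indicator (ball 0 R) y * K)" for K :: real
    by (intro integrable_mult_left integrable_indicator_ball)
  have bint: "integrable lborel h \<and> norm (\<integral>y. h y \<partial>lborel) \<le> ?V * K"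
    if hm: "h \<in> borel_measurable borel" and hb: "\<And>y. norm (h y) \<le> indicator (ball 0 R) y * K" for h :: "'a \<Rightarrow> complex" and K
  proof
    show i: "integrable lborel h"
      by (rule Bochner_Integration.integrable_bound[OF ib[of K]])
        (use hm hb in \<open>auto intro!: AE_I2 order_trans[OF hb]\<close>)
    have "norm (\<integral>y. h y \<partial>lborel) \<le> (\<integral>y. norm (h y) \<partial>lborel)" by (rule integral_norm_bound)
    also have "\<dots> \<le> (\<integral>y. indicator (ball (0::'a) R) y * K \<partial>lborel)" by (rule integral_mono[OF integrable_norm[OF i] ib hb])
    also have "\<dots> = ?V * K" using Vb by simp
    finally show "norm (\<integral>y. h y \<partial>lborel) \<le> ?V * K" .
  qed
  have PB: "y \<in> ball 0 R" if "y \<in> P" for y using that P(2) by blast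
  have PB': "y \<in> ball 0 R" if "y \<in> P'" for y using that P'(2) by blast
  have vE: "norm (v y - E y) \<le> \<nu>" if "y \<in> ball 0 R" for y using v[of y] that by (simp add: E_def)
  define h1 where "h1 = (\<lambda>y. (indicator P y * f y - indicator P' y * f' y) * (v y - E y))"
  have h1: "integrable lborel h1 \<and> norm (\<integral>y. h1 y \<partial>lborel) \<le> ?V * (2 * M * \<nu>)"
  proof (rule bint)
    show "h1 \<in> borel_measurable borel" unfolding h1_def by measurable
    fix y
    show "norm (h1 y) \<le> indicator (ball 0 R) y * (2 * M * \<nu>)"
    proof (cases "y \<in> ball 0 R")
      case True
      have "norm (indicator P y * f y) \<le> M" "norm (indicator P' y * f' y) \<le> M" using fb(1)[of y] fb(2)[of y] fb(3) by (simp_all add: indicator_def)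
      then have "norm (indicator P y * f y - indicator P' y * f' y) \<le> M + M"
        by (intro order_trans[OF norm_triangle_ineq4] add_mono)
      then have "norm (indicator P y * f y - indicator P' y * f' y) \<le> 2 * M" by (simp only: mult_2)
      then have "norm (h1 y) \<le> (2 * M) * \<nu>" unfolding h1_def norm_mult[of _ "v y - E y"] by (intro mult_mono vE[OF True]) (use fb(3) in auto)
      then show ?thesis using True by simp
    next
      case False
      then show ?thesis using PB PB' by (auto simp: h1_def indicator_def)
    qed
  qed
  define h2 where "h2 = (\<lambda>y. indicator P' y * f' y * E y)"
  have h2: "integrable lborel h2 \<and> norm (\<integral>y. h2 y \<partial>lborel) \<le> ?V * (M * exp (- \<eta>))"
  proof (rule bint)
    show "h2 \<in> borel_measurable borel" unfolding h2_def by measurable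
    fix y
    show "norm (h2 y) \<le> indicator (ball 0 R) y * (M * exp (- \<eta>))"
    proof (cases "y \<in> P'")
      case True
      then show ?thesis using PB'[OF True] fb A(2)[OF True] by (simp add: h2_def norm_mult nE mult_mono)
    qed (use fb(3) in \<open>simp add: h2_def\<close>)
  qed
  define h3 where "h3 = (\<lambda>y. indicator (P - Q) y * f y * E y)"
  have h3: "integrable lborel h3 \<and> norm (\<integral>y. h3 y \<partial>lborel) \<le> ?V * (M * exp (- (\<theta> * \<sigma>)))"
  proof (rule bint)
    show "h3 \<in> borel_measurable borel" unfolding h3_def by measurable
    fix y
    show "norm (h3 y) \<le> indicator (ball 0 R) y * (M * exp (- (\<theta> * \<sigma>)))"
    proof (cases "y \<in> P - Q")
      case True
      then show ?thesis using PB[of y] fb Pexp(2)[of y] by (simp add: h3_def norm_mult mult_mono)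
    qed (use fb(3) in \<open>simp add: h3_def\<close>)
  qed
  define h4 where "h4 = (\<lambda>y. indicator Q y * (f y - f0) * E y)"
  have h4b: "norm (h4 y) \<le> indicator Q y * (M * (real ?n * \<sigma>) powr \<beta>)" for y
  proof (cases "y \<in> Q")
    case True
    have "norm (f y - f0) \<le> M * norm (y - xc) powr \<beta>" using fh[of y] QP True Qnorm[OF True] \<sigma>(3) by force
    also have "\<dots> \<le> M * (real ?n * \<sigma>) powr \<beta>" using Qnorm[OF True] \<beta> fb(3) by (intro mult_left_mono powr_mono2) auto
    finally have "norm (f y - f0) * norm (E y) \<le> (M * (real ?n * \<sigma>) powr \<beta>) * 1"
      using Pexp(1)[of y] QP True fb(3) by (intro mult_mono) auto
    then show ?thesis using True by (simp add: h4_def norm_mult)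
  qed (simp add: h4_def)
  have iQ: "integrable lborel (\<lambda>y. indicator Q y * K)" for K :: real
    using J(3) Qs by (intro integrable_mult_left integrable_real_indicator) auto
  have h4i: "integrable lborel h4"
  proof (rule Bochner_Integration.integrable_bound[OF iQ])
    show "h4 \<in> borel_measurable lborel" unfolding h4_def by measurable
    show "AE y in lborel. norm (h4 y) \<le> norm (indicator Q y * (M * (real ?n * \<sigma>) powr \<beta>))"
      using h4b fb(3) by (intro AE_I2) (auto intro: order_trans[OF h4b])
  qed
  have h4: "norm (\<integral>y. h4 y \<partial>lborel) \<le> J * \<sigma> ^ ?n * (M * (real ?n * \<sigma>) powr \<beta>)"
  proof -
    have "norm (\<integral>y. h4 y \<partial>lborel) \<le> (\<integral>y. norm (h4 y) \<partial>lborel)" by (rule integral_norm_bound)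
    also have "\<dots> \<le> (\<integral>y. indicator Q y * (M * (real ?n * \<sigma>) powr \<beta>) \<partial>lborel)" by (rule integral_mono[OF integrable_norm[OF h4i] iQ h4b])
    also have "\<dots> = J * \<sigma> ^ ?n * (M * (real ?n * \<sigma>) powr \<beta>)" using J(2) by simp
    finally show ?thesis .
  qed
  define h5 where "h5 = (\<lambda>y. f0 * (indicator Q y * E y))"
  have h5i: "integrable lborel (\<lambda>y. indicator Q y * E y)"
  proof (rule Bochner_Integration.integrable_bound[OF iQ[of 1]])
    show "(\<lambda>y. indicator Q y * E y) \<in> borel_measurable lborel" by measurable
    show "AE y in lborel. norm (indicator Q y * E y) \<le> norm (indicator Q y * (1::real))"
      using Pexp(1) QP by (intro AE_I2) (auto simp: indicator_def)
  qed
  \<comment> \<open>The splitting announced above. It is an identity at every point because Q is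
    contained in P.\<close>
  have "(\<lambda>y. (indicator P y * f y - indicator P' y * f' y) * v y) = (\<lambda>y. h5 y + (h4 y + (h3 y - h2 y + h1 y)))"
  proof
    fix y
    show "(indicator P y * f y - indicator P' y * f' y) * v y = h5 y + (h4 y + (h3 y - h2 y + h1 y))"
      using QP by (cases "y \<in> P"; cases "y \<in> Q"; cases "y \<in> P'")
        (auto simp: h1_def h2_def h3_def h4_def h5_def algebra_simps)
  qed
  then have "(\<integral>y. (indicator P y * f y - indicator P' y * f' y) * v y \<partial>lborel)
     = (\<integral>y. h5 y \<partial>lborel) + ((\<integral>y. h4 y \<partial>lborel) + ((\<integral>y. h3 y \<partial>lborel) - (\<integral>y. h2 y \<partial>lborel) + (\<integral>y. h1 y \<partial>lborel)))"
    using h1 h2 h3 h4i h5i by (simp add: h5_def)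
  then have "norm (\<integral>y. h5 y \<partial>lborel) \<le> norm (\<integral>y. (indicator P y * f y - indicator P' y * f' y) * v y \<partial>lborel)
     + norm (\<integral>y. h4 y \<partial>lborel) + norm (\<integral>y. h3 y \<partial>lborel) + norm (\<integral>y. h2 y \<partial>lborel) + norm (\<integral>y. h1 y \<partial>lborel)"
    by (rule norm_le_five)
  moreover have "norm (\<integral>y. h5 y \<partial>lborel) \<ge> m0 * (J * (1 / (2 * T)) ^ ?n)"
    unfolding h5_def using main f0 J0 T0 by (simp add: norm_mult) (intro mult_mono; auto)
  moreover have "norm (\<integral>y. h4 y \<partial>lborel) \<le> J * (m0 * (1 / (2 * T)) ^ ?n / 2)"
    using h4 mult_left_mono[OF small less_imp_le[OF J0]] by (simp add: mult_ac)
  moreover have "(unit_ball_vol ?n * (\<kappa> / 2) ^ ?n) * (m0 * (1 / (2 * T)) ^ ?n / 2) \<le> J * (m0 * (1 / (2 * T)) ^ ?n / 2)"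
    using J(1) f0 T0 by (intro mult_right_mono) auto
  ultimately show ?thesis using h1 h2 h3 by (simp add: algebra_simps)
qed

subsection \<open>Corners of admissible shapes\<close>

text \<open>A proper face is the intersection of the facets that contain it. If only one facet
  passed through the vertex, it would equal the vertex, although its dimension is at least
  1.\<close>

lemma vertex_two_facets:
  fixes K :: "'a::euclidean_space set"
  assumes K: "polytope K" and x: "x extreme_point_of K" and d: "2 \<le> aff_dim K"
  obtains E1 E2 where "E1 facet_of K" "E2 facet_of K" "E1 \<noteq> E2" "x \<in> E1" "x \<in> E2"
proof -
  have ph: "polyhedron K" using K by (rule polytope_imp_polyhedron)
  have f: "{x} face_of K" using x by (simp add: face_of_singleton)
  have ne: "{x} \<noteq> K" using d by force
  have eq: "\<Inter>{F. F facet_of K \<and> {x} \<subseteq> F} = {x}" by (rule face_of_polyhedron[OF ph f _ ne, symmetric]) simp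
  have "{F. F facet_of K \<and> {x} \<subseteq> F} \<noteq> {}"
  proof
    assume "{F. F facet_of K \<and> {x} \<subseteq> F} = {}"
    \<comment> \<open>The intersection of the empty family is the whole type.\<close>
    then have "UNIV = {x}" using eq by (simp only: Inter_empty)
    then have "K \<subseteq> {x}" by blast
    then show False using d aff_dim_subset[of K "{x}"] by simp
  qed
  then obtain E1 where E1: "E1 facet_of K" "x \<in> E1" by auto
  have "\<exists>E2. E2 facet_of K \<and> x \<in> E2 \<and> E2 \<noteq> E1"
  proof (rule ccontr)
    assume *: "\<not> ?thesis"
    have all: "F = E1" if "F facet_of K" "x \<in> F" for F using * that by blast
    have "E1 \<subseteq> \<Inter>{F. F facet_of K \<and> {x} \<subseteq> F}"
    proof (rule Inter_greatest)
      fix F assume "F \<in> {F. F facet_of K \<and> {x} \<subseteq> F}"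
      then have "F = E1" by (intro all) simp_all
      then show "E1 \<subseteq> F" by simp
    qed
    then have "E1 \<subseteq> {x}" by (simp only: eq)
    then have "aff_dim E1 \<le> 0" using aff_dim_subset[of E1 "{x}"] by simp
    moreover have "aff_dim E1 = aff_dim K - 1" using E1(1) by (simp only: facet_of_def)
    ultimately show False using d by linarith
  qed
  then show ?thesis using E1 that by blast
qed

lemma mem_convex_3:
  assumes "convex S" "x \<in> S" "y \<in> S" "z \<in> S" "0 \<le> p" "0 \<le> q" "p + q \<le> 1"
  shows "(1 - p - q) *\<^sub>R x + p *\<^sub>R y + q *\<^sub>R z \<in> S"
proof -
  have "convex hull {x, y, z} \<subseteq> S" using assms by (intro hull_minimal) auto
  moreover have "(1 - p - q) *\<^sub>R x + p *\<^sub>R y + q *\<^sub>R z \<in> convex hull {x, y, z}"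
    unfolding convex_hull_3 using assms by (intro CollectI exI[of _ "1 - p - q"] exI[of _ p] exI[of _ q]) auto
  ultimately show ?thesis by blast
qed

text \<open>The other endpoint v lies on a second edge, which cannot contain x. The separation of x
  from that edge is at most |x - v|, so the edge from x to v has length at least l.\<close>

lemma polygon_edge:
  fixes K :: "'a::euclidean_space set"
  assumes K: "polytope K" and d: "aff_dim K = 2" and E: "E facet_of K" and x: "x extreme_point_of K" "x \<in> E"
    and sep: "\<And>v F. v extreme_point_of K \<Longrightarrow> F face_of K \<Longrightarrow> aff_dim F = 1 \<Longrightarrow> v \<notin> F \<Longrightarrow> l \<le> infdist v F"
  obtains v where "v \<noteq> x" "E = closed_segment x v" "l \<le> dist x v"
proof -
  have Ef: "E face_of K" "aff_dim E = 1" using E d by (auto simp: facet_of_def)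
  have Ep: "polytope E" using K Ef(1) by (rule face_of_polytope_polytope)
  have "collinear E" using Ef(2) by (simp add: collinear_aff_dim)
  then obtain a b where ab: "E = closed_segment a b"
    using compact_convex_collinear_segment[of E] polytope_imp_compact[OF Ep] polytope_imp_convex[OF Ep] x(2) by auto
  have "x extreme_point_of E" using x Ef(1) by (meson extreme_point_of_face)
  then have "x = a \<or> x = b" using ab by (simp add: extreme_point_of_segment)
  then obtain v where v: "E = closed_segment x v" using ab by (metis closed_segment_commute)
  have vx: "v \<noteq> x" using v Ef(2) by auto
  have vK: "v extreme_point_of K"
    using extreme_point_of_face[OF Ef(1), of v] v by (simp add: extreme_point_of_segment)
  obtain F1 F2 where F12: "F1 facet_of K" "F2 facet_of K" "F1 \<noteq> F2" "v \<in> F1" "v \<in> F2"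
    using vertex_two_facets[OF K vK] d by auto
  then obtain F where F: "F facet_of K" "v \<in> F" "F \<noteq> E" by metis
  have Ff: "F face_of K" "aff_dim F = 1" using F d by (auto simp: facet_of_def)
  have "x \<notin> F"
  proof
    assume "x \<in> F"
    then have "E \<subseteq> F" unfolding v using F(2) face_of_imp_convex[OF Ff(1)] by (simp add: closed_segment_subset)
    then have "E face_of F" using Ef(1) Ff(1) by (meson face_of_imp_subset face_of_subset)
    then have "aff_dim E < aff_dim F" using F(3) face_of_imp_convex[OF Ff(1)] by (intro face_of_aff_dim_lt) auto
    then show False using Ef Ff by simp
  qed
  then have "l \<le> infdist x F" using sep[OF x(1) Ff] by blast
  also have "\<dots> \<le> dist x v" using F(2) by (rule infdist_le)
  finally show ?thesis using that vx v by blast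
qed

lemma cos_vec_angle: "a \<noteq> 0 \<Longrightarrow> b \<noteq> 0 \<Longrightarrow> cos (vec_angle a b) = a \<bullet> b / (norm a * norm b)"
  using Cauchy_Schwarz_ineq2[of a b] unfolding vec_angle_def
  by (intro cos_arccos_abs) (simp add: abs_divide divide_le_eq)

lemma abs_cos_less_1:
  assumes "0 < y" "y < pi" shows "\<bar>cos y\<bar> < 1"
proof -
  have "0 < (sin y)\<^sup>2" using sin_gt_zero[OF assms] by simp
  then have "(cos y)\<^sup>2 < 1" using sin_cos_squared_add[of y] by linarith
  then show ?thesis by (simp add: abs_square_less_1)
qed

text \<open>\<open>L\<close> sends the basis to the unit edge vectors a and b. With q >= |a.b|, the
  identity |L s|^2 = |s|^2 + 2 s1 s2 (a.b) gives the lower bound (1 - q) |s|^2, and both inner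
  products with a + b equal 1 + a.b >= 1 - q; so kappa^2 = 1 - q serves for both conditions. The
  angle bounds keep q below 1.\<close>

lemma polygon_corner:
  fixes P :: "'a::euclidean_space set"
  assumes dim: "DIM('a) = 2" and P: "convex_polygon P" and l: "0 < l" "vertex_edge_sep P l"
    and am: "0 < lo" "lo < hi" "hi < pi" "angles_in P lo hi" and x: "x \<in> vertices P"
  shows "\<exists>L. corner (sqrt (1 - max \<bar>cos lo\<bar> \<bar>cos hi\<bar>)) (l / 2) P x L"
proof -
  obtain K where K: "polytope K" "P = interior K" "P \<noteq> {}" using P by (auto simp: convex_polygon_def)
  have cK: "convex K" "closed K" using K(1) by (auto simp: polytope_imp_convex polytope_imp_closed)
  have clP: "closure P = K" using convex_closure_interior[OF cK(1)] K cK by simp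
  have dK: "aff_dim K = 2" using K(2,3) dim by (simp add: aff_dim_nonempty_interior)
  have xK: "x extreme_point_of K" using x by (simp add: vertices_def clP)
  have sep: "l \<le> infdist v F" if "v extreme_point_of K" "F face_of K" "aff_dim F = 1" "v \<notin> F" for v F
    using l(2) that unfolding vertex_edge_sep_def vertices_def edges_def clP by blast
  obtain E1 E2 where E: "E1 facet_of K" "E2 facet_of K" "E1 \<noteq> E2" "x \<in> E1" "x \<in> E2"
    using vertex_two_facets[OF K(1) xK] dK by auto
  obtain v1 where v1: "v1 \<noteq> x" "E1 = closed_segment x v1" "l \<le> dist x v1"
    using polygon_edge[OF K(1) dK E(1) xK E(4) sep] by blast
  obtain v2 where v2: "v2 \<noteq> x" "E2 = closed_segment x v2" "l \<le> dist x v2"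
    using polygon_edge[OF K(1) dK E(2) xK E(5) sep] by blast
  define a where "a = (v1 - x) /\<^sub>R norm (v1 - x)"
  define b where "b = (v2 - x) /\<^sub>R norm (v2 - x)"
  have na: "norm a = 1" "norm b = 1" using v1(1) v2(1) by (auto simp: a_def b_def)
  have v1a: "v1 = x + dist x v1 *\<^sub>R a" "v2 = x + dist x v2 *\<^sub>R b"
    using v1(1) v2(1) by (auto simp: a_def b_def dist_norm norm_minus_commute)
  define q where "q = max \<bar>cos lo\<bar> \<bar>cos hi\<bar>"
  have edges: "E1 \<in> edges P" "E2 \<in> edges P" using E dK by (auto simp: edges_def clP facet_of_def)
  have "lo \<le> vec_angle (v1 - x) (v2 - x) \<and> vec_angle (v1 - x) (v2 - x) \<le> hi"
    using am(4) x edges E v1 v2 unfolding angles_in_def by auto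
  moreover have "a \<bullet> b = cos (vec_angle (v1 - x) (v2 - x))"
    using v1(1) v2(1) by (subst cos_vec_angle) (auto simp: a_def b_def divide_inverse mult_ac)
  ultimately obtain t where t: "lo \<le> t" "t \<le> hi" "a \<bullet> b = cos t" by blast
  have "cos t \<le> cos lo" "cos hi \<le> cos t" using t am by (auto intro!: cos_monotone_0_pi_le)
  then have abq: "\<bar>a \<bullet> b\<bar> \<le> q" unfolding t(3) q_def by linarith
  have q1: "q < 1"
    using abs_cos_less_1[of lo] abs_cos_less_1[of hi] am by (simp add: q_def)
  obtain b1 b2 :: 'a where B: "Basis = {b1, b2}" "b1 \<noteq> b2"
    using dim by (auto simp: card_2_iff)
  have bb: "b1 \<in> Basis" "b2 \<in> Basis" using B by auto
  have ib: "b1 \<bullet> b1 = 1" "b2 \<bullet> b2 = 1" "b1 \<bullet> b2 = 0" "b2 \<bullet> b1 = 0"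
    using bb B(2) by (auto simp: inner_Basis)
  define L where "L = (\<lambda>s. (s \<bullet> b1) *\<^sub>R a + (s \<bullet> b2) *\<^sub>R b)"
  have Lb: "L b1 = a" "L b2 = b" by (auto simp: L_def ib)
  have lin: "linear L" unfolding L_def by (intro linearI) (auto simp: algebra_simps inner_add_left)
  have nL: "(1 - q) * (norm s)\<^sup>2 \<le> (norm (L s))\<^sup>2" for s
  proof -
    have ns: "(norm s)\<^sup>2 = (s \<bullet> b1)\<^sup>2 + (s \<bullet> b2)\<^sup>2"
      using B(2) norm_sq_Basis[of s] by (simp add: B(1))
    have "(norm (L s))\<^sup>2 = (s \<bullet> b1)\<^sup>2 * (a \<bullet> a) + (s \<bullet> b2)\<^sup>2 * (b \<bullet> b) + 2 * ((s \<bullet> b1) * (s \<bullet> b2)) * (a \<bullet> b)"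
      unfolding L_def power2_norm_eq_inner by (simp add: inner_add_left inner_add_right inner_commute power2_eq_square algebra_simps)
    also have "\<dots> = (s \<bullet> b1)\<^sup>2 + (s \<bullet> b2)\<^sup>2 + 2 * ((s \<bullet> b1) * (s \<bullet> b2)) * (a \<bullet> b)"
      using na by (simp add: norm_eq_1)
    finally have e: "(norm (L s))\<^sup>2 = (norm s)\<^sup>2 + 2 * ((s \<bullet> b1) * (s \<bullet> b2)) * (a \<bullet> b)" by (simp add: ns)
    have "\<bar>2 * ((s \<bullet> b1) * (s \<bullet> b2))\<bar> \<le> (norm s)\<^sup>2"
      unfolding ns using sum_squares_bound[of "\<bar>s \<bullet> b1\<bar>" "\<bar>s \<bullet> b2\<bar>"] by (simp add: abs_mult mult.assoc)
    then have "\<bar>2 * ((s \<bullet> b1) * (s \<bullet> b2)) * (a \<bullet> b)\<bar> \<le> (norm s)\<^sup>2 * q"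
      unfolding abs_mult[of _ "a \<bullet> b"] by (intro mult_mono abq) auto
    then show ?thesis unfolding e by (simp add: left_diff_distrib mult.commute)
  qed
  have k0: "0 < sqrt (1 - q)" using q1 by simp
  have nL': "sqrt (1 - q) * norm s \<le> norm (L s)" for s

  proof (rule power2_le_imp_le)
    show "(sqrt (1 - q) * norm s)\<^sup>2 \<le> (norm (L s))\<^sup>2" using nL[of s] q1 by (simp add: power_mult_distrib)
  qed simp
  have inj: "inj L"
  proof (rule injI)
    fix y z assume "L y = L z"
    then have "sqrt (1 - q) * norm (y - z) \<le> 0" using nL'[of "y - z"] by (simp add: linear_diff[OF lin])
    then show "y = z" using k0 by (simp add: mult_le_0_iff)
  qed
  have surj: "surj L" using lin inj by (simp add: linear_injective_imp_surjective)
  \<comment> \<open>The edge F in direction a' lies on a supporting line with normal n. Then n.a' =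
    0, and n.a'' <= 0 because the other edge belongs to K; equality would make n orthogonal to
    everything. So the coordinate along a'' is nonnegative on K. It is applied once for each
    edge.\<close>
  have half: "0 \<le> s \<bullet> b''" if F: "F facet_of K" "x \<in> F" "v \<in> F" "v \<noteq> x" and vw: "v = x + r *\<^sub>R a'" "w = x + r' *\<^sub>R a''" "0 < r'" "0 < r" "w \<in> K" and y: "x + L s \<in> K"
     and Ls: "\<And>s. L s = (s \<bullet> b') *\<^sub>R a' + (s \<bullet> b'') *\<^sub>R a''" for F v w r r' a' a'' b' b'' s
  proof -
    have "F exposed_face_of K" using F(1) K(1) by (meson exposed_face_of_polyhedron facet_of_imp_face_of polytope_imp_polyhedron)
    moreover have "F \<noteq> K" using F(1) by (auto simp: facet_of_def)
    ultimately obtain n c where nc: "n \<noteq> 0" "K \<subseteq> {z. n \<bullet> z \<le> c}" "F = K \<inter> {z. n \<bullet> z = c}"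
      using F(2) unfolding exposed_face_of by blast
    have xc: "n \<bullet> x = c" using F(2) nc by auto
    have "n \<bullet> v = c" using F(3) nc by auto
    then have na': "n \<bullet> a' = 0" using vw xc by (simp add: inner_add_right)
    have "n \<bullet> w \<le> c" using vw nc by auto
    then have le: "n \<bullet> a'' \<le> 0" using vw xc by (simp add: inner_add_right mult_le_0_iff)
    have "n \<bullet> a'' \<noteq> 0"
    proof
      assume "n \<bullet> a'' = 0"
      moreover obtain s where "n = L s" using surj by (metis surjD)
      ultimately have "n \<bullet> n = 0" using na' by (metis Ls inner_add_right inner_scaleR_right mult_zero_right add_0)
      then show False using nc(1) by simp
    qed
    moreover have "(s \<bullet> b'') * (n \<bullet> a'') \<le> 0"
      using y nc(2) xc na' by (auto simp: Ls inner_add_right)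
    ultimately show ?thesis using le by (simp add: mult_le_0_iff)
  qed
  have dpos: "0 < dist x v1" "0 < dist x v2" using v1 v2 l by linarith+
  have vE: "v1 \<in> E1" "v2 \<in> E2" using v1 v2 by auto
  have vKK: "v1 \<in> K" "v2 \<in> K" using vE E facet_of_imp_subset by blast+
  have xKK: "x \<in> K" using xK by (simp add: extreme_point_of_def)
  have orth: "\<exists>s. (\<forall>b\<in>Basis. 0 \<le> s \<bullet> b) \<and> y = x + L s" if y: "y \<in> P" for y
  proof -
    have yK: "y \<in> K" using y K(2) interior_subset by blast
    obtain s where s: "L s = y - x" using surj by (metis surjD)
    then have ys: "x + L s \<in> K" using yK by simp
    have "0 \<le> s \<bullet> b2"
      by (rule half[where b'=b1 and b''=b2, OF E(1,4) vE(1) v1(1) v1a dpos(2,1) vKK(2) ys]) (rule L_def[THEN fun_cong])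
    moreover have "0 \<le> s \<bullet> b1"
      by (rule half[where b'=b2 and b''=b1, OF E(2,5) vE(2) v2(1) v1a(2,1) dpos(1,2) vKK(1) ys]) (simp add: L_def add.commute)
    ultimately show ?thesis using s B(1) by (intro exI[of _ s]) auto
  qed
  have box: "x + L s \<in> P" if s: "\<forall>b\<in>Basis. 0 < s \<bullet> b \<and> s \<bullet> b < l / 2" for s
  proof -
    let ?U = "(+) x ` (L ` box 0 ((l/2) *\<^sub>R One))"
    have op: "open ?U" using open_surjective_linear_image[OF open_box lin surj] by (rule open_translation)
    have "?U \<subseteq> K"
    proof clarsimp
      fix s :: 'a assume s: "s \<in> box 0 ((l/2) *\<^sub>R One)"
      \<comment> \<open>The edges have length at least l and the coordinates are below l/2, so p and
        r are at most 1/2 and x + L s lies in the triangle with corners x, v1, v2. This is the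
        origin of l/2.\<close>
      define p where "p = (s \<bullet> b1) / dist x v1"
      define r where "r = (s \<bullet> b2) / dist x v2"
      have s12: "0 < s \<bullet> b1" "s \<bullet> b1 < l/2" "0 < s \<bullet> b2" "s \<bullet> b2 < l/2" using s bb by (auto simp: mem_box)
      have p: "0 \<le> p" "p \<le> 1/2" "0 \<le> r" "r \<le> 1/2"
        using s12 v1(3) v2(3) dpos by (auto simp: p_def r_def divide_le_eq)
      have "x + L s = (1 - p - r) *\<^sub>R x + p *\<^sub>R v1 + r *\<^sub>R v2"
      proof -
        have "p *\<^sub>R v1 = p *\<^sub>R x + (s \<bullet> b1) *\<^sub>R a" using dpos by (subst v1a(1)) (simp add: p_def scaleR_add_right)
        moreover have "r *\<^sub>R v2 = r *\<^sub>R x + (s \<bullet> b2) *\<^sub>R b" using dpos by (subst v1a(2)) (simp add: r_def scaleR_add_right)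
        ultimately show ?thesis by (simp add: L_def algebra_simps)
      qed
      also have "\<dots> \<in> K" using p by (intro mem_convex_3[OF cK(1) xKK vKK]) auto
      finally show "x + L s \<in> K" .
    qed
    then have "?U \<subseteq> P" unfolding K(2) using op by (rule interior_maximal)
    moreover have "x + L s \<in> ?U" using s by (intro imageI) (auto simp: mem_box)
    ultimately show ?thesis by blast
  qed
  have LOne: "L One = a + b" using B(2) by (simp add: B(1) linear_add[OF lin] Lb)
  have LO: "1 - q \<le> L One \<bullet> L b'" if "b' \<in> Basis" for b'
  proof -
    have "(a + b) \<bullet> a = 1 + a \<bullet> b" "(a + b) \<bullet> b = 1 + a \<bullet> b"
      using na by (simp_all add: inner_add_left norm_eq_1 inner_commute[of b a])
    moreover have "b' = b1 \<or> b' = b2" using that B(1) by blast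
    ultimately show ?thesis using abq by (auto simp: Lb LOne)
  qed
  have nLb: "norm (L b') = 1" if "b' \<in> Basis" for b'
  proof -
    have "b' = b1 \<or> b' = b2" using that B(1) by blast
    then show ?thesis using na by (auto simp: Lb)
  qed
  show ?thesis
    using lin nLb nL' LO orth box k0 q1 unfolding corner_def q_def[symmetric] by (intro exI[of _ L]) auto
qed

lemma cuboid_orthogonal:
  fixes P :: "'a::euclidean_space set"
  assumes dim: "DIM('a) = 3" and P: "cuboid P"
  obtains t U h where "orthogonal_transformation U" "\<And>b::'a. b \<in> Basis \<Longrightarrow> 0 < (h b :: real)"
    "P = (\<lambda>s. t + U s) ` box 0 (\<Sum>b\<in>Basis. h b *\<^sub>R b)"
proof -
  obtain t u1 u2 u3 a b c where pos: "0 < a" "0 < b" "0 < c" and u: "norm u1 = 1" "norm u2 = 1" "norm u3 = 1"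
     "u1 \<bullet> u2 = 0" "u1 \<bullet> u3 = 0" "u2 \<bullet> u3 = 0"
     and Peq: "P = {t + x1 *\<^sub>R u1 + x2 *\<^sub>R u2 + x3 *\<^sub>R u3 | x1 x2 x3.
            0 < x1 \<and> x1 < a \<and> 0 < x2 \<and> x2 < b \<and> 0 < x3 \<and> x3 < c}"
    using P unfolding cuboid_def by blast
  obtain b1 b2 b3 :: 'a where B: "Basis = {b1, b2, b3}" "b1 \<noteq> b2" "b1 \<noteq> b3" "b2 \<noteq> b3"
    using dim by (auto simp: card_3_iff)
  have bb: "b1 \<in> Basis" "b2 \<in> Basis" "b3 \<in> Basis" using B by auto
  have ib: "b1 \<bullet> b1 = 1" "b2 \<bullet> b2 = 1" "b3 \<bullet> b3 = 1" "b1 \<bullet> b2 = 0" "b2 \<bullet> b1 = 0" "b1 \<bullet> b3 = 0" "b3 \<bullet> b1 = 0" "b2 \<bullet> b3 = 0" "b3 \<bullet> b2 = 0"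
    using bb B(2-4) by (auto simp: inner_Basis)
  have BS: "(\<Sum>b\<in>Basis. f b) = f b1 + f b2 + f b3" for f :: "'a \<Rightarrow> 'b::ab_group_add"
    by (simp add: B add.assoc)
  define U where "U = (\<lambda>s. (s \<bullet> b1) *\<^sub>R u1 + (s \<bullet> b2) *\<^sub>R u2 + (s \<bullet> b3) *\<^sub>R u3)"
  have lin: "linear U" unfolding U_def by (intro linearI) (auto simp: algebra_simps inner_add_left)
  have "U v \<bullet> U w = v \<bullet> w" for v w
  proof -
    have uu: "u1 \<bullet> u1 = 1" "u2 \<bullet> u2 = 1" "u3 \<bullet> u3 = 1" "u2 \<bullet> u1 = 0" "u3 \<bullet> u1 = 0" "u3 \<bullet> u2 = 0"
      using u by (auto simp: norm_eq_1 inner_commute)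
    have "v \<bullet> w = (v \<bullet> b1) * (w \<bullet> b1) + (v \<bullet> b2) * (w \<bullet> b2) + (v \<bullet> b3) * (w \<bullet> b3)"
      by (subst euclidean_inner) (simp add: BS)
    then show ?thesis unfolding U_def using u uu by (simp add: inner_add_left inner_add_right)
  qed
  then have oU: "orthogonal_transformation U" using lin by (simp add: orthogonal_transformation_def)
  define h where "h = (\<lambda>x. if x = b1 then a else if x = b2 then b else c)"
  have hb: "h b1 = a" "h b2 = b" "h b3 = c" using B by (auto simp: h_def)
  have box: "box 0 (\<Sum>b\<in>Basis. h b *\<^sub>R b) = {s. 0 < s \<bullet> b1 \<and> s \<bullet> b1 < a \<and> 0 < s \<bullet> b2 \<and> s \<bullet> b2 < b \<and> 0 < s \<bullet> b3 \<and> s \<bullet> b3 < c}"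
  proof -
    have "(\<forall>b\<in>Basis. Q b) \<longleftrightarrow> Q b1 \<and> Q b2 \<and> Q b3" for Q by (simp add: B(1))
    moreover have "(\<Sum>b\<in>Basis. h b *\<^sub>R b) \<bullet> b' = h b'" if "b' \<in> Basis" for b' using that by simp
    ultimately show ?thesis by (intro set_eqI) (simp only: mem_box mem_Collect_eq bb hb inner_zero_left conj_assoc)
  qed
  have "P = (\<lambda>s. t + U s) ` box 0 (\<Sum>b\<in>Basis. h b *\<^sub>R b)"
  proof (intro equalityI subsetI)
    fix y assume "y \<in> P"
    then have "\<exists>x1 x2 x3. y = t + x1 *\<^sub>R u1 + x2 *\<^sub>R u2 + x3 *\<^sub>R u3 \<and>
      0 < x1 \<and> x1 < a \<and> 0 < x2 \<and> x2 < b \<and> 0 < x3 \<and> x3 < c" unfolding Peq by (rule CollectD)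
    then obtain x1 x2 x3 where y: "y = t + x1 *\<^sub>R u1 + x2 *\<^sub>R u2 + x3 *\<^sub>R u3" "0 < x1" "x1 < a" "0 < x2" "x2 < b" "0 < x3" "x3 < c"
      by (elim exE conjE)
    define s where "s = x1 *\<^sub>R b1 + x2 *\<^sub>R b2 + x3 *\<^sub>R b3"
    have "s \<bullet> b1 = x1" "s \<bullet> b2 = x2" "s \<bullet> b3 = x3" by (auto simp: s_def inner_add_left ib)
    then have "y = t + U s" "s \<in> box 0 (\<Sum>b\<in>Basis. h b *\<^sub>R b)"
      unfolding box using y by (simp_all add: U_def add.assoc)
    then show "y \<in> (\<lambda>s. t + U s) ` box 0 (\<Sum>b\<in>Basis. h b *\<^sub>R b)" by (rule image_eqI)
  next
    fix y assume "y \<in> (\<lambda>s. t + U s) ` box 0 (\<Sum>b\<in>Basis. h b *\<^sub>R b)"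
    then obtain s where s: "y = t + U s" "s \<in> box 0 (\<Sum>b\<in>Basis. h b *\<^sub>R b)" by blast
    have "y = t + (s \<bullet> b1) *\<^sub>R u1 + (s \<bullet> b2) *\<^sub>R u2 + (s \<bullet> b3) *\<^sub>R u3" unfolding s(1) U_def by (simp only: add.assoc)
    then show "y \<in> P" unfolding Peq using s(2)[unfolded box mem_Collect_eq]
      by (intro CollectI exI[of _ "s \<bullet> b1"] exI[of _ "s \<bullet> b2"] exI[of _ "s \<bullet> b3"]) (rule conjI)
  qed
  moreover have "0 < h b'" if "b' \<in> Basis" for b' using pos by (simp add: h_def)
  ultimately show ?thesis using that oU by blast
qed

text \<open>Here the edges are orthonormal, so kappa = 1. The map is the rotation of the cuboid
  preceded by reflections in those axes along which the vertex sits at the far end.\<close>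

lemma cuboid_corner:
  fixes P :: "'a::euclidean_space set"
  assumes dim: "DIM('a) = 3" and P: "cuboid P" and l: "0 < l" "vertex_edge_sep P l" and x: "x \<in> vertices P"
  shows "\<exists>L. corner 1 (l / 2) P x L"
proof -
  obtain t U h where U: "orthogonal_transformation U" and h: "\<And>b::'a. b \<in> Basis \<Longrightarrow> 0 < (h b :: real)"
    and Peq: "P = (\<lambda>s. t + U s) ` box 0 (\<Sum>b\<in>Basis. h b *\<^sub>R b)"
    using cuboid_orthogonal[OF dim P] by blast
  let ?h = "\<Sum>b\<in>Basis. h b *\<^sub>R b"
  have lin: "linear U" and UU: "\<And>v w. U v \<bullet> U w = v \<bullet> w" using U by (auto simp: orthogonal_transformation_def)
  have inj: "inj U" using U by (rule orthogonal_transformation_inj)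
  have hb: "?h \<bullet> b = h b" if "b \<in> Basis" for b using that by simp
  have bne: "box 0 ?h \<noteq> {}" using h by (simp add: box_ne_empty)
  have cl: "closure P = (\<lambda>s. t + U s) ` cbox 0 ?h"
  proof -
    have "P = (+) t ` (U ` box 0 ?h)" unfolding Peq by (simp add: image_image)
    then have "closure P = (+) t ` (U ` closure (box 0 ?h))"
      by (simp add: closure_translation closure_injective_linear_image[OF lin inj])
    then show ?thesis using closure_box[OF bne] by (simp add: image_image)
  qed
  let ?K = "closure P"
  have mem: "t + U s \<in> ?K \<longleftrightarrow> s \<in> cbox 0 ?h" for s
    unfolding cl by (auto dest: injD[OF inj])
  have coord: "U b \<bullet> (t + U s) = U b \<bullet> t + s \<bullet> b" for b s by (simp add: inner_add_right UU inner_commute)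
  have face: "?K \<inter> {y. U b \<bullet> y = U b \<bullet> t + c} face_of ?K" if b: "b \<in> Basis" and c: "c = 0 \<or> c = h b" for b c
  proof -
    have conv: "convex ?K" unfolding Peq image_image[symmetric, of "(+) t" U]
      by (intro convex_closure convex_translation convex_linear_image lin convex_box)
    have "U b \<bullet> t \<le> U b \<bullet> y" "U b \<bullet> y \<le> U b \<bullet> t + h b" if "y \<in> ?K" for y
      using that b unfolding cl by (auto simp: coord mem_box hb)
    then show ?thesis using c conv
      by (auto intro: face_of_Int_supporting_hyperplane_le face_of_Int_supporting_hyperplane_ge)
  qed
  obtain p where p: "x = t + U p" "p \<in> cbox 0 ?h"
    using x unfolding vertices_def extreme_point_of_def cl by auto
  have pb: "0 \<le> p \<bullet> b" "p \<bullet> b \<le> h b" if "b \<in> Basis" for b using p(2) that by (auto simp: mem_box hb)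
  \<comment> \<open>A coordinate strictly between its bounds could be moved both ways, which would
    make the vertex the midpoint of a segment in the closure.\<close>
  have ends: "p \<bullet> b = 0 \<or> p \<bullet> b = h b" if b: "b \<in> Basis" for b
  proof (rule ccontr)
    assume "\<not> ?thesis"
    then have s: "0 < p \<bullet> b" "p \<bullet> b < h b" using pb[OF b] by auto
    define \<delta> where "\<delta> = min (p \<bullet> b) (h b - p \<bullet> b)"
    have \<delta>: "0 < \<delta>" "\<delta> \<le> p \<bullet> b" "p \<bullet> b + \<delta> \<le> h b" using s by (auto simp: \<delta>_def)
    have "p + e *\<^sub>R b \<in> cbox 0 ?h" if "\<bar>e\<bar> = \<delta>" for e
    proof -
      have "0 \<le> (p + e *\<^sub>R b) \<bullet> b' \<and> (p + e *\<^sub>R b) \<bullet> b' \<le> h b'" if "b' \<in> Basis" for b'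
        using pb[OF that] \<delta> \<open>\<bar>e\<bar> = \<delta>\<close> b that by (auto simp: inner_add_left inner_Basis)
      then show ?thesis by (simp add: mem_box hb)
    qed
    then have "t + U (p + (- \<delta>) *\<^sub>R b) \<in> ?K" "t + U (p + \<delta> *\<^sub>R b) \<in> ?K" using \<delta>(1) by (simp_all add: mem del: scaleR_minus_left)
    moreover have "x \<in> open_segment (t + U (p + (- \<delta>) *\<^sub>R b)) (t + U (p + \<delta> *\<^sub>R b))"
    proof -
      have "U b \<noteq> 0" using UU[of b b] b by auto
      then have "t + U (p + (- \<delta>) *\<^sub>R b) \<noteq> t + U (p + \<delta> *\<^sub>R b)" using \<delta>(1)
        by (simp add: linear_add[OF lin] linear_cmul[OF lin] del: scaleR_minus_left add_uminus_conv_diff)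
      moreover have "x = midpoint (t + U (p + (- \<delta>) *\<^sub>R b)) (t + U (p + \<delta> *\<^sub>R b))"
        unfolding midpoint_def p(1) by (simp add: linear_add[OF lin] linear_diff[OF lin] linear_cmul[OF lin] scaleR_add_right scaleR_right_diff_distrib flip: scaleR_2)
      ultimately show ?thesis by (metis midpoint_in_open_segment)
    qed
    ultimately show False using x unfolding vertices_def extreme_point_of_def by blast
  qed
  \<comment> \<open>Side b joins the vertex to its mirror image q in that coordinate. The edge
    through q in another direction c misses the vertex and is at distance at most h b from it, so
    the separation of vertices and edges bounds h b from below.\<close>
  have side: "l \<le> h b" if b: "b \<in> Basis" for b
  proof -
    obtain c where c: "c \<in> Basis" "c \<noteq> b"
    proof -
      have "card (Basis - {b}) = 2" using b dim by simp
      then have "Basis - {b} \<noteq> {}" by (metis card.empty zero_neq_numeral)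
      then show ?thesis using that by blast
    qed
    define q where "q = p + (h b - 2 * (p \<bullet> b)) *\<^sub>R b"
    have qb: "q \<bullet> b = h b - p \<bullet> b" "\<And>b'. b' \<in> Basis \<Longrightarrow> b' \<noteq> b \<Longrightarrow> q \<bullet> b' = p \<bullet> b'"
      using b by (auto simp: q_def inner_add_left inner_Basis)
    have qends: "q \<bullet> b' = 0 \<or> q \<bullet> b' = h b'" if "b' \<in> Basis" for b'
      using ends[OF that] qb that by (cases "b' = b") auto
    define E where "E = \<Inter>((\<lambda>b'. ?K \<inter> {y. U b' \<bullet> y = U b' \<bullet> t + q \<bullet> b'}) ` (Basis - {c}))"
    have bc: "b \<in> Basis - {c}" using b c by auto
    have Ef: "E face_of ?K" unfolding E_def
      by (rule face_of_Inter) (use bc face qends in auto)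
    define q0 where "q0 = q - (q \<bullet> c) *\<^sub>R c"
    have Ememb: "t + U s \<in> E \<longleftrightarrow> s \<in> cbox 0 ?h \<and> (\<forall>b'\<in>Basis - {c}. s \<bullet> b' = q \<bullet> b')" for s
      unfolding E_def using bc by (auto simp: mem coord)
    have qbox: "q \<in> cbox 0 ?h" using qends h by (auto simp: mem_box hb less_imp_le) (metis less_imp_le order_refl)+
    have Eeq: "E = closed_segment (t + U q0) (t + U (q0 + h c *\<^sub>R c))"
    proof (intro equalityI subsetI)
      fix y assume y: "y \<in> E"
      then have "y \<in> ?K" using Ef face_of_imp_subset by blast
      then obtain s where s: "y = t + U s" unfolding cl by blast
      then have ss: "s \<in> cbox 0 ?h" "\<forall>b'\<in>Basis - {c}. s \<bullet> b' = q \<bullet> b'" using y Ememb by auto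
      have sq: "s = q0 + (s \<bullet> c) *\<^sub>R c"
        by (rule euclidean_eqI) (use ss(2) c in \<open>auto simp: q0_def inner_diff_left inner_add_left inner_Basis\<close>)
      have "U s = U q0 + (s \<bullet> c) *\<^sub>R U c" using arg_cong[OF sq, of U] by (simp only: linear_add[OF lin] linear_cmul[OF lin])
      then have "y = (1 - (s \<bullet> c) / h c) *\<^sub>R (t + U q0) + ((s \<bullet> c) / h c) *\<^sub>R (t + U (q0 + h c *\<^sub>R c))"
        unfolding s using h[OF c(1)] by (simp add: linear_add[OF lin] linear_cmul[OF lin] algebra_simps)
      moreover have "0 \<le> (s \<bullet> c) / h c" "(s \<bullet> c) / h c \<le> 1" using ss(1) c(1) h[OF c(1)] by (auto simp: mem_box hb)
      ultimately show "y \<in> closed_segment (t + U q0) (t + U (q0 + h c *\<^sub>R c))" unfolding closed_segment_def by blast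
    next
      fix y assume "y \<in> closed_segment (t + U q0) (t + U (q0 + h c *\<^sub>R c))"
      then obtain r where r: "0 \<le> r" "r \<le> 1" "y = (1 - r) *\<^sub>R (t + U q0) + r *\<^sub>R (t + U (q0 + h c *\<^sub>R c))"
        unfolding closed_segment_def by blast
      then have y: "y = t + U (q0 + (r * h c) *\<^sub>R c)" by (simp add: linear_add[OF lin] linear_cmul[OF lin] algebra_simps)
      have rh: "0 \<le> r * h c" "r * h c \<le> h c" using r h[OF c(1)] by (auto simp: mult_left_le_one_le)
      show "y \<in> E" unfolding y Ememb using qbox c(1) rh
        by (auto simp: mem_box hb q0_def inner_diff_left inner_add_left inner_Basis)
    qed
    have "U c \<noteq> 0" using UU[of c c] c(1) by auto
    then have "t + U q0 \<noteq> t + U (q0 + h c *\<^sub>R c)" using h[OF c(1)] by (simp add: linear_add[OF lin] linear_cmul[OF lin])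
    then have "aff_dim E = 1" unfolding Eeq segment_convex_hull aff_dim_convex_hull by (simp add: aff_dim_2)
    then have "E \<in> edges P" using Ef by (simp add: edges_def)
    moreover have "x \<notin> E"
    proof -
      have "p \<bullet> b \<noteq> q \<bullet> b" using ends[OF b] qb(1) h[OF b] by auto
      then show ?thesis unfolding p(1) Ememb using bc by blast
    qed
    ultimately have "l \<le> infdist x E" using l(2) x unfolding vertex_edge_sep_def by blast
    also have "\<dots> \<le> dist x (t + U q)" using qbox by (intro infdist_le) (simp add: Ememb)
    also have "\<dots> = norm (U (p - q))" by (simp add: p(1) dist_norm linear_diff[OF lin])
    also have "\<dots> = norm (p - q)" using U by (simp add: orthogonal_transformation_norm)
    also have "\<dots> = h b" using ends[OF b] b h[OF b] by (auto simp: q_def)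
    finally show ?thesis .
  qed
  \<comment> \<open>The sign is -1 exactly for the coordinates in which the vertex is at the far
    end; there the inward edge points backwards.\<close>
  define \<sigma> where "\<sigma> = (\<lambda>b. if p \<bullet> b = 0 then 1 else - 1 :: real)"
  have s1: "\<sigma> b * \<sigma> b = 1" "\<sigma> b = 1 \<or> \<sigma> b = -1" for b by (auto simp: \<sigma>_def)
  define W where "W = (\<lambda>s::'a. \<Sum>b\<in>Basis. (\<sigma> b * (s \<bullet> b)) *\<^sub>R b)"
  have Wb: "W s \<bullet> b = \<sigma> b * (s \<bullet> b)" if "b \<in> Basis" for s b using that by (simp add: W_def)
  have linW: "linear W" unfolding W_def
    by (intro linear_compose_sum ballI linearI) (auto simp: algebra_simps inner_add_left)
  have WW: "W v \<bullet> W w = v \<bullet> w" for v w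
  proof -
    have "W v \<bullet> W w = (\<Sum>b\<in>Basis. (\<sigma> b * \<sigma> b) * ((v \<bullet> b) * (w \<bullet> b)))"
      by (subst euclidean_inner) (auto intro!: sum.cong simp: Wb)
    then show ?thesis by (simp add: s1 euclidean_inner[of v w])
  qed
  define L where "L = U \<circ> W"
  have linL: "linear L" unfolding L_def using linW lin by (rule linear_compose)
  have LL: "L v \<bullet> L w = v \<bullet> w" for v w by (simp add: L_def UU WW)
  have nL: "norm (L v) = norm v" for v by (simp add: norm_eq_sqrt_inner LL)
  have LxU: "x + L s = t + U (p + W s)" for s by (simp add: L_def p(1) linear_add[OF lin])
  have orth: "\<exists>s. (\<forall>b\<in>Basis. 0 \<le> s \<bullet> b) \<and> y = x + L s" if y: "y \<in> P" for y
  proof -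
    obtain r where r: "y = t + U r" "r \<in> box 0 ?h" using y unfolding Peq by blast
    define s where "s = W (r - p)"
    have "W s = r - p" by (rule euclidean_eqI) (simp add: s_def Wb s1 flip: mult.assoc)
    then have "y = x + L s" unfolding LxU r by simp
    moreover have "0 \<le> s \<bullet> b" if b: "b \<in> Basis" for b
      using ends[OF b] r(2) b h[OF b] by (auto simp: s_def Wb \<sigma>_def mem_box hb inner_diff_left less_imp_le)
    ultimately show ?thesis by blast
  qed
  have box: "x + L s \<in> P" if s: "\<forall>b\<in>Basis. 0 < s \<bullet> b \<and> s \<bullet> b < l / 2" for s
  proof -
    have "0 < (p + W s) \<bullet> b \<and> (p + W s) \<bullet> b < h b" if b: "b \<in> Basis" for b
    proof -
      have "0 < s \<bullet> b" "s \<bullet> b < h b" using s b side[OF b] l(1) by (auto dest!: bspec[of _ _ b])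
      then show ?thesis using ends[OF b] b h[OF b] by (auto simp: inner_add_left Wb \<sigma>_def)
    qed
    then have "p + W s \<in> box 0 ?h" by (simp add: mem_box hb)
    then show ?thesis unfolding LxU Peq by (rule imageI)
  qed
  show ?thesis using linL nL LL orth box unfolding corner_def by (intro exI[of _ L]) auto
qed

subsection \<open>The vertex farthest from the other shape\<close>

lemma admissible_shape_corner:
  fixes P :: "'a::euclidean_space set"
  assumes dim: "DIM('a) = 2 \<or> DIM('a) = 3" and P: "admissible_shape R P" and l: "0 < l" "vertex_edge_sep P l"
    and am: "DIM('a) = 2 \<Longrightarrow> 0 < lo \<and> lo < hi \<and> hi < pi \<and> angles_in P lo hi" and x: "x \<in> vertices P"
  shows "\<exists>L. corner (if DIM('a) = 2 then sqrt (1 - max \<bar>cos lo\<bar> \<bar>cos hi\<bar>) else 1) (l / 2) P x L"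
proof (cases "DIM('a) = 2")
  case True
  then show ?thesis using polygon_corner[OF True _ l _ _ _ _ x] am P by (auto simp: admissible_shape_def)
next
  case False
  then have "DIM('a) = 3" using dim by simp
  then show ?thesis using cuboid_corner[OF _ _ l x] P by (auto simp: admissible_shape_def)
qed

lemma admissible_shape_convex:
  fixes P :: "'a::euclidean_space set"
  assumes dim: "DIM('a) = 2 \<or> DIM('a) = 3" and P: "admissible_shape R P"
  shows "open P" "convex P" "P \<noteq> {}" "P \<subseteq> ball 0 R"
proof -
  have "open P \<and> convex P \<and> P \<noteq> {}"
  proof (cases "DIM('a) = 2")
    case True
    then obtain K where "polytope K" "P = interior K" "P \<noteq> {}" using P unfolding admissible_shape_def convex_polygon_def by metis
    then show ?thesis using convex_interior[OF polytope_imp_convex] by simp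
  next
    case False
    then have d: "DIM('a) = 3" and cP: "cuboid P" using dim P by (auto simp: admissible_shape_def)
    obtain t U h where U: "orthogonal_transformation U" and h: "\<And>b::'a. b \<in> Basis \<Longrightarrow> 0 < (h b :: real)"
      and Peq: "P = (\<lambda>s. t + U s) ` box 0 (\<Sum>b\<in>Basis. h b *\<^sub>R b)"
      using cuboid_orthogonal[OF d cP] by blast
    have lin: "linear U" "surj U" using U by (simp_all add: orthogonal_transformation_linear orthogonal_transformation_surj)
    have Peq': "P = (+) t ` (U ` box 0 (\<Sum>b\<in>Basis. h b *\<^sub>R b))" unfolding Peq by (simp add: image_image)
    have "open P" unfolding Peq' by (rule open_translation[OF open_surjective_linear_image[OF open_box lin]])
    moreover have "convex P" unfolding Peq' by (rule convex_translation[OF convex_linear_image[OF lin(1) convex_box(2)]])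
    moreover have "box 0 (\<Sum>b\<in>Basis. h b *\<^sub>R b) \<noteq> ({} :: 'a set)" using h by (simp add: box_ne_empty)
    then have "P \<noteq> {}" unfolding Peq' by blast
    ultimately show ?thesis by simp
  qed
  then show "open P" "convex P" "P \<noteq> {}" by auto
  show "P \<subseteq> ball 0 R" using P by (simp add: admissible_shape_def)
qed

text \<open>The maximal distance may be attained at a point xm that is not a vertex. The nearest
  point of P' to xm supplies a separating direction e, and maximality shows that e also supports P
  at xm; any extreme point of the supported face is a vertex of P at the same height above
  P'.\<close>

lemma farthest_vertex:
  fixes P P' :: "'a::euclidean_space set"
  assumes P: "bounded P" "convex P" "P \<noteq> {}" and P': "convex P'" "P' \<noteq> {}"
    and h: "0 < (SUP x\<in>P. infdist x P')"
  obtains xc e where "xc \<in> vertices P" "norm e = 1" "\<And>x. x \<in> closure P \<Longrightarrow> e \<bullet> (x - xc) \<le> 0"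
    "\<And>y. y \<in> P' \<Longrightarrow> e \<bullet> (y - xc) \<le> - (SUP x\<in>P. infdist x P')"
proof -
  let ?h = "SUP x\<in>P. infdist x P'"
  let ?K = "closure P"
  have K: "compact ?K" "convex ?K" "?K \<noteq> {}" using P by (auto intro: convex_closure)
  have "continuous_on ?K (\<lambda>x. infdist x P')" by (intro continuous_on_infdist continuous_on_id)
  then obtain xm where xm: "xm \<in> ?K" "\<And>x. x \<in> ?K \<Longrightarrow> infdist x P' \<le> infdist xm P'"
    using continuous_attains_sup[OF K(1,3), of "\<lambda>x. infdist x P'"] by blast
  have hm: "?h \<le> infdist xm P'"
    by (rule cSUP_least[OF P(3)]) (use xm(2) closure_subset in blast)
  have cP': "closed (closure P')" "convex (closure P')" "closure P' \<noteq> {}" using P' by (auto intro: convex_closure)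
  obtain x0 where x0: "x0 \<in> closure P'" "infdist xm (closure P') = dist xm x0"
    using infdist_attains_inf[OF cP'(1,3)] by blast
  have dm: "infdist xm P' = dist xm x0" using x0(2) by (simp add: infdist_eq_setdist)
  define d where "d = dist xm x0"
  have d: "0 < d" "?h \<le> d" using hm h dm by (auto simp: d_def)
  define e where "e = (xm - x0) /\<^sub>R d"
  have ne: "norm e = 1" using d by (simp add: e_def d_def dist_norm)
  have exm: "e \<bullet> (xm - x0) = d"
  proof -
    have "(xm - x0) \<bullet> (xm - x0) = d * d" unfolding d_def dist_norm by (simp only: dot_square_norm power2_eq_square)
    then show ?thesis using d by (simp add: e_def)
  qed
  have half: "e \<bullet> (y - x0) \<le> 0" if y: "y \<in> closure P'" for y
  proof -
    have "dist xm x0 \<le> dist xm z" if "z \<in> closure P'" for z using x0(2) infdist_le[OF that, of xm] by simp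
    then have "(xm - x0) \<bullet> (y - x0) \<le> 0" using any_closest_point_dot[OF cP'(2,1) x0(1) y] by blast
    then show ?thesis using d by (simp add: e_def mult_le_0_iff)
  qed
  \<comment> \<open>P' lies behind the hyperplane through x0, so the height of x above it is at most
    the distance of x from P', which is at most d, the height of xm.\<close>
  have le: "e \<bullet> x \<le> e \<bullet> xm" if x: "x \<in> ?K" for x
  proof -
    have "e \<bullet> (x - x0) \<le> infdist x P'"
      unfolding infdist_notempty[OF P'(2)]
    proof (rule cINF_greatest[OF P'(2)])
      fix y assume y: "y \<in> P'"
      have "e \<bullet> (x - x0) = e \<bullet> (x - y) + e \<bullet> (y - x0)" by (simp add: inner_diff_right)
      also have "\<dots> \<le> norm e * norm (x - y) + 0"
        by (rule add_mono[OF norm_cauchy_schwarz half[OF subsetD[OF closure_subset y]]])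
      finally show "e \<bullet> (x - x0) \<le> dist x y" using ne by (simp add: dist_norm)
    qed
    also have "\<dots> \<le> d" using xm(2)[OF x] dm by (simp add: d_def)
    finally show ?thesis using exm by (simp add: inner_diff_right)
  qed
  \<comment> \<open>All points of this face have the same height as xm, so the vertex may be chosen
    freely among its extreme points.\<close>
  let ?F = "?K \<inter> {x. e \<bullet> x = e \<bullet> xm}"
  have F: "?F face_of ?K" using le by (intro face_of_Int_supporting_hyperplane_le K) auto
  have "compact ?F" using K(1) by (intro compact_Int_closed closed_hyperplane)
  moreover have "convex ?F" using F by (rule face_of_imp_convex)
  moreover have "?F \<noteq> {}" using xm by auto
  ultimately obtain xc where xc: "xc extreme_point_of ?F" using extreme_point_exists_convex by blast
  then have v: "xc extreme_point_of ?K" using extreme_point_of_face[OF F] by blast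
  have exc: "e \<bullet> xc = e \<bullet> xm" using xc by (auto simp: extreme_point_of_def)
  show ?thesis
  proof (rule that)
    show "xc \<in> vertices P" using v by (simp add: vertices_def)
    show "norm e = 1" by (rule ne)
    show "e \<bullet> (x - xc) \<le> 0" if "x \<in> closure P" for x using le[OF that] exc by (simp add: inner_diff_right)
    show "e \<bullet> (y - xc) \<le> - ?h" if "y \<in> P'" for y
    proof -
      have "y \<in> closure P'" using that closure_subset by blast
      from half[OF this] show ?thesis using exm exc d by (simp add: inner_diff_right)
    qed
  qed
qed

lemma corner_closure:
  fixes L :: "'a::euclidean_space \<Rightarrow> 'a"
  assumes c: "corner \<kappa> d P xc L" and k: "0 < \<kappa>" "0 < d"
  shows "\<And>s. (\<And>b. b \<in> Basis \<Longrightarrow> 0 \<le> s \<bullet> b \<and> s \<bullet> b < d) \<Longrightarrow> xc + L s \<in> closure P"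
    and "\<And>s. xc + L s \<in> closure P \<Longrightarrow> b \<in> Basis \<Longrightarrow> 0 \<le> s \<bullet> b"
proof -
  have L: "linear L" "inj L" using c corner_inj[OF c k(1)] by (auto simp: corner_def)
  fix s :: 'a assume s: "\<And>b. b \<in> Basis \<Longrightarrow> 0 \<le> s \<bullet> b \<and> s \<bullet> b < d"
  define m where "m = Min ((\<lambda>b. d - s \<bullet> b) ` Basis)"
  have m: "0 < m" "\<And>b. b \<in> Basis \<Longrightarrow> m \<le> d - s \<bullet> b" using s by (auto simp: m_def)
  have in_P: "xc + L (s + \<epsilon> *\<^sub>R One) \<in> P" if "0 < \<epsilon>" "\<epsilon> < m" for \<epsilon>
  proof -
    have "\<forall>b\<in>Basis. 0 < (s + \<epsilon> *\<^sub>R One) \<bullet> b \<and> (s + \<epsilon> *\<^sub>R One) \<bullet> b < d"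
    proof
      fix b :: 'a assume b: "b \<in> Basis"
      have "(s + \<epsilon> *\<^sub>R One) \<bullet> b = s \<bullet> b + \<epsilon>" using b by (simp add: inner_add_left)
      then show "0 < (s + \<epsilon> *\<^sub>R One) \<bullet> b \<and> (s + \<epsilon> *\<^sub>R One) \<bullet> b < d" using s[OF b] m(2)[OF b] that by linarith
    qed
    then show ?thesis using c unfolding corner_def by blast
  qed
  have "((\<lambda>\<epsilon>. xc + L (s + \<epsilon> *\<^sub>R One)) \<longlongrightarrow> xc + L (s + 0 *\<^sub>R One)) (at_right 0)"
    by (intro tendsto_intros bounded_linear.tendsto[OF L(1)[unfolded linear_conv_bounded_linear]])
  moreover have "\<forall>\<^sub>F \<epsilon> in at_right 0. xc + L (s + \<epsilon> *\<^sub>R One) \<in> closure P"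
    by (rule eventually_mono[OF eventually_at_right_real[OF m(1)]]) (rule subsetD[OF closure_subset in_P]; simp)
  ultimately show "xc + L s \<in> closure P"
    using Lim_in_closed_set[OF closed_closure, of "\<lambda>\<epsilon>. xc + L (s + \<epsilon> *\<^sub>R One)" P "at_right 0"] by simp
next
  fix s b :: 'a assume *: "xc + L s \<in> closure P" "b \<in> Basis"
  have L: "linear L" "inj L" using c corner_inj[OF c k(1)] by (auto simp: corner_def)
  obtain L' where L': "linear L'" "\<And>x. L' (L x) = x" using linear_injective_left_inverse[OF L] by (metis comp_apply id_apply)
  have cont: "continuous_on UNIV (\<lambda>x. L' (x - xc) \<bullet> b)"
    by (intro continuous_intros bounded_linear.continuous_on[OF L'(1)[unfolded linear_conv_bounded_linear]])
  have "closed {x. 0 \<le> L' (x - xc) \<bullet> b}" by (intro closed_Collect_le cont continuous_intros)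
  moreover have "P \<subseteq> {x. 0 \<le> L' (x - xc) \<bullet> b}"
  proof
    fix x assume "x \<in> P"
    then obtain s where "\<forall>b\<in>Basis. 0 \<le> s \<bullet> b" "x = xc + L s" using c unfolding corner_def by blast
    then show "x \<in> {x. 0 \<le> L' (x - xc) \<bullet> b}" using *(2) by (simp add: L')
  qed
  ultimately have "closure P \<subseteq> {x. 0 \<le> L' (x - xc) \<bullet> b}" by (intro closure_minimal)
  then have "0 \<le> L' (xc + L s - xc) \<bullet> b" using *(1) by blast
  then show "0 \<le> s \<bullet> b" by (simp add: L')
qed

text \<open>By strict convexity of the ball, an edge at the vertex runs inside the open ball even if the vertex lies on the sphere.\<close>
lemma corner_limit_outside:
  fixes L :: "'a::euclidean_space \<Rightarrow> 'a"
  assumes dim: "2 \<le> DIM('a)" and c: "corner \<kappa> d P xc L" and k: "0 < \<kappa>" "0 < d" and P: "P \<subseteq> ball 0 R"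
  shows "xc \<in> closure (ball 0 R - closure P)"
proof -
  have L: "linear L" "inj L" using c corner_inj[OF c k(1)] by (auto simp: corner_def)
  obtain b1 b2 :: 'a where B: "b1 \<in> Basis" "b2 \<in> Basis" "b1 \<noteq> b2"
    using dim by (metis card_2_iff' ex_card subset_eq)
  have Lb1: "norm (L b1) = 1" using c B by (simp add: corner_def)
  have clR: "closure P \<subseteq> cball 0 R" using P by (intro closure_minimal) (auto simp: less_imp_le)
  define y where "y = xc + L ((d/2) *\<^sub>R b2)"
  have xK: "xc \<in> closure P" using corner_closure(1)[OF c k, of 0] k by (simp add: linear_0[OF L(1)])
  have yK: "y \<in> closure P" unfolding y_def
    by (rule corner_closure(1)[OF c k]) (use B k in \<open>auto simp: inner_Basis\<close>)
  have yx: "y \<noteq> xc"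
  proof
    assume "y = xc"
    then have "L ((d/2) *\<^sub>R b2) = L 0" by (simp add: y_def linear_0[OF L(1)])
    then have "(d/2) *\<^sub>R b2 = 0" using L(2) by (rule injD[rotated])
    then show False using k B by auto
  qed
  define z where "z = (\<lambda>t. xc + t *\<^sub>R (y - xc))"
  have zL: "z t = xc + L ((t * d / 2) *\<^sub>R b2)" for t by (simp add: z_def y_def linear_cmul[OF L(1)])
  have zb: "z t \<in> ball 0 R" if t: "0 < t" "t < 1" for t
  proof -
    have "z t = (1 - t) *\<^sub>R xc + t *\<^sub>R y" by (simp add: z_def algebra_simps)
    then have "z t \<in> open_segment xc y" using t yx unfolding in_segment by blast
    from dist_decreases_open_segment[OF this, of 0] show ?thesis
      using subsetD[OF clR xK] subsetD[OF clR yK] by (auto simp: dist_norm)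
  qed
  \<comment> \<open>Two edges are used: the point z t lies on the edge along b2, inside the open
    ball, and a small step against b1 makes the b1 coordinate negative and thus leaves the closure
    of P.\<close>
  have zc: "z t \<in> closure (ball 0 R - closure P)" if t: "0 < t" "t < 1" for t
  proof -
    obtain \<delta> where \<delta>: "0 < \<delta>" "ball (z t) \<delta> \<subseteq> ball 0 R" using zb[OF t] open_ball open_contains_ball by blast
    have "z t - \<epsilon> *\<^sub>R L b1 \<in> ball 0 R - closure P" if "0 < \<epsilon>" "\<epsilon> < \<delta>" for \<epsilon>
    proof -
      have "z t - \<epsilon> *\<^sub>R L b1 = xc + L ((t * d / 2) *\<^sub>R b2 - \<epsilon> *\<^sub>R b1)" by (simp add: zL linear_diff[OF L(1)] linear_cmul[OF L(1)])
      moreover have "((t * d / 2) *\<^sub>R b2 - \<epsilon> *\<^sub>R b1) \<bullet> b1 < 0" using B that by (simp add: inner_diff_left inner_Basis)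
      ultimately have "z t - \<epsilon> *\<^sub>R L b1 \<notin> closure P" using corner_closure(2)[OF c k _ B(1)] by force
      moreover have "z t - \<epsilon> *\<^sub>R L b1 \<in> ball (z t) \<delta>" using that Lb1 by (simp add: dist_norm)
      ultimately show ?thesis using \<delta>(2) by blast
    qed
    then have "\<forall>\<^sub>F \<epsilon> in at_right 0. z t - \<epsilon> *\<^sub>R L b1 \<in> closure (ball 0 R - closure P)"
      by (intro eventually_mono[OF eventually_at_right_real[OF \<delta>(1)]] subsetD[OF closure_subset]) simp
    moreover have "((\<lambda>\<epsilon>. z t - \<epsilon> *\<^sub>R L b1) \<longlongrightarrow> z t - 0 *\<^sub>R L b1) (at_right 0)" by (intro tendsto_intros)
    ultimately show ?thesis
      using Lim_in_closed_set[OF closed_closure, of "\<lambda>\<epsilon>. z t - \<epsilon> *\<^sub>R L b1" _ "at_right 0"] by simp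
  qed
  have "\<forall>\<^sub>F t in at_right 0. z t \<in> closure (ball 0 R - closure P)"
    by (rule eventually_mono[OF eventually_at_right_real[of 0 1]]) (auto intro: zc)
  moreover have "(z \<longlongrightarrow> xc + 0 *\<^sub>R (y - xc)) (at_right 0)" unfolding z_def by (intro tendsto_intros)
  ultimately show ?thesis
    using Lim_in_closed_set[OF closed_closure, of z _ "at_right 0"] by simp
qed

subsection \<open>Hoelder continuous contrasts\<close>

lemma finite_dirs: "finite (dirs_le m :: 'a::euclidean_space list set)" "finite (dirs_eq m :: 'a list set)"
  unfolding dirs_le_def dirs_eq_def by (auto intro!: finite_lists_length_le finite_lists_length_eq)

text \<open>\<open>holder_norm\<close> is a sum of suprema of reals. Membership in
  \<open>holder_space\<close> bounds the sets from above, so the suprema are genuine; all of them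
  are nonnegative, so each lies below the sum.\<close>

lemma holder_norm_terms:
  fixes f :: "'a::euclidean_space \<Rightarrow> complex"
  assumes f: "holder_space \<alpha> f" "holder_norm \<alpha> f \<le> M"
  shows "bs \<in> dirs_le (holder_order \<alpha>) \<Longrightarrow> norm (pd bs f x) \<le> M"
    and "bs \<in> dirs_eq (holder_order \<alpha>) \<Longrightarrow> norm (pd bs f x - pd bs f y) \<le> M * dist x y powr (\<alpha> - real (holder_order \<alpha>))"
proof -
  let ?m = "holder_order \<alpha>"
  define A where "A = (\<lambda>bs. SUP x. norm (pd bs f x))"
  let ?q = "\<lambda>bs xy. norm (pd bs f (fst xy) - pd bs f (snd xy)) / dist (fst xy) (snd xy) powr (\<alpha> - real ?m)"
  define B where "B = (\<lambda>bs. SUP xy\<in>{(x, y). x \<noteq> y}. ?q bs xy)"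
  have Ab: "norm (pd bs f x) \<le> A bs" if "bs \<in> dirs_le ?m" for bs x
  proof -
    have "bounded (range (pd bs f))" using f(1) that unfolding holder_space_def by blast
    then obtain c where "\<And>x. norm (pd bs f x) \<le> c" unfolding bounded_iff by blast
    then show ?thesis unfolding A_def by (intro cSUP_upper bdd_aboveI[of _ c]) auto
  qed
  have Bb: "?q bs (x, y) \<le> B bs" if "bs \<in> dirs_eq ?m" "x \<noteq> y" for bs x y
  proof -
    obtain L where L: "\<And>x y. norm (pd bs f x - pd bs f y) \<le> L * dist x y powr (\<alpha> - real ?m)"
      using f(1) \<open>bs \<in> dirs_eq ?m\<close> unfolding holder_space_def by blast
    have "?q bs z \<le> L" if "z \<in> {(x, y). x \<noteq> y}" for z
      using L[of "fst z" "snd z"] that by (auto simp: divide_le_eq)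
    then show ?thesis unfolding B_def using that(2) by (intro cSUP_upper bdd_aboveI[of _ L]) auto
  qed
  have A0: "0 \<le> A bs" if "bs \<in> dirs_le ?m" for bs using order_trans[OF norm_ge_zero Ab[OF that]] .
  obtain b0 :: 'a where b0: "b0 \<in> Basis" using nonempty_Basis by blast
  then have b0n: "b0 \<noteq> 0" by auto
  have B0: "0 \<le> B bs" if "bs \<in> dirs_eq ?m" for bs
    by (rule order_trans[OF _ Bb[OF that b0n]]) simp
  have S: "(\<Sum>bs\<in>dirs_le ?m. A bs) + (\<Sum>bs\<in>dirs_eq ?m. B bs) \<le> M"
    using f(2) by (simp add: holder_norm_def A_def B_def)
  have SA: "0 \<le> (\<Sum>bs\<in>dirs_le ?m. A bs)" using A0 by (rule sum_nonneg)
  have SB: "0 \<le> (\<Sum>bs\<in>dirs_eq ?m. B bs)" using B0 by (rule sum_nonneg)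
  {
    assume bs: "bs \<in> dirs_le ?m"
    have "A bs \<le> (\<Sum>bs\<in>dirs_le ?m. A bs)" by (rule member_le_sum[OF bs]) (use A0 finite_dirs in auto)
    then show "norm (pd bs f x) \<le> M" using Ab[OF bs, of x] S SB by linarith
  }
  {
    assume bs: "bs \<in> dirs_eq ?m"
    have "B bs \<le> (\<Sum>bs\<in>dirs_eq ?m. B bs)" by (rule member_le_sum[OF bs]) (use B0 finite_dirs in auto)
    then have BM: "B bs \<le> M" using S SA by linarith
    show "norm (pd bs f x - pd bs f y) \<le> M * dist x y powr (\<alpha> - real ?m)"
    proof (cases "x = y")
      case False
      then have "?q bs (x, y) \<le> M" using Bb[OF bs False] BM by linarith
      then show ?thesis using False by (simp add: divide_le_eq)
    qed simp
  }
qed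

text \<open>For alpha <= 1 the order is 0 and the seminorm of the function itself applies, including
  alpha = 1 since the order is the ceiling minus one. For alpha > 1 the first derivatives are
  bounded and the function is Lipschitz, hence the exponent min(alpha, 1).\<close>

lemma holder_estimate:
  fixes f :: "'a::euclidean_space \<Rightarrow> complex" and M :: real
  assumes f: "holder_space \<alpha> f" "holder_norm \<alpha> f \<le> M"
  shows "0 \<le> M" "norm (f x) \<le> M" "norm (f x - f y) \<le> DIM('a) * M * dist x y powr min \<alpha> 1"
    "continuous_on UNIV f"
proof -
  have \<alpha>: "0 < \<alpha>" using f(1) by (simp add: holder_space_def)
  have fM: "norm (f x) \<le> M" for x using holder_norm_terms(1)[OF f, of "[]"] by (simp add: dirs_le_def)
  show M0: "0 \<le> M" using fM[of 0] norm_ge_zero[of "f 0"] by linarith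
  show "norm (f x) \<le> M" by (rule fM)
  have est: "norm (f x - f y) \<le> DIM('a) * M * dist x y powr min \<alpha> 1" for x y
  proof (cases "\<alpha> \<le> 1")
    case True
    then have "holder_order \<alpha> = 0" using \<alpha> by (simp add: holder_order_def ceiling_le_iff)
    then have "norm (f x - f y) \<le> M * dist x y powr \<alpha>"
      using holder_norm_terms(2)[OF f, of "[]" x y] by (simp add: dirs_eq_def)
    also have "\<dots> \<le> DIM('a) * M * dist x y powr \<alpha>"
      using M0 DIM_positive[where 'a='a] by (intro mult_right_mono) (simp_all add: Suc_leI mult_le_cancel_right1)
    finally show ?thesis using True by simp
  next
    case False
    then have m: "1 \<le> holder_order \<alpha>" by (simp add: holder_order_def le_nat_iff)
    have diff: "f differentiable (at x)" for x
      using f(1) m unfolding holder_space_def by (auto dest!: spec[of _ "[]"])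
    let ?D = "\<lambda>x. frechet_derivative f (at x)"
    have D: "(f has_derivative ?D x) (at x within UNIV)" for x using diff frechet_derivative_works by blast
    have Db: "norm (?D x b) \<le> M" if "b \<in> Basis" for x b
      using holder_norm_terms(1)[OF f, of "[b]" x] that m by (simp add: dirs_le_def)
    have on: "onorm (?D x) \<le> DIM('a) * M" for x
    proof (rule onorm_bound)
      show "0 \<le> DIM('a) * M" using M0 by simp
      fix h
      have lin: "linear (?D x)" using D has_derivative_linear by blast
      have "?D x h = (\<Sum>b\<in>Basis. (h \<bullet> b) *\<^sub>R ?D x b)" by (rule linear_Basis_expand[OF lin])
      moreover have "norm (\<Sum>b\<in>Basis. (h \<bullet> b) *\<^sub>R ?D x b) \<le> (\<Sum>b\<in>(Basis::'a set). norm h * M)"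
        by (rule sum_norm_le) (auto simp: Db Basis_le_norm intro!: mult_mono)
      ultimately show "norm (?D x h) \<le> DIM('a) * M * norm h" by (simp add: mult_ac)
    qed
    have "norm (f x - f y) \<le> DIM('a) * M * norm (x - y)"
      by (rule differentiable_bound[OF convex_UNIV D on]) auto
    then show ?thesis using False by (simp add: dist_norm)
  qed
  show "norm (f x - f y) \<le> DIM('a) * M * dist x y powr min \<alpha> 1" by (rule est)
  show "continuous_on UNIV f"
  proof (rule continuous_at_imp_continuous_on, intro ballI)
    fix x :: 'a
    have "((\<lambda>y. dist y x) \<longlongrightarrow> dist x x) (at x)" by (intro tendsto_intros)
    then have "((\<lambda>y. dist y x powr min \<alpha> 1) \<longlongrightarrow> 0) (at x)"
      using \<alpha> by (intro tendsto_zero_powrI[where b="min \<alpha> 1"] tendsto_const) (auto intro: always_eventually)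
    then have "((\<lambda>y. DIM('a) * M * dist y x powr min \<alpha> 1) \<longlongrightarrow> 0) (at x)" by (rule tendsto_mult_right_zero)
    then have "((\<lambda>y. f y - f x) \<longlongrightarrow> 0) (at x)"
      by (rule Lim_null_comparison[rotated]) (intro always_eventually allI est)
    then show "isCont f x" unfolding isCont_def using LIM_zero_cancel by blast
  qed
qed

subsection \<open>Waves scattered by two shapes\<close>

text \<open>What the estimate consumes about one shape and its wave. The constants are shared by
  both shapes, so exchanging the roles of P and P' gives the other half of the Hausdorff distance
  with the same constants.\<close>

definition scatterer where
  "scatterer k R \<alpha> lo hi l M \<mu> c S P \<phi> \<omega> u F \<longleftrightarrow>
     admissible_shape R (P :: 'a::euclidean_space set) \<and> vertex_edge_sep P l \<and> (DIM('a) = 2 \<longrightarrow> angles_in P lo hi) \<and>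
     holder_space \<alpha> \<phi> \<and> holder_norm \<alpha> \<phi> \<le> M \<and> (\<forall>v\<in>vertices P. \<mu> \<le> cmod (\<phi> v)) \<and> norm \<omega> = 1 \<and>
     total_wave k (potential P \<phi>) \<omega> u \<and> H2_norm_le (ball 0 (2 * R)) (\<lambda>x. u x - plane_wave k \<omega> x) S \<and>
     (\<forall>x\<in>ball 0 R - closure P. c \<le> cmod (u x)) \<and> far_field k (\<lambda>x. u x - plane_wave k \<omega> x) F"

lemma plane_wave_lipschitz:
  assumes "norm \<omega> = 1" "0 < k"
  shows "norm (plane_wave k \<omega> x) = 1" "norm (plane_wave k \<omega> x - plane_wave k \<omega> y) \<le> k * dist x y"
    "continuous_on UNIV (plane_wave k \<omega>)"
proof -
  show "norm (plane_wave k \<omega> x) = 1" by (simp add: plane_wave_def)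
  have "plane_wave k \<omega> x - plane_wave k \<omega> y = plane_wave k \<omega> y * (exp (\<i> * of_real (k * (\<omega> \<bullet> (x - y)))) - 1)"
    by (simp add: plane_wave_def right_diff_distrib inner_diff_right of_real_diff flip: exp_add)
  then have "norm (plane_wave k \<omega> x - plane_wave k \<omega> y) = norm (exp (\<i> * of_real (k * (\<omega> \<bullet> (x - y)))) - 1)"
    by (simp only: norm_mult) (simp add: plane_wave_def)
  also have "\<dots> = 2 * \<bar>sin (k * (\<omega> \<bullet> (x - y)) / 2)\<bar>" by (rule dist_exp_i_1)
  also have "\<dots> \<le> 2 * \<bar>k * (\<omega> \<bullet> (x - y)) / 2\<bar>" by (intro mult_left_mono abs_sin_x_le_abs_x) simp
  also have "\<dots> = k * \<bar>\<omega> \<bullet> (x - y)\<bar>" using assms(2) by (simp add: abs_mult)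
  also have "\<dots> \<le> k * (norm \<omega> * norm (x - y))" using assms(2) by (intro mult_left_mono Cauchy_Schwarz_ineq2) auto
  finally show "norm (plane_wave k \<omega> x - plane_wave k \<omega> y) \<le> k * dist x y" using assms by (simp add: dist_norm)
  show "continuous_on UNIV (plane_wave k \<omega>)" unfolding plane_wave_def by (intro continuous_intros)
qed

definition holder_const :: "'a::euclidean_space itself \<Rightarrow> real \<Rightarrow> bool" where
  "holder_const _ C \<longleftrightarrow> 0 < C \<and> (\<forall>(f :: 'a \<Rightarrow> complex) R S. continuous_on UNIV f \<longrightarrow> 1 < R \<longrightarrow> H2_norm_le (ball 0 (2 * R)) f S \<longrightarrow>
     (\<forall>x\<in>cball 0 R. norm (f x) \<le> C * S \<and>
       (\<forall>y\<in>cball 0 R. dist x y \<le> 1 / 64 \<longrightarrow> norm (f x - f y) \<le> C * S * dist x y powr (1 / 6))))"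

lemma holder_const_exists:
  assumes "DIM('a::euclidean_space) = 2 \<or> DIM('a) = 3"
  shows "\<exists>C. holder_const TYPE('a) C"
proof -
  obtain C where "0 < C" "\<And>(f :: 'a \<Rightarrow> complex) R S x. continuous_on UNIV f \<Longrightarrow> 1 < R \<Longrightarrow>
      H2_norm_le (ball 0 (2 * R)) f S \<Longrightarrow> x \<in> cball 0 R \<Longrightarrow> norm (f x) \<le> C * S"
    "\<And>(f :: 'a \<Rightarrow> complex) R S x x'. continuous_on UNIV f \<Longrightarrow> 1 < R \<Longrightarrow>
      H2_norm_le (ball 0 (2 * R)) f S \<Longrightarrow> x \<in> cball 0 R \<Longrightarrow> x' \<in> cball 0 R \<Longrightarrow> dist x x' \<le> 1 / 64
      \<Longrightarrow> norm (f x - f x') \<le> C * S * dist x x' powr (1 / 6)"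
    using H2_holder_estimate[OF assms] by metis
  then show ?thesis unfolding holder_const_def by blast
qed

lemma scatterer_wave:
  fixes P :: "'a::euclidean_space set"
  assumes CH: "holder_const TYPE('a) CH" and s: "scatterer k R \<alpha> lo hi l M \<mu> c S P \<phi> \<omega> u F" and k: "0 < k" and R: "1 < R"
  shows "0 \<le> CH * S" "x \<in> cball 0 R \<Longrightarrow> norm (u x - plane_wave k \<omega> x) \<le> CH * S" "x \<in> cball 0 R \<Longrightarrow> norm (u x) \<le> CH * S + 1"
    "x \<in> cball 0 R \<Longrightarrow> y \<in> cball 0 R \<Longrightarrow> dist x y \<le> 1 / 64 \<Longrightarrow> norm (u x - u y) \<le> (CH * S + k) * dist x y powr (1 / 6)"
proof -
  have w: "norm \<omega> = 1" and H: "H2_norm_le (ball 0 (2 * R)) (\<lambda>x. u x - plane_wave k \<omega> x) S" and cu: "continuous_on UNIV u"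
    using s by (auto simp: scatterer_def total_wave_def)
  have c: "continuous_on UNIV (\<lambda>x. u x - plane_wave k \<omega> x)" by (intro continuous_on_diff cu plane_wave_lipschitz(3)[OF w k])
  show "0 \<le> CH * S" using CH H by (simp add: holder_const_def H2_norm_le_def)
  show b: "norm (u x - plane_wave k \<omega> x) \<le> CH * S" if "x \<in> cball 0 R"
    using CH c R H that unfolding holder_const_def by blast
  show "norm (u x) \<le> CH * S + 1" if "x \<in> cball 0 R"
    using norm_triangle_ineq2[of "u x" "plane_wave k \<omega> x"] plane_wave_lipschitz(1)[OF w k, of x] b[OF that] by linarith
  assume x: "x \<in> cball 0 R" "y \<in> cball 0 R" "dist x y \<le> 1 / 64"
  have 1: "norm ((u x - plane_wave k \<omega> x) - (u y - plane_wave k \<omega> y)) \<le> CH * S * dist x y powr (1 / 6)"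
    using CH c R H x unfolding holder_const_def by blast
  \<comment> \<open>At distances below 1 the Lipschitz bound of the incident wave implies one with
    the exponent 1/6 of the scattered wave.\<close>
  have "dist x y = dist x y powr 1" by simp
  also have "\<dots> \<le> dist x y powr (1/6)" using x(3) by (intro powr_mono') auto
  finally have "k * dist x y \<le> k * dist x y powr (1/6)" using k by simp
  then have 2: "norm (plane_wave k \<omega> x - plane_wave k \<omega> y) \<le> k * dist x y powr (1/6)" using plane_wave_lipschitz(2)[OF w k, of x y] by linarith
  have "u x - u y = ((u x - plane_wave k \<omega> x) - (u y - plane_wave k \<omega> y)) + (plane_wave k \<omega> x - plane_wave k \<omega> y)" by simp
  then have "norm (u x - u y) \<le> norm ((u x - plane_wave k \<omega> x) - (u y - plane_wave k \<omega> y)) + norm (plane_wave k \<omega> x - plane_wave k \<omega> y)"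
    by (metis norm_triangle_ineq)
  then show "norm (u x - u y) \<le> (CH * S + k) * dist x y powr (1 / 6)" using 1 2 by (simp add: distrib_right)
qed

lemma potential_bounds:
  fixes P :: "'a::euclidean_space set"
  assumes "open P" "P \<subseteq> ball 0 R" "holder_space \<alpha> \<phi>" "holder_norm \<alpha> \<phi> \<le> M"
  shows "potential P \<phi> \<in> borel_measurable borel" "norm (potential P \<phi> x) \<le> M" "R \<le> norm x \<Longrightarrow> potential P \<phi> x = 0"
proof -
  note h = holder_estimate[OF assms(3,4)]
  have "\<phi> \<in> borel_measurable borel" using h(4) by (rule borel_measurable_continuous_onI)
  then show "potential P \<phi> \<in> borel_measurable borel"
    unfolding potential_def using assms(1) by (intro borel_measurable_times borel_measurable_indicator) auto
  show "norm (potential P \<phi> x) \<le> M" using h(1) h(2)[of x] by (simp add: potential_def indicator_def)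
  show "R \<le> norm x \<Longrightarrow> potential P \<phi> x = 0" using assms(2) by (auto simp: potential_def indicator_def)
qed

lemma difference_weak:
  fixes V V' :: "'a::euclidean_space \<Rightarrow> complex"
  assumes u: "total_wave k V \<omega> u" "total_wave k V' \<omega> u'" and V: "V \<in> borel_measurable borel" "\<And>x. norm (V x) \<le> M"
    "V' \<in> borel_measurable borel" "\<And>x. norm (V' x) \<le> M"
    and \<psi>: "smooth \<psi>" "compact K" "\<And>x. x \<notin> K \<Longrightarrow> \<psi> x = 0"
  shows "(\<integral>x. (u x - u' x) * (lap \<psi> x + of_real (k\<^sup>2) * \<psi> x) \<partial>lborel) = - of_real (k\<^sup>2) * (\<integral>x. (V x * u x - V' x * u' x) * \<psi> x \<partial>lborel)"
proof -
  note w = total_wave_weak[OF u(1) V(1,2) \<psi>] and w' = total_wave_weak[OF u(2) V(3,4) \<psi>]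
  show ?thesis using w w' by (simp add: left_diff_distrib right_diff_distrib)
qed

lemma far_fieldE:
  fixes w F :: "'a::euclidean_space \<Rightarrow> complex"
  assumes "far_field k w F"
  obtains C \<rho> where "\<And>r \<theta>. \<rho> \<le> r \<Longrightarrow> norm \<theta> = 1 \<Longrightarrow>
        cmod (w (r *\<^sub>R \<theta>) - exp (\<i> * complex_of_real (k * r)) /
                 complex_of_real (r powr ((real DIM('a) - 1) / 2)) * F \<theta>) \<le> C * r powr (- real DIM('a) / 2)"
proof -
  obtain C \<rho> where *: "\<forall>r\<ge>\<rho>. \<forall>\<theta>\<in>sphere 0 1.
        cmod (w (r *\<^sub>R \<theta>) - exp (\<i> * complex_of_real (k * r)) /
                 complex_of_real (r powr ((real DIM('a) - 1) / 2)) * F \<theta>)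
        \<le> C * r powr (- real DIM('a) / 2)"
    using assms unfolding far_field_def by blast
  show ?thesis by (rule that) (rule *[rule_format]; simp)
qed

definition bump_const :: real where
  "bump_const = (SOME m. 0 < m \<and> (\<forall>t. \<bar>bump t\<bar> \<le> m \<and> \<bar>bump' t\<bar> \<le> m \<and> \<bar>step t\<bar> \<le> m))"

definition pairing_const :: "'a::euclidean_space itself \<Rightarrow> real" where
  "pairing_const _ = 2 ^ DIM('a) * 8 * bump_const * (measure lborel (ball (0::'a) 1) + 1)"

lemma bump_const: "0 < bump_const" "\<bar>bump t\<bar> \<le> bump_const \<and> \<bar>bump' t\<bar> \<le> bump_const"
  using someI_ex[OF bump_bounds] unfolding bump_const_def by blast+

lemma pairing_const_pos: "0 < pairing_const TYPE('a::euclidean_space)"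
  unfolding pairing_const_def using bump_const(1) by (intro mult_pos_pos add_nonneg_pos) auto

text \<open>The incident waves cancel, so u - u' has the far field F - F' and its source is V u - V'
  u' up to the factor -k^2, supported in the ball of radius R.\<close>

lemma scattered_pairing:
  fixes P P' :: "'a::euclidean_space set" and v :: "'a \<Rightarrow> complex"
  assumes s: "scatterer k R \<alpha> lo hi l M \<mu> c S P \<phi> \<omega> u F" and s': "scatterer k R \<alpha> lo hi l M \<mu> c S P' \<phi>' \<omega> u' F'"
    and op: "open P" "open P'" and v: "helmholtz k v" "decays B v" and pos: "0 < sphere_L2_norm (\<lambda>x. F x - F' x)"
  shows "k\<^sup>2 * step 1 * norm (\<integral>y. (indicator P y * (\<phi> y * u y) - indicator P' y * (\<phi>' y * u' y)) * v y \<partial>lborel)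
       \<le> B * pairing_const TYPE('a) * sphere_L2_norm (\<lambda>x. F x - F' x)"
proof -
  have PR: "P \<subseteq> ball 0 R" "P' \<subseteq> ball 0 R" using s s' by (auto simp: scatterer_def admissible_shape_def)
  have h: "holder_space \<alpha> \<phi>" "holder_norm \<alpha> \<phi> \<le> M" "holder_space \<alpha> \<phi>'" "holder_norm \<alpha> \<phi>' \<le> M"
    and tw: "total_wave k (potential P \<phi>) \<omega> u" "total_wave k (potential P' \<phi>') \<omega> u'"
    and ff: "far_field k (\<lambda>x. u x - plane_wave k \<omega> x) F" "far_field k (\<lambda>x. u' x - plane_wave k \<omega> x) F'"
    using s s' by (auto simp: scatterer_def)
  have cu: "continuous_on UNIV u" "continuous_on UNIV u'" using tw by (auto simp: total_wave_def)
  note V = potential_bounds[OF op(1) PR(1) h(1,2)] and V' = potential_bounds[OF op(2) PR(2) h(3,4)]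
  let ?g = "\<lambda>x. potential P \<phi> x * u x - potential P' \<phi>' x * u' x"
  obtain C1 \<rho>1 where f1: "\<And>r \<theta>. \<rho>1 \<le> r \<Longrightarrow> norm \<theta> = 1 \<Longrightarrow>
      cmod (u (r *\<^sub>R \<theta>) - plane_wave k \<omega> (r *\<^sub>R \<theta>) - exp (\<i> * complex_of_real (k * r)) /
               complex_of_real (r powr ((real DIM('a) - 1) / 2)) * F \<theta>) \<le> C1 * r powr (- real DIM('a) / 2)"
    using ff(1) by (rule far_fieldE) blast
  obtain C2 \<rho>2 where f2: "\<And>r \<theta>. \<rho>2 \<le> r \<Longrightarrow> norm \<theta> = 1 \<Longrightarrow>
      cmod (u' (r *\<^sub>R \<theta>) - plane_wave k \<omega> (r *\<^sub>R \<theta>) - exp (\<i> * complex_of_real (k * r)) /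
               complex_of_real (r powr ((real DIM('a) - 1) / 2)) * F' \<theta>) \<le> C2 * r powr (- real DIM('a) / 2)"
    using ff(2) by (rule far_fieldE) blast
  have fd: "cmod ((u (r *\<^sub>R \<theta>) - u' (r *\<^sub>R \<theta>)) - exp (\<i> * complex_of_real (k * r)) /
               complex_of_real (r powr ((real DIM('a) - 1) / 2)) * (F \<theta> - F' \<theta>)) \<le> (C1 + C2) * r powr (- real DIM('a) / 2)"
    if r: "max \<rho>1 \<rho>2 \<le> r" "norm \<theta> = 1" for r \<theta>
  proof -
    let ?q = "exp (\<i> * complex_of_real (k * r)) / complex_of_real (r powr ((real DIM('a) - 1) / 2))"
    have "(u (r *\<^sub>R \<theta>) - u' (r *\<^sub>R \<theta>)) - ?q * (F \<theta> - F' \<theta>)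
      = (u (r *\<^sub>R \<theta>) - plane_wave k \<omega> (r *\<^sub>R \<theta>) - ?q * F \<theta>) - (u' (r *\<^sub>R \<theta>) - plane_wave k \<omega> (r *\<^sub>R \<theta>) - ?q * F' \<theta>)"
      unfolding right_diff_distrib by simp
    then have "cmod ((u (r *\<^sub>R \<theta>) - u' (r *\<^sub>R \<theta>)) - ?q * (F \<theta> - F' \<theta>))
      \<le> cmod (u (r *\<^sub>R \<theta>) - plane_wave k \<omega> (r *\<^sub>R \<theta>) - ?q * F \<theta>) + cmod (u' (r *\<^sub>R \<theta>) - plane_wave k \<omega> (r *\<^sub>R \<theta>) - ?q * F' \<theta>)"
      by (simp only: norm_triangle_ineq4)
    then show ?thesis using f1[of r \<theta>] f2[of r \<theta>] r unfolding distrib_right by linarith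
  qed
  have "k\<^sup>2 * step 1 * norm (\<integral>x. ?g x * v x \<partial>lborel)
    \<le> B * 2 ^ DIM('a) * 8 * bump_const * (measure lborel (ball (0::'a) 1) + 1) * sphere_L2_norm (\<lambda>x. F x - F' x)"
  proof (rule pairing[where w="\<lambda>x. u x - u' x" and R=R, OF less_imp_le[OF bump_const(1)] bump_const(2) _ _ _ v fd pos])
    show "continuous_on UNIV (\<lambda>x. u x - u' x)" using cu by (rule continuous_on_diff)
    show "(\<integral>x. (u x - u' x) * (lap \<psi> x + of_real (k\<^sup>2) * \<psi> x) \<partial>lborel) = - of_real (k\<^sup>2) * (\<integral>x. ?g x * \<psi> x \<partial>lborel)"
      if "smooth \<psi>" "compact K" "\<And>x. x \<notin> K \<Longrightarrow> \<psi> x = 0" for \<psi> K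
      by (rule difference_weak[OF tw V(1,2) V'(1,2) that])
    show "?g x = 0" if "R \<le> norm x" for x using V(3)[OF that] V'(3)[OF that] by simp
  qed
  then show ?thesis
    unfolding potential_def pairing_const_def by (simp only: mult.assoc)
qed

text \<open>The lower bound for |u| is available only off the closure of P, whereas it is needed at
  the vertex. The vertex is a limit of points of the ball off the closure of P, so continuity of u
  transfers the bound.\<close>

lemma scatterer_vertex:
  fixes P P' :: "'a::euclidean_space set"
  assumes dim: "DIM('a) = 2 \<or> DIM('a) = 3" and s: "scatterer k R \<alpha> lo hi l M \<mu> c S P \<phi> \<omega> u F"
    and P': "admissible_shape R P'" and R: "1 < R" and l: "0 < l" and am: "DIM('a) = 2 \<Longrightarrow> 0 < lo \<and> lo < hi \<and> hi < pi"
    and \<kappa>: "\<kappa> = (if DIM('a) = 2 then sqrt (1 - max \<bar>cos lo\<bar> \<bar>cos hi\<bar>) else 1)" "0 < \<kappa>"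
    and h: "0 < (SUP x\<in>P. infdist x P')"
  obtains xc L e where "xc \<in> vertices P" "norm e = 1" "corner \<kappa> (l / 2) P xc L" "norm xc \<le> R" "xc \<in> closure P"
    "\<And>x. x \<in> closure P \<Longrightarrow> e \<bullet> (x - xc) \<le> 0"
    "\<And>y. y \<in> P' \<Longrightarrow> e \<bullet> (y - xc) \<le> - (SUP x\<in>P. infdist x P')" "c \<le> norm (u xc)"
proof -
  have s1: "admissible_shape R P" "vertex_edge_sep P l" "DIM('a) = 2 \<Longrightarrow> angles_in P lo hi"
    "total_wave k (potential P \<phi>) \<omega> u" "\<And>x. x \<in> ball 0 R - closure P \<Longrightarrow> c \<le> norm (u x)"
    using s by (auto simp: scatterer_def)
  note P = admissible_shape_convex[OF dim s1(1)] and Q = admissible_shape_convex[OF dim P']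
  have bP: "bounded P" using P(4) bounded_ball bounded_subset by blast
  obtain xc e where xc: "xc \<in> vertices P" "norm e = 1" "\<And>x. x \<in> closure P \<Longrightarrow> e \<bullet> (x - xc) \<le> 0"
    "\<And>y. y \<in> P' \<Longrightarrow> e \<bullet> (y - xc) \<le> - (SUP x\<in>P. infdist x P')"
    using farthest_vertex[OF bP P(2,3) Q(2,3) h] by blast
  obtain L where L: "corner \<kappa> (l / 2) P xc L"
    using admissible_shape_corner[OF dim s1(1) l s1(2) _ xc(1), of lo hi] am s1(3) unfolding \<kappa>(1) by blast
  have xcl: "xc \<in> closure P" using xc(1) by (simp add: vertices_def extreme_point_of_def)
  have "closure P \<subseteq> cball 0 R" using P(4) by (intro closure_minimal) (auto simp: less_imp_le)
  then have nx: "norm xc \<le> R" using xcl by auto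
  have "xc \<in> closure (ball 0 R - closure P)"
    by (rule corner_limit_outside[OF _ L \<kappa>(2) _ P(4)]) (use dim l in auto)
  moreover have "closed {x. c \<le> norm (u x)}"
    using s1(4) by (intro closed_Collect_le continuous_intros) (simp add: total_wave_def)
  then have "closure (ball 0 R - closure P) \<subseteq> {x. c \<le> norm (u x)}" using s1(5) by (intro closure_minimal subsetI CollectI)
  ultimately have "c \<le> norm (u xc)" by blast
  then show ?thesis using that xc L nx xcl by blast
qed

lemma orthogonal_of_norm:
  fixes A :: "'a::euclidean_space"
  assumes "2 \<le> DIM('a)" "0 \<le> r"
  obtains B where "A \<bullet> B = 0" "norm B = r"
proof -
  obtain y where y: "y \<noteq> 0" "orthogonal A y" using orthogonal_to_vector_exists[OF assms(1), of A] by blast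
  show ?thesis
    by (rule that[of "(r / norm y) *\<^sub>R y"]) (use y assms(2) in \<open>auto simp: orthogonal_def\<close>)
qed

text \<open>The direction e is tilted into the corner, so that the exponential decays along all its edges.\<close>
lemma tilted_direction:
  fixes L :: "'a::euclidean_space \<Rightarrow> 'a"
  assumes dim: "DIM('a) \<le> 3" and c: "corner \<kappa> d P xc L" and \<kappa>: "0 < \<kappa>" "0 < d" and e: "norm e = 1" "\<And>x. x \<in> closure P \<Longrightarrow> e \<bullet> (x - xc) \<le> 0"
    and h: "0 < h" "h \<le> 2 * R" "\<And>y. y \<in> P' \<Longrightarrow> e \<bullet> (y - xc) \<le> - h" and R: "norm xc \<le> R" "P' \<subseteq> ball 0 R"
  defines "a \<equiv> e - (h / (12 * R)) *\<^sub>R L One"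
  shows "1 \<le> norm a" "norm a \<le> 2" "b \<in> Basis \<Longrightarrow> a \<bullet> L b \<le> - (\<kappa>\<^sup>2 * h / (12 * R))" "y \<in> P' \<Longrightarrow> a \<bullet> (y - xc) \<le> - (h / 2)"
proof -
  have L: "linear L" using c by (simp add: corner_def)
  have R0: "0 < R" using h by linarith
  have eL: "e \<bullet> L b \<le> 0" if b: "b \<in> Basis" for b
  proof -
    have "xc + L ((d/2) *\<^sub>R b) \<in> closure P" by (rule corner_closure(1)[OF c \<kappa>]) (use b \<kappa> in \<open>auto simp: inner_Basis\<close>)
    from e(2)[OF this] show ?thesis using \<kappa>(2) by (simp add: linear_cmul[OF L] mult_le_0_iff)
  qed
  have LO: "L One = (\<Sum>b\<in>Basis. L b)" by (simp add: linear_sum[OF L])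
  have nLO: "norm (L One) \<le> 3"
  proof -
    have "norm (L One) \<le> (\<Sum>b\<in>(Basis::'a set). 1)" unfolding LO by (rule sum_norm_le) (use c in \<open>auto simp: corner_def\<close>)
    then show ?thesis using dim by simp
  qed
  have eLO: "e \<bullet> L One \<le> 0" unfolding LO inner_sum_right by (rule sum_nonpos) (rule eL)
  \<comment> \<open>The factor 12 R: |L One| <= 3 and |y - xc| <= 2 R on P', so the tilt changes the
    inner product there by at most h/2 and leaves half of the separation. Since h <= 2 R, the tilt
    vector has norm at most 1.\<close>
  have t: "0 \<le> h / (12 * R)" using h R0 by simp
  \<comment> \<open>e has nonpositive inner product with every edge, so subtracting a multiple of
    their sum does not shorten its component along e.\<close>
  have "e \<bullet> e = 1" using e(1) by (simp add: norm_eq_1)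
  then have "1 \<le> e \<bullet> a" using mult_nonneg_nonpos[OF t eLO] by (simp add: a_def inner_diff_right)
  also have "\<dots> \<le> norm e * norm a" by (rule norm_cauchy_schwarz)
  finally show "1 \<le> norm a" using e(1) by simp
  have "norm a \<le> norm e + norm ((h / (12 * R)) *\<^sub>R L One)" unfolding a_def by (rule norm_triangle_ineq4)
  also have "norm ((h / (12 * R)) *\<^sub>R L One) \<le> h / (12 * R) * 3"
    unfolding norm_scaleR abs_of_nonneg[OF t] by (rule mult_left_mono[OF nLO t])
  also have "\<dots> \<le> 1" using h R0 by (simp add: field_simps)
  finally show "norm a \<le> 2" using e(1) by simp
  show "a \<bullet> L b \<le> - (\<kappa>\<^sup>2 * h / (12 * R))" if b: "b \<in> Basis"
  proof -
    have "h / (12 * R) * \<kappa>\<^sup>2 \<le> h / (12 * R) * (L One \<bullet> L b)" using c b t by (intro mult_left_mono) (auto simp: corner_def)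
    then show ?thesis using eL[OF b] by (simp add: a_def inner_diff_left mult.commute)
  qed
  show "a \<bullet> (y - xc) \<le> - (h / 2)" if y: "y \<in> P'"
  proof -
    have "norm y \<le> R" using y R(2) by (auto simp: less_imp_le)
    then have "norm (y - xc) \<le> 2 * R" using norm_triangle_ineq4[of y xc] R(1) by linarith
    then have "norm (L One) * norm (y - xc) \<le> 3 * (2 * R)" using nLO by (intro mult_mono) auto
    then have "- (6 * R) \<le> L One \<bullet> (y - xc)" using Cauchy_Schwarz_ineq2[of "L One" "y - xc"] by linarith
    then have "h / (12 * R) * - (6 * R) \<le> h / (12 * R) * (L One \<bullet> (y - xc))" using t by (rule mult_left_mono)
    moreover have "h / (12 * R) * - (6 * R) = - (h / 2)" using R0 by simp
    ultimately show ?thesis using h(3)[OF y] by (simp add: a_def inner_diff_left)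
  qed
qed

subsection \<open>The stability estimate\<close>

text \<open>The exponent is the worse of that of the contrast and the 1/6 of the wave; since
  distances stay below 1, the other bound can be weakened to it.\<close>

lemma contrast_wave_holder:
  fixes P :: "'a::euclidean_space set"
  assumes CH: "holder_const TYPE('a) CH" and s: "scatterer k R \<alpha> lo hi l M \<mu> c S P \<phi> \<omega> u F" and k: "0 < k" and R: "1 < R"
    and x: "x \<in> cball 0 R"
  defines "m \<equiv> real DIM('a) * M * (CH * S + 1) + M * (CH * S + k)"
  shows "norm (\<phi> x * u x) \<le> m"
    "y \<in> cball 0 R \<Longrightarrow> dist x y \<le> 1 / 64 \<Longrightarrow> norm (\<phi> x * u x - \<phi> y * u y) \<le> m * dist x y powr min \<alpha> (1 / 6)"
proof -
  have h: "holder_space \<alpha> \<phi>" "holder_norm \<alpha> \<phi> \<le> M" using s by (auto simp: scatterer_def)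
  note hh = holder_estimate[OF h] and wave = scatterer_wave[OF CH s k R]
  have "norm (\<phi> x * u x) \<le> M * (CH * S + 1)"
    unfolding norm_mult using hh(1,2) wave(3)[OF x] by (intro mult_mono) auto
  also have "\<dots> \<le> real DIM('a) * M * (CH * S + 1)"
    using hh(1) wave(1) DIM_positive[where 'a='a] by (intro mult_right_mono) (auto simp: Suc_leI mult_le_cancel_right1)
  also have "\<dots> \<le> m" using hh(1) wave(1) k by (simp add: m_def)
  finally show "norm (\<phi> x * u x) \<le> m" .
  assume y: "y \<in> cball 0 R" "dist x y \<le> 1 / 64"
  let ?d = "dist x y powr min \<alpha> (1 / 6)"
  have d: "dist x y powr min \<alpha> 1 \<le> ?d" "dist x y powr (1 / 6) \<le> ?d" using y(2) by (auto intro!: powr_mono')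
  have "norm (\<phi> x - \<phi> y) * norm (u x) \<le> (real DIM('a) * M * ?d) * (CH * S + 1)"
  proof (rule mult_mono)
    show "norm (\<phi> x - \<phi> y) \<le> real DIM('a) * M * ?d"
      by (rule order_trans[OF hh(3) mult_left_mono[OF d(1)]]) (use hh(1) in simp)
  qed (use wave(3)[OF x] hh(1) in auto)
  moreover have "norm (\<phi> y) * norm (u x - u y) \<le> M * ((CH * S + k) * ?d)"
  proof (rule mult_mono)
    show "norm (u x - u y) \<le> (CH * S + k) * ?d"
      by (rule order_trans[OF wave(4)[OF x y] mult_left_mono[OF d(2)]]) (use wave(1) k in simp)
  qed (use hh in auto)
  moreover have "\<phi> x * u x - \<phi> y * u y = (\<phi> x - \<phi> y) * u x + \<phi> y * (u x - u y)" by (simp add: algebra_simps)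
  then have "norm (\<phi> x * u x - \<phi> y * u y) \<le> norm (\<phi> x - \<phi> y) * norm (u x) + norm (\<phi> y) * norm (u x - u y)"
    by (metis norm_mult norm_triangle_ineq)
  ultimately show "norm (\<phi> x * u x - \<phi> y * u y) \<le> m * ?d"
    by (simp add: m_def algebra_simps)
qed

text \<open>Let beta = min(alpha, 1/6). The Hoelder remainder sigma^(n+beta) must stay below
  tau^(-n), so sigma is of order tau^(-q) with q = n/(n+beta). The rest of the corner is of size
  exp(-c tau h sigma), where h >= tau^(-gamma) gives tau h sigma the power 1 - q - gamma. Since 1 -
  q = beta/(n+beta), taking gamma to be half of this leaves the power gamma.\<close>

definition rate :: "nat \<Rightarrow> real \<Rightarrow> real" where
  "rate n \<alpha> = min \<alpha> (1/6) / (2 * (real n + min \<alpha> (1/6)))"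

lemma SUP_infdist_le:
  assumes "P \<subseteq> ball 0 R" "P' \<subseteq> ball (0::'a::euclidean_space) R" "P \<noteq> {}" "P' \<noteq> {}"
  shows "(SUP x\<in>P. infdist x P') \<le> 2 * R"
proof (rule cSUP_least[OF assms(3)])
  fix x assume x: "x \<in> P"
  obtain y where y: "y \<in> P'" using assms(4) by blast
  have "infdist x P' \<le> dist x y" using y by (rule infdist_le)
  also have "\<dots> \<le> dist x 0 + dist 0 y" by (rule dist_triangle)
  also have "\<dots> \<le> 2 * R" using subsetD[OF assms(1) x] subsetD[OF assms(2) y] by simp
  finally show "infdist x P' \<le> 2 * R" .
qed

text \<open>tau is left free here: whenever h is at least tau^(-gamma), the main term forces a lower
  bound on the far-field difference. All constants are fixed before the shapes and waves
  appear.\<close>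

lemma vertex_distance_bound:
  fixes \<alpha> :: real
  assumes dim: "DIM('a::euclidean_space) = 2 \<or> DIM('a) = 3" and \<alpha>: "0 < \<alpha>" and k: "0 < k" and R: "1 < R" and l: "0 < l"
    and am: "DIM('a) = 2 \<Longrightarrow> 0 < lo \<and> lo < hi \<and> hi < pi" and M: "0 \<le> M" and \<mu>: "0 < \<mu>" and c: "0 < c" and S: "0 \<le> S"
  obtains K C \<tau>0 where "0 < K" "0 < C" "1 \<le> \<tau>0"
    "\<And>(P::'a set) \<phi> \<omega> u F P' \<phi>' u' F' \<tau>. scatterer k R \<alpha> lo hi l M \<mu> c S P \<phi> \<omega> u F \<Longrightarrow> scatterer k R \<alpha> lo hi l M \<mu> c S P' \<phi>' \<omega> u' F' \<Longrightarrow>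
      0 < sphere_L2_norm (\<lambda>x. F x - F' x) \<Longrightarrow> \<tau>0 \<le> \<tau> \<Longrightarrow> \<tau> powr (- rate DIM('a) \<alpha>) \<le> (SUP x\<in>P. infdist x P') \<Longrightarrow>
      \<tau> powr (- real DIM('a)) \<le> C * exp (exp (K * \<tau>)) * sphere_L2_norm (\<lambda>x. F x - F' x)"
proof -
  define n where "n = real DIM('a)"
  have n: "2 \<le> n" "n \<le> 3" using dim by (auto simp: n_def)
  define \<beta> where "\<beta> = min \<alpha> (1/6)"
  have \<beta>: "0 < \<beta>" "\<beta> \<le> 1/6" using \<alpha> by (auto simp: \<beta>_def)
  define \<gamma> where "\<gamma> = rate DIM('a) \<alpha>"
  have \<gamma>: "\<gamma> = \<beta> / (2 * (n + \<beta>))" by (simp add: \<gamma>_def rate_def \<beta>_def n_def)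
  have \<gamma>0: "0 < \<gamma>" "\<gamma> < 1" using \<beta> n by (auto simp: \<gamma> divide_less_eq)
  define \<kappa> where "\<kappa> = (if DIM('a) = 2 then sqrt (1 - max \<bar>cos lo\<bar> \<bar>cos hi\<bar>) else 1)"
  have \<kappa>: "0 < \<kappa>"
  proof (cases "DIM('a) = 2")
    case True
    show ?thesis using abs_cos_less_1[of lo] abs_cos_less_1[of hi] am[OF True] True by (simp add: \<kappa>_def)
  qed (simp add: \<kappa>_def)
  obtain CH where CH: "holder_const TYPE('a) CH" using holder_const_exists[OF dim] by blast
  then have CH0: "0 < CH" by (simp add: holder_const_def)
  define M1 where "M1 = n * M * (CH * S + 1) + M * (CH * S + k)"
  have M1: "0 \<le> M1" using n M CH0 S k by (simp add: M1_def)
  define Cp where "Cp = pairing_const TYPE('a)"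
  have Cp: "0 < Cp" unfolding Cp_def by (rule pairing_const_pos)
  obtain K where K: "exponential_approx TYPE('a) k R K"
    using dim approx_exponential_2d[OF _ k, where 'a='a] approx_exponential_3d[OF _ k, where 'a='a] R by (metis less_trans zero_less_one)
  then have K0: "0 < K" by (simp add: exponential_approx_def)
  define m0 where "m0 = \<mu> * c"
  have m0: "0 < m0" using \<mu> c by (simp add: m0_def)
  \<comment> \<open>Chosen so that sigma^(n+beta) = X tau^(-n) satisfies hypothesis
    \<open>small\<close> of \<open>corner_estimate\<close> with T = 5 tau, as |A| <= 2 tau and |B|
    <= 3 tau; this explains the 10. The summand 1 keeps the denominator positive when M1 =
    0.\<close>
  define X where "X = m0 / (2 * 10 ^ DIM('a) * (M1 + 1) * n powr \<beta>)"
  have X: "0 < X" using m0 M1 n by (simp add: X_def)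
  define \<kappa>1 where "\<kappa>1 = X powr (1 / (n + \<beta>))"
  have \<kappa>1: "0 < \<kappa>1" "\<kappa>1 powr (n + \<beta>) = X" using X n \<beta> by (auto simp: \<kappa>1_def powr_powr)
  define q where "q = n / (n + \<beta>)"
  have q: "0 < q" "q * (n + \<beta>) = n" using n \<beta> by (auto simp: q_def)
  have q\<gamma>: "1 - q - \<gamma> = \<gamma>"
  proof -
    have "1 - q = \<beta> / (n + \<beta>)" using n \<beta> by (simp add: q_def field_simps)
    then show ?thesis using n \<beta> by (simp add: \<gamma> field_simps)
  qed
  define c1 where "c1 = \<kappa>\<^sup>2 * \<kappa>1 / (12 * R)"
  have c1: "0 < c1" using \<kappa> \<kappa>1 R by (simp add: c1_def)
  define Vn where "Vn = unit_ball_vol n * R ^ DIM('a)"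
  have Vn: "0 < Vn" using R by (simp add: Vn_def n_def)
  define G where "G = unit_ball_vol n * (\<kappa> / 2) ^ DIM('a) * (m0 * (1 / 10) ^ DIM('a) / 2)"
  have G: "0 < G" using \<kappa> m0 by (simp add: G_def n_def)
  \<comment> \<open>The conditions bound sigma by the corner size and by the range of the Hoelder
    estimate, ensure theta sigma >= 1, and let half of the main term of order tau^(-n) absorb the
    three exponentially small errors. Each of the last is exponential in a positive power of tau, so
    a threshold depending on the constants alone exists.\<close>
  have ev: "\<forall>\<^sub>F \<tau> in at_top. max 1 k \<le> \<tau> \<and> \<kappa>1 * \<tau> powr (- q) \<le> l / 2 \<and> \<kappa>1 * \<tau> powr (- q) \<le> 1 / 256 \<and> 1 \<le> c1 * \<tau> powr \<gamma> \<and>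
     (M1 * Vn + 1) * (exp (- (c1 * \<tau> powr \<gamma>)) + exp (- (\<tau> powr (1 - \<gamma>) / 2)) + 2 * exp (- \<tau>)) \<le> G / 2 * \<tau> powr (- n)"
  proof (intro eventually_conj)
    show "\<forall>\<^sub>F \<tau> in at_top. max 1 k \<le> \<tau>" by (rule eventually_ge_at_top)
    show "\<forall>\<^sub>F \<tau> in at_top. \<kappa>1 * \<tau> powr (- q) \<le> l / 2" using \<kappa>1(1) q(1) l by real_asymp
    show "\<forall>\<^sub>F \<tau> in at_top. \<kappa>1 * \<tau> powr (- q) \<le> 1 / 256" using \<kappa>1(1) q(1) by real_asymp
    show "\<forall>\<^sub>F \<tau> in at_top. 1 \<le> c1 * \<tau> powr \<gamma>" using c1 \<gamma>0(1) by real_asymp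
    define m where "m = M1 * Vn + 1"
    have m: "0 < m" using M1 Vn by (simp add: m_def add_nonneg_pos)
    define \<delta> where "\<delta> = 1 - \<gamma>"
    have \<delta>: "0 < \<delta>" using \<gamma>0 by (simp add: \<delta>_def)
    have nn: "0 < n" using n by simp
    have "\<forall>\<^sub>F \<tau> in at_top. m * exp (- (c1 * \<tau> powr \<gamma>)) \<le> G / 6 * \<tau> powr (- n)" using m c1 \<gamma>0(1) G nn by real_asymp
    moreover have "\<forall>\<^sub>F \<tau> in at_top. m * exp (- (\<tau> powr \<delta> / 2)) \<le> G / 6 * \<tau> powr (- n)" using m \<delta> G nn by real_asymp
    moreover have "\<forall>\<^sub>F \<tau> in at_top. m * (2 * exp (- \<tau>)) \<le> G / 6 * \<tau> powr (- n)" using m G nn by real_asymp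
    ultimately show "\<forall>\<^sub>F \<tau> in at_top. (M1 * Vn + 1) * (exp (- (c1 * \<tau> powr \<gamma>)) + exp (- (\<tau> powr (1 - \<gamma>) / 2)) + 2 * exp (- \<tau>)) \<le> G / 2 * \<tau> powr (- n)"
      unfolding m_def[symmetric] \<delta>_def[symmetric] by eventually_elim (simp add: distrib_left)
  qed
  then obtain \<tau>1 where \<tau>1: "\<And>\<tau>. \<tau>1 \<le> \<tau> \<Longrightarrow> max 1 k \<le> \<tau> \<and> \<kappa>1 * \<tau> powr (- q) \<le> l / 2 \<and> \<kappa>1 * \<tau> powr (- q) \<le> 1 / 256 \<and> 1 \<le> c1 * \<tau> powr \<gamma> \<and>
     (M1 * Vn + 1) * (exp (- (c1 * \<tau> powr \<gamma>)) + exp (- (\<tau> powr (1 - \<gamma>) / 2)) + 2 * exp (- \<tau>)) \<le> G / 2 * \<tau> powr (- n)"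
    unfolding eventually_at_top_linorder by blast
  define C where "C = 2 * Cp / (k\<^sup>2 * step 1 * G)"
  have C: "0 < C" using Cp k step_1_pos G by (simp add: C_def)
  show ?thesis
  proof (rule that[OF K0 C])
    show "1 \<le> max 1 \<tau>1" by simp
  next
    fix P P' :: "'a set" and \<phi> \<phi>' u u' F F' and \<omega> :: 'a and \<tau> :: real
    assume s: "scatterer k R \<alpha> lo hi l M \<mu> c S P \<phi> \<omega> u F" and s': "scatterer k R \<alpha> lo hi l M \<mu> c S P' \<phi>' \<omega> u' F'"
      and pos: "0 < sphere_L2_norm (\<lambda>x. F x - F' x)" and \<tau>: "max 1 \<tau>1 \<le> \<tau>" and h\<tau>: "\<tau> powr (- rate DIM('a) \<alpha>) \<le> (SUP x\<in>P. infdist x P')"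
    let ?\<epsilon> = "sphere_L2_norm (\<lambda>x. F x - F' x)"
    define h where "h = (SUP x\<in>P. infdist x P')"
    have t: "max 1 k \<le> \<tau>" "\<kappa>1 * \<tau> powr (- q) \<le> l / 2" "\<kappa>1 * \<tau> powr (- q) \<le> 1 / 256" "1 \<le> c1 * \<tau> powr \<gamma>"
     "(M1 * Vn + 1) * (exp (- (c1 * \<tau> powr \<gamma>)) + exp (- (\<tau> powr (1 - \<gamma>) / 2)) + 2 * exp (- \<tau>)) \<le> G / 2 * \<tau> powr (- n)"
      using \<tau>1[of \<tau>] \<tau> by auto
    have \<tau>pos: "1 \<le> \<tau>" "k \<le> \<tau>" "0 < \<tau>" using t(1) by auto
    have hh: "\<tau> powr (- \<gamma>) \<le> h" using h\<tau> by (simp add: \<gamma>_def h_def)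
    moreover have "0 < \<tau> powr (- \<gamma>)" using \<tau>pos by simp
    ultimately have h0: "0 < h" by linarith
    have adm: "admissible_shape R P" "admissible_shape R P'" using s s' by (auto simp: scatterer_def)
    note PP = admissible_shape_convex[OF dim adm(1)] and PP' = admissible_shape_convex[OF dim adm(2)]
    have h2R: "h \<le> 2 * R" unfolding h_def by (rule SUP_infdist_le[OF PP(4) PP'(4) PP(3) PP'(3)])
    obtain xc L e where v: "xc \<in> vertices P" "norm e = 1" "corner \<kappa> (l / 2) P xc L" "norm xc \<le> R" "xc \<in> closure P"
      "\<And>x. x \<in> closure P \<Longrightarrow> e \<bullet> (x - xc) \<le> 0"
      "\<And>y. y \<in> P' \<Longrightarrow> e \<bullet> (y - xc) \<le> - h" "c \<le> norm (u xc)"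
      by (rule scatterer_vertex[OF dim s adm(2) R l _ \<kappa>_def \<kappa> h0[unfolded h_def], folded h_def]) ((rule am, assumption), (rule that, assumption+))
    define a where "a = e - (h / (12 * R)) *\<^sub>R L One"
    have l2: "0 < l / 2" using l by simp
    have d3: "DIM('a) \<le> 3" "2 \<le> DIM('a)" using dim by auto
    note a0 = tilted_direction[OF d3(1) v(3) \<kappa> l2 v(2) _ h0 h2R _ v(4) PP'(4), folded a_def]
    have a: "1 \<le> norm a" "norm a \<le> 2" by (rule a0, fact v(6), fact v(7))+
    have a3: "a \<bullet> L b \<le> - (\<kappa>\<^sup>2 * h / (12 * R))" if "b \<in> Basis" for b
      by (rule a0(3)[OF _ _ that], fact v(6), fact v(7))
    have a4: "a \<bullet> (y - xc) \<le> - (h / 2)" if "y \<in> P'" for y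
      by (rule a0(4)[OF _ _ that], fact v(6), fact v(7))
    define A where "A = \<tau> *\<^sub>R a"
    have nA: "\<tau> \<le> norm A" "norm A \<le> 2 * \<tau>" using a(1,2) \<tau>pos by (auto simp: A_def)
    obtain B where B: "A \<bullet> B = 0" "norm B = sqrt ((norm A)\<^sup>2 + k\<^sup>2)"
      using orthogonal_of_norm[OF d3(2), of "sqrt ((norm A)\<^sup>2 + k\<^sup>2)" A] by auto
    have B2: "(norm B)\<^sup>2 = (norm A)\<^sup>2 + k\<^sup>2" unfolding B(2) by simp
    have "norm B \<le> norm A + k" unfolding B(2) using k by (intro real_le_lsqrt) (auto simp: power2_sum)
    then have nAB: "norm A + norm B \<le> 5 * \<tau>" using nA \<tau>pos by linarith
    obtain w where w0: "helmholtz k w \<and> decays (exp (exp (K * \<tau>))) w \<and>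
       (\<forall>y. norm y \<le> R \<longrightarrow> norm (w y - exp (of_real (A \<bullet> (y - xc)) + \<i> * of_real (B \<bullet> (y - xc)))) \<le> exp (- \<tau>))"
      using K t(1) B(1) B2 nA v(4) unfolding exponential_approx_def by meson
    have w: "helmholtz k w" "decays (exp (exp (K * \<tau>))) w" using w0 by simp_all
    have w3: "norm (w y - exp (of_real (A \<bullet> (y - xc)) + \<i> * of_real (B \<bullet> (y - xc)))) \<le> exp (- \<tau>)" if "norm y \<le> R" for y
      using w0 that by (elim conjE allE[of _ y]) (rule mp)
    define \<sigma> where "\<sigma> = \<kappa>1 * \<tau> powr (- q)"
    define \<theta> where "\<theta> = \<tau> * (\<kappa>\<^sup>2 * h / (12 * R))"
    have \<sigma>0: "0 < \<sigma>" using \<kappa>1(1) \<tau>pos by (simp add: \<sigma>_def)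
    have \<theta>0: "0 < \<theta>" using \<tau>pos \<kappa> h0 R by (simp add: \<theta>_def)
    \<comment> \<open>Here the assumption h >= tau^(-gamma) is used: tau h sigma is at least of
      order tau^(1-q-gamma) = tau^gamma.\<close>
    have \<theta>\<sigma>: "c1 * \<tau> powr \<gamma> \<le> \<theta> * \<sigma>"
    proof -
      have "\<tau> powr \<gamma> = \<tau> powr (1 - q - \<gamma>)" using q\<gamma> by simp
      also have "\<dots> = \<tau> * \<tau> powr (- \<gamma>) * \<tau> powr (- q)" using \<tau>pos by (simp add: powr_diff powr_minus divide_inverse)
      also have "\<dots> \<le> \<tau> * h * \<tau> powr (- q)" using hh \<tau>pos by (intro mult_right_mono mult_left_mono) auto
      finally have "c1 * \<tau> powr \<gamma> \<le> c1 * (\<tau> * h * \<tau> powr (- q))" using c1 by (intro mult_left_mono) auto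
      also have "\<dots> = \<theta> * \<sigma>" by (simp add: c1_def \<theta>_def \<sigma>_def)
      finally show ?thesis .
    qed
    have \<eta>: "\<tau> powr (1 - \<gamma>) / 2 \<le> \<tau> * h / 2"
    proof -
      have "\<tau> powr (1 - \<gamma>) = \<tau> * \<tau> powr (- \<gamma>)" using \<tau>pos by (simp add: powr_diff powr_minus divide_inverse)
      also have "\<dots> \<le> \<tau> * h" using hh \<tau>pos by (intro mult_left_mono) auto
      finally show ?thesis by simp
    qed
    have hs: "holder_space \<alpha> \<phi>" "holder_norm \<alpha> \<phi> \<le> M" "holder_space \<alpha> \<phi>'" "holder_norm \<alpha> \<phi>' \<le> M"
      "total_wave k (potential P \<phi>) \<omega> u" "total_wave k (potential P' \<phi>') \<omega> u'" "\<mu> \<le> norm (\<phi> xc)"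
      using s s' v(1) by (auto simp: scatterer_def)
    have cont: "continuous_on UNIV (\<lambda>x. \<phi> x * u x)" "continuous_on UNIV (\<lambda>x. \<phi>' x * u' x)"
      using holder_estimate(4)[OF hs(1,2)] holder_estimate(4)[OF hs(3,4)] hs(5,6)
      by (auto intro!: continuous_on_mult simp: total_wave_def)
    have wm: "w \<in> borel_measurable borel" using w(1) by (intro borel_measurable_continuous_onI smooth_continuous) (simp add: helmholtz_def)
    have inR: "y \<in> cball 0 R" if "y \<in> ball (0::'a) R" for y using that by auto
    have est: "unit_ball_vol DIM('a) * (\<kappa> / 2) ^ DIM('a) * (m0 * (1 / (2 * (5 * \<tau>))) ^ DIM('a) / 2)
     \<le> norm (\<integral>y. (indicator P y * (\<phi> y * u y) - indicator P' y * (\<phi>' y * u' y)) * w y \<partial>lborel)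
       + M1 * (unit_ball_vol DIM('a) * R ^ DIM('a)) * (exp (- (\<theta> * \<sigma>)) + exp (- (\<tau> * h / 2)) + 2 * exp (- \<tau>))"
    proof (rule corner_estimate[OF v(3) \<kappa> PP(1,4) PP'(1,4), where ?f0.0="\<phi> xc * u xc" and \<beta>=\<beta> and A=A and B=B])
      show "(\<lambda>x. \<phi> x * u x) \<in> borel_measurable borel" "(\<lambda>x. \<phi>' x * u' x) \<in> borel_measurable borel"
        using cont by (auto intro: borel_measurable_continuous_onI)
      show "w \<in> borel_measurable borel" by (rule wm)
      show "norm (\<phi> y * u y) \<le> M1" if "y \<in> P" for y
        using contrast_wave_holder(1)[OF CH s k R inR[OF subsetD[OF PP(4) that]]] by (simp add: M1_def n_def)
      show "norm (\<phi>' y * u' y) \<le> M1" if "y \<in> P'" for y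
        using contrast_wave_holder(1)[OF CH s' k R inR[OF subsetD[OF PP'(4) that]]] by (simp add: M1_def n_def)
      show "0 \<le> M1" by (rule M1)
      show "m0 \<le> norm (\<phi> xc * u xc)" unfolding m0_def norm_mult using hs(7) v(8) \<mu> c by (intro mult_mono) auto
      show "0 < m0" by (rule m0)
      show "norm (\<phi> y * u y - \<phi> xc * u xc) \<le> M1 * norm (y - xc) powr \<beta>" if "y \<in> P" "norm (y - xc) \<le> 1 / 64" for y
        using contrast_wave_holder(2)[OF CH s k R inR[OF subsetD[OF PP(4) that(1)]], of xc] that(2) v(4) by (simp add: M1_def n_def \<beta>_def dist_norm)
      show "0 < \<beta>" by (rule \<beta>(1))
      show "A \<bullet> L b \<le> - \<theta>" if "b \<in> Basis" for b
        using mult_left_mono[OF a3[OF that], of \<tau>] \<tau>pos by (simp add: A_def \<theta>_def)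
      show "A \<bullet> (y - xc) \<le> - (\<tau> * h / 2)" if "y \<in> P'" for y
        using mult_left_mono[OF a4[OF that], of \<tau>] \<tau>pos by (simp add: A_def)
      show "norm A + norm B \<le> 5 * \<tau>" by (rule nAB)
      show "norm (w y - exp (of_real (A \<bullet> (y - xc)) + \<i> * of_real (B \<bullet> (y - xc)))) \<le> exp (- \<tau>)" if "norm y \<le> R" for y by (rule w3[OF that])
      show "0 < \<sigma>" by (rule \<sigma>0)
      show "\<sigma> \<le> l / 2" using t(2) by (simp add: \<sigma>_def)
      show "real DIM('a) * \<sigma> \<le> 1 / 64"
      proof -
        have "n * \<sigma> \<le> 3 * (1 / 256)" using n t(3) \<sigma>0 by (intro mult_mono) (auto simp: \<sigma>_def)
        then show ?thesis by (simp add: n_def)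
      qed
      show "1 \<le> \<theta> * \<sigma>" using t(4) \<theta>\<sigma> by linarith
      show "0 < \<theta>" by (rule \<theta>0)
      show "M1 * (real DIM('a) * \<sigma>) powr \<beta> * \<sigma> ^ DIM('a) \<le> m0 * (1 / (2 * (5 * \<tau>))) ^ DIM('a) / 2"
      proof -
        have "\<sigma> ^ DIM('a) = \<sigma> powr n" using \<sigma>0 by (simp add: n_def powr_realpow)
        then have "(real DIM('a) * \<sigma>) powr \<beta> * \<sigma> ^ DIM('a) = n powr \<beta> * (\<sigma> powr \<beta> * \<sigma> powr n)"
          using \<sigma>0 n by (simp add: n_def powr_mult)
        also have "\<sigma> powr \<beta> * \<sigma> powr n = \<sigma> powr (n + \<beta>)" by (simp add: powr_add mult.commute)
        also have "\<dots> = X * \<tau> powr (- n)"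
          unfolding \<sigma>_def using \<kappa>1 \<tau>pos q(2) by (subst powr_mult) (auto simp: powr_powr)
        also have "n powr \<beta> * (X * \<tau> powr (- n)) = m0 / (2 * 10 ^ DIM('a) * (M1 + 1)) * \<tau> powr (- n)"
          using n by (simp add: X_def)
        finally have "M1 * ((real DIM('a) * \<sigma>) powr \<beta> * \<sigma> ^ DIM('a)) = (M1 / (M1 + 1)) * (m0 / (2 * 10 ^ DIM('a)) * \<tau> powr (- n))"
          by simp
        also have "\<dots> \<le> 1 * (m0 / (2 * 10 ^ DIM('a)) * \<tau> powr (- n))" using M1 m0 by (intro mult_right_mono) auto
        also have "\<tau> powr (- n) = (1 / \<tau>) ^ DIM('a)"
          using \<tau>pos by (simp add: n_def powr_minus powr_realpow power_one_over inverse_eq_divide)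
        finally show ?thesis by (simp add: mult.assoc power_divide power_mult_distrib)
      qed
    qed
    let ?I = "norm (\<integral>y. (indicator P y * (\<phi> y * u y) - indicator P' y * (\<phi>' y * u' y)) * w y \<partial>lborel)"
    have lhs: "unit_ball_vol DIM('a) * (\<kappa> / 2) ^ DIM('a) * (m0 * (1 / (2 * (5 * \<tau>))) ^ DIM('a) / 2) = G * \<tau> powr (- n)"
      using \<tau>pos by (simp add: G_def n_def powr_minus powr_realpow power_divide power_mult_distrib inverse_eq_divide)
    have "M1 * Vn * (exp (- (\<theta> * \<sigma>)) + exp (- (\<tau> * h / 2)) + 2 * exp (- \<tau>)) \<le> (M1 * Vn + 1) * (exp (- (c1 * \<tau> powr \<gamma>)) + exp (- (\<tau> powr (1 - \<gamma>) / 2)) + 2 * exp (- \<tau>))"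
      using \<theta>\<sigma> \<eta> M1 Vn by (intro mult_mono add_mono) (auto intro!: add_nonneg_nonneg)
    also have "\<dots> \<le> G / 2 * \<tau> powr (- n)" by (rule t(5))
    finally have "G * \<tau> powr (- n) \<le> ?I + G / 2 * \<tau> powr (- n)"
      using est unfolding lhs by (simp add: Vn_def n_def)
    then have "G / 2 * \<tau> powr (- n) \<le> ?I" by (simp add: field_simps)
    then have "k\<^sup>2 * step 1 * (G / 2 * \<tau> powr (- n)) \<le> k\<^sup>2 * step 1 * ?I" using step_1_pos by (intro mult_left_mono) auto
    also have "\<dots> \<le> exp (exp (K * \<tau>)) * Cp * ?\<epsilon>" unfolding Cp_def by (rule scattered_pairing[OF s s' PP(1) PP'(1) w(1,2) pos])
    finally have "k\<^sup>2 * step 1 * (G / 2 * \<tau> powr (- n)) \<le> exp (exp (K * \<tau>)) * Cp * ?\<epsilon>" .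
    moreover have "0 < k\<^sup>2 * step 1 * G" using k step_1_pos G by simp
    ultimately show "\<tau> powr (- real DIM('a)) \<le> C * exp (exp (K * \<tau>)) * ?\<epsilon>"
      unfolding n_def[symmetric] C_def by (simp add: field_simps)
  qed
qed

lemma lap_zero_outside:
  fixes \<psi> :: "'a::euclidean_space \<Rightarrow> complex"
  assumes "smooth \<psi>" "compact K" "\<And>x. x \<notin> K \<Longrightarrow> \<psi> x = 0" "x \<notin> K"
  shows "lap \<psi> x = 0"
proof -
  have "pd [b, b] \<psi> x = 0" for b using pd_zero_outside[of K \<psi> x "[b, b]"] assms by (simp add: compact_imp_closed)
  then show ?thesis by (simp add: lap_def)
qed

text \<open>For S = 0 both waves are the incident one near the shapes, and then a contrast supported on only one shape must vanish.\<close>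
lemma scatterer_zero:
  fixes P P' :: "'a::euclidean_space set"
  assumes dim: "DIM('a) = 2 \<or> DIM('a) = 3" and k: "0 < k" and R: "1 < R" and \<mu>: "0 < \<mu>"
    and s: "scatterer k R \<alpha> lo hi l M \<mu> c 0 P \<phi> \<omega> u F" and s': "scatterer k R \<alpha> lo hi l M \<mu> c 0 P' \<phi>' \<omega> u' F'"
  shows "(SUP x\<in>P. infdist x P') \<le> 0"
proof (rule ccontr)
  assume "\<not> ?thesis"
  then have h: "0 < (SUP x\<in>P. infdist x P')" (is "0 < ?h") by simp
  have adm: "admissible_shape R P" "admissible_shape R P'" using s s' by (auto simp: scatterer_def)
  note PP = admissible_shape_convex[OF dim adm(1)] and PP' = admissible_shape_convex[OF dim adm(2)]
  have bP: "bounded P" using PP(4) bounded_ball bounded_subset by blast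
  obtain xc e where xc: "xc \<in> vertices P" "norm e = 1" "\<And>y. y \<in> P' \<Longrightarrow> e \<bullet> (y - xc) \<le> - ?h"
    using farthest_vertex[OF bP PP(2,3) PP'(2,3) h] by metis
  have far: "?h \<le> dist y xc" if "y \<in> P'" for y
  proof -
    have "- (e \<bullet> (y - xc)) \<le> norm e * norm (y - xc)" using Cauchy_Schwarz_ineq2[of e "y - xc"] by linarith
    then show ?thesis using xc(3)[OF that] xc(2) by (simp add: dist_norm)
  qed
  have hs: "holder_space \<alpha> \<phi>" "holder_norm \<alpha> \<phi> \<le> M" "holder_space \<alpha> \<phi>'" "holder_norm \<alpha> \<phi>' \<le> M"
    "total_wave k (potential P \<phi>) \<omega> u" "total_wave k (potential P' \<phi>') \<omega> u'" "\<mu> \<le> norm (\<phi> xc)" "norm \<omega> = 1"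
    using s s' xc(1) by (auto simp: scatterer_def)
  obtain CH where CH: "holder_const TYPE('a) CH" using holder_const_exists[OF dim] by blast
  \<comment> \<open>With S = 0 the uniform bound \<open>CH * S\<close> is 0, so both scattered waves
    vanish at every point of the closed ball.\<close>
  have uw: "u x = plane_wave k \<omega> x" "u' x = plane_wave k \<omega> x" if "x \<in> cball 0 R" for x
    using scatterer_wave(2)[OF CH s k R that] scatterer_wave(2)[OF CH s' k R that] by auto
  let ?f = "\<lambda>x. \<phi> x * u x"
  have c\<phi>: "continuous_on UNIV \<phi>" by (rule holder_estimate(4)[OF hs(1,2)])
  have cf: "continuous_on UNIV ?f" using c\<phi> hs(5) by (intro continuous_on_mult) (simp_all add: total_wave_def)
  have "\<phi> xc \<noteq> 0" using hs(7) \<mu> by auto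
  moreover have "isCont \<phi> xc" using c\<phi> by (simp add: continuous_on_eq_continuous_at)
  ultimately obtain \<delta> where \<delta>: "0 < \<delta>" "\<And>x. dist xc x < \<delta> \<Longrightarrow> \<phi> x \<noteq> 0"
    using continuous_at_avoid[of xc \<phi> 0] by blast
  have "xc \<in> closure P" using xc(1) by (simp add: vertices_def extreme_point_of_def)
  moreover have "0 < min \<delta> (?h / 2)" using \<delta>(1) h by simp
  ultimately have "\<exists>p\<in>P. dist p xc < min \<delta> (?h / 2)" unfolding closure_approachable by (elim allE impE)
  then obtain p where p: "p \<in> P" "dist p xc < min \<delta> (?h / 2)" by (rule bexE)
  have pR: "p \<in> cball 0 R" using p(1) PP(4) by (auto simp: less_imp_le)
  have fp: "?f p \<noteq> 0" using \<delta>(2)[of p] p(2) uw(1)[OF pR] plane_wave_lipschitz(1)[OF hs(8) k, of p] by (auto simp: dist_commute)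
  have "isCont ?f p" using cf by (simp add: continuous_on_eq_continuous_at)
  moreover have "0 < norm (?f p) / 2" using fp by simp
  ultimately have "\<exists>d>0. \<forall>x. dist x p < d \<longrightarrow> dist (?f x) (?f p) < norm (?f p) / 2"
    unfolding continuous_at_eps_delta by (elim allE impE)
  then obtain \<delta>1 where \<delta>1: "0 < \<delta>1" "\<And>x. dist x p < \<delta>1 \<Longrightarrow> dist (?f x) (?f p) < norm (?f p) / 2"
    by (elim exE conjE) blast
  obtain \<delta>2 where \<delta>2: "0 < \<delta>2" "ball p \<delta>2 \<subseteq> P" using PP(1) p(1) open_contains_ball by blast
  \<comment> \<open>p is within h/2 of the vertex, and the cutoff ball is so small that it lies in
    P, misses P', and keeps phi u within half of its nonzero value at p.\<close>
  define \<rho> where "\<rho> = min (?h / 2) (min \<delta>1 \<delta>2) / 4"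
  have \<rho>: "0 < \<rho>" "4 * \<rho> \<le> ?h / 2" "4 * \<rho> \<le> \<delta>1" "4 * \<rho> \<le> \<delta>2" using h \<delta>1(1) \<delta>2(1) by (auto simp: \<rho>_def)
  let ?K = "cball p (2 * \<rho>)"
  let ?\<psi> = "cutoff p \<rho>"
  have K: "x \<in> P" "x \<notin> P'" "norm (?f x - ?f p) \<le> norm (?f p) / 2" if x: "x \<in> ?K" for x
  proof -
    have d: "dist p x < 4 * \<rho>" using x \<rho>(1) by simp
    show "x \<in> P" using d \<rho>(4) \<delta>2(2) by auto
    show "norm (?f x - ?f p) \<le> norm (?f p) / 2" using \<delta>1(2)[of x] d \<rho>(3) by (simp add: dist_norm norm_minus_commute)
    have "dist x xc < ?h" using dist_triangle[of x xc p] d p(2) \<rho>(2) by (simp add: dist_commute)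
    then show "x \<notin> P'" using far[of x] by auto
  qed
  have \<psi>0: "?\<psi> x = 0" if "x \<notin> ?K" for x using that \<rho>(1) by (intro cutoff_eq_0) (auto simp: dist_norm norm_minus_commute)
  note \<psi> = smooth_cutoff[of p \<rho>] compact_cball[of p "2 * \<rho>"] \<psi>0
  note V = potential_bounds[OF PP(1,4) hs(1,2)] and V' = potential_bounds[OF PP'(1,4) hs(3,4)]
  have "(\<integral>x. (u x - u' x) * (lap ?\<psi> x + of_real (k\<^sup>2) * ?\<psi> x) \<partial>lborel) = - of_real (k\<^sup>2) * (\<integral>x. (potential P \<phi> x * u x - potential P' \<phi>' x * u' x) * ?\<psi> x \<partial>lborel)"
    by (rule difference_weak[OF hs(5,6) V(1,2) V'(1,2) \<psi>])
  moreover have "(\<lambda>x. (u x - u' x) * (lap ?\<psi> x + of_real (k\<^sup>2) * ?\<psi> x)) = (\<lambda>x. 0)"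
  proof
    fix x
    show "(u x - u' x) * (lap ?\<psi> x + of_real (k\<^sup>2) * ?\<psi> x) = 0"
    proof (cases "x \<in> ?K")
      case True
      then have "x \<in> cball 0 R" using subsetD[OF PP(4) K(1)[OF True]] by simp
      then show ?thesis using uw[of x] by simp
    next
      case False
      then show ?thesis using lap_zero_outside[OF \<psi>] \<psi>0 by simp
    qed
  qed
  moreover have "(\<lambda>x. (potential P \<phi> x * u x - potential P' \<phi>' x * u' x) * ?\<psi> x) = (\<lambda>x. ?f x * ?\<psi> x)"
  proof
    fix x
    show "(potential P \<phi> x * u x - potential P' \<phi>' x * u' x) * ?\<psi> x = ?f x * ?\<psi> x"
      using K[of x] \<psi>0[of x] by (cases "x \<in> ?K") (auto simp: potential_def)
  qed
  ultimately have zero: "(\<integral>x. ?f x * ?\<psi> x \<partial>lborel) = 0" using k by simp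
  have c\<psi>: "continuous_on UNIV ?\<psi>" by (rule smooth_continuous[OF smooth_cutoff])
  have i\<psi>: "integrable lborel ?\<psi>" by (rule integrable_cont_compact[OF c\<psi> \<psi>(2,3)])
  define J where "J = (\<integral>x. norm (?\<psi> x) \<partial>lborel)"
  have n\<psi>: "norm (?\<psi> x) = step (radsq p \<rho> x)" "of_real (step (radsq p \<rho> x)) = ?\<psi> x" for x by (auto simp: cutoff_def step_nonneg)
  have int\<psi>: "(\<integral>x. ?\<psi> x \<partial>lborel) = of_real J" unfolding J_def n\<psi>(1) by (subst integral_complex_of_real[symmetric]) (simp add: n\<psi>(2))
  have J: "0 < J"
  proof -
    have "0 < step 1 * measure lborel (ball p \<rho>)" using step_1_pos \<rho>(1) by (simp add: content_ball)
    also have "\<dots> = (\<integral>x. step 1 * indicator (ball p \<rho>) x \<partial>lborel)" by simp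
    also have "\<dots> \<le> J" unfolding J_def
    proof (rule integral_mono)
      show "integrable lborel (\<lambda>x. step 1 * indicator (ball p \<rho>) x :: real)" by (intro integrable_mult_right integrable_indicator_ball)
      show "integrable lborel (\<lambda>x. norm (?\<psi> x))" using i\<psi> by (rule integrable_norm)
      show "step 1 * indicator (ball p \<rho>) x \<le> norm (?\<psi> x)" for x
        using cutoff_eq_1[OF \<rho>(1), of x p] step_1_pos by (auto simp: indicator_def dist_norm norm_minus_commute)
    qed
    finally show ?thesis .
  qed
  have if\<psi>: "integrable lborel (\<lambda>x. ?f x * ?\<psi> x)"
    by (rule integrable_cont_compact[OF continuous_on_mult[OF cf c\<psi>] \<psi>(2)]) (simp add: \<psi>0)
  have ifp: "integrable lborel (\<lambda>x. ?f p * ?\<psi> x)" using i\<psi> by (rule integrable_mult_right)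
  have id: "integrable lborel (\<lambda>x. (?f x - ?f p) * ?\<psi> x)" unfolding left_diff_distrib using if\<psi> ifp by (rule Bochner_Integration.integrable_diff)
  \<comment> \<open>The weak equation gives a zero integral of phi u against a nonnegative cutoff of
    mass J > 0. Freezing phi u at p changes it by at most half, so |f p| J would be at most half of
    itself.\<close>
  have "?f p * of_real J = (\<integral>x. ?f p * ?\<psi> x \<partial>lborel)" using int\<psi> by simp
  also have "\<dots> = - (\<integral>x. (?f x - ?f p) * ?\<psi> x \<partial>lborel)" using zero if\<psi> ifp by (simp add: left_diff_distrib)
  finally have "norm (?f p) * J = norm (\<integral>x. (?f x - ?f p) * ?\<psi> x \<partial>lborel)" using J by (metis norm_minus_cancel norm_mult norm_of_real abs_of_pos)
  also have "\<dots> \<le> (\<integral>x. norm ((?f x - ?f p) * ?\<psi> x) \<partial>lborel)" by (rule integral_norm_bound)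
  also have "\<dots> \<le> (\<integral>x. norm (?f p) / 2 * norm (?\<psi> x) \<partial>lborel)"
  proof (rule integral_mono)
    show "integrable lborel (\<lambda>x. norm ((?f x - ?f p) * ?\<psi> x))" using id by (rule integrable_norm)
    show "integrable lborel (\<lambda>x. norm (?f p) / 2 * norm (?\<psi> x))" using i\<psi> by (intro integrable_mult_right integrable_norm)
    show "norm ((?f x - ?f p) * ?\<psi> x) \<le> norm (?f p) / 2 * norm (?\<psi> x)" for x
      unfolding norm_mult[of "?f x - ?f p"]
    proof (cases "x \<in> ?K")
      case True
      show "norm (?f x - ?f p) * norm (?\<psi> x) \<le> norm (?f p) / 2 * norm (?\<psi> x)" by (rule mult_right_mono[OF K(3)[OF True]]) simp
    next
      case False
      show "norm (?f x - ?f p) * norm (?\<psi> x) \<le> norm (?f p) / 2 * norm (?\<psi> x)" by (simp add: \<psi>0[OF False])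
    qed
  qed
  also have "\<dots> = norm (?f p) / 2 * J" by (simp add: J_def)
  finally have "norm (?f p) * J \<le> 0" by linarith
  moreover have "0 < norm (?f p) * J" using fp J by (intro mult_pos_pos) simp_all
  ultimately show False by linarith
qed

lemma scatterer_stability:
  fixes \<alpha> :: real
  assumes dim: "DIM('a::euclidean_space) = 2 \<or> DIM('a) = 3" and \<alpha>: "0 < \<alpha>" and k: "0 < k" and R: "1 < R" and l: "0 < l"
    and am: "DIM('a) = 2 \<Longrightarrow> 0 < lo \<and> lo < hi \<and> hi < pi" and M: "0 \<le> M" and \<mu>: "0 < \<mu>" and c: "0 < c" and S: "0 \<le> S"
  obtains \<epsilon>0 C where "0 < \<epsilon>0"
    "\<And>(P::'a set) \<phi> \<omega> u F P' \<phi>' u' F'. scatterer k R \<alpha> lo hi l M \<mu> c S P \<phi> \<omega> u F \<Longrightarrow> scatterer k R \<alpha> lo hi l M \<mu> c S P' \<phi>' \<omega> u' F' \<Longrightarrow>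
      0 < sphere_L2_norm (\<lambda>x. F x - F' x) \<Longrightarrow> sphere_L2_norm (\<lambda>x. F x - F' x) < \<epsilon>0 \<Longrightarrow>
      (SUP x\<in>P. infdist x P') \<le> C * ln (ln (S / sphere_L2_norm (\<lambda>x. F x - F' x))) powr (- rate DIM('a) \<alpha>)"
proof (cases "S = 0")
  case True
  \<comment> \<open>For S = 0 the quotient S / eps is 0 and the logarithms carry no information. The
    witness C = 0 asserts that the distance itself is not positive.\<close>
  show ?thesis
    by (rule that[of 1 0]) (use scatterer_zero[OF dim k R \<mu>] True in auto)
next
  case False
  then have S0: "0 < S" using S by simp
  obtain K C \<tau>0 where K: "0 < K" and C: "0 < C" and \<tau>0: "1 \<le> \<tau>0" and bound:
    "\<And>(P::'a set) \<phi> \<omega> u F P' \<phi>' u' F' \<tau>. scatterer k R \<alpha> lo hi l M \<mu> c S P \<phi> \<omega> u F \<Longrightarrow> scatterer k R \<alpha> lo hi l M \<mu> c S P' \<phi>' \<omega> u' F' \<Longrightarrow>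
      0 < sphere_L2_norm (\<lambda>x. F x - F' x) \<Longrightarrow> \<tau>0 \<le> \<tau> \<Longrightarrow> \<tau> powr (- rate DIM('a) \<alpha>) \<le> (SUP x\<in>P. infdist x P') \<Longrightarrow>
      \<tau> powr (- real DIM('a)) \<le> C * exp (exp (K * \<tau>)) * sphere_L2_norm (\<lambda>x. F x - F' x)"
    by (rule vertex_distance_bound[OF dim \<alpha> k R l _ M \<mu> c S]) ((rule am, assumption), blast)
  define n where "n = real DIM('a)"
  have n: "0 < n" by (simp add: n_def)
  have "\<forall>\<^sub>F x in at_top. 1 \<le> x \<and> \<tau>0 \<le> ln (ln x) / (2 * K) \<and> 1 < ln x \<and> C * exp (sqrt (ln x)) * (S / x) < (ln (ln x) / (2 * K)) powr (- n)"
  proof (intro eventually_conj)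
    show "\<forall>\<^sub>F x::real in at_top. 1 \<le> x" by (rule eventually_ge_at_top)
    show "\<forall>\<^sub>F x in at_top. \<tau>0 \<le> ln (ln x) / (2 * K)" using K by real_asymp
    show "\<forall>\<^sub>F x::real in at_top. 1 < ln x" by real_asymp
    show "\<forall>\<^sub>F x in at_top. C * exp (sqrt (ln x)) * (S / x) < (ln (ln x) / (2 * K)) powr (- n)" using C K S0 n by real_asymp
  qed
  \<comment> \<open>x stands for S / eps. The last condition holds for large x because exp(sqrt(ln
    x)) / x tends to 0 faster than every negative power of ln (ln x). The threshold for eps is then
    S / max 1 X, which makes S / eps exceed X.\<close>
  then obtain X where X: "\<And>x. X \<le> x \<Longrightarrow> 1 \<le> x \<and> \<tau>0 \<le> ln (ln x) / (2 * K) \<and> 1 < ln x \<and> C * exp (sqrt (ln x)) * (S / x) < (ln (ln x) / (2 * K)) powr (- n)"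
    unfolding eventually_at_top_linorder by blast
  show ?thesis
  proof (rule that)
    show "0 < S / max 1 X" using S0 by simp
  next
    fix P P' :: "'a set" and \<phi> \<phi>' u u' F F' and \<omega> :: 'a
    assume s: "scatterer k R \<alpha> lo hi l M \<mu> c S P \<phi> \<omega> u F" and s': "scatterer k R \<alpha> lo hi l M \<mu> c S P' \<phi>' \<omega> u' F'"
      and pos: "0 < sphere_L2_norm (\<lambda>x. F x - F' x)" and small: "sphere_L2_norm (\<lambda>x. F x - F' x) < S / max 1 X"
    define \<epsilon> where "\<epsilon> = sphere_L2_norm (\<lambda>x. F x - F' x)"
    have \<epsilon>: "0 < \<epsilon>" using pos by (simp add: \<epsilon>_def)
    define x where "x = S / \<epsilon>"
    have mx: "0 < max 1 X" by (simp add: less_max_iff_disj)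
    have "\<epsilon> * max 1 X < S" using small unfolding \<epsilon>_def[symmetric] pos_less_divide_eq[OF mx] .
    then have "max 1 X < x" unfolding x_def pos_less_divide_eq[OF \<epsilon>] by (simp only: mult.commute)
    then have x: "1 \<le> x" "\<tau>0 \<le> ln (ln x) / (2 * K)" "1 < ln x" "C * exp (sqrt (ln x)) * (S / x) < (ln (ln x) / (2 * K)) powr (- n)"
      using X[of x] by auto
    \<comment> \<open>The factor 2 turns exp(K tau) into the square root of ln x, so the double
      exponential is only exp(sqrt(ln x)) and loses against eps = S / x.\<close>
    define \<tau> where "\<tau> = ln (ln x) / (2 * K)"
    have \<tau>: "\<tau>0 \<le> \<tau>" "0 < \<tau>" using x(2) \<tau>0 by (auto simp: \<tau>_def)
    have "\<not> \<tau> powr (- rate DIM('a) \<alpha>) \<le> (SUP x\<in>P. infdist x P')"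
    proof
      assume "\<tau> powr (- rate DIM('a) \<alpha>) \<le> (SUP x\<in>P. infdist x P')"
      then have "\<tau> powr (- n) \<le> C * exp (exp (K * \<tau>)) * \<epsilon>"
        unfolding n_def \<epsilon>_def by (rule bound[OF s s' pos \<tau>(1)])
      also have "exp (K * \<tau>) = sqrt (ln x)"
      proof -
        have "K * \<tau> = 1 / 2 * ln (ln x)" using K by (simp add: \<tau>_def)
        then have "exp (K * \<tau>) = ln x powr (1 / 2)" using x(3) by (simp add: powr_def)
        then show ?thesis using x(3) by (simp add: powr_half_sqrt)
      qed
      also have "\<epsilon> = S / x" using S0 \<epsilon> by (simp add: x_def)
      finally show False using x(4) by (simp add: \<tau>_def)
    qed
    then have "(SUP x\<in>P. infdist x P') \<le> \<tau> powr (- rate DIM('a) \<alpha>)" by simp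
    also have "\<dots> = (2 * K) powr rate DIM('a) \<alpha> * (2 * K * \<tau>) powr (- rate DIM('a) \<alpha>)"
      using K \<tau> by (simp add: powr_mult powr_minus field_simps)
    also have "2 * K * \<tau> = ln (ln (S / \<epsilon>))" using K by (simp add: \<tau>_def x_def)
    finally show "(SUP x\<in>P. infdist x P') \<le> (2 * K) powr rate DIM('a) \<alpha> * ln (ln (S / sphere_L2_norm (\<lambda>x. F x - F' x))) powr (- rate DIM('a) \<alpha>)"
      by (simp add: \<epsilon>_def)
  qed
qed

text \<open>The support of V lies in the closure of P, so the a-priori lower bound for the wave
  holds off that closure.\<close>

lemma scattererI:
  fixes P :: "'a::euclidean_space set"
  assumes "admissible_shape R P" "admissible_contrast \<alpha> P \<phi>" "well_posed k R (potential P \<phi>) S"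
    "apriori_bounds k R \<alpha> s r l \<alpha>m \<alpha>M D M \<mu> c P \<phi>" "\<omega> \<in> sphere 0 1" "total_wave k (potential P \<phi>) \<omega> u"
    "far_field k (\<lambda>x. u x - plane_wave k \<omega> x) F"
  shows "scatterer k R \<alpha> (2 * \<alpha>m) (2 * \<alpha>M) l M \<mu> c S P \<phi> \<omega> u F"
proof -
  have "{x. potential P \<phi> x \<noteq> 0} \<subseteq> P" by (auto simp: potential_def indicator_def)
  then have "supp (potential P \<phi>) \<subseteq> closure P" unfolding supp_def by (rule closure_mono)
  moreover have "\<forall>x\<in>ball 0 R - supp (potential P \<phi>). c \<le> cmod (u x)" using assms(4-6) unfolding apriori_bounds_def by blast
  ultimately have "\<forall>x\<in>ball 0 R - closure P. c \<le> cmod (u x)" by blast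
  moreover have "H2_norm_le (ball 0 (2 * R)) (\<lambda>x. u x - plane_wave k \<omega> x) S" using assms(3,5,6) unfolding well_posed_def by blast
  ultimately show ?thesis
    using assms unfolding scatterer_def apriori_bounds_def admissible_contrast_def by simp
qed

lemma stability_constants:
  fixes \<alpha> k R l \<alpha>m \<alpha>M D M \<mu> c S :: real
  assumes dim: "DIM('a::euclidean_space) = 2 \<or> DIM('a) = 3" and \<alpha>: "0 < \<alpha>" and k: "0 < k" and R: "1 < R"
  shows "\<exists>\<epsilon>min>0. \<exists>C::real. \<forall>(P::'a set) \<phi> P' \<phi>' \<omega> F F'.
        (let r = 2 * (real DIM('a) + 1) / (real DIM('a) + 3) in
         admissible_shape R P \<and> admissible_shape R P' \<and>
         admissible_contrast \<alpha> P \<phi> \<and> admissible_contrast \<alpha> P' \<phi>' \<and>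
         well_posed k R (potential P \<phi>) S \<and> well_posed k R (potential P' \<phi>') S \<and>
         nonvanishing_waves k R (potential P \<phi>) \<and> nonvanishing_waves k R (potential P' \<phi>') \<and>
         apriori_bounds k R \<alpha> s r l \<alpha>m \<alpha>M D M \<mu> c P \<phi> \<and>
         apriori_bounds k R \<alpha> s r l \<alpha>m \<alpha>M D M \<mu> c P' \<phi>' \<and>
         \<omega> \<in> sphere 0 1 \<and>
         far_field_of k (potential P \<phi>) \<omega> F \<and> far_field_of k (potential P' \<phi>') \<omega> F' \<and>
         0 < sphere_L2_norm (\<lambda>x. F x - F' x) \<and> sphere_L2_norm (\<lambda>x. F x - F' x) < \<epsilon>min)
        \<longrightarrow> hausdorff_dist P P' \<le>
              C * (ln (ln (S / sphere_L2_norm (\<lambda>x. F x - F' x)))) powr (- rate DIM('a) \<alpha>)"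
    (is "\<exists>\<epsilon>min>0. \<exists>C. \<forall>P \<phi> P' \<phi>' \<omega> F F'. ?A \<epsilon>min P \<phi> P' \<phi>' \<omega> F F' \<longrightarrow> ?Z C P P' F F'")
proof (cases "0 < l \<and> (DIM('a) = 2 \<longrightarrow> 0 < 2 * \<alpha>m \<and> 2 * \<alpha>m < 2 * \<alpha>M \<and> 2 * \<alpha>M < pi) \<and> 0 \<le> M \<and> 0 < \<mu> \<and> 0 < c \<and> 0 \<le> S")
  case False
  \<comment> \<open>Constants outside their range admit no data, so the claim is vacuous there: the
    H^2 bound forces S >= 0, the Hoelder bound forces M >= 0, and the remaining signs are part of
    the a-priori bounds.\<close>
  have neg: "\<not> ?A 1 P \<phi> P' \<phi>' \<omega> F F'" for P :: "'a set" and \<phi> P' \<phi>' \<omega> F F'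
  proof
    assume A0: "?A 1 P \<phi> P' \<phi>' \<omega> F F'"
    note A = A0[unfolded Let_def]
    obtain u where "total_wave k (potential P \<phi>) \<omega> u" using A unfolding far_field_of_def by blast
    then have "H2_norm_le (ball 0 (2 * R)) (\<lambda>x. u x - plane_wave k \<omega> x) S" using A unfolding well_posed_def by blast
    then have "0 \<le> S" by (simp add: H2_norm_le_def)
    moreover have "0 \<le> M" using A holder_estimate(1)[of \<alpha> \<phi> M] by (simp add: admissible_contrast_def apriori_bounds_def)
    ultimately show False using False A by (simp add: apriori_bounds_def)
  qed
  show ?thesis by (intro exI[of _ "1::real"] exI[of _ "0::real"] conjI allI impI) (simp, erule neg[THEN notE])
next
  case True
  then have v: "0 < l" "0 \<le> M" "0 < \<mu>" "0 < c" "0 \<le> S" "DIM('a) = 2 \<Longrightarrow> 0 < 2 * \<alpha>m \<and> 2 * \<alpha>m < 2 * \<alpha>M \<and> 2 * \<alpha>M < pi" by auto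
  obtain \<epsilon>0 C where \<epsilon>0: "0 < \<epsilon>0" and stab:
    "\<And>(P::'a set) \<phi> \<omega> u F P' \<phi>' u' F'. scatterer k R \<alpha> (2 * \<alpha>m) (2 * \<alpha>M) l M \<mu> c S P \<phi> \<omega> u F \<Longrightarrow> scatterer k R \<alpha> (2 * \<alpha>m) (2 * \<alpha>M) l M \<mu> c S P' \<phi>' \<omega> u' F' \<Longrightarrow>
      0 < sphere_L2_norm (\<lambda>x. F x - F' x) \<Longrightarrow> sphere_L2_norm (\<lambda>x. F x - F' x) < \<epsilon>0 \<Longrightarrow>
      (SUP x\<in>P. infdist x P') \<le> C * ln (ln (S / sphere_L2_norm (\<lambda>x. F x - F' x))) powr (- rate DIM('a) \<alpha>)"
    by (rule scatterer_stability[OF dim \<alpha> k R v(1) _ v(2-5)]) ((rule v(6), assumption), (rule that, assumption+))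
  have "?Z C P P' F F'" if A0: "?A \<epsilon>0 P \<phi> P' \<phi>' \<omega> F F'" for P :: "'a set" and \<phi> P' \<phi>' \<omega> F F'
  proof -
    note A = A0[unfolded Let_def]
    obtain u where u: "total_wave k (potential P \<phi>) \<omega> u" "far_field k (\<lambda>x. u x - plane_wave k \<omega> x) F"
      using A unfolding far_field_of_def by blast
    obtain u' where u': "total_wave k (potential P' \<phi>') \<omega> u'" "far_field k (\<lambda>x. u' x - plane_wave k \<omega> x) F'"
      using A unfolding far_field_of_def by blast
    have s: "scatterer k R \<alpha> (2 * \<alpha>m) (2 * \<alpha>M) l M \<mu> c S P \<phi> \<omega> u F"
      by (rule scattererI[OF _ _ _ _ _ u]) (use A in blast)+
    have s': "scatterer k R \<alpha> (2 * \<alpha>m) (2 * \<alpha>M) l M \<mu> c S P' \<phi>' \<omega> u' F'"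
      by (rule scattererI[OF _ _ _ _ _ u']) (use A in blast)+
    \<comment> \<open>The one-sided estimate is also applied with the shapes exchanged; the
      far-field difference then only changes sign.\<close>
    have sym: "sphere_L2_norm (\<lambda>x. F' x - F x) = sphere_L2_norm (\<lambda>x. F x - F' x)"
      unfolding sphere_L2_norm_def by (simp only: norm_minus_commute)
    have pos: "0 < sphere_L2_norm (\<lambda>x. F x - F' x)" "sphere_L2_norm (\<lambda>x. F x - F' x) < \<epsilon>0" using A by blast+
    show ?thesis
      unfolding hausdorff_dist_def using stab[OF s s' pos] stab[OF s' s, unfolded sym, OF pos] by (rule max.boundedI)
  qed
  then show ?thesis using \<epsilon>0 by blast
qed

theorem mainTheorem1:
  fixes \<alpha> s :: real
  assumes dim: "DIM('a::euclidean_space) = 2 \<or> DIM('a) = 3"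
    and s_range: "if DIM('a) = 2 then 0 \<le> s \<and> s < min \<alpha> (5/6)
                  else 1/4 < s \<and> s < min \<alpha> (3/4)"
  shows "\<exists>\<gamma>>0. \<forall>k R l \<alpha>m \<alpha>M D M \<mu> c S.
     0 < k \<longrightarrow> 1 < R \<longrightarrow>
     (\<exists>\<epsilon>min>0. \<exists>C::real. \<forall>(P::'a set) \<phi> P' \<phi>' \<omega> F F'.
        (let r = 2 * (real DIM('a) + 1) / (real DIM('a) + 3) in
         admissible_shape R P \<and> admissible_shape R P' \<and>
         admissible_contrast \<alpha> P \<phi> \<and> admissible_contrast \<alpha> P' \<phi>' \<and>
         well_posed k R (potential P \<phi>) S \<and> well_posed k R (potential P' \<phi>') S \<and>
         nonvanishing_waves k R (potential P \<phi>) \<and> nonvanishing_waves k R (potential P' \<phi>') \<and>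
         apriori_bounds k R \<alpha> s r l \<alpha>m \<alpha>M D M \<mu> c P \<phi> \<and>
         apriori_bounds k R \<alpha> s r l \<alpha>m \<alpha>M D M \<mu> c P' \<phi>' \<and>
         \<omega> \<in> sphere 0 1 \<and>
         far_field_of k (potential P \<phi>) \<omega> F \<and> far_field_of k (potential P' \<phi>') \<omega> F' \<and>
         0 < sphere_L2_norm (\<lambda>x. F x - F' x) \<and> sphere_L2_norm (\<lambda>x. F x - F' x) < \<epsilon>min)
        \<longrightarrow> hausdorff_dist P P' \<le>
              C * (ln (ln (S / sphere_L2_norm (\<lambda>x. F x - F' x)))) powr (- \<gamma>))"
proof -
  have \<alpha>: "0 < \<alpha>" using s_range by (auto split: if_splits)
  have \<gamma>: "0 < rate DIM('a) \<alpha>" using \<alpha> by (simp add: rate_def add_nonneg_pos)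
  show ?thesis
    \<comment> \<open>The exponent is fixed before k, R and the a-priori constants because
      \<open>rate\<close> involves only the dimension and alpha; the threshold and C are fixed after
      these constants but before shapes, contrasts and the direction.\<close>
    by (rule exI[of _ "rate DIM('a) \<alpha>"], rule conjI[OF \<gamma>], intro allI impI, rule stability_constants[OF dim \<alpha>])
qed

end
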